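(* Fix an even integer $k\ge 1$, a real number $0<q\le 1$, and let $\sigma=(k+1)k\cdots 321$ be the decreasing permutation of $\{1,\dots,k+1\}$. For $n\ge 1$ let $q(n)=q^{\sqrt{k/n}}$, and let $\Pi_n$ be a random involution of $\{1,\dots,n\}$ avoiding $\sigma$, distributed according to $\mathbb{P}^{q(n),\sigma}_n$. Let $M$ be a random matrix drawn from the $k\times k$ Gaussian Orthogonal Ensemble conditioned to have trace $0$, let $\Lambda_1\ge\Lambda_2\ge\cdots\ge\Lambda_k$ be its eigenvalues, define $$S_k=\sum_{j=1}^k(-1)^{j+1}\Lambda_j,$$ and let $\mathbb{P}_k$ be the distribution of $S_k$. Let $X_k$ be a random variable whose distribution $\mathbf{P}_k$ is absolutely continuous with respect to $\mathbb{P}_k$ and given by $$\mathbf{P}_k(ds)=\frac{q^{s}}{\mathbb{E}\left[q^{S_k}\right]}\,\mathbb{P}_k(ds).$$ Then, as $n\to\infty$, $$\sqrt{\frac{k}{n}}\,\mathrm{fp}(\Pi_n)\to_d X_k.$$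
   Context: Let $[n]=\{1,\dots,n\}$. A permutation $\pi$ of $[n]$ contains a permutation $\sigma$ of $[m]$ if there exist indices $i_1<\dots<i_m$ in $[n]$ such that for all $j<l$ in $[m]$, $\pi(i_j)<\pi(i_l)$ if and only if $\sigma(j)<\sigma(l)$; $\pi$ avoids $\sigma$ if it does not contain $\sigma$. Let $I_n(\sigma)$ be the set of involutions of $[n]$ (permutations $\pi$ with $\pi\circ\pi=\mathrm{id}$) that avoid $\sigma$. For a permutation $\pi$, $\mathrm{fp}(\pi)$ is its number of fixed points. For $t\in(0,\infty)$, $\mathbb{P}^{t,\sigma}_n$ is the probability measure on $I_n(\sigma)$ with $\mathbb{P}^{t,\sigma}_n(\pi)\propto t^{\mathrm{fp}(\pi)}$, i.e. $\mathbb{P}^{t,\sigma}_n(\pi)=t^{\mathrm{fp}(\pi)}/\sum_{\tau\in I_n(\sigma)}t^{\mathrm{fp}(\tau)}$. The $k\times k$ Gaussian Orthogonal Ensemble is normalized to have density proportional to $\exp(-\tfrac12\mathrm{tr}(A^2))$ on real symmetric $k\times k$ matrices $A$ (independent centered Gaussian entries on and above the diagonal, with variance $1$ on the diagonal and $1/2$ off the diagonal). Conditioned to have trace $0$, it is the probability measure on the space of trace-zero real symmetric $k\times k$ matrices with density proportional to $\exp(-\tfrac12\mathrm{tr}(A^2))$ with respect to Lebesgue measure on that space; equivalently, it is the law of $A-\frac{\mathrm{tr}(A)}{k}I$ for $A$ drawn from the ensemble. The symbol $\to_d$ denotes convergence in distribution. *)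

theory Defs
  imports
    "HOL-Probability.Probability"
    "HOL-Computational_Algebra.Polynomial"
    "Jordan_Normal_Form.Char_Poly"
begin

text \<open>A permutation of \<open>{1..n}\<close> is a function \<open>p\<close> on \<open>nat\<close> with \<open>p permutes {1..n}\<close>;
  in particular it is the identity outside \<open>{1..n}\<close>.\<close>

definition perm_contains :: "nat \<Rightarrow> (nat \<Rightarrow> nat) \<Rightarrow> nat \<Rightarrow> (nat \<Rightarrow> nat) \<Rightarrow> bool" where
  "perm_contains n p m s \<longleftrightarrow>
     (\<exists>i. strict_mono_on {1..m} i \<and> i ` {1..m} \<subseteq> {1..n} \<and>
          (\<forall>j\<in>{1..m}. \<forall>l\<in>{1..m}. j < l \<longrightarrow> (p (i j) < p (i l) \<longleftrightarrow> s j < s l)))"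

definition avoiding_involutions :: "nat \<Rightarrow> nat \<Rightarrow> (nat \<Rightarrow> nat) \<Rightarrow> (nat \<Rightarrow> nat) set" where
  "avoiding_involutions n m s =
     {p. p permutes {1..n} \<and> p \<circ> p = id \<and> \<not> perm_contains n p m s}"

definition decreasing_perm :: "nat \<Rightarrow> nat \<Rightarrow> nat" where
  "decreasing_perm m i = (if i \<in> {1..m} then m + 1 - i else i)"

definition fp :: "nat \<Rightarrow> (nat \<Rightarrow> nat) \<Rightarrow> nat" where
  "fp n p = card {i \<in> {1..n}. p i = i}"

definition fp_weighted_measure ::
    "real \<Rightarrow> nat \<Rightarrow> nat \<Rightarrow> (nat \<Rightarrow> nat) \<Rightarrow> (nat \<Rightarrow> nat) measure" where
  "fp_weighted_measure t n m s =
     point_measure (avoiding_involutions n m s)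
       (\<lambda>p. ennreal (t ^ fp n p / (\<Sum>r\<in>avoiding_involutions n m s. t ^ fp n r)))"

text \<open>The ensemble is realised on the probability space of its independent entries on and above
  the diagonal, with row and column indices \<open>0, \<dots>, k - 1\<close>. The second argument of
  \<open>normal_density\<close> is the standard deviation, so the variances are \<open>1\<close> and \<open>1/2\<close>.\<close>

definition goe_space :: "nat \<Rightarrow> (nat \<times> nat \<Rightarrow> real) measure" where
  "goe_space k = (\<Pi>\<^sub>M (i, j)\<in>{(i, j). i \<le> j \<and> j < k}.
     density lborel (normal_density 0 (if i = j then 1 else sqrt (1 / 2))))"

definition goe_matrix :: "nat \<Rightarrow> (nat \<times> nat \<Rightarrow> real) \<Rightarrow> real mat" where
  "goe_matrix k x = mat k k (\<lambda>(i, j). x (min i j, max i j))"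

definition mat_trace :: "'a :: comm_monoid_add mat \<Rightarrow> 'a" where
  "mat_trace A = (\<Sum>i<dim_row A. A $$ (i, i))"

text \<open>The law of this random matrix under \<open>goe_space k\<close> is the ensemble conditioned to have
  trace \<open>0\<close>: the density \<open>exp (- tr (A\<^sup>2) / 2)\<close> factors over the orthogonal decomposition of the
  symmetric matrices into trace-zero and scalar ones.\<close>

definition goe0_matrix :: "nat \<Rightarrow> (nat \<times> nat \<Rightarrow> real) \<Rightarrow> real mat" where
  "goe0_matrix k x =
     goe_matrix k x - (mat_trace (goe_matrix k x) / real k) \<cdot>\<^sub>m 1\<^sub>m k"

text \<open>Real eigenvalues, with algebraic multiplicity, in weakly decreasing order. For a symmetric
  matrix these are all its eigenvalues.\<close>

definition ordered_eigenvalues :: "real mat \<Rightarrow> real list" where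
  "ordered_eigenvalues A = rev (sorted_list_of_multiset (proots (char_poly A)))"

text \<open>List positions start at \<open>0\<close>, so \<open>\<Lambda>\<^sub>j\<close> is at position \<open>j - 1\<close>.\<close>

definition alternating_eigenvalue_sum :: "nat \<Rightarrow> real mat \<Rightarrow> real" where
  "alternating_eigenvalue_sum k A =
     (\<Sum>j = 1..k. (-1) ^ (j + 1) * ordered_eigenvalues A ! (j - 1))"

definition S_law :: "nat \<Rightarrow> real measure" where
  "S_law k = distr (goe_space k) borel (\<lambda>x. alternating_eigenvalue_sum k (goe0_matrix k x))"

definition X_law :: "nat \<Rightarrow> real \<Rightarrow> real measure" where
  "X_law k q =
     density (S_law k) (\<lambda>s. ennreal (q powr s / (\<integral>u. q powr u \<partial>S_law k)))"

lemma decreasing_perm_permutes: "decreasing_perm m permutes {1..m}"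
proof (rule bij_imp_permutes)
  show "bij_betw (decreasing_perm m) {1..m} {1..m}"
    by (rule bij_betw_byWitness[where f' = "decreasing_perm m"])
       (auto simp: decreasing_perm_def)
qed (auto simp: decreasing_perm_def)

lemma prob_space_fp_weighted_measure:
  assumes t: "t > 0" and ne: "avoiding_involutions n m s \<noteq> {}"
  shows "prob_space (fp_weighted_measure t n m s)"
proof -
  let ?A = "avoiding_involutions n m s"
  have fin: "finite ?A"
    by (rule finite_subset[OF _ finite_permutations[of "{1..n}"]])
       (auto simp: avoiding_involutions_def)
  have pos: "(\<Sum>p\<in>?A. t ^ fp n p) > 0"
    using t ne fin by (intro sum_pos) auto
  have "(\<Sum>p\<in>?A. ennreal (t ^ fp n p / (\<Sum>r\<in>?A. t ^ fp n r))) =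
      ennreal (\<Sum>p\<in>?A. t ^ fp n p / (\<Sum>r\<in>?A. t ^ fp n r))"
    using t pos by (intro sum_ennreal) auto
  also have "\<dots> = 1"
    using pos by (simp flip: sum_divide_distrib)
  finally show ?thesis
    unfolding fp_weighted_measure_def using fin
    by (intro prob_spaceI) (simp add: emeasure_point_measure_finite space_point_measure)
qed

lemma prob_space_goe_space: "prob_space (goe_space k)"
  unfolding goe_space_def case_prod_beta
  by (intro prob_space_PiM prob_space_normal_density) auto

lemma mat_trace_goe0_matrix:
  assumes "k \<ge> 1"
  shows "mat_trace (goe0_matrix k x) = 0"
  using assms by (simp add: mat_trace_def goe0_matrix_def goe_matrix_def sum_subtractf)

end

theory Submission
  imports Defs
    "HOL-Library.Sublist"
    "Jordan_Normal_Form.Schur_Decomposition"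
begin

text \<open>
  Robinson-Schensted insertion sends an involution of \<open>{1..n}\<close> to a standard tableau. The tableau
  is recorded by the word whose letter at position \<open>v\<close> is the row that contains the value
  \<open>v\<close>; these words are the ballot words. Avoiding the decreasing permutation of length
  \<open>k + 1\<close> means having at most \<open>k\<close> rows, hence letters at most \<open>k\<close>
  (\<open>bij_involutions_words\<close>), and the fixed points are counted by the alternating sum of the row
  lengths (\<open>sum_sg_word\<close>).

  Let \<open>l\<close> be the row lengths increased by the staircase \<open>k - 1, \<dots>, 1, 0\<close>.
  There are \<open>n! / \<Prod>\<^sub>r l\<^sub>r!\<close> times the Vandermonde product of \<open>l\<close>
  ballot words with these row lengths, and \<open>N! / \<Prod>\<^sub>r l\<^sub>r!\<close> arbitrary words of
  length \<open>N = n + k (k - 1) / 2\<close> with letter counts \<open>l\<close>. The factorials of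
  \<open>l\<close> cancel, so a sum over ballot words is a multiple of an average over uniformly random words,
  weighted by the Vandermonde product of the letter counts on the set where these decrease
  (\<open>sum_ballot_words_eq\<close>).

  By the central limit theorem the letter counts, centred and scaled by \<open>sqrt (k / n)\<close>, converge
  to a standard Gaussian vector minus its mean. Uniformly bounded exponential moments allow the Vandermonde
  product as a weight. That product and, for even \<open>k\<close>, the alternating sum do not change when a
  constant is added to all coordinates, so the mean may be put back (\<open>weighted_word_clt\<close>).

  A standard Gaussian vector weighted by the Vandermonde product on the decreasing vectors is distributed like
  the ordered eigenvalues of the Gaussian Orthogonal Ensemble (\<open>goe_eigvec_law\<close>). This is proved
  without a change of variables: Gaussian integration by parts gives the same loop equations for the joint
  moments of the power sums on one side (\<open>loop_vandermonde\<close>) and of the traces of powers on the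
  other (\<open>loop_goe\<close>), and these equations determine the moments. Damping by powers of
  \<open>exp (- p\<^sub>2 / 4)\<close>, where \<open>p\<^sub>2\<close> is the sum of squares, and the
  Stone-Weierstrass theorem then lead from moments to laws. Conditioning on trace \<open>0\<close> subtracts a
  constant from all eigenvalues, which the alternating sum does not see either.

  Finally, the weight \<open>t ^ fp\<close> with \<open>t = q powr sqrt (k / n)\<close> is
  \<open>q\<close> to the power of the scaled number of fixed points. As \<open>q \<le> 1\<close> and the
  alternating sum of a decreasing vector of even length is nonnegative, it is a bounded continuous function of
  the converging quantity, and the normalising constants cancel in the quotient of two such averages.
\<close>

section \<open>Row insertion on words of row numbers\<close>

text \<open>A word lists for each value the row of a tableau that contains it, with \<open>0\<close> for an
  absent value. A value entering row \<open>c\<close> displaces the next larger value of that row, that is the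
  first later letter \<open>c\<close>, into row \<open>c + 1\<close>, where the process continues. The
  second component is the row that finally grows. Started with \<open>c = 0\<close> at an absent value, this
  inserts that value into row \<open>1\<close>.\<close>

fun bump :: "nat \<Rightarrow> nat list \<Rightarrow> nat list \<times> nat" where
  "bump c [] = ([], c)"
| "bump c (y # ys) =
    (if y = c then (Suc c # fst (bump (Suc c) ys), snd (bump (Suc c) ys))
     else (y # fst (bump c ys), snd (bump c ys)))"

text \<open>Lengths of strictly increasing subsequences. The lower bound \<open>b\<close> on the letters makes
  the recursion close and is the bound that a letter in front imposes on the rest.\<close>

fun lis :: "nat \<Rightarrow> nat list \<Rightarrow> nat" where
  "lis b [] = 0"
| "lis b (y # ys) = (if b < y then max (lis b ys) (Suc (lis y ys)) else lis b ys)"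

lemma lis_antimono: "a \<le> b \<Longrightarrow> lis b ys \<le> lis a ys"
proof (induction ys arbitrary: a b)
  case (Cons y ys)
  have "lis b ys \<le> lis a ys" using Cons by blast
  then show ?case using Cons.prems by auto
qed simp

lemma lis_le_Suc: "lis b ys \<le> Suc (lis (Suc b) ys)"
proof (induction ys arbitrary: b)
  case (Cons y ys)
  have "lis b ys \<le> Suc (lis (Suc b) ys)" by (rule Cons.IH)
  moreover have "lis (Suc b) ys \<le> lis b ys" by (rule lis_antimono) simp
  moreover have "y = Suc b \<or> y \<le> b \<or> y > Suc b" by arith
  ultimately show ?case by auto
qed simp

text \<open>Bumping changes letters only by raising some of them, and a chain that profits from a raised
  letter had a competitor starting at \<open>c - 1\<close>. The induction on the word needs this for all
  bounds \<open>b\<close> at once; the last disjunct says that a changed value is dominated by that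
  competitor, even after padding by \<open>b - c\<close>.\<close>

lemma lis_bump:
  fixes c :: nat
  assumes "c \<ge> 1"
  shows "(\<forall>b<c. lis b (fst (bump c ys)) = lis b ys) \<and>
    lis c (fst (bump c ys)) = lis (c - 1) ys \<and>
    (\<forall>b>c. lis b ys \<le> lis b (fst (bump c ys)) \<and>
      (lis b (fst (bump c ys)) = lis b ys \<or> lis b (fst (bump c ys)) + (b - c) \<le> lis (c - 1) ys))"
  using assms
proof (induction ys arbitrary: c)
  case (Cons y ys)
  show ?case
  proof (cases "y = c")
    case True
    define L where "L b = lis b ys" for b
    define L'' where "L'' b = lis b (fst (bump (Suc c) ys))" for b
    have IH: "\<And>b. b < Suc c \<Longrightarrow> L'' b = L b" "L'' (Suc c) = L c"
      "\<And>b. b > Suc c \<Longrightarrow> L b \<le> L'' b"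
      "\<And>b. b > Suc c \<Longrightarrow> L'' b = L b \<or> L'' b + (b - Suc c) \<le> L c"
      using Cons.IH[of "Suc c"] unfolding L_def L''_def by auto
    have a: "L (c - 1) \<le> Suc (L c)"
      using lis_le_Suc[of "c - 1" ys] Cons.prems unfolding L_def by simp
    have b: "L (Suc c) \<le> L c" unfolding L_def by (rule lis_antimono) simp
    have e1: "lis b (y # ys) = (if b < c then max (L b) (Suc (L c)) else L b)" for b
      using True by (simp add: L_def)
    have e2: "lis b (fst (bump c (y # ys))) = (if b < Suc c then max (L'' b) (Suc (L'' (Suc c))) else L'' b)" for b
      using True by (simp add: L''_def)
    show ?thesis unfolding e1 e2
    proof (intro conjI allI impI)
      fix x assume x: "c < x"
      show "(if x < c then max (L x) (Suc (L c)) else L x)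
         \<le> (if x < Suc c then max (L'' x) (Suc (L'' (Suc c))) else L'' x)"
        using x IH(2) IH(3)[of x] b by (cases "x = Suc c") auto
      show "(if x < Suc c then max (L'' x) (Suc (L'' (Suc c))) else L'' x) =
         (if x < c then max (L x) (Suc (L c)) else L x) \<or>
         (if x < Suc c then max (L'' x) (Suc (L'' (Suc c))) else L'' x) + (x - c)
         \<le> (if c - 1 < c then max (L (c - 1)) (Suc (L c)) else L (c - 1))"
        using x IH(2) IH(4)[of x] Cons.prems by (cases "x = Suc c") auto
    next
      show "(if c < Suc c then max (L'' c) (Suc (L'' (Suc c))) else L'' c) =
        (if c - 1 < c then max (L (c - 1)) (Suc (L c)) else L (c - 1))"
        using IH(1)[of c] IH(2) a Cons.prems by auto
    qed (use IH in auto)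
  next
    case False
    define L where "L b = lis b ys" for b
    define L' where "L' b = lis b (fst (bump c ys))" for b
    have IH: "\<And>b. b < c \<Longrightarrow> L' b = L b" "L' c = L (c - 1)"
      "\<And>b. b > c \<Longrightarrow> L b \<le> L' b"
      "\<And>b. b > c \<Longrightarrow> L' b = L b \<or> L' b + (b - c) \<le> L (c - 1)"
      using Cons.IH[of c] Cons.prems unfolding L_def L'_def by auto
    have mono: "a \<le> b \<Longrightarrow> L b \<le> L a" for a b unfolding L_def by (rule lis_antimono)
    have e1: "lis b (y # ys) = (if b < y then max (L b) (Suc (L y)) else L b)" for b
      by (simp add: L_def)
    have e2: "lis b (fst (bump c (y # ys))) = (if b < y then max (L' b) (Suc (L' y)) else L' b)" for b
      using False by (simp add: L'_def)
    show ?thesis unfolding e1 e2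
    proof (intro conjI allI impI)
      fix b assume b: "b < c"
      show "(if b < y then max (L' b) (Suc (L' y)) else L' b) =
        (if b < y then max (L b) (Suc (L y)) else L b)"
      proof (cases "y < c")
        case True
        then show ?thesis using b IH(1)[of b] IH(1)[of y] by auto
      next
        case yc: False
        have "L (c - 1) \<le> L b" using b by (intro mono) simp
        then have "L' y = L y \<or> Suc (L' y) \<le> L b" "L y \<le> L' y"
          using IH(3)[of y] IH(4)[of y] yc False by auto
        then show ?thesis using b IH(1)[of b] by auto
      qed
    next
      show "(if c < y then max (L' c) (Suc (L' y)) else L' c) =
        (if c - 1 < y then max (L (c - 1)) (Suc (L y)) else L (c - 1))"
        using False IH(2) IH(3)[of y] IH(4)[of y] Cons.prems
        by (cases "y < c") auto
    next
      fix b assume b: "c < b"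
      show "(if b < y then max (L b) (Suc (L y)) else L b)
         \<le> (if b < y then max (L' b) (Suc (L' y)) else L' b)"
        using b IH(3)[of y] IH(3)[of b] by auto
      show "(if b < y then max (L' b) (Suc (L' y)) else L' b) =
         (if b < y then max (L b) (Suc (L y)) else L b) \<or>
         (if b < y then max (L' b) (Suc (L' y)) else L' b) + (b - c)
         \<le> (if c - 1 < y then max (L (c - 1)) (Suc (L y)) else L (c - 1))"
        using b IH(3)[of y] IH(3)[of b] IH(4)[of y] IH(4)[of b] by (cases "b < y") (auto simp: max_def)
    qed
  qed
qed simp

lemma lis_bump_suffix: "c \<ge> 1 \<Longrightarrow> lis 0 (fst (bump c ys)) = lis 0 ys"
  using lis_bump[of c ys] by auto

text \<open>A new letter \<open>1\<close> in front of \<open>z\<close> offers one new kind of chain to the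
  letters of \<open>u\<close>: itself, followed by a chain of \<open>z\<close>. Every other gain is absorbed
  by that one.\<close>

lemma lis_insert_aux:
  "lis 0 (u @ 1 # fst (bump 1 z)) = max (lis 0 (u @ z)) (Suc (lis 0 z)) \<and>
   (\<forall>b\<ge>1. lis b (u @ z) \<le> lis b (u @ 1 # fst (bump 1 z)) \<and>
     (lis b (u @ 1 # fst (bump 1 z)) = lis b (u @ z) \<or>
      lis b (u @ 1 # fst (bump 1 z)) + b \<le> Suc (lis 0 z)))"
proof (induction u)
  case Nil
  have a: "lis b z \<le> lis 0 z" for b by (rule lis_antimono) simp
  have e: "lis 0 (fst (bump 1 z)) = lis 0 z" "lis 1 (fst (bump 1 z)) = lis 0 z"
    and h: "\<And>b. b > 1 \<Longrightarrow> lis b z \<le> lis b (fst (bump 1 z)) \<and>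
      (lis b (fst (bump 1 z)) = lis b z \<or> lis b (fst (bump 1 z)) + (b - 1) \<le> lis 0 z)"
    using lis_bump[of 1 z] by auto
  show ?case
  proof (intro conjI allI impI)
    show "lis 0 ([] @ 1 # fst (bump 1 z)) = max (lis 0 ([] @ z)) (Suc (lis 0 z))" using e by simp
    fix b :: nat assume b: "1 \<le> b"
    show "lis b ([] @ z) \<le> lis b ([] @ 1 # fst (bump 1 z))"
      using b h[of b] e a[of b] by (cases "b = 1") auto
    show "lis b ([] @ 1 # fst (bump 1 z)) = lis b ([] @ z) \<or>
      lis b ([] @ 1 # fst (bump 1 z)) + b \<le> Suc (lis 0 z)"
      using b h[of b] e by (cases "b = 1") auto
  qed
next
  case (Cons y u)
  define S where "S b = lis b (u @ z)" for b
  define S' where "S' b = lis b (u @ 1 # fst (bump 1 z))" for b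
  have IH: "S' 0 = max (S 0) (Suc (lis 0 z))" "\<And>b. b \<ge> 1 \<Longrightarrow> S b \<le> S' b"
    "\<And>b. b \<ge> 1 \<Longrightarrow> S' b = S b \<or> S' b + b \<le> Suc (lis 0 z)"
    using Cons.IH unfolding S_def S'_def by auto
  have e1: "lis b ((y # u) @ z) = (if b < y then max (S b) (Suc (S y)) else S b)" for b
    by (simp add: S_def)
  have e2: "lis b ((y # u) @ 1 # fst (bump 1 z)) = (if b < y then max (S' b) (Suc (S' y)) else S' b)" for b
    by (simp add: S'_def)
  show ?case unfolding e1 e2
  proof (intro conjI allI impI)
    show "(if 0 < y then max (S' 0) (Suc (S' y)) else S' 0) =
      max (if 0 < y then max (S 0) (Suc (S y)) else S 0) (Suc (lis 0 z))"
      using IH(1) IH(2)[of y] IH(3)[of y] by (auto simp: max_def)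
    fix b :: nat assume b: "1 \<le> b"
    show "(if b < y then max (S b) (Suc (S y)) else S b) \<le> (if b < y then max (S' b) (Suc (S' y)) else S' b)"
      using b IH(2)[of y] IH(2)[of b] by auto
    show "(if b < y then max (S' b) (Suc (S' y)) else S' b) = (if b < y then max (S b) (Suc (S y)) else S b) \<or>
         (if b < y then max (S' b) (Suc (S' y)) else S' b) + b \<le> Suc (lis 0 z)"
      using b IH(2)[of y] IH(2)[of b] IH(3)[of y] IH(3)[of b] by (auto simp: max_def)
  qed
qed

definition ins :: "nat \<Rightarrow> nat list \<Rightarrow> nat list" where
  "ins j ys = take j ys @ fst (bump 0 (drop j ys))"
definition ins_row :: "nat \<Rightarrow> nat list \<Rightarrow> nat" where
  "ins_row j ys = snd (bump 0 (drop j ys))"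

lemma length_bump [simp]: "length (fst (bump c ys)) = length ys"
  by (induction c ys rule: bump.induct) auto

text \<open>A suffix depends on the earlier letters only through the row in which the displaced value
  arrives.\<close>

lemma drop_bump: "\<exists>d\<ge>c. drop i (fst (bump c ys)) = fst (bump d (drop i ys))"
proof (induction ys arbitrary: c i)
  case (Cons y ys)
  show ?case
  proof (cases i)
    case (Suc i')
    then show ?thesis using Cons.IH[of "Suc c" i'] Cons.IH[of c i'] by (auto intro: Suc_leD)
  qed auto
qed auto

text \<open>Inserting the value \<open>j + 1\<close> acts on the suffixes just as a new last entry
  \<open>j + 1\<close> of a permutation acts on its decreasing subsequences with values above
  \<open>i\<close>: it can only be appended to those with values above \<open>j + 1\<close>.\<close>

lemma lis_drop_ins:
  assumes j: "j < length ys" and y: "ys ! j = 0"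
  shows "lis 0 (drop i (ins j ys)) =
    (if i \<le> j then max (lis 0 (drop i ys)) (Suc (lis 0 (drop (Suc j) ys))) else lis 0 (drop i ys))"
proof -
  have d: "drop j ys = 0 # drop (Suc j) ys" using j y by (metis Cons_nth_drop_Suc)
  have I: "ins j ys = take j ys @ 1 # fst (bump 1 (drop (Suc j) ys))" by (simp add: ins_def d)
  have lt: "length (take j ys) = j" using j by simp
  show ?thesis
  proof (cases "i \<le> j")
    case True
    have e: "drop i (ins j ys) = drop i (take j ys) @ 1 # fst (bump 1 (drop (Suc j) ys))"
      using True lt by (simp add: I)
    have "drop i ys = drop i (take j ys) @ drop j ys"
      using True j by (metis append_take_drop_id drop_append drop_take drop_drop take_add le_add_diff_inverse add.commute diff_is_0_eq drop0 length_take lt)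
    then have "drop i ys = drop i (take j ys) @ 0 # drop (Suc j) ys" using d by simp
    moreover have "lis 0 (u @ 0 # z) = lis 0 (u @ z)" for u z
    proof -
      have "lis b (u @ 0 # z) = lis b (u @ z)" for b by (induction u arbitrary: b) auto
      then show ?thesis .
    qed
    ultimately show ?thesis using lis_insert_aux[of "drop i (take j ys)" "drop (Suc j) ys"] e True by simp
  next
    case False
    then obtain m where i: "i = Suc j + m" by (metis less_iff_Suc_add not_le add_Suc)
    have "drop i (ins j ys) = drop m (fst (bump 1 (drop (Suc j) ys)))"
      using i j lt by (simp add: I)
    moreover obtain c where "c \<ge> 1" "drop m (fst (bump 1 (drop (Suc j) ys))) = fst (bump c (drop m (drop (Suc j) ys)))"
      using drop_bump by blast
    ultimately show ?thesis using False lis_bump_suffix[of c] i by (simp add: add.commute)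
  qed
qed

lemma bump_append1:
  "bump c (xs @ [y]) = (if y = snd (bump c xs) then (fst (bump c xs) @ [Suc y], Suc y)
     else (fst (bump c xs) @ [y], snd (bump c xs)))"
  by (induction c xs rule: bump.induct) auto

lemma ins_append1:
  assumes "j < length ys"
  shows "ins j (ys @ [y]) = ins j ys @ [if y = ins_row j ys then Suc y else y]"
    "ins_row j (ys @ [y]) = (if y = ins_row j ys then Suc y else ins_row j ys)"
  using assms by (auto simp: ins_def ins_row_def bump_append1)

lemma ins_last: "ins (length ys) (ys @ [0]) = ys @ [1]" "ins_row (length ys) (ys @ [0]) = 1"
  by (auto simp: ins_def ins_row_def)

lemma length_ins [simp]: "length (ins j ys) = length ys"
  by (simp add: ins_def min_def)

text \<open>These are the words of row numbers of standard tableaux. The letter \<open>0\<close> stands for an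
  absent value and is exempt from the condition.\<close>

definition ballot :: "nat list \<Rightarrow> bool" where
  "ballot ys \<longleftrightarrow> (\<forall>m\<le>length ys. \<forall>r\<ge>1. count_list (take m ys) (Suc r) \<le> count_list (take m ys) r)"

lemma ballot_Nil [simp]: "ballot []" by (simp add: ballot_def)

lemma ballot_append1:
  "ballot (ys @ [y]) \<longleftrightarrow> ballot ys \<and> (\<forall>r\<ge>1. count_list (ys @ [y]) (Suc r) \<le> count_list (ys @ [y]) r)"
  unfolding ballot_def by (auto simp: le_Suc_eq)

lemma ballot_count: "ballot ys \<Longrightarrow> r \<ge> 1 \<Longrightarrow> count_list ys (Suc r) \<le> count_list ys r"
  unfolding ballot_def by force

text \<open>Only the last letter has to be examined in each step of an induction from the right, since it
  changes exactly if it equals the row in which the displaced value arrives.\<close>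

lemma ins_ballot:
  assumes "ballot ys" "j < length ys" "ys ! j = 0"
  shows "ballot (ins j ys) \<and> ins_row j ys \<ge> 1 \<and>
    (\<forall>r\<ge>1. count_list (ins j ys) r = count_list ys r + (if r = ins_row j ys then 1 else 0))"
  using assms
proof (induction ys rule: rev_induct)
  case (snoc y ys)
  show ?case
  proof (cases "j < length ys")
    case True
    have ly: "ballot ys" and cy: "\<And>r. r \<ge> 1 \<Longrightarrow> count_list (ys @ [y]) (Suc r) \<le> count_list (ys @ [y]) r"
      using snoc.prems by (auto simp: ballot_append1)
    define d where "d = ins_row j ys"
    have IH: "ballot (ins j ys)" "d \<ge> 1"
      "\<And>r. r \<ge> 1 \<Longrightarrow> count_list (ins j ys) r = count_list ys r + (if r = d then 1 else 0)"
      using snoc.IH[OF ly True] snoc.prems True by (auto simp: d_def nth_append)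
    have cz: "\<And>r. r \<ge> 1 \<Longrightarrow> count_list ys (Suc r) \<le> count_list ys r" using ly ballot_count by blast
    have "count_list (ins j (ys @ [y])) (Suc r) \<le> count_list (ins j (ys @ [y])) r" if r: "r \<ge> 1" for r
      using cy[OF r] cz[OF r] IH(3)[of r] IH(3)[of "Suc r"] r ballot_count[OF IH(1) r]
      unfolding ins_append1[OF True] d_def[symmetric] by (auto split: if_splits)
    then have "ballot (ins j (ys @ [y]))"
      unfolding ins_append1[OF True] using IH(1) by (subst ballot_append1) auto
    then show ?thesis using IH unfolding ins_append1[OF True] d_def[symmetric] by auto
  next
    case False
    then have j: "j = length ys" using snoc.prems by simp
    then have y: "y = 0" using snoc.prems by simp
    have ly: "ballot ys" using snoc.prems by (simp add: ballot_append1)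
    show ?thesis using ly ballot_count[OF ly] unfolding j y ins_last
      by (auto simp: ballot_append1 le_SucI)
  qed
qed simp

text \<open>Reverse insertion: read from the right, the row that is to lose its last cell tells which letter
  was raised last, and so on down to the letter \<open>1\<close> that was inserted.\<close>

lemma ex_ins:
  assumes "ballot zs" "c \<ge> 1" "count_list zs c > count_list zs (Suc c)"
  shows "\<exists>ys j. ballot ys \<and> j < length ys \<and> ys ! j = 0 \<and> ins j ys = zs \<and> ins_row j ys = c"
  using assms
proof (induction zs arbitrary: c rule: rev_induct)
  case (snoc z zs)
  have lz: "ballot zs" and cz: "\<And>r. r \<ge> 1 \<Longrightarrow> count_list (zs @ [z]) (Suc r) \<le> count_list (zs @ [z]) r"
    using snoc.prems by (auto simp: ballot_append1)
  have ext: "\<exists>ys j. ballot ys \<and> j < length ys \<and> ys ! j = 0 \<and> ins j ys = zs @ [z] \<and> ins_row j ys = c"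
    if h: "ballot ys" "j < length ys" "ys ! j = 0" "ins j ys = zs" "ins_row j ys = d"
      and g: "z = (if y = d then Suc y else y)" "c = (if y = d then Suc y else d)" for ys j d y
  proof -
    have I: "d \<ge> 1" "\<And>r. r \<ge> 1 \<Longrightarrow> count_list zs r = count_list ys r + (if r = d then 1 else 0)"
      using ins_ballot[OF h(1-3)] h by auto
    have "count_list (ys @ [y]) (Suc r) \<le> count_list (ys @ [y]) r" if r: "r \<ge> 1" for r
      using cz[OF r] I(2)[OF r] I(2)[of "Suc r"] r snoc.prems(3) ballot_count[OF h(1) r] ballot_count[OF lz r] g I(1)
      by (auto split: if_splits)
    then have "ballot (ys @ [y])" using h(1) by (simp add: ballot_append1)
    then show ?thesis using h g ins_append1[OF h(2), of y]
      by (intro exI[of _ "ys @ [y]"] exI[of _ j]) (auto simp: nth_append)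
  qed
  show ?case
  proof (cases "z = c")
    case False
    have "count_list zs c > count_list zs (Suc c)" using snoc.prems(3) False by (auto split: if_splits)
    from snoc.IH[OF lz snoc.prems(2) this] obtain ys j where
      h: "ballot ys" "j < length ys" "ys ! j = 0" "ins j ys = zs" "ins_row j ys = c" by blast
    show ?thesis using ext[OF h, of z] False by auto
  next
    case True
    show ?thesis
    proof (cases "c = 1")
      case c1: True
      have "ballot (zs @ [0])" using lz ballot_count[OF lz] by (simp add: ballot_append1)
      then show ?thesis using ins_last[of zs] c1 True
        by (intro exI[of _ "zs @ [0]"] exI[of _ "length zs"]) auto
    next
      case c1: False
      then have c2: "c - 1 \<ge> 1" "Suc (c - 1) = c" using snoc.prems(2) by auto
      have "count_list zs (c - 1) > count_list zs (Suc (c - 1))"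
        using cz[OF c2(1)] True c2 by (auto split: if_splits)
      from snoc.IH[OF lz c2(1) this] obtain ys j where
        h: "ballot ys" "j < length ys" "ys ! j = 0" "ins j ys = zs" "ins_row j ys = c - 1" by blast
      show ?thesis using ext[OF h, of "c - 1"] True c2 by auto
    qed
  qed
qed simp

lemma ins_row_pos:
  assumes "j < length ys" "ys ! j = 0"
  shows "ins_row j ys \<ge> 1"
  using assms
proof (induction ys rule: rev_induct)
  case (snoc y ys)
  then show ?case
    by (cases "j < length ys") (auto simp: ins_append1 ins_last nth_append less_Suc_eq)
qed simp

text \<open>Reverse insertion is deterministic, because a raised letter is recognised by being the final
  row.\<close>

lemma ins_inj:
  assumes "ins j ys = ins j' ys'" "ins_row j ys = ins_row j' ys'"
    "j < length ys" "ys ! j = 0" "j' < length ys'" "ys' ! j' = 0"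
  shows "ys = ys' \<and> j = j'"
proof -
  note row = ins_row_pos
  have "length ys = length ys'" using assms(1) length_ins by metis
  then show ?thesis using assms
  proof (induction ys ys' rule: rev_induct2)
    case (4 y ys y' ys')
    note p = "4.prems"
    consider "j < length ys" "j' < length ys'" | "j < length ys" "j' = length ys'"
      | "j = length ys" "j' < length ys'" | "j = length ys" "j' = length ys'"
      using p by fastforce
    then show ?case
    proof cases
      case 1
      have r: "ins_row j ys \<ge> 1" "ins_row j' ys' \<ge> 1" using row 1 p by (auto simp: nth_append)
      have e: "ins j ys = ins j' ys'" "ins_row j ys = ins_row j' ys' \<and> y = y'"
        using p(2,3) 1 by (auto simp: ins_append1 split: if_splits)
      then show ?thesis using "4.IH" p 1 by (auto simp: nth_append)
    next
      case 2
      have "ins_row j ys \<ge> 1" using row 2 p by (auto simp: nth_append)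
      moreover have y: "y' = 0" using 2 p by simp
      moreover have "ins j' (ys' @ [y']) = ys' @ [1]" "ins_row j' (ys' @ [y']) = 1"
        using 2 y ins_last[of ys'] by auto
      ultimately show ?thesis using p(2,3) 2 by (auto simp: ins_append1 split: if_splits)
    next
      case 3
      have "ins_row j' ys' \<ge> 1" using row 3 p by (auto simp: nth_append)
      moreover have y: "y = 0" using 3 p by (metis nth_append_length)
      moreover have "ins j (ys @ [y]) = ys @ [1]" "ins_row j (ys @ [y]) = 1"
        using 3 y ins_last[of ys] by auto
      ultimately show ?thesis using p(2,3) 3 by (auto simp: ins_append1 split: if_splits)
    next
      case 4
      then have y: "y = 0" "y' = 0" using p by (metis nth_append_length)+
      have "ins (length ys) (ys @ [0]) = ins (length ys') (ys' @ [0])" using p(2) 4 y by simp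
      then have "ys = ys'" unfolding ins_last by simp
      then show ?thesis using 4 y by simp
    qed
  qed auto
qed

section \<open>Involutions and ballot words\<close>

text \<open>Summed over the word of a tableau, the signs give the alternating sum of its row lengths, which is
  the number of its columns of odd length.\<close>

definition sg :: "nat \<Rightarrow> int" where
  "sg y = (if y = 0 then 0 else if odd y then 1 else - 1)"

lemma sg_01: "sg 0 = 0" "sg (Suc 0) = 1"
  by (simp_all add: sg_def)

lemma sum_sg_ins:
  assumes "j < length ys" "ys ! j = 0"
  shows "sum_list (map sg (ins j ys)) = sum_list (map sg ys) + sg (ins_row j ys)"
  using assms
proof (induction ys rule: rev_induct)
  case (snoc y ys)
  show ?case
  proof (cases "j < length ys")
    case True
    then have "sum_list (map sg (ins j ys)) = sum_list (map sg ys) + sg (ins_row j ys)"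
      using snoc by (auto simp: nth_append)
    then show ?thesis by (auto simp: ins_append1[OF True])
  next
    case False
    then have j: "j = length ys" using snoc.prems by simp
    then have y: "y = 0" using snoc.prems by simp
    show ?thesis unfolding j y ins_last by (simp add: sg_def)
  qed
qed simp

text \<open>The local rule of a growth diagram. \<open>X\<close> tells whether the square is marked,
  \<open>c\<close> and \<open>y\<close> are the rows to which a cell is added along the two incoming edges,
  with \<open>0\<close> for no cell, and the result lists the rows for the opposite edges.\<close>

definition cell :: "bool \<Rightarrow> nat \<Rightarrow> nat \<Rightarrow> nat \<times> nat" where
  "cell X c y = (if X then (1, 1) else if c = y \<and> 0 < c then (Suc c, Suc c) else (c, y))"

text \<open>The growth diagram of the graph of \<open>f\<close>. The first component is the row that gains a
  cell among the values up to \<open>v\<close> when the \<open>p\<close>-th value is inserted, the second is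
  the row that contains \<open>v\<close> after \<open>p\<close> insertions.\<close>

fun grow :: "(nat \<Rightarrow> nat) \<Rightarrow> nat \<Rightarrow> nat \<Rightarrow> nat \<times> nat" where
  "grow f 0 v = (0, 0)"
| "grow f (Suc p) 0 = (0, 0)"
| "grow f (Suc p) (Suc v) =
     cell (f (Suc p) = Suc v) (fst (grow f (Suc p) v)) (snd (grow f p (Suc v)))"

lemma grow_0 [simp]: "grow f p 0 = (0, 0)"
  by (cases p) auto

text \<open>The local rule treats its two edges alike, so reflecting the marked squares reflects the diagram.
  This is the symmetry of the Robinson-Schensted correspondence under inversion.\<close>

lemma grow_sym:
  assumes "\<And>p v. 1 \<le> p \<Longrightarrow> 1 \<le> v \<Longrightarrow> f p = v \<longleftrightarrow> f v = p"
  shows "grow f v p = prod.swap (grow f p v)"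
  using assms
proof (induction f p v rule: grow.induct[case_names a b c])
  case (c f p v)
  have sw: "cell X a b = prod.swap (cell X b a)" for X a b by (auto simp: cell_def)
  have "f (Suc v) = Suc p \<longleftrightarrow> f (Suc p) = Suc v" by (rule c.prems) auto
  then show ?case using c.IH(1)[OF c.prems] c.IH(2)[OF c.prems]
    using sw[of "f (Suc p) = Suc v" "snd (grow f p (Suc v))"] by simp
qed auto

lemma grow_cong:
  assumes "\<And>p v. 1 \<le> p \<Longrightarrow> p \<le> n \<Longrightarrow> 1 \<le> v \<Longrightarrow> v \<le> n \<Longrightarrow> f p = v \<longleftrightarrow> g p = v"
  shows "p \<le> n \<Longrightarrow> v \<le> n \<Longrightarrow> grow f p v = grow g p v"
proof (induction p arbitrary: v)
  case (Suc p)
  from Suc.prems show ?case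
  proof (induction v)
    case (Suc v)
    then show ?case using Suc.prems Suc.IH \<open>\<And>v. p \<le> n \<Longrightarrow> v \<le> n \<Longrightarrow> grow f p v = grow g p v\<close>[of "Suc v"]
       assms[of "Suc p" "Suc v"] by auto
  qed auto
qed auto

lemma letter_zero: "(\<And>u. 1 \<le> u \<Longrightarrow> u \<le> p \<Longrightarrow> f u \<noteq> v) \<Longrightarrow> snd (grow f p v) = 0"
proof (induction p)
  case (Suc p)
  then have "snd (grow f p v) = 0" by auto
  then show ?case using Suc.prems[of "Suc p"] by (cases v) (auto simp: cell_def)
qed auto

lemma letter_pos: "u \<ge> 1 \<Longrightarrow> u \<le> p \<Longrightarrow> f u = v \<Longrightarrow> v \<ge> 1 \<Longrightarrow> snd (grow f p v) \<ge> 1"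
proof (induction p)
  case (Suc p)
  obtain w where w: "v = Suc w" using Suc.prems by (cases v) auto
  show ?case
  proof (cases "u = Suc p")
    case True
    then show ?thesis using Suc.prems w by (auto simp: cell_def)
  next
    case False
    then have "snd (grow f p v) \<ge> 1" using Suc by auto
    then show ?thesis using w by (auto simp: cell_def)
  qed
qed auto

definition word :: "(nat \<Rightarrow> nat) \<Rightarrow> nat \<Rightarrow> nat \<Rightarrow> nat list" where
  "word f p n = map (\<lambda>v. snd (grow f p v)) [1..<Suc n]"

lemma length_word [simp]: "length (word f p n) = n"
  by (simp add: word_def)

lemma word_Suc: "word f p (Suc n) = word f p n @ [snd (grow f p (Suc n))]"
  by (simp add: word_def)

lemma word_nth: "i < n \<Longrightarrow> word f p n ! i = snd (grow f p (Suc i))"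
  by (simp add: word_def del: upt_Suc)

text \<open>One line of the growth diagram carries out one insertion, since the local rule along the line is
  the recursion of \<open>bump\<close>.\<close>

lemma word_step_aux:
  assumes z: "snd (grow f p (f (Suc p))) = 0"
  shows "(if 1 \<le> f (Suc p) \<and> f (Suc p) \<le> m
      then word f (Suc p) m = ins (f (Suc p) - 1) (word f p m) \<and>
        fst (grow f (Suc p) m) = ins_row (f (Suc p) - 1) (word f p m)
      else word f (Suc p) m = word f p m \<and> fst (grow f (Suc p) m) = 0)"
proof (induction m)
  case 0
  then show ?case by (auto simp: word_def)
next
  case (Suc m)
  define j where "j = f (Suc p)"
  consider "1 \<le> j \<and> j \<le> m" | "j = Suc m" | "j = 0 \<or> j > Suc m" by linarith
  then show ?case
  proof cases
    case 1
    then have h: "word f (Suc p) m = ins (j - 1) (word f p m)"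
      "fst (grow f (Suc p) m) = ins_row (j - 1) (word f p m)" using Suc by (auto simp: j_def)
    have l: "j - 1 < length (word f p m)" using 1 by auto
    have "j - 1 < m" "Suc (j - 1) = j" using 1 by auto
    then have "word f p m ! (j - 1) = 0" using z word_nth[of "j - 1" m f p] by (simp add: j_def[symmetric])
    then have pos: "ins_row (j - 1) (word f p m) \<ge> 1" using ins_row_pos l by blast
    note a = ins_append1[OF l, of "snd (grow f p (Suc m))"]
    have "f (Suc p) \<noteq> Suc m" using 1 by (simp add: j_def)
    then have g: "grow f (Suc p) (Suc m) = cell False (ins_row (j - 1) (word f p m)) (snd (grow f p (Suc m)))"
      using h(2) by simp
    have "word f (Suc p) (Suc m) = ins (j - 1) (word f p (Suc m))"
      "fst (grow f (Suc p) (Suc m)) = ins_row (j - 1) (word f p (Suc m))"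
      unfolding word_Suc[of f "Suc p"] word_Suc[of f p] a g h(1) using pos by (auto simp: cell_def)
    then show ?thesis using 1 unfolding j_def[symmetric] by simp
  next
    case 2
    then have h: "word f (Suc p) m = word f p m" "fst (grow f (Suc p) m) = 0"
      using Suc by (auto simp: j_def)
    have z': "snd (grow f p (Suc m)) = 0" using z 2 by (simp add: j_def)
    show ?thesis using 2 ins_last[of "word f p m"] unfolding j_def[symmetric]
      by (simp add: word_Suc[of f "Suc p"] word_Suc[of f p] h cell_def j_def[symmetric] z')
  next
    case 3
    then have "word f (Suc p) m = word f p m" "fst (grow f (Suc p) m) = 0"
      using Suc by (auto simp: j_def split: if_splits)
    then show ?thesis using 3 unfolding j_def[symmetric]
      by (auto simp: word_Suc[of f "Suc p"] word_Suc[of f p] cell_def j_def[symmetric])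
  qed
qed

text \<open>Partial involutions, where \<open>0\<close> means undefined. They arise because removing
  \<open>n + 1\<close> from an involution leaves its partner without an image.\<close>

definition pinv :: "nat \<Rightarrow> (nat \<Rightarrow> nat) set" where
  "pinv n = {f. (\<forall>v. v \<notin> {1..n} \<longrightarrow> f v = 0) \<and> (\<forall>v. f v \<noteq> 0 \<longrightarrow> f (f v) = v)}"

lemma pinv_sym: "f \<in> pinv n \<Longrightarrow> 1 \<le> p \<Longrightarrow> 1 \<le> v \<Longrightarrow> f p = v \<longleftrightarrow> f v = p"
  unfolding pinv_def by force

lemma pinv_range: "f \<in> pinv n \<Longrightarrow> f v \<le> n"
proof (rule ccontr)
  assume f: "f \<in> pinv n" and v: "\<not> f v \<le> n"
  then have "f (f v) = 0" "f (f v) = v" by (auto simp: pinv_def)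
  then have "v = 0" by simp
  then show False using f v by (auto simp: pinv_def)
qed

lemma pinv_sndgrow:
  assumes f: "f \<in> pinv n"
  shows "snd (grow f p (f (Suc p))) = 0"
proof (cases "f (Suc p) = 0")
  case False
  have "f u \<noteq> f (Suc p)" if "1 \<le> u" "u \<le> p" for u
    using that False f unfolding pinv_def by (metis (mono_tags, lifting) mem_Collect_eq not_less_eq_eq order_refl)
  then show ?thesis by (intro letter_zero) auto
qed simp

definition res :: "nat \<Rightarrow> (nat \<Rightarrow> nat) \<Rightarrow> nat \<Rightarrow> nat" where
  "res n f = f(f (Suc n) := 0, Suc n := 0)"

lemma pinv_invol: "f \<in> pinv n \<Longrightarrow> f v \<noteq> 0 \<Longrightarrow> f (f v) = v"
  by (simp add: pinv_def)

lemma pinv_zero: "f \<in> pinv n \<Longrightarrow> v = 0 \<or> n < v \<Longrightarrow> f v = 0"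
  by (auto simp: pinv_def)

lemma pinvI:
  assumes "\<And>v. v = 0 \<or> n < v \<Longrightarrow> f v = 0" "\<And>v. f v \<noteq> 0 \<Longrightarrow> f (f v) = v"
  shows "f \<in> pinv n"
  using assms unfolding pinv_def by (auto simp: not_le Suc_le_eq)

lemma res_pinv:
  assumes f: "f \<in> pinv (Suc n)"
  shows "res n f \<in> pinv n"
proof (rule pinvI)
  fix v assume "v = 0 \<or> n < v"
  then show "res n f v = 0" using pinv_zero[OF f, of v] by (cases "v = Suc n") (auto simp: res_def)
next
  fix v assume v: "res n f v \<noteq> 0"
  then have a: "v \<noteq> Suc n" "v \<noteq> f (Suc n)" "res n f v = f v" "f v \<noteq> 0" by (auto simp: res_def split: if_splits)
  have b: "f (f v) = v" using pinv_invol[OF f a(4)] .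
  then have "f v \<noteq> Suc n" using a by metis
  moreover have "f v \<noteq> f (Suc n)"
  proof
    assume e: "f v = f (Suc n)"
    then have "f (f (Suc n)) = Suc n" using a(4) pinv_invol[OF f, of "Suc n"] by simp
    then show False using e b a by simp
  qed
  ultimately show "res n f (res n f v) = v" using a b by (simp add: res_def)
qed

lemma word_res:
  assumes "f \<in> pinv (Suc n)"
  shows "word (res n f) n n = word f n n"
proof -
  have "grow (res n f) n v = grow f n v" if "v \<le> n" for v
  proof (rule grow_cong[OF _ order_refl that])
    fix p v assume h: "1 \<le> p" "p \<le> n" "1 \<le> v" "v \<le> n"
    show "res n f p = v \<longleftrightarrow> f p = v"
      using h assms pinv_sym[OF assms, of p v] pinv_sym[OF assms, of "Suc n" p] by (auto simp: res_def)
  qed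
  then show ?thesis by (auto simp: word_def)
qed

text \<open>The letter of the new value \<open>n + 1\<close> lies on the last column of the diagram, which
  by symmetry equals the last line. There the partner of \<open>n + 1\<close> is inserted, which adds a cell
  to some row \<open>c\<close>; the corner square then sends \<open>n + 1\<close> to row
  \<open>c + 1\<close>.\<close>

lemma word_pinv_Suc:
  assumes f: "f \<in> pinv (Suc n)"
  shows "word f (Suc n) (Suc n) =
    (if f (Suc n) = 0 then word (res n f) n n @ [0]
     else if f (Suc n) = Suc n then word (res n f) n n @ [1]
     else ins (f (Suc n) - 1) (word (res n f) n n) @ [Suc (ins_row (f (Suc n) - 1) (word (res n f) n n))])"
proof -
  define j where "j = f (Suc n)"
  have jn: "j \<le> Suc n" using pinv_range[OF f] j_def by simp
  note st = word_step_aux[OF pinv_sndgrow[OF f], of n, folded j_def]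
  have s: "snd (grow f n (Suc n)) = fst (grow f (Suc n) n)"
    using grow_sym[of f "Suc n" n] pinv_sym[OF f] by simp
  consider "j = 0" | "j = Suc n" | "1 \<le> j" "j \<le> n" using jn by linarith
  then show ?thesis
  proof cases
    case 1
    then show ?thesis using st s unfolding j_def[symmetric] word_res[OF f]
      by (auto simp: word_Suc cell_def j_def)
  next
    case 2
    then show ?thesis using st s unfolding j_def[symmetric] word_res[OF f]
      by (auto simp: word_Suc cell_def j_def)
  next
    case 3
    have l: "j - 1 < length (word f n n)" using 3 by auto
    have "word f n n ! (j - 1) = 0" using 3 pinv_sndgrow[OF f, of n] by (simp add: word_nth j_def)
    then have pos: "ins_row (j - 1) (word f n n) \<ge> 1" using ins_row_pos l by blast
    from 3 st s have h: "word f (Suc n) n = ins (j - 1) (word f n n)"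
      "fst (grow f (Suc n) n) = ins_row (j - 1) (word f n n)" "snd (grow f n (Suc n)) = ins_row (j - 1) (word f n n)"
      by auto
    show ?thesis using 3 pos h unfolding j_def[symmetric] word_res[OF f] word_Suc[of f "Suc n" n]
      by (auto simp: cell_def j_def[symmetric])
  qed
qed

lemma word_zero_iff:
  assumes f: "f \<in> pinv n" and v: "1 \<le> v" "v \<le> n"
  shows "word f n n ! (v - 1) = 0 \<longleftrightarrow> f v = 0"
proof
  assume "f v = 0"
  then have "snd (grow f n v) = 0" using pinv_sym[OF f] v by (intro letter_zero) force
  then show "word f n n ! (v - 1) = 0" using v by (simp add: word_nth)
next
  assume w: "word f n n ! (v - 1) = 0"
  show "f v = 0"
  proof (rule ccontr)
    assume "f v \<noteq> 0"
    then have "snd (grow f n v) \<ge> 1" using pinv_sym[OF f, of v "f v"] v pinv_range[OF f]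
      by (intro letter_pos[of "f v"]) auto
    then show False using w v by (simp add: word_nth)
  qed
qed

lemma res_j_zero:
  assumes f: "f \<in> pinv (Suc n)" and j: "1 \<le> f (Suc n)" "f (Suc n) \<le> n"
  shows "f (Suc n) - 1 < length (word (res n f) n n)" "word (res n f) n n ! (f (Suc n) - 1) = 0"
proof -
  show "f (Suc n) - 1 < length (word (res n f) n n)" using j by auto
  show "word (res n f) n n ! (f (Suc n) - 1) = 0"
    by (subst word_zero_iff[OF res_pinv[OF f] j]) (simp add: res_def)
qed

lemma word_ballot: "f \<in> pinv n \<Longrightarrow> ballot (word f n n)"
proof (induction n arbitrary: f)
  case (Suc n)
  let ?r = "word (res n f) n n"
  have r: "ballot ?r" using Suc res_pinv by blast
  consider "f (Suc n) = 0" | "f (Suc n) = Suc n" | "1 \<le> f (Suc n)" "f (Suc n) \<le> n"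
    using pinv_range[OF Suc.prems, of "Suc n"] by linarith
  then show ?case
  proof cases
    case 3
    note z = res_j_zero[OF Suc.prems 3]
    have a: "ballot (ins (f (Suc n) - 1) ?r)" "ins_row (f (Suc n) - 1) ?r \<ge> 1"
      "\<And>r. r \<ge> 1 \<Longrightarrow> count_list (ins (f (Suc n) - 1) ?r) r = count_list ?r r + (if r = ins_row (f (Suc n) - 1) ?r then 1 else 0)"
      using ins_ballot[OF r z] by auto
    define c where "c = ins_row (f (Suc n) - 1) ?r"
    define w where "w = ins (f (Suc n) - 1) ?r"
    have "count_list (w @ [Suc c]) (Suc x) \<le> count_list (w @ [Suc c]) x" if x: "x \<ge> 1" for x
      using ballot_count[OF a(1) x] ballot_count[OF r x] a(3)[OF x] a(3)[of "Suc x"] x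
      unfolding w_def[symmetric] c_def[symmetric] by (cases "x = c") auto
    then have "ballot (ins (f (Suc n) - 1) ?r @ [Suc (ins_row (f (Suc n) - 1) ?r)])"
      using a(1) by (simp add: ballot_append1 w_def c_def)
    then show ?thesis using 3 by (simp add: word_pinv_Suc[OF Suc.prems])
  qed (use r ballot_count[OF r] in \<open>auto simp: word_pinv_Suc[OF Suc.prems] ballot_append1 le_SucI\<close>)
qed (simp add: word_def)

lemma word_inj: "f \<in> pinv n \<Longrightarrow> g \<in> pinv n \<Longrightarrow> word f n n = word g n n \<Longrightarrow> f = g"
proof (induction n arbitrary: f g)
  case 0
  then show ?case by (auto simp: pinv_def fun_eq_iff)
next
  case (Suc n)
  have c: "f (Suc n) = 0 \<or> f (Suc n) = Suc n \<or> 1 \<le> f (Suc n) \<and> f (Suc n) \<le> n" if "f \<in> pinv (Suc n)" for f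
    using pinv_range[OF that, of "Suc n"] by linarith
  have e: "f (Suc n) = g (Suc n) \<and> word (res n f) n n = word (res n g) n n"
  proof -
    have *: "f (Suc n) - 1 < length (word (res n f) n n) \<and> word (res n f) n n ! (f (Suc n) - 1) = 0
        \<and> ins_row (f (Suc n) - 1) (word (res n f) n n) \<ge> 1"
      if "f \<in> pinv (Suc n)" "1 \<le> f (Suc n)" "f (Suc n) \<le> n" for f
      using res_j_zero[OF that] ins_row_pos by blast
    show ?thesis
      using Suc.prems(3) c[OF Suc.prems(1)] c[OF Suc.prems(2)] *[OF Suc.prems(1)] *[OF Suc.prems(2)]
        ins_inj[of "f (Suc n) - 1" "word (res n f) n n" "g (Suc n) - 1" "word (res n g) n n"]
      unfolding word_pinv_Suc[OF Suc.prems(1)] word_pinv_Suc[OF Suc.prems(2)]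
      by (auto split: if_splits)
  qed
  have r: "res n f = res n g"
    using Suc.IH[OF res_pinv[OF Suc.prems(1)] res_pinv[OF Suc.prems(2)]] e by blast
  have rec: "f = (res n f)(Suc n := f (Suc n), f (Suc n) := (if f (Suc n) = 0 then 0 else Suc n))" if "f \<in> pinv (Suc n)" for f
    using that unfolding pinv_def res_def by (auto simp: fun_eq_iff)
  show ?case using rec[OF Suc.prems(1)] rec[OF Suc.prems(2)] r e by simp
qed

text \<open>The last letter tells how \<open>n + 1\<close> behaves: it is undefined for \<open>0\<close>,
  fixed for \<open>1\<close>, and for \<open>z \<ge> 2\<close> its partner is found by reverse insertion
  from row \<open>z - 1\<close>.\<close>

lemma word_surj: "length y = n \<Longrightarrow> ballot y \<Longrightarrow> \<exists>f\<in>pinv n. word f n n = y"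
proof (induction n arbitrary: y)
  case 0
  then show ?case by (intro bexI[of _ "\<lambda>_. 0"]) (auto simp: pinv_def word_def)
next
  case (Suc n)
  obtain ys z where y: "y = ys @ [z]" "length ys = n" using Suc.prems(1) by (metis length_Suc_conv_rev)
  have ly: "ballot ys" and cy: "\<And>r. r \<ge> 1 \<Longrightarrow> count_list (ys @ [z]) (Suc r) \<le> count_list (ys @ [z]) r"
    using Suc.prems(2) unfolding y by (auto simp: ballot_append1)
  consider "z = 0" | "z = 1" | "z \<ge> 2" by linarith
  then show ?case
  proof cases
    case 1
    obtain f where f: "f \<in> pinv n" "word f n n = ys" using Suc.IH[OF y(2) ly] by blast
    then have f': "f \<in> pinv (Suc n)" "f (Suc n) = 0" by (auto simp: pinv_def)
    have "res n f = f" using f' f(1) by (auto simp: res_def pinv_def fun_eq_iff)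
    then show ?thesis using f f' 1 y by (intro bexI[OF _ f'(1)]) (simp add: word_pinv_Suc[OF f'(1)])
  next
    case 2
    obtain f where f: "f \<in> pinv n" "word f n n = ys" using Suc.IH[OF y(2) ly] by blast
    define g where "g = f(Suc n := Suc n)"
    have g: "g \<in> pinv (Suc n)" using f(1) pinv_range[OF f(1)]
      unfolding g_def pinv_def by (auto simp: Suc_n_not_le_n) (metis Suc_n_not_le_n)+
    have "res n g = f" using f(1) by (auto simp: res_def g_def pinv_def fun_eq_iff)
    moreover have "g (Suc n) = Suc n" by (simp add: g_def)
    ultimately show ?thesis using f 2 y by (intro bexI[OF _ g]) (simp add: word_pinv_Suc[OF g])
  next
    case 3
    define c where "c = z - 1"
    have c: "c \<ge> 1" "z = Suc c" using 3 by (auto simp: c_def)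
    have "count_list ys c > count_list ys (Suc c)" using cy[OF c(1)] c by auto
    from ex_ins[OF ly c(1) this] obtain xs j where
      x: "ballot xs" "j < length xs" "xs ! j = 0" "ins j xs = ys" "ins_row j xs = c" by blast
    have lx: "length xs = n" using x(4) y(2) length_ins by metis
    obtain f where f: "f \<in> pinv n" "word f n n = xs" using Suc.IH[OF lx x(1)] by blast
    have fj: "f (Suc j) = 0" using word_zero_iff[OF f(1), of "Suc j"] x(2,3) lx f(2) by simp
    define g where "g = f(Suc n := Suc j, Suc j := Suc n)"
    have nf: "f v \<noteq> Suc n" "f v \<noteq> Suc j" for v
    proof -
      show "f v \<noteq> Suc n" using pinv_range[OF f(1), of v] by auto
      show "f v \<noteq> Suc j"
      proof
        assume a: "f v = Suc j"
        then have "f (Suc j) = v" using f(1) unfolding pinv_def by (metis (mono_tags, lifting) mem_Collect_eq nat.distinct(1))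
        then show False using fj a f(1) unfolding pinv_def by auto
      qed
    qed
    have g: "g \<in> pinv (Suc n)"
      using f(1) nf x(2) lx unfolding g_def pinv_def by auto
    have "res n g = f" using f(1) fj x(2) lx by (auto simp: res_def g_def pinv_def fun_eq_iff)
    moreover have "g (Suc n) = Suc j" using x(2) lx by (simp add: g_def)
    ultimately show ?thesis using f x y c lx by (intro bexI[OF _ g]) (simp add: word_pinv_Suc[OF g])
  qed
qed

text \<open>A pair of exchanged values adds cells to two consecutive rows, whose signs cancel, while a fixed
  point adds a cell to the first row.\<close>

lemma sum_sg_word: "f \<in> pinv n \<Longrightarrow> sum_list (map sg (word f n n)) = int (card {v\<in>{1..n}. f v = v})"
proof (induction n arbitrary: f)
  case (Suc n)
  let ?r = "word (res n f) n n"
  have r: "sum_list (map sg ?r) = int (card {v\<in>{1..n}. res n f v = v})" using Suc res_pinv by blast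
  have e: "{v\<in>{1..Suc n}. f v = v} = {v\<in>{1..n}. res n f v = v} \<union> (if f (Suc n) = Suc n then {Suc n} else {})"
    using Suc.prems by (auto simp: res_def le_Suc_eq pinv_def split: if_splits)
  have ce: "card {v\<in>{1..Suc n}. f v = v} = card {v\<in>{1..n}. res n f v = v} + (if f (Suc n) = Suc n then 1 else 0)"
    unfolding e by (subst card_Un_disjoint) auto
  consider "f (Suc n) = 0" | "f (Suc n) = Suc n" | "1 \<le> f (Suc n)" "f (Suc n) \<le> n"
    using pinv_range[OF Suc.prems, of "Suc n"] by linarith
  then show ?case
  proof cases
    case 3
    note z = res_j_zero[OF Suc.prems 3]
    have "ins_row (f (Suc n) - 1) ?r \<ge> 1" using z ins_row_pos by blast
    moreover have "sg c + sg (Suc c) = 0" if "c \<ge> 1" for c using that by (auto simp: sg_def)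
    ultimately have "sg (ins_row (f (Suc n) - 1) ?r) + sg (Suc (ins_row (f (Suc n) - 1) ?r)) = 0" by blast
    moreover have "word f (Suc n) (Suc n) = ins (f (Suc n) - 1) ?r @ [Suc (ins_row (f (Suc n) - 1) ?r)]"
      using 3 by (simp add: word_pinv_Suc[OF Suc.prems])
    ultimately show ?thesis using 3 r sum_sg_ins[OF z] unfolding ce by simp
  qed (use r ce in \<open>auto simp: word_pinv_Suc[OF Suc.prems] sg_01\<close>)
qed (simp add: word_def)

text \<open>Increasing subsequences of the row numbers and decreasing subsequences of the permutation obey the
  same recursion, by \<open>lis_drop_ins\<close>. For \<open>i = 0\<close> this is the theorem of
  Schensted.\<close>

lemma lis_word:
  assumes f: "f \<in> pinv n" and t: "\<And>v. 1 \<le> v \<Longrightarrow> v \<le> n \<Longrightarrow> 1 \<le> f v" and p: "p \<le> n"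
  shows "lis 0 (drop i (word f p n)) = lis i (rev (map f [1..<Suc p]))"
  using p
proof (induction p arbitrary: i)
  case 0
  have "lis 0 (map (\<lambda>_. 0) xs) = 0" for xs :: "nat list" by (induction xs) auto
  then show ?case by (simp add: word_def drop_map)
next
  case (Suc p)
  define j where "j = f (Suc p)"
  have j: "1 \<le> j" "j \<le> n" using t[of "Suc p"] Suc.prems pinv_range[OF f] by (auto simp: j_def)
  have w: "word f (Suc p) n = ins (j - 1) (word f p n)"
    using word_step_aux[OF pinv_sndgrow[OF f], of p n] j by (auto simp: j_def)
  have z: "word f p n ! (j - 1) = 0" using j pinv_sndgrow[OF f, of p] by (simp add: word_nth j_def)
  have l: "j - 1 < length (word f p n)" using j by auto
  have r: "rev (map f [1..<Suc (Suc p)]) = j # rev (map f [1..<Suc p])" by (simp add: j_def)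
  show ?case unfolding w lis_drop_ins[OF l z] r using Suc j by auto
qed

text \<open>In a ballot word a letter \<open>x\<close> is preceded by \<open>x - 1\<close>, which is
  preceded by \<open>x - 2\<close>, and so on down to \<open>1\<close>. Hence \<open>1, \<dots>, x\<close>
  is a subsequence.\<close>

lemma lis_le_iff_letters:
  assumes "ballot y"
  shows "lis 0 y \<le> k \<longleftrightarrow> (\<forall>x\<in>set y. x \<le> k)"
proof
  have "lis b y \<le> k - b" if "\<forall>x\<in>set y. x \<le> k" for b y
    using that
  proof (induction y arbitrary: b)
    case (Cons a y)
    have "lis b y \<le> k - b" "lis a y \<le> k - a" "a \<le> k" using Cons by auto
    then show ?case by auto
  qed simp
  then show "\<forall>x\<in>set y. x \<le> k \<Longrightarrow> lis 0 y \<le> k" by (metis diff_zero)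
next
  \<comment> \<open>The predecessor of a letter occurs before its first occurrence.\<close>
  have chain: "subseq [1..<Suc x] y" if "ballot y" "x \<in> set y" "1 \<le> x" for x y
    using that
  proof (induction y arbitrary: x rule: rev_induct)
    case (snoc z y)
    have ly: "ballot y" using snoc.prems by (simp add: ballot_append1)
    show ?case
    proof (cases "x \<in> set y")
      case True
      then show ?thesis using snoc.IH[OF ly True snoc.prems(3)] list_emb_append2 by blast
    next
      case False
      then have z: "z = x" using snoc.prems by simp
      show ?thesis
      proof (cases "x = 1")
        case True
        then show ?thesis using z by (simp add: list_emb_append2)
      next
        case x1: False
        then have x2: "x - 1 \<ge> 1" "Suc (x - 1) = x" using snoc.prems by auto
        have "count_list (y @ [z]) (Suc (x - 1)) \<le> count_list (y @ [z]) (x - 1)"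
          using snoc.prems(1) x2(1) unfolding ballot_append1 by blast
        then have "count_list y (x - 1) \<noteq> 0" using x2 z by (auto split: if_splits)
        then have "x - 1 \<in> set y" by (metis count_notin)
        from snoc.IH[OF ly this x2(1)] have "subseq [1..<x] y" using x2 by simp
        then have "subseq ([1..<x] @ [x]) (y @ [x])" by simp
        then show ?thesis using z snoc.prems(3) by simp
      qed
    qed
  qed simp
  have sub: "x - b \<le> lis b y" if "subseq [Suc b..<Suc x] y" for b y x
    using that
  proof (induction y arbitrary: b rule: list.induct)
    case Nil
    then have "[Suc b..<Suc x] = []" by (cases "[Suc b..<Suc x]") simp_all
    then have "Suc x \<le> Suc b" unfolding upt_eq_Nil_conv by auto
    then show ?case by simp
  next
    case (Cons a y)
    show ?case
    proof (cases "b < x")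
      case True
      then have u: "[Suc b..<Suc x] = Suc b # [Suc (Suc b)..<Suc x]" by (simp add: upt_conv_Cons)
      show ?thesis
      proof (cases "a = Suc b")
        case True
        then have "subseq [Suc (Suc b)..<Suc x] y" using Cons.prems unfolding u by simp
        from Cons.IH[OF this] show ?thesis using True by auto
      next
        case False
        then have "subseq [Suc b..<Suc x] y" using Cons.prems unfolding u by (simp add: subseq_Cons2_iff)
        from Cons.IH[OF this] show ?thesis by auto
      qed
    qed simp
  qed
  have ex: "lis 0 y \<ge> x" if "ballot y" "x \<in> set y" for x y
    using chain[OF that] sub[of 0 x y] by (cases "x = 0") auto
  show "\<forall>x\<in>set y. x \<le> k" if "lis 0 y \<le> k"
    using ex[OF assms] that by (meson le_trans)
qed

text \<open>The positions are found from the right, where the smallest value of a decreasing subsequence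
  stands; \<open>b\<close> bounds the values from below.\<close>

lemma lis_ge_iff:
  "d \<le> lis b (rev (map f [1..<Suc p])) \<longleftrightarrow>
    (\<exists>i. strict_mono_on {1..d} i \<and> i ` {1..d} \<subseteq> {1..p} \<and>
      (\<forall>j\<in>{1..d}. \<forall>l\<in>{1..d}. j < l \<longrightarrow> f (i l) < f (i j)) \<and> (\<forall>j\<in>{1..d}. b < f (i j)))"
proof (induction p arbitrary: d b)
  case 0
  show ?case by (cases d) (auto simp: strict_mono_on_def)
next
  case (Suc p)
  define x where "x = f (Suc p)"
  define P where "P d b p i \<longleftrightarrow> strict_mono_on {1..d} i \<and> i ` {1..d} \<subseteq> {1..p} \<and>
      (\<forall>j\<in>{1..d}. \<forall>l\<in>{1..d}. j < l \<longrightarrow> f (i l) < f (i j)) \<and> (\<forall>j\<in>{1..d}. b < f (i j))" for d b p and i :: "nat \<Rightarrow> nat"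
  have IH: "d \<le> lis b (rev (map f [1..<Suc p])) \<longleftrightarrow> (\<exists>i. P d b p i)" for d b
    using Suc.IH unfolding P_def by blast
  have r: "rev (map f [1..<Suc (Suc p)]) = x # rev (map f [1..<Suc p])" by (simp add: x_def)
  have "d \<le> lis b (rev (map f [1..<Suc (Suc p)])) \<longleftrightarrow>
     d \<le> lis b (rev (map f [1..<Suc p])) \<or> (b < x \<and> d \<ge> 1 \<and> d - 1 \<le> lis x (rev (map f [1..<Suc p])))"
    unfolding r by (cases d) auto
  also have "\<dots> \<longleftrightarrow> (\<exists>i. P d b p i) \<or> (b < x \<and> d \<ge> 1 \<and> (\<exists>i. P (d - 1) x p i))"
    unfolding IH ..
  also have "\<dots> \<longleftrightarrow> (\<exists>i. P d b (Suc p) i)"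
  proof
    assume "(\<exists>i. P d b p i) \<or> (b < x \<and> d \<ge> 1 \<and> (\<exists>i. P (d - 1) x p i))"
    then show "\<exists>i. P d b (Suc p) i"
    proof (elim disjE conjE exE)
      fix i assume "P d b p i"
      then show ?thesis unfolding P_def by (intro exI[of _ i]) auto
    next
      fix i assume h: "b < x" "d \<ge> 1" "P (d - 1) x p i"
      have a: "j \<in> {1..d - 1}" if "j \<in> {1..d}" "j \<noteq> d" for j using that by auto
      define i' where "i' = i(d := Suc p)"
      have i1: "i' j = i j" if "j \<noteq> d" for j using that by (simp add: i'_def)
      have i2: "i' d = Suc p" by (simp add: i'_def)
      have h3: "\<And>j l. j \<in> {1..d-1} \<Longrightarrow> l \<in> {1..d-1} \<Longrightarrow> j < l \<Longrightarrow> i j < i l \<and> f (i l) < f (i j)"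
        "\<And>j. j \<in> {1..d-1} \<Longrightarrow> 1 \<le> i j \<and> i j \<le> p \<and> x < f (i j)"
        using h(3) unfolding P_def by (auto simp: strict_mono_on_def image_subset_iff)
      have "i' j < i' l \<and> f (i' l) < f (i' j)" if "j \<in> {1..d}" "l \<in> {1..d}" "j < l" for j l
        using that h3(1)[of j l] h3(2)[of j] i1 i2 by (cases "l = d") (auto simp: x_def less_Suc_eq_le)
      moreover have "1 \<le> i' j \<and> i' j \<le> Suc p \<and> b < f (i' j)" if "j \<in> {1..d}" for j
        using h3(2)[OF a[OF that]] h(1) i1[of j] i2 by (cases "j = d") (auto simp: x_def)
      ultimately have "P d b (Suc p) i'" unfolding P_def strict_mono_on_def by auto
      then show ?thesis by blast
    qed
  next
    assume "\<exists>i. P d b (Suc p) i"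
    then obtain i where i: "P d b (Suc p) i" by blast
    show "(\<exists>i. P d b p i) \<or> (b < x \<and> d \<ge> 1 \<and> (\<exists>i. P (d - 1) x p i))"
    proof (cases "d \<ge> 1 \<and> i d = Suc p")
      case True
      then have d: "d \<in> {1..d}" by simp
      then have "b < f (i d)" using i unfolding P_def by blast
      then have "b < x" using True by (simp add: x_def)
      moreover have "P (d - 1) x p i"
      proof -
        have a: "j \<in> {1..d} \<and> j < d" if "j \<in> {1..d - 1}" for j using that by auto
        have b1: "\<And>j l. j \<in> {1..d} \<Longrightarrow> l \<in> {1..d} \<Longrightarrow> j < l \<Longrightarrow> i j < i l \<and> f (i l) < f (i j)"
          and b2: "\<And>j. j \<in> {1..d} \<Longrightarrow> i j \<in> {1..Suc p}"
          using i unfolding P_def strict_mono_on_def by blast+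
        have "i j \<in> {1..p} \<and> x < f (i j)" if "j \<in> {1..d-1}" for j
          using b1[of j d] b2[of j] a[OF that] d True by (auto simp: x_def)
        then show ?thesis unfolding P_def strict_mono_on_def using a b1 by blast
      qed
      ultimately show ?thesis using True by blast
    next
      case False
      have "i j \<le> p" if j: "j \<in> {1..d}" for j
      proof -
        have "i j \<le> i d" using i j unfolding P_def strict_mono_on_def by (cases "j = d") (auto intro: less_imp_le)
        moreover have "d \<in> {1..d}" using j by auto
        then have "i d \<in> {1..Suc p}" using i unfolding P_def by blast
        ultimately show ?thesis using False j by auto
      qed
      then have "P d b p i" using i unfolding P_def by (auto simp: image_subset_iff)
      then show ?thesis by blast
    qed
  qed
  finally show ?case unfolding P_def .
qed

section \<open>Involutions without long decreasing subsequences\<close>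

definition ballot_words :: "nat \<Rightarrow> nat \<Rightarrow> nat list set" where
  "ballot_words n k = {y. length y = n \<and> ballot y \<and> set y \<subseteq> {1..k}}"

text \<open>Outside \<open>{1..n}\<close> a permutation is the identity, whereas partial involutions are
  \<open>0\<close> there.\<close>

definition extend0 :: "nat \<Rightarrow> (nat \<Rightarrow> nat) \<Rightarrow> nat \<Rightarrow> nat" where
  "extend0 n p v = (if v \<in> {1..n} then p v else 0)"

lemma perm_contains_decreasing:
  assumes p: "p permutes {1..n}"
  shows "perm_contains n p m (decreasing_perm m) \<longleftrightarrow> m \<le> lis 0 (rev (map p [1..<Suc n]))"
proof -
  have inj: "inj p" using p by (rule permutes_inj)
  have d: "decreasing_perm m l < decreasing_perm m j" if "j \<in> {1..m}" "l \<in> {1..m}" "j < l" for j l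
    using that by (auto simp: decreasing_perm_def)
  have "(p (i j) < p (i l) \<longleftrightarrow> decreasing_perm m j < decreasing_perm m l) \<longleftrightarrow> p (i l) < p (i j)"
    if "j \<in> {1..m}" "l \<in> {1..m}" "j < l" "strict_mono_on {1..m} i" for i j l
  proof -
    have "i j < i l" using that unfolding strict_mono_on_def by blast
    then have "p (i j) \<noteq> p (i l)" using inj by (metis injD less_irrefl)
    then show ?thesis using d[OF that(1-3)] by auto
  qed
  moreover have "0 < p (i j)" if "j \<in> {1..m}" "i ` {1..m} \<subseteq> {1..n}" for i j
  proof -
    have "i j \<in> {1..n}" using that by blast
    then have "p (i j) \<in> {1..n}" using p by (meson permutes_in_image)
    then show ?thesis by simp
  qed
  ultimately show ?thesis unfolding perm_contains_def lis_ge_iff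
    by (intro ex_cong) (smt (verit))
qed

text \<open>Avoidance bounds the number of rows by Schensted's theorem, and the absence of the letter
  \<open>0\<close> means that the partial involution is defined everywhere.\<close>

lemma bij_involutions_words:
  "bij_betw (\<lambda>p. word (extend0 n p) n n)
     (avoiding_involutions n (k + 1) (decreasing_perm (k + 1))) (ballot_words n k)"
proof -
  let ?A = "avoiding_involutions n (k + 1) (decreasing_perm (k + 1))"
  have E: "extend0 n p \<in> pinv n" "\<And>v. 1 \<le> v \<Longrightarrow> v \<le> n \<Longrightarrow> 1 \<le> extend0 n p v"
    if p: "p permutes {1..n}" "p \<circ> p = id" for p
  proof -
    have "v \<in> {1..n} \<Longrightarrow> p v \<in> {1..n} \<and> p (p v) = v" for v
      using p by (metis comp_apply id_apply permutes_in_image)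
    then show "extend0 n p \<in> pinv n" "\<And>v. 1 \<le> v \<Longrightarrow> v \<le> n \<Longrightarrow> 1 \<le> extend0 n p v"
      unfolding pinv_def extend0_def by auto
  qed
  have L: "lis 0 (word (extend0 n p) n n) = lis 0 (rev (map p [1..<Suc n]))"
    if p: "p permutes {1..n}" "p \<circ> p = id" for p
  proof -
    have "map (extend0 n p) [1..<Suc n] = map p [1..<Suc n]" by (auto simp: extend0_def)
    then show ?thesis using lis_word[OF E[OF p] order_refl, of 0] unfolding drop_0 by metis
  qed
  have pos: "(\<forall>x\<in>set (word f n n). 1 \<le> x) \<longleftrightarrow> (\<forall>v\<in>{1..n}. f v \<noteq> 0)" if f: "f \<in> pinv n" for f
  proof -
    have "(\<forall>x\<in>set (word f n n). 1 \<le> x) \<longleftrightarrow> (\<forall>i<n. word f n n ! i \<noteq> 0)"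
      by (auto simp: in_set_conv_nth Suc_le_eq)
    also have "\<dots> \<longleftrightarrow> (\<forall>v\<in>{1..n}. word f n n ! (v - 1) \<noteq> 0)"
    proof (intro iffI ballI allI impI)
      fix v assume "\<forall>i<n. word f n n ! i \<noteq> 0" "v \<in> {1..n}"
      then show "word f n n ! (v - 1) \<noteq> 0" by auto
    next
      fix i assume h: "\<forall>v\<in>{1..n}. word f n n ! (v - 1) \<noteq> 0" "i < n"
      then show "word f n n ! i \<noteq> 0" using bspec[OF h(1), of "Suc i"] by simp
    qed
    also have "\<dots> \<longleftrightarrow> (\<forall>v\<in>{1..n}. f v \<noteq> 0)"
      by (intro ball_cong refl) (simp add: word_zero_iff[OF f] del: One_nat_def)
    finally show ?thesis .
  qed
  have inj: "inj_on (\<lambda>p. word (extend0 n p) n n) ?A"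
  proof (rule inj_onI)
    fix p q assume h: "p \<in> ?A" "q \<in> ?A" "word (extend0 n p) n n = word (extend0 n q) n n"
    then have "extend0 n p = extend0 n q" using E word_inj unfolding avoiding_involutions_def by blast
    then have "v \<in> {1..n} \<Longrightarrow> p v = q v" for v by (metis extend0_def)
    moreover have "v \<notin> {1..n} \<Longrightarrow> p v = q v" for v
      using h permutes_not_in[of p "{1..n}" v] permutes_not_in[of q "{1..n}" v]
      unfolding avoiding_involutions_def by auto
    ultimately show "p = q" by blast
  qed
  have "word (extend0 n p) n n \<in> ballot_words n k" if p: "p \<in> ?A" for p
  proof -
    have pp: "p permutes {1..n}" "p \<circ> p = id" and "lis 0 (word (extend0 n p) n n) \<le> k"
      using p perm_contains_decreasing[of p n "k + 1"] L[of p] unfolding avoiding_involutions_def by auto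
    then have "\<forall>x\<in>set (word (extend0 n p) n n). x \<le> k"
      using lis_le_iff_letters word_ballot E by blast
    moreover have "\<forall>x\<in>set (word (extend0 n p) n n). 1 \<le> x"
      using pos[OF E(1)[OF pp]] E(2)[OF pp] by (auto simp: Suc_le_eq)
    ultimately show ?thesis unfolding ballot_words_def using word_ballot[OF E(1)[OF pp]] by auto
  qed
  moreover have "y \<in> (\<lambda>p. word (extend0 n p) n n) ` ?A" if y: "y \<in> ballot_words n k" for y
  proof -
    obtain f where f: "f \<in> pinv n" "word f n n = y"
      using word_surj[of y n] y unfolding ballot_words_def by auto
    have nz: "f v \<noteq> 0" if "v \<in> {1..n}" for v
      using that pos[OF f(1)] y f(2) unfolding ballot_words_def by auto
    define p where "p v = (if v \<in> {1..n} then f v else v)" for v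
    have fi: "f v \<in> {1..n} \<and> f (f v) = v" if "v \<in> {1..n}" for v
      using nz[OF that] pinv_range[OF f(1), of v] pinv_invol[OF f(1)] by auto
    have pp: "p \<circ> p = id" using fi by (auto simp: p_def fun_eq_iff)
    have "bij_betw p {1..n} {1..n}"
      using fi by (intro bij_betw_byWitness[where f' = p]) (auto simp: p_def)
    then have perm: "p permutes {1..n}" by (intro bij_imp_permutes) (auto simp: p_def)
    have e: "extend0 n p = f" using f(1) unfolding pinv_def by (auto simp: extend0_def p_def)
    have "lis 0 y \<le> k" using lis_le_iff_letters[of y k] y unfolding ballot_words_def by auto
    then have "p \<in> ?A" using L[OF perm pp] perm_contains_decreasing[OF perm, of "k + 1"] perm pp e f
      unfolding avoiding_involutions_def by auto
    then show ?thesis using e f by blast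
  qed
  ultimately show ?thesis using inj unfolding bij_betw_def by blast
qed

lemma fp_eq_sum_sg:
  assumes "p \<in> avoiding_involutions n m s"
  shows "int (fp n p) = sum_list (map sg (word (extend0 n p) n n))"
proof -
  have p: "p permutes {1..n}" "p \<circ> p = id" using assms by (auto simp: avoiding_involutions_def)
  have "v \<in> {1..n} \<Longrightarrow> p v \<in> {1..n} \<and> p (p v) = v" for v
    using p by (metis comp_apply id_apply permutes_in_image)
  then have "extend0 n p \<in> pinv n" unfolding pinv_def extend0_def by auto
  moreover have "{v \<in> {1..n}. extend0 n p v = v} = {v \<in> {1..n}. p v = v}" by (auto simp: extend0_def)
  ultimately show ?thesis using sum_sg_word[of "extend0 n p" n] by (simp add: fp_def)
qed

lemma finite_ballot_words: "finite (ballot_words n k)"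
  by (rule finite_subset[OF _ finite_lists_length_eq[of "{1..k}" n]]) (auto simp: ballot_words_def)

lemma sum_involutions_words:
  "(\<Sum>p\<in>avoiding_involutions n (k + 1) (decreasing_perm (k + 1)). G (int (fp n p))) =
    (\<Sum>y\<in>ballot_words n k. G (sum_list (map sg y)) :: real)"
  by (subst sum.reindex_bij_betw[OF bij_involutions_words, symmetric])
     (simp add: fp_eq_sum_sg cong: sum.cong)

section \<open>The Vandermonde product and the number of ballot words\<close>

text \<open>The sign is such that strictly decreasing vectors have a positive product.\<close>

definition vdm :: "nat \<Rightarrow> (nat \<Rightarrow> real) \<Rightarrow> real" where
  "vdm k x = (\<Prod>j<k. \<Prod>i<j. x i - x j)"

text \<open>The Vandermonde product, cut off outside the Weyl chamber of weakly decreasing vectors.\<close>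

definition vdmp :: "nat \<Rightarrow> (nat \<Rightarrow> real) \<Rightarrow> real" where
  "vdmp k x = (if \<forall>i j. i < j \<and> j < k \<longrightarrow> x j \<le> x i then vdm k x else 0)"

lemma vdm_eq_0: "i < j \<Longrightarrow> j < k \<Longrightarrow> x i = x j \<Longrightarrow> vdm k x = 0"
proof -
  assume h: "i < j" "j < k" "x i = x j"
  then have "(\<Prod>i<j. x i - x j) = 0" by (intro prod_zero) auto
  then show ?thesis unfolding vdm_def using h by (intro prod_zero) auto
qed

lemma sum_lessThan_id: "(\<Sum>r<k. r) = k * (k - 1) div 2" for k :: nat
proof -
  have "2 * (\<Sum>r<k. r) = k * (k - 1)"
  proof (induction k)
    case (Suc k)
    then show ?case by (cases k) (auto simp: algebra_simps)
  qed simp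
  then show ?thesis by simp
qed

lemma vdm_Suc: "vdm (Suc k) x = (\<Prod>j<k. x 0 - x (Suc j)) * vdm k (\<lambda>i. x (Suc i))"
proof -
  have "(\<Prod>i<Suc j. x i - x (Suc j)) = (x 0 - x (Suc j)) * (\<Prod>i<j. x (Suc i) - x (Suc j))" for j
    by (subst prod.lessThan_Suc_shift) simp
  then show ?thesis unfolding vdm_def
    by (subst prod.lessThan_Suc_shift) (simp add: prod.distrib)
qed

text \<open>Expanding along the first row gives a polynomial in \<open>x 0\<close> of degree at most
  \<open>k\<close>, whose coefficient at \<open>k\<close> is the smaller determinant and which vanishes at the
  other points. If these are distinct, that determines it; if two of them coincide, both sides are
  \<open>0\<close>.\<close>

lemma det_monic:
  fixes P :: "nat \<Rightarrow> real poly"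
  assumes P: "\<And>j. degree (P j) = j" "\<And>j. lead_coeff (P j) = 1"
  shows "det (mat k k (\<lambda>(i, j). poly (P (k - 1 - j)) (x i))) = vdm k x"
proof (induction k arbitrary: x)
  case 0
  then show ?case by (simp add: vdm_def det_def)
next
  case (Suc k)
  define A where "A z = mat (Suc k) (Suc k) (\<lambda>(i, j). poly (P (k - j)) (if i = 0 then z else x i))" for z
  have cof: "cofactor (A z) 0 j = cofactor (A 0) 0 j" for z j
  proof -
    have "mat_delete (A z) 0 j = mat_delete (A 0) 0 j"
      unfolding mat_delete_def A_def by (rule eq_matI) auto
    then show ?thesis by (simp add: cofactor_def)
  qed
  define Q where "Q = (\<Sum>j<Suc k. Polynomial.smult (cofactor (A 0) 0 j) (P (k - j)))"
  have Q: "det (A z) = poly Q z" for z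
  proof -
    have "det (A z) = (\<Sum>j<Suc k. A z $$ (0, j) * cofactor (A z) 0 j)"
      by (rule laplace_expansion_row) (auto simp: A_def)
    also have "\<dots> = (\<Sum>j<Suc k. poly (P (k - j)) z * cofactor (A 0) 0 j)"
      by (intro sum.cong refl) (subst cof, simp add: A_def)
    finally show ?thesis by (simp add: Q_def poly_sum mult.commute)
  qed
  have "mat_delete (A 0) 0 0 = mat k k (\<lambda>(i, j). poly (P (k - 1 - j)) (x (Suc i)))"
    unfolding mat_delete_def A_def by (rule eq_matI) auto
  then have lc: "cofactor (A 0) 0 0 = vdm k (\<lambda>i. x (Suc i))"
    using Suc.IH[of "\<lambda>i. x (Suc i)"] by (simp add: cofactor_def)
  have degQ: "degree Q \<le> k"
    unfolding Q_def by (intro degree_sum_le) (auto intro!: order_trans[OF degree_smult_le] simp: P)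
  have coQ: "coeff Q k = vdm k (\<lambda>i. x (Suc i))"
  proof -
    have "coeff Q k = (\<Sum>j<Suc k. cofactor (A 0) 0 j * coeff (P (k - j)) k)"
      by (simp add: Q_def coeff_sum)
    also have "\<dots> = (\<Sum>j\<in>{0}. cofactor (A 0) 0 j * coeff (P (k - j)) k)"
      by (intro sum.mono_neutral_right) (auto intro!: coeff_eq_0 simp: P)
    finally show ?thesis using P[of k] lc by simp
  qed
  have root: "poly Q (x (Suc j)) = 0" if j: "j < k" for j
    unfolding Q[symmetric]
  proof (rule det_identical_rows[of _ "Suc k" 0 "Suc j"])
    show "row (A (x (Suc j))) 0 = row (A (x (Suc j))) (Suc j)"
      by (rule eq_vecI) (use j in \<open>auto simp: A_def\<close>)
  qed (use j in \<open>auto simp: A_def\<close>)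
  have Ax: "det (mat (Suc k) (Suc k) (\<lambda>(i, j). poly (P (Suc k - 1 - j)) (x i))) = poly Q (x 0)"
    unfolding Q[symmetric] A_def by (intro arg_cong[of _ _ det] eq_matI) auto
  show ?case
  proof (cases "inj_on (\<lambda>j. x (Suc j)) {..<k}")
    case False
    then obtain i j where ij: "i < j" "j < k" "x (Suc i) = x (Suc j)"
      unfolding inj_on_def by (metis lessThan_iff linorder_neqE_nat)
    then have "vdm k (\<lambda>i. x (Suc i)) = 0" using vdm_eq_0[of i j k "\<lambda>i. x (Suc i)"] by blast
    moreover have "det (mat (Suc k) (Suc k) (\<lambda>(i, j). poly (P (Suc k - 1 - j)) (x i))) = 0"
    proof (rule det_identical_rows[of _ "Suc k" "Suc i" "Suc j"])
      show "row (mat (Suc k) (Suc k) (\<lambda>(i, j). poly (P (Suc k - 1 - j)) (x i))) (Suc i) =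
        row (mat (Suc k) (Suc k) (\<lambda>(i, j). poly (P (Suc k - 1 - j)) (x i))) (Suc j)"
        by (rule eq_vecI) (use ij in auto)
    qed (use ij in auto)
    ultimately show ?thesis by (simp add: vdm_Suc)
  next
    case True
    define R where "R = Polynomial.smult (vdm k (\<lambda>i. x (Suc i))) (\<Prod>j<k. [:- x (Suc j), 1:])"
    have degP: "degree (\<Prod>j<k. [:- x (Suc j), 1:]) = k" "lead_coeff (\<Prod>j<k. [:- x (Suc j), 1:]) = 1"
      by (simp add: degree_prod_eq_sum_degree, unfold lead_coeff_prod, simp)
    have "Q - R = 0"
    proof (rule ccontr)
      assume nz: "Q - R \<noteq> 0"
      have cR: "coeff R k = vdm k (\<lambda>i. x (Suc i))" using degP by (simp add: R_def)
      have "degree (Q - R) \<le> k"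
        by (intro degree_diff_le degQ) (auto simp: R_def degP intro: order_trans[OF degree_smult_le])
      moreover have "coeff (Q - R) k = 0" using cR coQ by simp
      ultimately have d: "degree (Q - R) < k"
        using nz by (metis leading_coeff_0_iff le_neq_implies_less)
      have "(\<lambda>j. x (Suc j)) ` {..<k} \<subseteq> {z. poly (Q - R) z = 0}"
        using root by (auto simp: R_def poly_prod intro!: prod_zero)
      then have "card ((\<lambda>j. x (Suc j)) ` {..<k}) \<le> card {z. poly (Q - R) z = 0}"
        by (intro card_mono poly_roots_finite nz)
      also have "\<dots> \<le> degree (Q - R)" by (rule card_poly_roots_bound[OF nz])
      finally show False using d True by (simp add: card_image)
    qed
    then have "poly Q (x 0) = poly R (x 0)" by simp
    then show ?thesis unfolding Ax vdm_Suc by (simp add: R_def poly_prod)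
  qed
qed

text \<open>The falling factorial \<open>y (y - 1) \<cdots> (y - m + 1)\<close>.\<close>

definition ffp :: "nat \<Rightarrow> real poly" where
  "ffp m = (\<Prod>u<m. [:- of_nat u, 1:])"

lemma ffp_monic: "degree (ffp m) = m" "lead_coeff (ffp m) = 1"
proof -
  show "degree (ffp m) = m" unfolding ffp_def by (simp add: degree_prod_eq_sum_degree)
  show "lead_coeff (ffp m) = 1" unfolding ffp_def lead_coeff_prod by simp
qed

lemma ffp_shift: "y * poly (ffp m) (y - 1) = poly (ffp m) y * (y - real m)"
proof -
  have "poly (ffp (Suc m)) y = poly (ffp m) y * poly [:- real m, 1:] y"
    unfolding ffp_def prod.lessThan_Suc poly_mult by simp
  then have "poly (ffp m) y * (y - real m) = poly (ffp (Suc m)) y" by simp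
  also have "\<dots> = (\<Prod>u<Suc m. y - real u)"
    unfolding ffp_def poly_prod by (rule prod.cong) auto
  also have "\<dots> = y * (\<Prod>u<m. y - 1 - real u)"
    unfolding prod.lessThan_Suc_shift by (simp add: diff_diff_add)
  also have "(\<Prod>u<m. y - 1 - real u) = poly (ffp m) (y - 1)"
    unfolding ffp_def poly_prod by (rule prod.cong) auto
  finally show ?thesis by (rule sym)
qed

lemma vdm_leibniz:
  "vdm k x = (\<Sum>p | p permutes {0..<k}. signof p * (\<Prod>i = 0..<k. poly (ffp (k - 1 - p i)) (x i)))"
proof -
  have "vdm k x = det (mat k k (\<lambda>(i, j). poly (ffp (k - 1 - j)) (x i)))"
    by (rule det_monic[OF ffp_monic, symmetric])
  also have "\<dots> = (\<Sum>p | p permutes {0..<k}. signof p * (\<Prod>i = 0..<k. poly (ffp (k - 1 - p i)) (x i)))"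
    unfolding det_def
    by (auto intro!: sum.cong prod.cong arg_cong2[of _ _ _ _ "(*)"] dest: permutes_in_image)
  finally show ?thesis .
qed

text \<open>In the expansion of the determinant into falling factorials, lowering \<open>x r\<close> by
  \<open>1\<close> and multiplying by \<open>x r\<close> amounts to a factor \<open>x r - m\<close> by
  \<open>ffp_shift\<close>, and the degrees \<open>m\<close> occurring in one term are
  \<open>0, \<dots>, k - 1\<close> in some order. This is the recursion that the numbers of ballot words
  satisfy.\<close>

lemma vdm_shift_sum:
  "(\<Sum>r<k. x r * vdm k (x(r := x r - 1))) = ((\<Sum>r<k. x r) - real (k * (k - 1) div 2)) * vdm k x"
proof -
  define S where "S = {p. p permutes {0..<k}}"
  define a where "a i m y = poly (ffp (k - 1 - m)) (y :: real)" for i m :: nat and y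
  have t: "x r * (\<Prod>i = 0..<k. poly (ffp (k - 1 - p i)) ((x(r := x r - 1)) i)) =
      (x r - real (k - 1 - p r)) * (\<Prod>i = 0..<k. poly (ffp (k - 1 - p i)) (x i))" if r: "r < k" for r p
  proof -
    have s: "{0..<k} = insert r ({0..<k} - {r})" using r by auto
    have "(\<Prod>i = 0..<k. poly (ffp (k - 1 - p i)) ((x(r := x r - 1)) i)) =
      poly (ffp (k - 1 - p r)) (x r - 1) * (\<Prod>i\<in>{0..<k} - {r}. poly (ffp (k - 1 - p i)) (x i))"
      by (subst s, subst prod.insert) auto
    moreover have "(\<Prod>i = 0..<k. poly (ffp (k - 1 - p i)) (x i)) =
      poly (ffp (k - 1 - p r)) (x r) * (\<Prod>i\<in>{0..<k} - {r}. poly (ffp (k - 1 - p i)) (x i))"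
      by (subst s, subst prod.insert) auto
    moreover have "x r * (poly (ffp (k - 1 - p r)) (x r - 1) * R) =
      (x r - real (k - 1 - p r)) * (poly (ffp (k - 1 - p r)) (x r) * R)" for R
      using ffp_shift[of "x r" "k - 1 - p r"] by (metis (no_types) mult.assoc mult.commute)
    ultimately show ?thesis by (simp only:)
  qed
  have c: "(\<Sum>r<k. real (k - 1 - p r)) = real (k * (k - 1) div 2)" if "p permutes {0..<k}" for p
  proof -
    have "(\<Sum>r<k. real (k - 1 - p r)) = (\<Sum>r<k. real (k - 1 - r))"
      using sum.permute[OF that, of "\<lambda>r. real (k - 1 - r)"] by (simp add: lessThan_atLeast0 o_def)
    also have "\<dots> = (\<Sum>r<k. real r)"
      using sum.nat_diff_reindex[of "\<lambda>r. real r" k] by simp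
    also have "\<dots> = real (\<Sum>r<k. r)" by simp
    also have "(\<Sum>r<k. r) = k * (k - 1) div 2" by (rule sum_lessThan_id)
    finally show ?thesis .
  qed
  have "(\<Sum>r<k. x r * vdm k (x(r := x r - 1))) =
    (\<Sum>r<k. \<Sum>p\<in>S. signof p * ((x r - real (k - 1 - p r)) * (\<Prod>i = 0..<k. poly (ffp (k - 1 - p i)) (x i))))"
    unfolding vdm_leibniz[of k] S_def[symmetric] sum_distrib_left
    by (intro sum.cong refl) (subst t[symmetric], auto simp: algebra_simps)
  also have "\<dots> = (\<Sum>p\<in>S. \<Sum>r<k. signof p * ((x r - real (k - 1 - p r)) * (\<Prod>i = 0..<k. poly (ffp (k - 1 - p i)) (x i))))"
    by (rule sum.swap)
  also have "\<dots> = (\<Sum>p\<in>S. ((\<Sum>r<k. x r) - real (k * (k - 1) div 2)) * (signof p * (\<Prod>i = 0..<k. poly (ffp (k - 1 - p i)) (x i))))"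
  proof (intro sum.cong refl)
    fix p assume "p \<in> S"
    then have "(\<Sum>r<k. x r - real (k - 1 - p r)) = (\<Sum>r<k. x r) - real (k * (k - 1) div 2)"
      using c[of p] by (simp add: S_def sum_subtractf)
    then show "(\<Sum>r<k. signof p * ((x r - real (k - 1 - p r)) * (\<Prod>i = 0..<k. poly (ffp (k - 1 - p i)) (x i)))) =
      ((\<Sum>r<k. x r) - real (k * (k - 1) div 2)) * (signof p * (\<Prod>i = 0..<k. poly (ffp (k - 1 - p i)) (x i)))"
      by (simp flip: sum_distrib_left sum_distrib_right add: mult.left_commute)
  qed
  also have "\<dots> = ((\<Sum>r<k. x r) - real (k * (k - 1) div 2)) * vdm k x"
    unfolding vdm_leibniz[of k x] S_def[symmetric] by (simp add: sum_distrib_left)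
  finally show ?thesis .
qed

text \<open>The staircase makes the row lengths strictly decreasing and turns the hook length formula into a
  Vandermonde product.\<close>

definition shifted_content :: "nat \<Rightarrow> nat list \<Rightarrow> nat \<Rightarrow> nat" where
  "shifted_content k y r = (if r < k then count_list y (Suc r) + (k - 1 - r) else 0)"

definition words :: "nat \<Rightarrow> nat \<Rightarrow> nat list set" where
  "words N k = {w. length w = N \<and> set w \<subseteq> {..<k}}"

lemma finite_words: "finite (words N k)"
  by (rule finite_subset[OF _ finite_lists_length_eq[of "{..<k}" N]]) (auto simp: words_def)

lemma sum_fun_dec:
  fixes l :: "nat \<Rightarrow> nat"
  assumes "r < k" "l r \<ge> 1"
  shows "sum (l(r := l r - 1)) {..<k} = sum l {..<k} - 1"
    "(\<Prod>i<k. fact (l i) :: real) = real (l r) * (\<Prod>i<k. fact ((l(r := l r - 1)) i))"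
proof -
  have s: "{..<k} = insert r ({..<k} - {r})" using assms by auto
  have e: "sum l {..<k} = l r + sum l ({..<k} - {r})" by (subst s, subst sum.insert) auto
  moreover have "sum (l(r := l r - 1)) {..<k} = (l r - 1) + sum l ({..<k} - {r})"
    by (subst s, subst sum.insert) (auto intro!: sum.cong)
  ultimately show "sum (l(r := l r - 1)) {..<k} = sum l {..<k} - 1" using assms by simp
  have "(\<Prod>i<k. fact (l i) :: real) = fact (l r) * (\<Prod>i\<in>{..<k} - {r}. fact (l i))"
    by (subst s, subst prod.insert) auto
  moreover have "(\<Prod>i<k. fact ((l(r := l r - 1)) i) :: real) = fact (l r - 1) * (\<Prod>i\<in>{..<k} - {r}. fact (l i))"
    by (subst s, subst prod.insert) auto
  moreover have "(fact (l r) :: real) = real (l r) * fact (l r - 1)"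
    using assms by (metis fact_reduce less_eq_Suc_le One_nat_def)
  ultimately show "(\<Prod>i<k. fact (l i) :: real) = real (l r) * (\<Prod>i<k. fact ((l(r := l r - 1)) i))" by simp
qed

lemma card_snoc_split:
  fixes k :: nat
  assumes A: "A = (\<Union>r\<in>{r. r < k \<and> P r}. (\<lambda>y. y @ [c r]) ` S r)"
    and c: "inj c" and S: "\<And>r. finite (S r)"
  shows "card A = (\<Sum>r | r < k \<and> P r. card (S r))"
proof -
  have "card A = (\<Sum>r\<in>{r. r < k \<and> P r}. card ((\<lambda>y. y @ [c r]) ` S r))"
    unfolding A using S c by (intro card_UN_disjoint finite_subset[of "{r. r < k \<and> P r}" "{..<k}"]) (auto simp: inj_def)
  also have "\<dots> = (\<Sum>r | r < k \<and> P r. card (S r))"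
    by (intro sum.cong refl card_image) (auto simp: inj_on_def)
  finally show ?thesis .
qed

text \<open>The multinomial coefficient, by removing the last letter.\<close>

lemma card_words_content:
  assumes "\<And>r. r \<ge> k \<Longrightarrow> l r = 0" "sum l {..<k} = N"
  shows "real (card {w \<in> words N k. count_list w = l}) * (\<Prod>i<k. fact (l i)) = fact N"
  using assms
proof (induction N arbitrary: l)
  case 0
  then have "l = (\<lambda>_. 0)" by (auto simp: fun_eq_iff not_less) (metis lessThan_iff not_less)
  then have "{w \<in> words 0 k. count_list w = l} = {[]}" by (auto simp: words_def)
  then show ?case using \<open>l = _\<close> by simp
next
  case (Suc N)
  define S where "S r = {w \<in> words N k. count_list w = l(r := l r - 1)}" for r
  have A: "{w \<in> words (Suc N) k. count_list w = l} = (\<Union>r\<in>{r. r < k \<and> 1 \<le> l r}. (\<lambda>y. y @ [r]) ` S r)"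
  proof (intro equalityI subsetI)
    fix w assume w: "w \<in> {w \<in> words (Suc N) k. count_list w = l}"
    then obtain y r where y: "w = y @ [r]" "length y = N" by (auto simp: words_def length_Suc_conv_rev)
    have l: "l = count_list (y @ [r])" using w y by auto
    have "r < k" "y \<in> words N k" "count_list y = l(r := l r - 1)" "1 \<le> l r"
      unfolding l using w y by (auto simp: words_def)
    then show "w \<in> (\<Union>r\<in>{r. r < k \<and> 1 \<le> l r}. (\<lambda>y. y @ [r]) ` S r)" using y by (auto simp: S_def)
  next
    fix w assume "w \<in> (\<Union>r\<in>{r. r < k \<and> 1 \<le> l r}. (\<lambda>y. y @ [r]) ` S r)"
    then show "w \<in> {w \<in> words (Suc N) k. count_list w = l}" by (auto simp: S_def words_def fun_eq_iff)
  qed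
  have "card {w \<in> words (Suc N) k. count_list w = l} = (\<Sum>r | r < k \<and> 1 \<le> l r. card (S r))"
    by (rule card_snoc_split[where c = "\<lambda>r. r", OF A]) (auto simp: S_def finite_words)
  then have "real (card {w \<in> words (Suc N) k. count_list w = l}) * (\<Prod>i<k. fact (l i)) =
      (\<Sum>r | r < k \<and> 1 \<le> l r. real (card (S r)) * (\<Prod>i<k. fact (l i)))"
    by (simp add: sum_distrib_right)
  also have "\<dots> = (\<Sum>r | r < k \<and> 1 \<le> l r. real (l r) * fact N)"
  proof (intro sum.cong refl)
    fix r assume "r \<in> {r. r < k \<and> 1 \<le> l r}"
    then have r: "r < k" "1 \<le> l r" by auto
    have "real (card (S r)) * (\<Prod>i<k. fact ((l(r := l r - 1)) i)) = fact N"
      unfolding S_def by (rule Suc.IH) (use Suc.prems sum_fun_dec(1)[where l = l, OF r] r in auto)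
    then show "real (card (S r)) * (\<Prod>i<k. fact (l i)) = real (l r) * fact N"
      by (subst sum_fun_dec(2)[where l = l, OF r]) (simp add: mult.left_commute)
  qed
  also have "\<dots> = (\<Sum>r<k. real (l r) * fact N)"
    by (intro sum.mono_neutral_left) auto
  also have "\<dots> = real (sum l {..<k}) * fact N" by (simp add: sum_distrib_right)
  finally show ?case using Suc.prems by simp
qed

lemma vdm_staircase: "vdm k (\<lambda>r. real (k - 1 - r)) = (\<Prod>i<k. fact (k - 1 - i))"
proof (induction k)
  case (Suc k)
  have "(\<Prod>j<k. real k - real (k - Suc j)) = fact k"
  proof -
    have "(\<Prod>j<k. real k - real (k - Suc j)) = (\<Prod>j<k. real (Suc j))"
      by (intro prod.cong) (auto simp: of_nat_diff)
    also have "\<dots> = fact k" by (simp add: fact_prod_Suc lessThan_atLeast0)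
    finally show ?thesis .
  qed
  moreover have "vdm k (\<lambda>i. real (k - Suc i)) = vdm k (\<lambda>i. real (k - 1 - i))" by simp
  moreover have "(\<Prod>i<Suc k. fact (Suc k - 1 - i) :: real) = fact k * (\<Prod>i<k. fact (k - 1 - i))"
    by (subst prod.lessThan_Suc_shift) simp
  ultimately show ?case using Suc by (subst vdm_Suc) simp
qed (simp add: vdm_def)

definition strictly_dec :: "nat \<Rightarrow> (nat \<Rightarrow> nat) \<Rightarrow> bool" where
  "strictly_dec k l \<longleftrightarrow> (\<forall>r. Suc r < k \<longrightarrow> l (Suc r) < l r)"

lemma strictly_decD: "strictly_dec k l \<Longrightarrow> i < j \<Longrightarrow> j < k \<Longrightarrow> l j < l i"
proof (induction j)
  case (Suc j)
  then show ?case unfolding strictly_dec_def by (cases "i = j") (auto intro: less_trans[of _ "l j"])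
qed simp

lemma strictly_dec_ge: "strictly_dec k l \<Longrightarrow> r < k \<Longrightarrow> k - 1 - r \<le> l r"
proof (induction "k - 1 - r" arbitrary: r)
  case (Suc m)
  then have "k - 1 - Suc r \<le> l (Suc r)" by auto
  moreover have "l (Suc r) < l r" using Suc unfolding strictly_dec_def by auto
  ultimately show ?case using Suc.hyps by linarith
qed simp

lemma vdmp_not_strict:
  assumes "\<not> strictly_dec k l"
  shows "vdmp k (\<lambda>r. real (l r)) = 0"
proof -
  obtain r where r: "Suc r < k" "l r \<le> l (Suc r)" using assms by (auto simp: strictly_dec_def not_less)
  show ?thesis
  proof (cases "l r = l (Suc r)")
    case True
    then show ?thesis using r by (simp add: vdmp_def vdm_eq_0[of r "Suc r"])
  next
    case False
    then have "\<not> real (l (Suc r)) \<le> real (l r)" using r by simp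
    then show ?thesis using r unfolding vdmp_def by (metis lessI)
  qed
qed

lemma strictly_dec_content:
  assumes "y \<in> ballot_words n k"
  shows "strictly_dec k (shifted_content k y)"
  unfolding strictly_dec_def
proof (intro allI impI)
  fix r assume r: "Suc r < k"
  have "count_list y (Suc (Suc r)) \<le> count_list y (Suc r)"
    using assms by (intro ballot_count) (auto simp: ballot_words_def)
  then show "shifted_content k y (Suc r) < shifted_content k y r"
    using r by (simp add: shifted_content_def)
qed

text \<open>Both sides satisfy the recursion that removes the last letter, the right one by
  \<open>vdm_shift_sum\<close>. A removal that destroys the ballot property makes two shifted row lengths
  equal, and then the Vandermonde product vanishes as well.\<close>

lemma card_ballot_content:
  assumes "\<And>r. r \<ge> k \<Longrightarrow> l r = 0" "sum l {..<k} = n + k * (k - 1) div 2"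
  shows "real (card {y \<in> ballot_words n k. shifted_content k y = l}) * (\<Prod>i<k. fact (l i)) =
    fact n * vdmp k (\<lambda>r. real (l r))"
  using assms
proof (induction n arbitrary: l)
  case 0
  define d where "d r = (if r < k then k - 1 - r else 0)" for r
  have sd: "sum d {..<k} = k * (k - 1) div 2"
  proof -
    have "sum d {..<k} = (\<Sum>r<k. k - Suc r)" by (auto simp: d_def intro!: sum.cong)
    also have "\<dots> = (\<Sum>r<k. r)" by (rule sum.nat_diff_reindex)
    also have "\<dots> = k * (k - 1) div 2" by (rule sum_lessThan_id)
    finally show ?thesis .
  qed
  have lw: "ballot_words 0 k = {[]}" by (auto simp: ballot_words_def)
  have c: "shifted_content k [] = d" by (auto simp: shifted_content_def d_def fun_eq_iff)
  show ?case
  proof (cases "strictly_dec k l")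
    case True
    have "l r = d r" if "r < k" for r
    proof (rule ccontr)
      assume "l r \<noteq> d r"
      moreover have le: "d i \<le> l i" if "i < k" for i using strictly_dec_ge[OF True that] that by (simp add: d_def)
      ultimately have "sum d {..<k} < sum l {..<k}"
        using that by (intro sum_strict_mono_ex1) (auto simp: le_neq_implies_less intro!: bexI[of _ r])
      then show False using sd 0 by simp
    qed
    then have ld: "l = d" using 0 by (auto simp: fun_eq_iff d_def not_less)
    have "vdm k (\<lambda>r. real (d r)) = vdm k (\<lambda>r. real (k - 1 - r))" unfolding vdm_def d_def by (intro prod.cong) auto
    then have "vdmp k (\<lambda>r. real (l r)) = (\<Prod>i<k. fact (l i))"
      unfolding ld vdmp_def using vdm_staircase[of k] by (auto simp: d_def intro!: prod.cong)
    then show ?thesis by (simp add: lw c ld Collect_conv_if cong: conj_cong)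
  next
    case False
    moreover have "strictly_dec k d" by (auto simp: strictly_dec_def d_def)
    ultimately have "d \<noteq> l" by auto
    then show ?thesis using vdmp_not_strict[OF False] by (simp add: lw c Collect_conv_if cong: conj_cong)
  qed
next
  case (Suc n)
  show ?case
  proof (cases "strictly_dec k l")
    case False
    then have "{y \<in> ballot_words (Suc n) k. shifted_content k y = l} = {}" using strictly_dec_content by blast
    then have "card {y \<in> ballot_words (Suc n) k. shifted_content k y = l} = 0" by (simp only: card.empty)
    then show ?thesis using vdmp_not_strict[OF False] by simp
  next
    case True
    define S where "S r = {y \<in> ballot_words n k. shifted_content k y = l(r := l r - 1)}" for r
    have A: "{y \<in> ballot_words (Suc n) k. shifted_content k y = l} =
      (\<Union>r\<in>{r. r < k \<and> 1 \<le> l r}. (\<lambda>y. y @ [Suc r]) ` S r)"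
    proof (intro equalityI subsetI)
      fix w assume w: "w \<in> {y \<in> ballot_words (Suc n) k. shifted_content k y = l}"
      then obtain y c where y: "w = y @ [c]" "length y = n" by (auto simp: ballot_words_def length_Suc_conv_rev)
      then have "1 \<le> c" "c \<le> k" "y \<in> ballot_words n k"
        using w by (auto simp: ballot_words_def ballot_append1)
      then obtain r where r: "c = Suc r" "r < k" by (metis Suc_le_D Suc_le_lessD One_nat_def)
      have l: "l = shifted_content k (y @ [Suc r])" using w y r by simp
      have "shifted_content k y = l(r := l r - 1)" "1 \<le> l r"
        unfolding l using r by (auto simp: shifted_content_def fun_eq_iff)
      then show "w \<in> (\<Union>r\<in>{r. r < k \<and> 1 \<le> l r}. (\<lambda>y. y @ [Suc r]) ` S r)"
        using y r \<open>y \<in> ballot_words n k\<close> by (auto simp: S_def)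
    next
      fix w assume "w \<in> (\<Union>r\<in>{r. r < k \<and> 1 \<le> l r}. (\<lambda>y. y @ [Suc r]) ` S r)"
      then obtain r y where r: "r < k" "1 \<le> l r" "w = y @ [Suc r]" and yS: "y \<in> S r" by blast
      then have r4: "y \<in> ballot_words n k" and r5: "shifted_content k y = l(r := l r - 1)"
        by (simp_all only: S_def mem_Collect_eq)
      have sc: "shifted_content k w = l"
      proof
        fix i show "shifted_content k w i = l i"
          using fun_cong[OF r5, of i] r by (cases "i = r") (auto simp: shifted_content_def)
      qed
      have "count_list w (Suc i) \<le> count_list w i" if i: "i \<ge> 1" for i
      proof (cases "i < k")
        case True
        obtain j where j: "i = Suc j" using i by (cases i) auto
        have "l i < l j" using strictly_decD[OF \<open>strictly_dec k l\<close>, of j i] True j by simp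
        then show ?thesis using fun_cong[OF sc, of i] fun_cong[OF sc, of j] True j
          by (simp add: shifted_content_def)
      next
        case False
        then have "Suc i \<notin> set w" using r r4 by (auto simp: ballot_words_def)
        then show ?thesis by (simp add: count_notin)
      qed
      then have "w \<in> ballot_words (Suc n) k" using r r4 by (auto simp: ballot_words_def ballot_append1)
      then show "w \<in> {y \<in> ballot_words (Suc n) k. shifted_content k y = l}" using sc by simp
    qed
    have "card {y \<in> ballot_words (Suc n) k. shifted_content k y = l} = (\<Sum>r | r < k \<and> 1 \<le> l r. card (S r))"
      by (rule card_snoc_split[where c = Suc, OF A]) (auto simp: S_def finite_ballot_words)
    then have "real (card {y \<in> ballot_words (Suc n) k. shifted_content k y = l}) * (\<Prod>i<k. fact (l i)) =
        (\<Sum>r | r < k \<and> 1 \<le> l r. real (card (S r)) * (\<Prod>i<k. fact (l i)))"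
      by (simp add: sum_distrib_right)
    also have "\<dots> = (\<Sum>r | r < k \<and> 1 \<le> l r. fact n * (real (l r) * vdm k ((\<lambda>i. real (l i))(r := real (l r) - 1))))"
    proof (intro sum.cong refl)
      fix r assume "r \<in> {r. r < k \<and> 1 \<le> l r}"
      then have r: "r < k" "1 \<le> l r" by auto
      have e: "(\<lambda>i. real ((l(r := l r - 1)) i)) = (\<lambda>i. real (l i))(r := real (l r) - 1)"
        using r by (auto simp: fun_eq_iff of_nat_diff)
      have "(l(r := l r - 1)) j \<le> (l(r := l r - 1)) i" if "i < j" "j < k" for i j
        using strictly_decD[OF True that] by auto
      then have v: "vdmp k (\<lambda>i. real ((l(r := l r - 1)) i)) = vdm k ((\<lambda>i. real (l i))(r := real (l r) - 1))"
        unfolding vdmp_def e[symmetric] by (simp only: of_nat_le_iff) auto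
      have "real (card (S r)) * (\<Prod>i<k. fact ((l(r := l r - 1)) i)) = fact n * vdmp k (\<lambda>i. real ((l(r := l r - 1)) i))"
        unfolding S_def by (rule Suc.IH) (use Suc.prems sum_fun_dec(1)[where l = l, OF r] r in auto)
      then show "real (card (S r)) * (\<Prod>i<k. fact (l i)) =
          fact n * (real (l r) * vdm k ((\<lambda>i. real (l i))(r := real (l r) - 1)))"
        unfolding v by (subst sum_fun_dec(2)[where l = l, OF r]) (simp add: mult_ac)
    qed
    also have "\<dots> = (\<Sum>r<k. fact n * (real (l r) * vdm k ((\<lambda>i. real (l i))(r := real (l r) - 1))))"
      by (intro sum.mono_neutral_left) auto
    also have "\<dots> = fact n * (((\<Sum>r<k. real (l r)) - real (k * (k - 1) div 2)) * vdm k (\<lambda>i. real (l i)))"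
      unfolding sum_distrib_left[symmetric] vdm_shift_sum ..
    also have "(\<Sum>r<k. real (l r)) = real (Suc n) + real (k * (k - 1) div 2)"
      using Suc.prems(2) by (metis of_nat_add of_nat_sum)
    also have "vdm k (\<lambda>i. real (l i)) = vdmp k (\<lambda>i. real (l i))"
      unfolding vdmp_def using strictly_decD[OF True] by (auto simp: less_imp_le)
    finally show ?thesis by (simp add: algebra_simps)
  qed
qed

section \<open>From ballot words to all words\<close>

text \<open>In the quotient of the two counting formulas the product of the factorials of the letter counts
  cancels.\<close>

lemma sum_ballot_words_eq:
  fixes G :: "(nat \<Rightarrow> nat) \<Rightarrow> real"
  defines "N \<equiv> \<lambda>n k. n + k * (k - 1) div 2"
  shows "(\<Sum>y\<in>ballot_words n k. G (shifted_content k y)) =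
    fact n / fact (N n k) * (\<Sum>w\<in>words (N n k) k. vdmp k (\<lambda>r. real (count_list w r)) * G (count_list w))"
proof -
  define L where "L = {l. (\<forall>r\<ge>k. l r = 0) \<and> sum l {..<k} = N n k}"
  have cw: "count_list w \<in> L" if "w \<in> words (N n k) k" for w
  proof -
    have "sum (count_list w) {..<k} = length w"
      using that sum_count_set[of w "{..<k}"] by (auto simp: words_def)
    then show ?thesis using that unfolding L_def words_def by (auto intro!: count_notin)
  qed
  have sw: "shifted_content k y \<in> L" if "y \<in> ballot_words n k" for y
  proof -
    have y: "set y \<subseteq> Suc ` {..<k}" "length y = n"
    proof -
      show "length y = n" using that by (simp add: ballot_words_def)
      show "set y \<subseteq> Suc ` {..<k}"
      proof
        fix c assume "c \<in> set y"
        then have "1 \<le> c" "c \<le> k" using that by (auto simp: ballot_words_def)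
        then show "c \<in> Suc ` {..<k}" by (intro image_eqI[of _ _ "c - 1"]) auto
      qed
    qed
    have "(\<Sum>r<k. count_list y (Suc r)) = length y"
      using sum_count_set[OF y(1)] by (simp add: sum.reindex)
    moreover have "(\<Sum>r<k. k - 1 - r) = k * (k - 1) div 2"
    proof -
      have "(\<Sum>r<k. k - Suc r) = (\<Sum>r<k. r)" by (rule sum.nat_diff_reindex)
      also have "\<dots> = k * (k - 1) div 2" by (rule sum_lessThan_id)
      finally show ?thesis by simp
    qed
    moreover have "sum (shifted_content k y) {..<k} = (\<Sum>r<k. count_list y (Suc r)) + (\<Sum>r<k. k - 1 - r)"
      by (simp add: shifted_content_def flip: sum.distrib)
    ultimately show ?thesis using y unfolding L_def N_def by (auto simp: shifted_content_def)
  qed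
  define L' where "L' = shifted_content k ` ballot_words n k \<union> count_list ` words (N n k) k"
  have L': "finite L'" "L' \<subseteq> L" using cw sw by (auto simp: L'_def finite_words finite_ballot_words)
  have "(\<Sum>y\<in>ballot_words n k. G (shifted_content k y)) =
    (\<Sum>l\<in>L'. \<Sum>y | y \<in> ballot_words n k \<and> shifted_content k y = l. G (shifted_content k y))"
    by (rule sum.group[symmetric]) (auto simp: L' finite_ballot_words, auto simp: L'_def)
  also have "\<dots> = (\<Sum>l\<in>L'. real (card {y \<in> ballot_words n k. shifted_content k y = l}) * G l)"
    by (intro sum.cong refl) simp
  also have "\<dots> = (\<Sum>l\<in>L'. fact n / fact (N n k) * (real (card {w \<in> words (N n k) k. count_list w = l}) * (vdmp k (\<lambda>r. real (l r)) * G l)))"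
  proof (intro sum.cong refl)
    fix l assume "l \<in> L'"
    then have l: "\<And>r. r \<ge> k \<Longrightarrow> l r = 0" "sum l {..<k} = N n k" using L' by (auto simp: L_def)
    have a: "real (card {y \<in> ballot_words n k. shifted_content k y = l}) * (\<Prod>i<k. fact (l i)) = fact n * vdmp k (\<lambda>r. real (l r))"
      by (rule card_ballot_content) (use l in \<open>auto simp: N_def\<close>)
    have b: "real (card {w \<in> words (N n k) k. count_list w = l}) * (\<Prod>i<k. fact (l i)) = fact (N n k)"
      by (rule card_words_content) (use l in auto)
    have nz: "(\<Prod>i<k. fact (l i) :: real) \<noteq> 0" by simp
    have "real (card {y \<in> ballot_words n k. shifted_content k y = l}) = fact n * vdmp k (\<lambda>r. real (l r)) / (\<Prod>i<k. fact (l i))"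
      "real (card {w \<in> words (N n k) k. count_list w = l}) = fact (N n k) / (\<Prod>i<k. fact (l i))"
      using a b nz by (auto simp: nonzero_eq_divide_eq)
    then show "real (card {y \<in> ballot_words n k. shifted_content k y = l}) * G l =
      fact n / fact (N n k) * (real (card {w \<in> words (N n k) k. count_list w = l}) * (vdmp k (\<lambda>r. real (l r)) * G l))"
      by simp
  qed
  also have "\<dots> = fact n / fact (N n k) * (\<Sum>l\<in>L'. \<Sum>w | w \<in> words (N n k) k \<and> count_list w = l. vdmp k (\<lambda>r. real (count_list w r)) * G (count_list w))"
    unfolding sum_distrib_left[symmetric] by (intro arg_cong2[of _ _ _ _ "(*)"] refl sum.cong) simp
  also have "(\<Sum>l\<in>L'. \<Sum>w | w \<in> words (N n k) k \<and> count_list w = l. vdmp k (\<lambda>r. real (count_list w r)) * G (count_list w)) =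
    (\<Sum>w\<in>words (N n k) k. vdmp k (\<lambda>r. real (count_list w r)) * G (count_list w))"
    by (rule sum.group) (auto simp: L' finite_words, auto simp: L'_def)
  finally show ?thesis .
qed

definition alt :: "nat \<Rightarrow> (nat \<Rightarrow> real) \<Rightarrow> real" where
  "alt k x = (\<Sum>r<k. (-1) ^ r * x r)"

text \<open>The staircase alone contributes \<open>(k - 1) - (k - 2) + \<cdots> - 0\<close>, which
  is \<open>k div 2\<close> as \<open>k\<close> is even.\<close>

lemma sum_sg_content:
  assumes y: "y \<in> ballot_words n k" and k: "even k"
  shows "real_of_int (sum_list (map sg y)) = alt k (\<lambda>r. real (shifted_content k y r)) - real (k div 2)"
proof -
  have "set y \<subseteq> {1..k}" using y by (auto simp: ballot_words_def)
  then have a: "real_of_int (sum_list (map sg y)) = (\<Sum>r<k. (-1) ^ r * real (count_list y (Suc r)))"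
  proof (induction y)
    case (Cons a y)
    then obtain c where c: "a = Suc c" "c < k" by (metis Suc_le_D atLeastAtMost_iff One_nat_def list.set_intros(1) subsetD Suc_le_lessD)
    have "(\<Sum>r<k. (-1) ^ r * real (count_list (a # y) (Suc r))) =
      (\<Sum>r<k. (-1) ^ r * real (count_list y (Suc r)) + (if r = c then (-1) ^ r else 0))"
      using c by (intro sum.cong) (auto simp: algebra_simps)
    also have "\<dots> = (\<Sum>r<k. (-1) ^ r * real (count_list y (Suc r))) + (-1) ^ c"
      using c by (simp add: sum.distrib)
    finally show ?case using Cons c by (auto simp: sg_def)
  qed simp
  have "(\<Sum>r<2 * m. (-1) ^ r * real (2 * m - 1 - r)) = real m" for m
  proof (induction m)
    case (Suc m)
    have "(\<Sum>r<2 * Suc m. (-1) ^ r * real (2 * Suc m - 1 - r)) =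
      real (2 * m + 1) - real (2 * m) + (\<Sum>r<2 * m. (-1) ^ r * real (2 * m - 1 - r))"
      by (simp add: sum.lessThan_Suc_shift del: sum.lessThan_Suc)
    then show ?case using Suc by simp
  qed simp
  from this[of "k div 2"] k have b: "(\<Sum>r<k. (-1) ^ r * real (k - 1 - r)) = real (k div 2)" by simp
  have "alt k (\<lambda>r. real (shifted_content k y r)) =
    (\<Sum>r<k. (-1) ^ r * real (count_list y (Suc r))) + (\<Sum>r<k. (-1) ^ r * real (k - 1 - r))"
    unfolding alt_def sum.distrib[symmetric] by (intro sum.cong) (auto simp: shifted_content_def algebra_simps)
  then show ?thesis using a b by simp
qed

section \<open>Convergence of expectations tested on an algebra of functions\<close>

lemma poly_comp_in_algebra:
  fixes R :: "('a \<Rightarrow> real) set"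
  assumes R: "\<And>c. (\<lambda>_. c) \<in> R" "\<And>f g. f \<in> R \<Longrightarrow> g \<in> R \<Longrightarrow> (\<lambda>x. f x + g x) \<in> R"
    "\<And>f g. f \<in> R \<Longrightarrow> g \<in> R \<Longrightarrow> (\<lambda>x. f x * g x) \<in> R" and g: "g \<in> R"
  shows "(\<lambda>x. poly p (g x)) \<in> R"
proof (induction p)
  case (pCons a p)
  show ?case using R(2)[OF R(1)[of a] R(3)[OF g pCons.IH]] by simp
qed (simp add: R)

lemma poly_approx_on_interval:
  fixes f :: "real \<Rightarrow> real"
  assumes "continuous_on {a..b} f" "0 < e"
  shows "\<exists>p. \<forall>x\<in>{a..b}. \<bar>f x - poly p x\<bar> < e"
proof -
  have "\<exists>g. (\<exists>p. g = poly p) \<and> (\<forall>x\<in>{a..b}. \<bar>f x - g x\<bar> < e)"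
  proof (rule Stone_Weierstrass_HOL[of "{a..b}" "\<lambda>g. \<exists>p. g = poly p"])
    show "\<exists>p. (\<lambda>x. c) = poly p" for c :: real by (intro exI[of _ "[:c:]"]) auto
    show "\<exists>h. (\<exists>p. h = poly p) \<and> h x \<noteq> h y" if "x \<in> {a..b} \<and> y \<in> {a..b} \<and> x \<noteq> y" for x y :: real
      using that by (intro exI[of _ "poly [:0, 1:]"]) auto
    show "\<exists>p. (\<lambda>x. g x + h x) = poly p" if asm: "(\<exists>p. g = poly p) \<and> (\<exists>p. h = poly p)" for g h :: "real \<Rightarrow> real"
    proof -
      obtain p q where "g = poly p" "h = poly q" using asm by auto
      then show ?thesis by (intro exI[of _ "p + q"]) auto
    qed
    show "\<exists>p. (\<lambda>x. g x * h x) = poly p" if asm: "(\<exists>p. g = poly p) \<and> (\<exists>p. h = poly p)" for g h :: "real \<Rightarrow> real"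
    proof -
      obtain p q where "g = poly p" "h = poly q" using asm by auto
      then show ?thesis by (intro exI[of _ "p * q"]) auto
    qed
  qed (use assms in \<open>auto intro: continuous_intros\<close>)
  then show ?thesis by blast
qed

text \<open>Stone-Weierstrass controls the approximant on \<open>K\<close> only. Composing it with a
  polynomial that is close to the truncation at \<open>\<plusminus> C\<close> on its whole range keeps it in
  the algebra and bounds it everywhere.\<close>

lemma algebra_approx_clamped:
  fixes R :: "('a::t2_space \<Rightarrow> real) set"
  assumes R: "\<And>c. (\<lambda>_. c) \<in> R" "\<And>f g. f \<in> R \<Longrightarrow> g \<in> R \<Longrightarrow> (\<lambda>x. f x + g x) \<in> R"
    "\<And>f g. f \<in> R \<Longrightarrow> g \<in> R \<Longrightarrow> (\<lambda>x. f x * g x) \<in> R"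
    and cont: "\<And>f. f \<in> R \<Longrightarrow> continuous_on K f"
    and bdd: "\<And>f. f \<in> R \<Longrightarrow> \<exists>B. \<forall>x. \<bar>f x\<bar> \<le> B"
    and K: "compact K" "\<And>x y. x \<in> K \<Longrightarrow> y \<in> K \<Longrightarrow> x \<noteq> y \<Longrightarrow> \<exists>f\<in>R. f x \<noteq> f y"
    and F: "continuous_on K F" "\<And>x. x \<in> K \<Longrightarrow> \<bar>F x\<bar> \<le> C" and e: "e > 0" and C: "C \<ge> 0"
  shows "\<exists>h\<in>R. (\<forall>x\<in>K. \<bar>F x - h x\<bar> \<le> e) \<and> (\<forall>x. \<bar>h x\<bar> \<le> C + e)"
proof -
  have "\<exists>g. g \<in> R \<and> (\<forall>x\<in>K. \<bar>F x - g x\<bar> < e / 2)"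
  proof (rule Stone_Weierstrass_HOL[of K "\<lambda>f. f \<in> R"])
    show "\<exists>f. f \<in> R \<and> f x \<noteq> f y" if "x \<in> K \<and> y \<in> K \<and> x \<noteq> y" for x y using K(2) that by blast
  qed (use R cont K F e in auto)
  then obtain g where g: "g \<in> R" "\<And>x. x \<in> K \<Longrightarrow> \<bar>F x - g x\<bar> < e / 2" by blast
  obtain B where B: "\<And>x. \<bar>g x\<bar> \<le> B" using bdd[OF g(1)] by blast
  define cl where "cl y = max (- C) (min C y)" for y :: real
  have "continuous_on {- B..B} cl" unfolding cl_def by (intro continuous_intros)
  then have "\<exists>p. \<forall>y\<in>{- B..B}. \<bar>cl y - poly p y\<bar> < e / 2"
    using e by (intro poly_approx_on_interval) auto
  then obtain p where p: "\<And>y. y \<in> {- B..B} \<Longrightarrow> \<bar>cl y - poly p y\<bar> < e / 2" by blast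
  have gB: "g x \<in> {- B..B}" for x using B[of x] by (auto simp: abs_le_iff)
  show ?thesis
  proof (intro bexI conjI ballI allI)
    show "(\<lambda>x. poly p (g x)) \<in> R" by (rule poly_comp_in_algebra[OF R g(1)])
    fix x
    have clb: "\<bar>cl y\<bar> \<le> C" for y using C by (auto simp: cl_def)
    show "\<bar>poly p (g x)\<bar> \<le> C + e" using p[OF gB[of x]] clb[of "g x"] e by linarith
    assume x: "x \<in> K"
    have "\<bar>F x - cl (g x)\<bar> \<le> \<bar>F x - g x\<bar>" using F(2)[OF x] by (auto simp: cl_def)
    then show "\<bar>F x - poly p (g x)\<bar> \<le> e" using p[OF gB[of x]] g(2)[OF x] by linarith
  qed
qed

lemma expectation_approx:
  fixes X :: "'b \<Rightarrow> 'a::t2_space" and F h :: "'a \<Rightarrow> real"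
  assumes "prob_space M" and X: "X \<in> M \<rightarrow>\<^sub>M borel" and K: "compact K"
    and m: "measure M {x \<in> space M. X x \<notin> K} \<le> d"
    and F: "F \<in> borel_measurable borel" "\<And>x. \<bar>F x\<bar> \<le> C" and h: "h \<in> borel_measurable borel" "\<And>x. \<bar>h x\<bar> \<le> C'"
    and a: "\<And>x. x \<in> K \<Longrightarrow> \<bar>F x - h x\<bar> \<le> e" and e: "e \<ge> 0" and C: "C + C' \<ge> 0"
  shows "\<bar>(\<integral>x. F (X x) \<partial>M) - (\<integral>x. h (X x) \<partial>M)\<bar> \<le> e + (C + C') * d"
proof -
  interpret prob_space M by fact
  have E: "{x \<in> space M. X x \<notin> K} \<in> sets M"
  proof -
    have "{x \<in> space M. X x \<notin> K} = X -` (- K) \<inter> space M" by auto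
    then show ?thesis using measurable_sets[OF X, of "- K"] compact_imp_closed[OF K] by auto
  qed
  have FX [measurable]: "(\<lambda>x. F (X x)) \<in> borel_measurable M" using X F by measurable
  have hX [measurable]: "(\<lambda>x. h (X x)) \<in> borel_measurable M" using X h by measurable
  have iF: "integrable M (\<lambda>x. F (X x))" by (rule integrable_const_bound[of _ C]) (use F in auto)
  have ih: "integrable M (\<lambda>x. h (X x))" by (rule integrable_const_bound[of _ C']) (use h in auto)
  have ii: "integrable M (\<lambda>x. e + (C + C') * indicator {x \<in> space M. X x \<notin> K} x)"
    using E by (intro Bochner_Integration.integrable_add integrable_mult_right) (auto simp: emeasure_eq_measure)
  have "\<bar>(\<integral>x. F (X x) \<partial>M) - (\<integral>x. h (X x) \<partial>M)\<bar> = \<bar>\<integral>x. F (X x) - h (X x) \<partial>M\<bar>"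
    using iF ih by simp
  also have "\<dots> \<le> (\<integral>x. \<bar>F (X x) - h (X x)\<bar> \<partial>M)" by (rule integral_abs_bound)
  also have "\<dots> \<le> (\<integral>x. e + (C + C') * indicator {x \<in> space M. X x \<notin> K} x \<partial>M)"
  proof (rule integral_mono)
    fix x assume x: "x \<in> space M"
    show "\<bar>F (X x) - h (X x)\<bar> \<le> e + (C + C') * indicator {x \<in> space M. X x \<notin> K} x"
      using a[of "X x"] F(2)[of "X x"] h(2)[of "X x"] e x
      by (cases "X x \<in> K") (auto split: split_indicator)
  qed (use iF ih ii in auto)
  also have "\<dots> = e + (C + C') * measure M {x \<in> space M. X x \<notin> K}"
    using E by (simp add: prob_space emeasure_eq_measure)
  also have "\<dots> \<le> e + (C + C') * d" using m C by (intro add_left_mono mult_left_mono) auto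
  finally show ?thesis .
qed

text \<open>An algebra of test functions that separates points determines limits in law as soon as the
  sequence is tight. Separation is asked for on the compact sets only, because symmetric functions separate
  ordered vectors but not arbitrary ones.\<close>

lemma expectation_convergence_algebra:
  fixes R :: "('a::t2_space \<Rightarrow> real) set" and X :: "nat \<Rightarrow> 'b \<Rightarrow> 'a" and Y :: "'c \<Rightarrow> 'a"
    and F :: "'a \<Rightarrow> real"
  assumes M: "\<forall>\<^sub>F n in sequentially. prob_space (M n)" "prob_space L"
    and X: "\<forall>\<^sub>F n in sequentially. X n \<in> M n \<rightarrow>\<^sub>M borel" "Y \<in> L \<rightarrow>\<^sub>M borel"
    and R: "\<And>c. (\<lambda>_. c) \<in> R" "\<And>f g. f \<in> R \<Longrightarrow> g \<in> R \<Longrightarrow> (\<lambda>x. f x + g x) \<in> R"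
      "\<And>f g. f \<in> R \<Longrightarrow> g \<in> R \<Longrightarrow> (\<lambda>x. f x * g x) \<in> R"
    and cont: "\<And>f. f \<in> R \<Longrightarrow> continuous_on UNIV f"
    and bdd: "\<And>f. f \<in> R \<Longrightarrow> \<exists>B. \<forall>x. \<bar>f x\<bar> \<le> B"
    and conv: "\<And>f. f \<in> R \<Longrightarrow> (\<lambda>n. \<integral>x. f (X n x) \<partial>M n) \<longlonglongrightarrow> (\<integral>x. f (Y x) \<partial>L)"
    and tight: "\<And>e. e > 0 \<Longrightarrow> \<exists>K. compact K \<and> (\<forall>x\<in>K. \<forall>y\<in>K. x \<noteq> y \<longrightarrow> (\<exists>f\<in>R. f x \<noteq> f y)) \<and>
      (\<forall>\<^sub>F n in sequentially. measure (M n) {x \<in> space (M n). X n x \<notin> K} \<le> e) \<and>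
      measure L {x \<in> space L. Y x \<notin> K} \<le> e"
    and F: "continuous_on UNIV F" "\<And>x. \<bar>F x\<bar> \<le> C"
  shows "(\<lambda>n. \<integral>x. F (X n x) \<partial>M n) \<longlonglongrightarrow> (\<integral>x. F (Y x) \<partial>L)"
proof (rule tendstoI)
  fix r :: real assume r: "r > 0"
  have C: "C \<ge> 0" using F(2)[of undefined] by linarith
  \<comment> \<open>Chosen such that the two approximation errors together use at most half of \<open>r\<close>; see \<open>re\<close>.\<close>
  define e where "e = min 1 (r / (4 * (2 + 2 * C)))"
  have e: "e > 0" "e \<le> 1" using r C by (auto simp: e_def)
  have re: "2 * (e + (C + (C + e)) * e) \<le> r / 2"
  proof -
    have "e + (C + (C + e)) * e \<le> e + (2 * C + 1) * e" using e C by (intro add_left_mono mult_right_mono) auto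
    also have "\<dots> = (2 + 2 * C) * e" by (simp add: algebra_simps)
    also have "\<dots> \<le> (2 + 2 * C) * (r / (4 * (2 + 2 * C)))" using C by (intro mult_left_mono) (auto simp: e_def)
    also have "\<dots> = r / 4" using C by (simp add: field_simps)
    finally show ?thesis by simp
  qed
  from tight[OF e(1)] obtain K where "compact K \<and> (\<forall>x\<in>K. \<forall>y\<in>K. x \<noteq> y \<longrightarrow> (\<exists>f\<in>R. f x \<noteq> f y)) \<and>
      (\<forall>\<^sub>F n in sequentially. measure (M n) {x \<in> space (M n). X n x \<notin> K} \<le> e) \<and>
      measure L {x \<in> space L. Y x \<notin> K} \<le> e" ..
  then have K: "compact K" "\<And>x y. x \<in> K \<Longrightarrow> y \<in> K \<Longrightarrow> x \<noteq> y \<Longrightarrow> \<exists>f\<in>R. f x \<noteq> f y"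
    "\<forall>\<^sub>F n in sequentially. measure (M n) {x \<in> space (M n). X n x \<notin> K} \<le> e"
    "measure L {x \<in> space L. Y x \<notin> K} \<le> e" by simp_all
  have "\<exists>h\<in>R. (\<forall>x\<in>K. \<bar>F x - h x\<bar> \<le> e) \<and> (\<forall>x. \<bar>h x\<bar> \<le> C + e)"
  proof (rule algebra_approx_clamped[OF R])
    show "continuous_on K f" if "f \<in> R" for f using cont[OF that] continuous_on_subset by blast
    show "continuous_on K F" using F(1) continuous_on_subset by blast
  qed (use bdd K F e C in auto)
  then obtain h where h: "h \<in> R" "\<And>x. x \<in> K \<Longrightarrow> \<bar>F x - h x\<bar> \<le> e" "\<And>x. \<bar>h x\<bar> \<le> C + e" by blast
  have Fm: "F \<in> borel_measurable borel" using F(1) by (rule borel_measurable_continuous_onI)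
  have hm: "h \<in> borel_measurable borel" using cont[OF h(1)] by (rule borel_measurable_continuous_onI)
  have l: "\<bar>(\<integral>x. F (Y x) \<partial>L) - (\<integral>x. h (Y x) \<partial>L)\<bar> \<le> e + (C + (C + e)) * e"
    by (rule expectation_approx[OF M(2) X(2) K(1) K(4) Fm F(2) hm h(3) h(2)]) (use e C in auto)
  have "\<forall>\<^sub>F n in sequentially. dist (\<integral>x. h (X n x) \<partial>M n) (\<integral>x. h (Y x) \<partial>L) < r / 2"
    using conv[OF h(1)] r by (intro tendstoD) auto
  then show "\<forall>\<^sub>F n in sequentially. dist (\<integral>x. F (X n x) \<partial>M n) (\<integral>x. F (Y x) \<partial>L) < r"
    using K(3) M(1) X(1)
  proof eventually_elim
    case (elim n)
    have 1: "\<bar>(\<integral>x. F (X n x) \<partial>M n) - (\<integral>x. h (X n x) \<partial>M n)\<bar> \<le> e + (C + (C + e)) * e"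
      by (rule expectation_approx[OF elim(3) elim(4) K(1) elim(2) Fm F(2) hm h(3) h(2)]) (use e C in auto)
    have "\<bar>a - c\<bar> < r"
      if "\<bar>a - b\<bar> \<le> E" "\<bar>c - d\<bar> \<le> E" "\<bar>b - d\<bar> < r / 2" "2 * E \<le> r / 2" for a b c d E :: real
      using that by linarith
    from this[OF 1 l _ re] show ?case using elim(1) unfolding dist_real_def by blast
  qed
qed

section \<open>Gaussian integration by parts\<close>

text \<open>The product is a multiple of the Gaussian density with variance
  \<open>\<sigma>\<^sup>2 / (1 - 2 \<kappa> \<sigma>\<^sup>2)\<close>.\<close>

lemma integrable_gauss_exp:
  assumes s: "\<sigma> > 0" and k: "2 * \<kappa> * \<sigma>\<^sup>2 < 1"
  shows "integrable lborel (\<lambda>t. normal_density 0 \<sigma> t * exp (\<kappa> * t\<^sup>2))"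
proof -
  define c where "c = 1 - 2 * \<kappa> * \<sigma>\<^sup>2"
  define s where "s = \<sigma> / sqrt c"
  have c: "c > 0" using k by (simp add: c_def)
  have s0: "s > 0" using assms c by (simp add: s_def)
  have ss: "s\<^sup>2 = \<sigma>\<^sup>2 / c" using c by (simp add: s_def power_divide)
  have e: "normal_density 0 \<sigma> t * exp (\<kappa> * t\<^sup>2) = (sqrt (2 * pi * s\<^sup>2) / sqrt (2 * pi * \<sigma>\<^sup>2)) * normal_density 0 s t" for t
  proof -
    have "- (t\<^sup>2 / (2 * \<sigma>\<^sup>2)) + \<kappa> * t\<^sup>2 = - (t\<^sup>2 / (2 * s\<^sup>2))"
      using c assms(1) by (simp add: ss c_def field_simps)
    then have x: "exp (- (t\<^sup>2 / (2 * \<sigma>\<^sup>2))) * exp (\<kappa> * t\<^sup>2) = exp (- (t\<^sup>2 / (2 * s\<^sup>2)))"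
      by (simp flip: exp_add)
    have "sqrt (2 * pi * s\<^sup>2) \<noteq> 0" using s0 by simp
    then show ?thesis unfolding normal_density_def using x by (simp add: mult.assoc)
  qed
  show ?thesis unfolding e by (intro integrable_mult_right integrable_normal_density s0)
qed

lemma abs_le_exp_sq: "\<kappa> > 0 \<Longrightarrow> \<bar>t\<bar> \<le> (1 + 1 / \<kappa>) * exp (\<kappa> * t\<^sup>2)" for t :: real
proof -
  assume k: "\<kappa> > 0"
  have "\<bar>t\<bar> \<le> 1 + t\<^sup>2"
    using zero_le_power2[of "\<bar>t\<bar> - 1"] by (simp add: power2_diff)
  also have "\<dots> \<le> (1 + 1 / \<kappa>) * (1 + \<kappa> * t\<^sup>2)" using k by (simp add: field_simps)
  also have "\<dots> \<le> (1 + 1 / \<kappa>) * exp (\<kappa> * t\<^sup>2)" using k by (intro mult_left_mono exp_ge_add_one_self) auto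
  finally show ?thesis .
qed

text \<open>Multiplied by the density, the two integrands differ by a multiple of the derivative of
  \<open>g\<close> times the density, and that product tends to \<open>0\<close> at both ends. The exceptional
  set \<open>S\<close> admits the corners that come from cutting off outside the Weyl chamber.\<close>

lemma stein_1d:
  fixes g g' :: "real \<Rightarrow> real"
  assumes s: "\<sigma> > 0" and k: "2 * \<kappa> * \<sigma>\<^sup>2 < 1"
    and cont: "continuous_on UNIV g" and S: "finite S" "\<And>t. t \<notin> S \<Longrightarrow> (g has_real_derivative g' t) (at t)"
    and m: "g' \<in> borel_measurable borel"
    and b: "\<And>t. \<bar>g t\<bar> \<le> C * exp (\<kappa> * t\<^sup>2)" "\<And>t. \<bar>g' t\<bar> \<le> C * exp (\<kappa> * t\<^sup>2)"
  shows "(\<integral>t. t * g t \<partial>density lborel (normal_density 0 \<sigma>)) = \<sigma>\<^sup>2 * (\<integral>t. g' t \<partial>density lborel (normal_density 0 \<sigma>))"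
proof -
  let ?\<phi> = "normal_density 0 \<sigma>"
  obtain \<kappa>' where k': "\<kappa> < \<kappa>'" "2 * \<kappa>' * \<sigma>\<^sup>2 < 1"
  proof -
    have "\<kappa> < 1 / (2 * \<sigma>\<^sup>2)" using k s by (simp add: field_simps)
    then obtain z where "\<kappa> < z" "z < 1 / (2 * \<sigma>\<^sup>2)" using dense by blast
    then show ?thesis using s by (intro that[of z]) (auto simp: field_simps)
  qed
  have C0: "C \<ge> 0" using b(1)[of 0] by simp
  have gm: "g \<in> borel_measurable borel" using cont by (rule borel_measurable_continuous_onI)
  have i1: "integrable lborel (\<lambda>t. ?\<phi> t * g' t)"
  proof (rule Bochner_Integration.integrable_bound[OF integrable_mult_right[OF integrable_gauss_exp[OF s k], of C]])
    show "AE t in lborel. norm (?\<phi> t * g' t) \<le> norm (C * (?\<phi> t * exp (\<kappa> * t\<^sup>2)))"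
      using b(2) C0 by (intro AE_I2) (auto simp: abs_mult mult.left_commute[of C] intro!: mult_left_mono)
  qed (use m in measurable)
  have tb: "\<bar>t * g t\<bar> \<le> (1 + 1 / (\<kappa>' - \<kappa>)) * C * exp (\<kappa>' * t\<^sup>2)" for t
  proof -
    have "\<bar>t * g t\<bar> \<le> ((1 + 1 / (\<kappa>' - \<kappa>)) * exp ((\<kappa>' - \<kappa>) * t\<^sup>2)) * (C * exp (\<kappa> * t\<^sup>2))"
      unfolding abs_mult using k' b(1)[of t] by (intro mult_mono abs_le_exp_sq) auto
    also have "\<dots> = (1 + 1 / (\<kappa>' - \<kappa>)) * C * exp (\<kappa>' * t\<^sup>2)"
      by (simp add: algebra_simps flip: exp_add)
    finally show ?thesis .
  qed
  have i2: "integrable lborel (\<lambda>t. ?\<phi> t * (t * g t))"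
  proof (rule Bochner_Integration.integrable_bound[OF integrable_mult_right[OF integrable_gauss_exp[OF s k'(2)], of "(1 + 1 / (\<kappa>' - \<kappa>)) * C"]])
    have "\<bar>(1 + 1 / (\<kappa>' - \<kappa>)) * C\<bar> = (1 + 1 / (\<kappa>' - \<kappa>)) * C" using C0 k' by simp
    then show "AE t in lborel. norm (?\<phi> t * (t * g t)) \<le> norm ((1 + 1 / (\<kappa>' - \<kappa>)) * C * (?\<phi> t * exp (\<kappa>' * t\<^sup>2)))"
      unfolding real_norm_def abs_mult[of "?\<phi> _"] abs_mult[of "_ * C"]
      using tb by (intro AE_I2) (auto simp: mult.left_commute intro!: mult_left_mono)
  qed (use gm in measurable)
  define H where "H t = ?\<phi> t * g' t - ?\<phi> t * (t * g t) / \<sigma>\<^sup>2" for t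
  have iH: "integrable lborel H" unfolding H_def using i1 i2 by (intro Bochner_Integration.integrable_diff integrable_divide)
  have d\<phi>: "(?\<phi> has_real_derivative (- t / \<sigma>\<^sup>2 * ?\<phi> t)) (at t)" for t
    unfolding normal_density_def using s
    by (auto intro!: derivative_eq_intros simp: field_simps power2_eq_square)
  have FTC: "(H has_integral (?\<phi> b * g b - ?\<phi> a * g a)) {a..b}" if "a \<le> b" for a b
  proof (rule fundamental_theorem_of_calculus_interior_strong[OF S(1) that])
    fix t assume "t \<in> {a<..<b} - S"
    then have "((\<lambda>t. ?\<phi> t * g t) has_real_derivative H t) (at t)"
      using d\<phi>[of t] S(2)[of t] by (auto intro!: derivative_eq_intros simp: H_def field_simps)
    then show "((\<lambda>t. ?\<phi> t * g t) has_vector_derivative H t) (at t)"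
      by (simp add: has_real_derivative_iff_has_vector_derivative)
  next
    have "continuous_on UNIV ?\<phi>" using d\<phi> by (auto intro!: continuous_at_imp_continuous_on DERIV_isCont)
    then show "continuous_on {a..b} (\<lambda>t. ?\<phi> t * g t)"
      using cont by (intro continuous_on_mult) (auto intro: continuous_on_subset)
  qed
  have set_int: "(\<integral>t. indicator {- real n..real n} t *\<^sub>R H t \<partial>lborel) = ?\<phi> (real n) * g (real n) - ?\<phi> (- real n) * g (- real n)" for n
  proof -
    have "set_integrable lborel {- real n..real n} H"
      unfolding set_integrable_def using integrable_mult_indicator[OF _ iH, of "{- real n..real n}"] by simp
    then have "(LINT t : {- real n..real n} | lborel. H t) = integral {- real n..real n} H"
      by (rule set_borel_integral_eq_integral)
    then show ?thesis using integral_unique[OF FTC[of "- real n" "real n"]]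
      unfolding set_lebesgue_integral_def by simp
  qed
  have lim1: "(\<lambda>n. \<integral>t. indicator {- real n..real n} t *\<^sub>R H t \<partial>lborel) \<longlonglongrightarrow> (\<integral>t. H t \<partial>lborel)"
  proof (rule integral_dominated_convergence[where w = "\<lambda>t. norm (H t)"])
    show "AE t in lborel. (\<lambda>n. indicator {- real n..real n} t *\<^sub>R H t) \<longlonglongrightarrow> H t"
    proof (rule AE_I2)
      fix t :: real
      obtain N where "\<bar>t\<bar> \<le> real N" using real_arch_simple by blast
      then have "\<forall>\<^sub>F n in sequentially. indicator {- real n..real n} t *\<^sub>R H t = H t"
        by (intro eventually_sequentiallyI[of N]) (auto simp: abs_le_iff split: split_indicator)
      then show "(\<lambda>n. indicator {- real n..real n} t *\<^sub>R H t) \<longlonglongrightarrow> H t" by (rule tendsto_eventually)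
    qed
  qed (use iH in \<open>auto split: split_indicator\<close>)
  have z: "(\<lambda>n. ?\<phi> (c * real n) * g (c * real n)) \<longlonglongrightarrow> 0" if c: "c\<^sup>2 = 1" for c
  proof (rule Lim_null_comparison)
    define r where "r = 1 / (2 * \<sigma>\<^sup>2) - \<kappa>"
    have r: "r > 0" using k s by (simp add: r_def field_simps)
    show "\<forall>\<^sub>F n in sequentially. norm (?\<phi> (c * real n) * g (c * real n)) \<le> C / sqrt (2 * pi * \<sigma>\<^sup>2) * exp (- (r * real n))"
    proof (rule eventually_sequentiallyI[of 1])
      fix n :: nat assume n: "1 \<le> n"
      have cn: "(c * real n)\<^sup>2 = (real n)\<^sup>2" using c by (simp add: power_mult_distrib)
      have "norm (?\<phi> (c * real n) * g (c * real n)) \<le> ?\<phi> (c * real n) * (C * exp (\<kappa> * (c * real n)\<^sup>2))"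
        using b(1)[of "c * real n"] by (auto simp: abs_mult intro!: mult_left_mono)
      also have "\<dots> = C / sqrt (2 * pi * \<sigma>\<^sup>2) * exp (- (r * (real n)\<^sup>2))"
      proof -
        have "- ((real n)\<^sup>2 / (2 * \<sigma>\<^sup>2)) + \<kappa> * (real n)\<^sup>2 = - (r * (real n)\<^sup>2)"
          by (simp add: r_def algebra_simps)
        then have e: "exp (- ((real n)\<^sup>2 / (2 * \<sigma>\<^sup>2))) * exp (\<kappa> * (real n)\<^sup>2) = exp (- (r * (real n)\<^sup>2))"
          by (simp flip: exp_add)
        show ?thesis unfolding normal_density_def diff_zero cn e[symmetric] by simp
      qed
      also have "\<dots> \<le> C / sqrt (2 * pi * \<sigma>\<^sup>2) * exp (- (r * real n))"
        using C0 r n by (intro mult_left_mono) (auto simp: power2_eq_square)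
      finally show "norm (?\<phi> (c * real n) * g (c * real n)) \<le> C / sqrt (2 * pi * \<sigma>\<^sup>2) * exp (- (r * real n))" .
    qed
    have "(\<lambda>n. exp (- (r * real n))) \<longlonglongrightarrow> 0"
      using r by (intro filterlim_compose[OF exp_at_bot] filterlim_uminus_at_bot_at_top[THEN filterlim_compose]
        filterlim_tendsto_pos_mult_at_top[OF tendsto_const] filterlim_real_sequentially)
    then show "(\<lambda>n. C / sqrt (2 * pi * \<sigma>\<^sup>2) * exp (- (r * real n))) \<longlonglongrightarrow> 0"
      using tendsto_mult_right_zero by blast
  qed
  have "(\<lambda>n. ?\<phi> (real n) * g (real n) - ?\<phi> (- real n) * g (- real n)) \<longlonglongrightarrow> 0 - 0"
    using z[of 1] z[of "- 1"] by (intro tendsto_diff) auto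
  then have "(\<integral>t. H t \<partial>lborel) = 0" using lim1 unfolding set_int by (simp add: LIMSEQ_unique)
  then have "(\<integral>t. ?\<phi> t * g' t \<partial>lborel) = (\<integral>t. ?\<phi> t * (t * g t) \<partial>lborel) / \<sigma>\<^sup>2"
    using i1 i2 unfolding H_def by simp
  then show ?thesis using s gm m by (simp add: integral_density)
qed

definition gauss_prod :: "'i set \<Rightarrow> ('i \<Rightarrow> real) \<Rightarrow> ('i \<Rightarrow> real) measure" where
  "gauss_prod I \<sigma> = Pi\<^sub>M I (\<lambda>i. density lborel (normal_density 0 (\<sigma> i)))"

text \<open>Growth below every Gaussian. This is preserved by products, and such functions are integrable even
  against a slowly growing exponential of the sum of squares.\<close>

definition tame :: "'i set \<Rightarrow> (('i \<Rightarrow> real) \<Rightarrow> real) \<Rightarrow> bool" where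
  "tame I f \<longleftrightarrow> f \<in> borel_measurable (Pi\<^sub>M I (\<lambda>_. borel)) \<and>
     (\<forall>\<kappa>>0. \<exists>C. \<forall>x. \<bar>f x\<bar> \<le> C * exp (\<kappa> * (\<Sum>i\<in>I. (x i)\<^sup>2)))"

lemma tameI:
  assumes "f \<in> borel_measurable (Pi\<^sub>M I (\<lambda>_. borel))"
    "\<And>\<kappa>. \<kappa> > 0 \<Longrightarrow> \<exists>C. \<forall>x. \<bar>f x\<bar> \<le> C * exp (\<kappa> * (\<Sum>i\<in>I. (x i)\<^sup>2))"
  shows "tame I f"
  using assms by (auto simp: tame_def)

lemma tame_measurable: "tame I f \<Longrightarrow> f \<in> borel_measurable (Pi\<^sub>M I (\<lambda>_. borel))"
  by (simp add: tame_def)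

lemma tame_bound:
  assumes "tame I f" "\<kappa> > 0"
  obtains C where "C \<ge> 0" "\<And>x. \<bar>f x\<bar> \<le> C * exp (\<kappa> * (\<Sum>i\<in>I. (x i)\<^sup>2))"
proof -
  obtain C where C: "\<And>x. \<bar>f x\<bar> \<le> C * exp (\<kappa> * (\<Sum>i\<in>I. (x i)\<^sup>2))"
    using assms by (auto simp: tame_def)
  have "0 \<le> C * exp (\<kappa> * (\<Sum>i\<in>I. (0::real)\<^sup>2))" using C[of "\<lambda>_. 0"] by (metis abs_ge_zero order_trans)
  then have "C \<ge> 0" by simp
  then show ?thesis using C that by blast
qed

lemma tame_mono:
  assumes "tame I g" "f \<in> borel_measurable (Pi\<^sub>M I (\<lambda>_. borel))" "\<And>x. \<bar>f x\<bar> \<le> \<bar>g x\<bar>"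
  shows "tame I f"
  using assms unfolding tame_def by (meson order_trans)

lemma tame_const: "tame I (\<lambda>_. c)"
proof (rule tameI)
  fix \<kappa> :: real assume "\<kappa> > 0"
  have "\<bar>c\<bar> * 1 \<le> \<bar>c\<bar> * exp (\<kappa> * (\<Sum>i\<in>I. (x i)\<^sup>2))" for x :: "_ \<Rightarrow> real"
    using \<open>\<kappa> > 0\<close> by (intro mult_left_mono) (auto intro!: mult_nonneg_nonneg sum_nonneg)
  then show "\<exists>C. \<forall>x. \<bar>c\<bar> \<le> C * exp (\<kappa> * (\<Sum>i\<in>I. (x i)\<^sup>2))" by auto
qed simp

lemma tame_coord:
  assumes "finite I" "i \<in> I"
  shows "tame I (\<lambda>x. x i)"
proof (rule tameI)
  fix \<kappa> :: real assume k: "\<kappa> > 0"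
  have "\<bar>x i\<bar> \<le> (1 + 1 / \<kappa>) * exp (\<kappa> * (\<Sum>i\<in>I. (x i)\<^sup>2))" for x :: "_ \<Rightarrow> real"
  proof -
    have "\<bar>x i\<bar> \<le> (1 + 1 / \<kappa>) * exp (\<kappa> * (x i)\<^sup>2)" by (rule abs_le_exp_sq[OF k])
    also have "\<dots> \<le> (1 + 1 / \<kappa>) * exp (\<kappa> * (\<Sum>i\<in>I. (x i)\<^sup>2))"
      using k assms by (auto intro!: mult_left_mono member_le_sum)
    finally show ?thesis .
  qed
  then show "\<exists>C. \<forall>x. \<bar>x i\<bar> \<le> C * exp (\<kappa> * (\<Sum>i\<in>I. (x i)\<^sup>2))" by blast
qed (use assms in measurable)

lemma tame_add:
  assumes "tame I f" "tame I g"
  shows "tame I (\<lambda>x. f x + g x)"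
proof (rule tameI)
  fix \<kappa> :: real assume k: "\<kappa> > 0"
  obtain C where C: "\<And>x. \<bar>f x\<bar> \<le> C * exp (\<kappa> * (\<Sum>i\<in>I. (x i)\<^sup>2))" using tame_bound[OF assms(1) k] by blast
  obtain D where D: "\<And>x. \<bar>g x\<bar> \<le> D * exp (\<kappa> * (\<Sum>i\<in>I. (x i)\<^sup>2))" using tame_bound[OF assms(2) k] by blast
  have "\<bar>f x + g x\<bar> \<le> (C + D) * exp (\<kappa> * (\<Sum>i\<in>I. (x i)\<^sup>2))" for x
    using C[of x] D[of x] unfolding distrib_right by linarith
  then show "\<exists>C. \<forall>x. \<bar>f x + g x\<bar> \<le> C * exp (\<kappa> * (\<Sum>i\<in>I. (x i)\<^sup>2))" by blast
qed (use assms[THEN tame_measurable] in measurable)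

lemma tame_mult:
  assumes "tame I f" "tame I g"
  shows "tame I (\<lambda>x. f x * g x)"
proof (rule tameI)
  fix \<kappa> :: real assume k: "\<kappa> > 0"
  then have k2: "\<kappa> / 2 > 0" by simp
  obtain C where C: "C \<ge> 0" "\<And>x. \<bar>f x\<bar> \<le> C * exp (\<kappa> / 2 * (\<Sum>i\<in>I. (x i)\<^sup>2))" using tame_bound[OF assms(1) k2] by blast
  obtain D where D: "D \<ge> 0" "\<And>x. \<bar>g x\<bar> \<le> D * exp (\<kappa> / 2 * (\<Sum>i\<in>I. (x i)\<^sup>2))" using tame_bound[OF assms(2) k2] by blast
  have "\<bar>f x * g x\<bar> \<le> (C * D) * exp (\<kappa> * (\<Sum>i\<in>I. (x i)\<^sup>2))" for x
  proof -
    have "\<bar>f x * g x\<bar> \<le> (C * exp (\<kappa> / 2 * (\<Sum>i\<in>I. (x i)\<^sup>2))) * (D * exp (\<kappa> / 2 * (\<Sum>i\<in>I. (x i)\<^sup>2)))"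
      unfolding abs_mult using C D by (intro mult_mono) auto
    also have "\<dots> = (C * D) * exp (\<kappa> * (\<Sum>i\<in>I. (x i)\<^sup>2))" by (simp add: mult_exp_exp algebra_simps)
    finally show ?thesis .
  qed
  then show "\<exists>C. \<forall>x. \<bar>f x * g x\<bar> \<le> C * exp (\<kappa> * (\<Sum>i\<in>I. (x i)\<^sup>2))" by blast
qed (use assms[THEN tame_measurable] in measurable)

lemma tame_cmult: "tame I f \<Longrightarrow> tame I (\<lambda>x. c * f x)"
  by (intro tame_mult tame_const)

lemma tame_diff: "tame I f \<Longrightarrow> tame I g \<Longrightarrow> tame I (\<lambda>x. f x - g x)"
  using tame_add[of I f "\<lambda>x. - 1 * g x"] tame_cmult[of I g "- 1"] by simp

lemma tame_sum: "(\<And>a. a \<in> A \<Longrightarrow> tame I (f a)) \<Longrightarrow> tame I (\<lambda>x. \<Sum>a\<in>A. f a x)"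
  by (induction A rule: infinite_finite_induct) (auto intro: tame_const tame_add)

lemma tame_prod: "(\<And>a. a \<in> A \<Longrightarrow> tame I (f a)) \<Longrightarrow> tame I (\<lambda>x. \<Prod>a\<in>A. f a x)"
  by (induction A rule: infinite_finite_induct) (auto intro: tame_const tame_mult)

lemma tame_prod_list: "(\<And>a. a \<in> set as \<Longrightarrow> tame I (f a)) \<Longrightarrow> tame I (\<lambda>x. prod_list (map (\<lambda>a. f a x) as))"
  by (induction as) (auto intro: tame_const tame_mult)

lemma tame_power: "tame I f \<Longrightarrow> tame I (\<lambda>x. f x ^ n)"
  by (induction n) (auto intro: tame_const tame_mult)

lemmas tame_intros = tame_const tame_coord tame_add tame_mult tame_diff tame_sum tame_prod tame_power

lemma sets_gauss_prod: "sets (gauss_prod I \<sigma>) = sets (Pi\<^sub>M I (\<lambda>_. borel))"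
  unfolding gauss_prod_def by (intro sets_PiM_cong) auto

lemma measurable_gauss_prod: "measurable (gauss_prod I \<sigma>) N = measurable (Pi\<^sub>M I (\<lambda>_. borel)) N"
  by (rule measurable_cong_sets[OF sets_gauss_prod refl])

lemma prob_space_gauss_prod:
  assumes "\<And>i. i \<in> I \<Longrightarrow> \<sigma> i > 0"
  shows "prob_space (gauss_prod I \<sigma>)"
  unfolding gauss_prod_def using assms by (intro prob_space_PiM prob_space_normal_density) auto

text \<open>A little room is left in each of the finitely many strict inequalities, and the growth of
  \<open>f\<close> fits into it.\<close>

lemma integrable_tame_exp:
  assumes I: "finite I" and s: "\<And>i. \<sigma> i > 0" and f: "tame I f"
    and c: "\<And>i. i \<in> I \<Longrightarrow> 2 * c i * (\<sigma> i)\<^sup>2 < 1"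
  shows "integrable (gauss_prod I \<sigma>) (\<lambda>x. f x * exp (\<Sum>i\<in>I. c i * (x i)\<^sup>2))"
proof -
  interpret product_sigma_finite "\<lambda>i. density lborel (normal_density 0 (\<sigma> i))"
    using s by (intro product_sigma_finite.intro prob_space_imp_sigma_finite prob_space_normal_density)
  have "\<exists>d>0. \<forall>i\<in>I. 2 * (c i + d) * (\<sigma> i)\<^sup>2 < 1" using I c
  proof (induction I rule: finite_induct)
    case empty
    show ?case by (intro exI[of _ 1]) auto
  next
    case (insert j I)
    then obtain d where d: "d > 0" "\<And>i. i \<in> I \<Longrightarrow> 2 * (c i + d) * (\<sigma> i)\<^sup>2 < 1" by auto
    have "c j < 1 / (2 * (\<sigma> j)\<^sup>2)" using insert.prems[of j] s[of j] by (simp add: field_simps)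
    then obtain z where z: "c j < z" "z < 1 / (2 * (\<sigma> j)\<^sup>2)" using dense by blast
    define e where "e = min d (z - c j)"
    have e: "e > 0" "e \<le> d" "c j + e \<le> z" using z d by (auto simp: e_def)
    have "2 * (c i + e) * (\<sigma> i)\<^sup>2 < 1" if "i \<in> insert j I" for i
    proof (cases "i = j")
      case True
      have "(c j + e) * (\<sigma> j)\<^sup>2 \<le> z * (\<sigma> j)\<^sup>2" using e by (intro mult_right_mono) auto
      also have "\<dots> < 1 / 2" using z s[of j] by (simp add: field_simps)
      finally show ?thesis using True by (simp add: algebra_simps)
    next
      case False
      then have "2 * (c i + d) * (\<sigma> i)\<^sup>2 < 1" using that d by auto
      moreover have "2 * (c i + e) * (\<sigma> i)\<^sup>2 \<le> 2 * (c i + d) * (\<sigma> i)\<^sup>2" using e by (intro mult_right_mono) auto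
      ultimately show ?thesis by linarith
    qed
    then show ?case using e(1) by blast
  qed
  then obtain d where d: "d > 0" "\<And>i. i \<in> I \<Longrightarrow> 2 * (c i + d) * (\<sigma> i)\<^sup>2 < 1" by blast
  obtain C where C: "C \<ge> 0" "\<And>x. \<bar>f x\<bar> \<le> C * exp (d * (\<Sum>i\<in>I. (x i)\<^sup>2))" using tame_bound[OF f d(1)] by blast
  have "integrable (density lborel (normal_density 0 (\<sigma> i))) (\<lambda>t. exp ((c i + d) * t\<^sup>2))" if "i \<in> I" for i
    using integrable_gauss_exp[OF s d(2)[OF that]] by (simp add: integrable_density)
  then have i: "integrable (gauss_prod I \<sigma>) (\<lambda>x. C * (\<Prod>i\<in>I. exp ((c i + d) * (x i)\<^sup>2)))"
    unfolding gauss_prod_def by (intro integrable_mult_right product_integrable_prod I)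
  show ?thesis
  proof (rule Bochner_Integration.integrable_bound[OF i])
    show "(\<lambda>x. f x * exp (\<Sum>i\<in>I. c i * (x i)\<^sup>2)) \<in> borel_measurable (gauss_prod I \<sigma>)"
      unfolding measurable_gauss_prod using tame_measurable[OF f] by measurable
    have "norm (f x * exp (\<Sum>i\<in>I. c i * (x i)\<^sup>2)) \<le> norm (C * (\<Prod>i\<in>I. exp ((c i + d) * (x i)\<^sup>2)))" for x
    proof -
      have "norm (f x * exp (\<Sum>i\<in>I. c i * (x i)\<^sup>2)) \<le> (C * exp (d * (\<Sum>i\<in>I. (x i)\<^sup>2))) * exp (\<Sum>i\<in>I. c i * (x i)\<^sup>2)"
        using C(2)[of x] by (simp add: abs_mult)
      also have "\<dots> = C * exp (\<Sum>i\<in>I. (c i + d) * (x i)\<^sup>2)"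
        by (simp add: sum_distrib_left distrib_right sum.distrib exp_add)
      also have "\<dots> = C * (\<Prod>i\<in>I. exp ((c i + d) * (x i)\<^sup>2))" by (simp add: exp_sum I)
      also have "\<dots> \<le> norm (C * (\<Prod>i\<in>I. exp ((c i + d) * (x i)\<^sup>2)))" by simp
      finally show ?thesis .
    qed
    then show "AE x in gauss_prod I \<sigma>. norm (f x * exp (\<Sum>i\<in>I. c i * (x i)\<^sup>2)) \<le> norm (C * (\<Prod>i\<in>I. exp ((c i + d) * (x i)\<^sup>2)))"
      by blast
  qed
qed

lemma integrable_tame:
  assumes "finite I" "\<And>i. \<sigma> i > 0" "tame I f"
  shows "integrable (gauss_prod I \<sigma>) f"
  using integrable_tame_exp[OF assms, of "\<lambda>_. 0"] by simp

text \<open>Fubini reduces this to one coordinate, with the others frozen.\<close>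

lemma stein:
  assumes I: "finite I" "e \<in> I" and s: "\<And>i. \<sigma> i > 0" and G: "tame I G" and G': "tame I G'"
    and cont: "\<And>x. continuous_on UNIV (\<lambda>t. G (x(e := t)))"
    and der: "\<And>x. \<exists>S. finite S \<and> (\<forall>t. t \<notin> S \<longrightarrow> ((\<lambda>t. G (x(e := t))) has_real_derivative G' (x(e := t))) (at t))"
  shows "(\<integral>x. x e * G x \<partial>gauss_prod I \<sigma>) = (\<sigma> e)\<^sup>2 * (\<integral>x. G' x \<partial>gauss_prod I \<sigma>)"
proof -
  let ?N = "\<lambda>i. density lborel (normal_density 0 (\<sigma> i))"
  interpret product_sigma_finite ?N
    using s by (intro product_sigma_finite.intro prob_space_imp_sigma_finite prob_space_normal_density)
  define J where "J = I - {e}"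
  have J: "finite J" "e \<notin> J" "I = insert e J" using I by (auto simp: J_def)
  define \<kappa> where "\<kappa> = 1 / (4 * (\<sigma> e)\<^sup>2)"
  have k: "\<kappa> > 0" "2 * \<kappa> * (\<sigma> e)\<^sup>2 < 1" using s[of e] by (auto simp: \<kappa>_def)
  obtain C where C: "C \<ge> 0" "\<And>x. \<bar>G x\<bar> \<le> C * exp (\<kappa> * (\<Sum>i\<in>I. (x i)\<^sup>2))" using tame_bound[OF G k(1)] by blast
  obtain D where D: "D \<ge> 0" "\<And>x. \<bar>G' x\<bar> \<le> D * exp (\<kappa> * (\<Sum>i\<in>I. (x i)\<^sup>2))" using tame_bound[OF G' k(1)] by blast
  have iG: "integrable (Pi\<^sub>M (insert e J) ?N) (\<lambda>x. x e * G x)"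
    using integrable_tame[OF I(1) s tame_mult[OF tame_coord[OF I] G]] unfolding gauss_prod_def J(3) .
  have iG': "integrable (Pi\<^sub>M (insert e J) ?N) (\<lambda>x. (\<sigma> e)\<^sup>2 * G' x)"
    using integrable_tame[OF I(1) s tame_cmult[OF G']] unfolding gauss_prod_def J(3) .
  have "(\<integral>x. x e * G x \<partial>gauss_prod I \<sigma>) = (\<integral>x. (\<integral>t. t * G (x(e := t)) \<partial>?N e) \<partial>Pi\<^sub>M J ?N)"
    unfolding gauss_prod_def J(3) by (subst product_integral_insert[OF J(1,2) iG]) simp
  also have "\<dots> = (\<integral>x. (\<integral>t. (\<sigma> e)\<^sup>2 * G' (x(e := t)) \<partial>?N e) \<partial>Pi\<^sub>M J ?N)"
  proof (rule Bochner_Integration.integral_cong[OF refl])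
    fix x assume x: "x \<in> space (Pi\<^sub>M J ?N)"
    define B where "B = (C + D) * exp (\<kappa> * (\<Sum>i\<in>J. (x i)\<^sup>2))"
    have sum: "(\<Sum>i\<in>I. ((x(e := t)) i)\<^sup>2) = t\<^sup>2 + (\<Sum>i\<in>J. (x i)\<^sup>2)" for t
    proof -
      have "(\<Sum>i\<in>J. ((x(e := t)) i)\<^sup>2) = (\<Sum>i\<in>J. (x i)\<^sup>2)" using J by (intro sum.cong) auto
      then show ?thesis using J by simp
    qed
    have b: "\<bar>G (x(e := t))\<bar> \<le> B * exp (\<kappa> * t\<^sup>2)" "\<bar>G' (x(e := t))\<bar> \<le> B * exp (\<kappa> * t\<^sup>2)" for t
    proof -
      have eq: "E * exp (\<kappa> * (\<Sum>i\<in>I. ((x(e := t)) i)\<^sup>2)) = E * exp (\<kappa> * (\<Sum>i\<in>J. (x i)\<^sup>2)) * exp (\<kappa> * t\<^sup>2)" for E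
        unfolding sum by (simp add: distrib_left exp_add)
      have le: "E * exp (\<kappa> * (\<Sum>i\<in>J. (x i)\<^sup>2)) * exp (\<kappa> * t\<^sup>2) \<le> B * exp (\<kappa> * t\<^sup>2)" if "E \<le> C + D" for E
        unfolding B_def using that by (intro mult_right_mono) auto
      show "\<bar>G (x(e := t))\<bar> \<le> B * exp (\<kappa> * t\<^sup>2)"
        using C(2)[of "x(e := t)"] le[of C] D(1) unfolding eq by linarith
      show "\<bar>G' (x(e := t))\<bar> \<le> B * exp (\<kappa> * t\<^sup>2)"
        using D(2)[of "x(e := t)"] le[of D] C(1) unfolding eq by linarith
    qed
    obtain S where S: "finite S" "\<And>t. t \<notin> S \<Longrightarrow> ((\<lambda>t. G (x(e := t))) has_real_derivative G' (x(e := t))) (at t)"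
      using der[of x] by blast
    have "space (Pi\<^sub>M J ?N) = space (Pi\<^sub>M J (\<lambda>_. borel :: real measure))" by (simp add: space_PiM)
    then have "(\<lambda>t. x(e := t)) \<in> borel \<rightarrow>\<^sub>M Pi\<^sub>M (insert e J) (\<lambda>_. borel)"
      using x J(2) by (intro measurable_component_update) auto
    then have m: "(\<lambda>t. G' (x(e := t))) \<in> borel_measurable borel"
      using tame_measurable[OF G'] unfolding J(3) by (rule measurable_compose)
    show "(\<integral>t. t * G (x(e := t)) \<partial>?N e) = (\<integral>t. (\<sigma> e)\<^sup>2 * G' (x(e := t)) \<partial>?N e)"
      using stein_1d[OF s k(2) cont S m b] by simp
  qed
  also have "\<dots> = (\<integral>x. (\<sigma> e)\<^sup>2 * G' x \<partial>gauss_prod I \<sigma>)"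
    unfolding gauss_prod_def J(3) by (subst product_integral_insert[OF J(1,2) iG']) simp
  finally show ?thesis by simp
qed

section \<open>Loop equations for Gaussian vectors with Vandermonde weight\<close>

definition psum :: "nat \<Rightarrow> nat \<Rightarrow> (nat \<Rightarrow> real) \<Rightarrow> real" where
  "psum k r x = (\<Sum>i<k. x i ^ r)"

definition pmon :: "nat \<Rightarrow> nat list \<Rightarrow> (nat \<Rightarrow> real) \<Rightarrow> real" where
  "pmon k rs x = prod_list (map (\<lambda>r. psum k r x) rs)"

lemma pmon_simps [simp]: "pmon k [] x = 1" "pmon k (r # rs) x = psum k r x * pmon k rs x"
  by (simp_all add: pmon_def)

text \<open>The right-hand side of the loop equations. Here \<open>\<Phi> rs\<close> stands for the expected
  product of the power sums with exponents \<open>rs\<close>, that is of the traces of these powers; the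
  equations express \<open>\<Phi> (Suc r # rs)\<close> by means of it.\<close>

definition loop_rhs :: "(nat list \<Rightarrow> real) \<Rightarrow> nat \<Rightarrow> nat list \<Rightarrow> real" where
  "loop_rhs \<Phi> r rs = real r / 2 * \<Phi> ((r - 1) # rs) + (\<Sum>a<r. \<Phi> (a # (r - 1 - a) # rs)) / 2 +
     (\<Sum>m<length rs. real (rs ! m) * \<Phi> (rs[m := r + rs ! m - 1]))"

text \<open>Each term with nonzero coefficient on the right of the loop equation has total degree smaller by
  \<open>2\<close> and at most one factor more, so the sum of degree and number of factors decreases.
  Vanishing exponents only contribute the constant \<open>c\<close>.\<close>

lemma loop_unique:
  assumes z: "\<Phi> [] = \<Psi> []"
    and c: "\<And>rs. \<Phi> (0 # rs) = c * \<Phi> rs" "\<And>rs. \<Psi> (0 # rs) = c * \<Psi> rs"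
    and p: "\<And>as b bs. \<Phi> (as @ b # bs) = \<Phi> (b # as @ bs)" "\<And>as b bs. \<Psi> (as @ b # bs) = \<Psi> (b # as @ bs)"
    and l: "\<And>r rs. \<Phi> (Suc r # rs) = loop_rhs \<Phi> r rs" "\<And>r rs. \<Psi> (Suc r # rs) = loop_rhs \<Psi> r rs"
  shows "\<Phi> rs = \<Psi> rs"
proof (induction "sum_list rs + length rs" arbitrary: rs rule: less_induct)
  case less
  consider "rs = []" | rs' where "rs = 0 # rs'" | as r bs where "rs = as @ Suc r # bs"
  proof (cases "\<exists>x\<in>set rs. x \<noteq> 0")
    case True
    then obtain x where "x \<in> set rs" "x \<noteq> 0" by blast
    then obtain as bs r where "rs = as @ Suc r # bs" by (metis in_set_conv_decomp not0_implies_Suc)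
    then show ?thesis using that by blast
  next
    case False
    then show ?thesis using that by (cases rs) auto
  qed
  then show ?case
  proof cases
    case 2
    then show ?thesis using less[of rs'] c by simp
  next
    case (3 as r bs)
    let ?t = "as @ bs"
    have "\<Phi> ((r - 1) # ?t) = \<Psi> ((r - 1) # ?t)"
      by (rule less) (use 3 in auto)
    moreover have "\<Phi> (a # (r - 1 - a) # ?t) = \<Psi> (a # (r - 1 - a) # ?t)" if "a < r" for a
      by (rule less) (use 3 that in auto)
    moreover have "real (?t ! m) * \<Phi> (?t[m := r + ?t ! m - 1]) = real (?t ! m) * \<Psi> (?t[m := r + ?t ! m - 1])"
      if m: "m < length ?t" for m
    proof (cases "?t ! m = 0")
      case False
      have "sum_list (?t[m := r + ?t ! m - 1]) = sum_list ?t + (r + ?t ! m - 1) - ?t ! m"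
        using m by (simp add: sum_list_update)
      then have "\<Phi> (?t[m := r + ?t ! m - 1]) = \<Psi> (?t[m := r + ?t ! m - 1])"
        using 3 False by (intro less) auto
      then show ?thesis by simp
    qed simp
    ultimately have "loop_rhs \<Phi> r ?t = loop_rhs \<Psi> r ?t"
      unfolding loop_rhs_def by (intro arg_cong2[of _ _ _ _ "(+)"] arg_cong2[of _ _ _ _ "(/)"] sum.cong) auto
    then show ?thesis using 3 p l by simp
  qed (simp add: z)
qed

lemma psum_0: "psum k 0 x = real k" by (simp add: psum_def)

lemma pmon_perm: "pmon k (as @ b # bs) x = pmon k (b # as @ bs) x"
  by (simp add: pmon_def)

lemma tame_psum: "tame {..<k} (psum k r)"
  unfolding psum_def[abs_def] by (intro tame_sum tame_power tame_coord) auto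

lemma tame_pmon: "tame {..<k} (pmon k rs)"
  unfolding pmon_def[abs_def] by (intro tame_prod_list tame_psum)

definition pairs :: "nat \<Rightarrow> (nat \<times> nat) set" where
  "pairs k = {(i, j). i < j \<and> j < k}"

lemma finite_pairs [simp]: "finite (pairs k)"
  by (rule finite_subset[of _ "{..<k} \<times> {..<k}"]) (auto simp: pairs_def)

lemma vdm_pairs: "vdm k x = (\<Prod>(i, j)\<in>pairs k. x i - x j)"
proof -
  have "vdm k x = (\<Prod>(j, i)\<in>Sigma {..<k} (\<lambda>j. {..<j}). x i - x j)"
    unfolding vdm_def by (rule prod.Sigma) auto
  also have "\<dots> = (\<Prod>(i, j)\<in>pairs k. x i - x j)"
    by (rule prod.reindex_bij_witness[of _ prod.swap prod.swap]) (auto simp: pairs_def)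
  finally show ?thesis .
qed

definition chamber :: "nat \<Rightarrow> (nat \<Rightarrow> real) \<Rightarrow> bool" where
  "chamber k x \<longleftrightarrow> (\<forall>(i, j)\<in>pairs k. x j \<le> x i)"

lemma vdmp_chamber: "vdmp k x = (if chamber k x then vdm k x else 0)"
  unfolding vdmp_def chamber_def pairs_def by auto

lemma chamber_measurable: "Measurable.pred (Pi\<^sub>M {..<k} (\<lambda>_. borel)) (chamber k)"
proof -
  have "Measurable.pred (Pi\<^sub>M {..<k} (\<lambda>_. borel :: real measure)) (\<lambda>x. x j \<le> x i)" if "(i, j) \<in> pairs k" for i j
  proof -
    have "i \<in> {..<k}" "j \<in> {..<k}" using that by (auto simp: pairs_def)
    then have "(\<lambda>x. x i) \<in> borel_measurable (Pi\<^sub>M {..<k} (\<lambda>_. borel :: real measure))"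
      "(\<lambda>x. x j) \<in> borel_measurable (Pi\<^sub>M {..<k} (\<lambda>_. borel :: real measure))"
      by (auto intro!: measurable_component_singleton)
    then show ?thesis unfolding pred_def by (intro borel_measurable_le)
  qed
  then show ?thesis unfolding chamber_def[abs_def]
    by (intro pred_intros_finite) (auto simp: split_beta)
qed

lemma tame_vdm: "tame {..<k} (vdm k)"
  unfolding vdm_def[abs_def] by (intro tame_prod tame_diff tame_coord) auto

lemma tame_chamber:
  assumes "tame {..<k} f"
  shows "tame {..<k} (\<lambda>x. if chamber k x then f x else 0)"
proof (rule tame_mono[OF assms])
  show "(\<lambda>x. if chamber k x then f x else 0) \<in> borel_measurable (Pi\<^sub>M {..<k} (\<lambda>_. borel))"
    using chamber_measurable tame_measurable[OF assms] by measurable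
qed auto

lemma tame_vdmp: "tame {..<k} (vdmp k)"
  unfolding vdmp_chamber[abs_def] by (intro tame_chamber tame_vdm)

text \<open>The logarithmic derivative multiplied out, so that it also makes sense where coordinates
  coincide.\<close>

definition dvdm :: "nat \<Rightarrow> nat \<Rightarrow> (nat \<Rightarrow> real) \<Rightarrow> real" where
  "dvdm k e x = (\<Sum>p\<in>pairs k. (of_bool (fst p = e) - of_bool (snd p = e)) *
     (\<Prod>(i, j)\<in>pairs k - {p}. x i - x j))"

lemma vdm_derivative:
  "((\<lambda>t. vdm k (x(e := t))) has_real_derivative dvdm k e (x(e := t))) (at t)"
proof -
  have d: "((\<lambda>t. (x(e := t)) i) has_real_derivative of_bool (i = e)) (at t)" for i
    by (cases "i = e") auto
  have "((\<lambda>t. \<Prod>p\<in>pairs k. (x(e := t)) (fst p) - (x(e := t)) (snd p)) has_real_derivative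
    (\<Sum>p\<in>pairs k. (of_bool (fst p = e) - of_bool (snd p = e)) *
      (\<Prod>q\<in>pairs k - {p}. (x(e := t)) (fst q) - (x(e := t)) (snd q)))) (at t)"
    by (intro has_field_derivative_prod DERIV_diff d)
  then show ?thesis unfolding vdm_pairs dvdm_def by (simp only: case_prod_unfold)
qed

text \<open>The sum over all ordered pairs consists of the pairs with \<open>i < j\<close>, their mirror
  images, and the diagonal.\<close>

lemma sum_complete_pairs:
  "(\<Sum>(i, j)\<in>pairs k. \<Sum>a<r. x i ^ a * x j ^ (r - 1 - a)) =
    ((\<Sum>a<r. psum k a x * psum k (r - 1 - a) x) - real r * psum k (r - 1) x) / 2"
proof -
  define h where "h i j = (\<Sum>a<r. x i ^ a * x j ^ (r - 1 - a))" for i j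
  have sym: "h i j = h j i" for i j
    unfolding h_def by (rule sum.reindex_bij_witness[of _ "\<lambda>a. r - 1 - a" "\<lambda>a. r - 1 - a"]) (auto simp: mult.commute)
  have dg: "h i i = real r * x i ^ (r - 1)" for i
  proof -
    have "h i i = (\<Sum>a<r. x i ^ (r - 1))" unfolding h_def by (intro sum.cong) (auto simp flip: power_add)
    then show ?thesis by simp
  qed
  have split: "{..<k} \<times> {..<k} = pairs k \<union> (prod.swap ` pairs k \<union> (\<lambda>i. (i, i)) ` {..<k})"
    unfolding pairs_def by (auto simp: image_iff)
  have "(\<Sum>(i, j)\<in>{..<k} \<times> {..<k}. h i j) = (\<Sum>(i, j)\<in>pairs k. h i j) +
      ((\<Sum>(i, j)\<in>prod.swap ` pairs k. h i j) + (\<Sum>(i, j)\<in>(\<lambda>i. (i, i)) ` {..<k}. h i j))"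
  proof -
    have f: "finite (prod.swap ` pairs k)" "finite ((\<lambda>i. (i, i)) ` {..<k})" by simp_all
    have d2: "prod.swap ` pairs k \<inter> (\<lambda>i. (i, i)) ` {..<k} = {}" by (auto simp: pairs_def)
    have d1: "pairs k \<inter> (prod.swap ` pairs k \<union> (\<lambda>i. (i, i)) ` {..<k}) = {}" by (auto simp: pairs_def)
    show ?thesis unfolding split
      by (simp only: sum.union_disjoint[OF finite_pairs finite_UnI[OF f] d1] sum.union_disjoint[OF f d2])
  qed
  also have "(\<Sum>(i, j)\<in>prod.swap ` pairs k. h i j) = (\<Sum>(i, j)\<in>pairs k. h i j)"
    by (subst sum.reindex) (auto simp: split_beta sym intro!: sum.cong)
  also have "(\<Sum>(i, j)\<in>(\<lambda>i. (i, i)) ` {..<k}. h i j) = real r * psum k (r - 1) x"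
    by (subst sum.reindex) (auto simp: dg psum_def sum_distrib_left inj_on_def)
  also have "(\<Sum>(i, j)\<in>{..<k} \<times> {..<k}. h i j) = (\<Sum>a<r. psum k a x * psum k (r - 1 - a) x)"
  proof -
    have "(\<Sum>(i, j)\<in>{..<k} \<times> {..<k}. h i j) = (\<Sum>i<k. \<Sum>j<k. \<Sum>a<r. x i ^ a * x j ^ (r - 1 - a))"
      unfolding h_def sum.cartesian_product[of _ "{..<k}"] ..
    also have "\<dots> = (\<Sum>i<k. \<Sum>a<r. \<Sum>j<k. x i ^ a * x j ^ (r - 1 - a))"
      by (intro sum.cong refl sum.swap)
    also have "\<dots> = (\<Sum>a<r. \<Sum>i<k. \<Sum>j<k. x i ^ a * x j ^ (r - 1 - a))" by (rule sum.swap)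
    finally show ?thesis unfolding psum_def by (simp add: sum_product)
  qed
  finally show ?thesis unfolding h_def by (simp add: field_simps)
qed

text \<open>A pair contributes
  \<open>(x\<^sub>i\<^sup>r - x\<^sub>j\<^sup>r) / (x\<^sub>i - x\<^sub>j)\<close>, which is a sum of
  \<open>r\<close> monomials.\<close>

lemma sum_dvdm:
  "(\<Sum>e<k. x e ^ r * dvdm k e x) = vdm k x *
    (((\<Sum>a<r. psum k a x * psum k (r - 1 - a) x) - real r * psum k (r - 1) x) / 2)"
proof -
  define Q where "Q p = (\<Prod>(i, j)\<in>pairs k - {p}. x i - x j)" for p
  have "(\<Sum>e<k. x e ^ r * dvdm k e x) =
      (\<Sum>e<k. \<Sum>p\<in>pairs k. x e ^ r * (of_bool (fst p = e) - of_bool (snd p = e)) * Q p)"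
    unfolding dvdm_def Q_def by (simp add: sum_distrib_left mult.assoc)
  also have "\<dots> = (\<Sum>p\<in>pairs k. \<Sum>e<k. x e ^ r * (of_bool (fst p = e) - of_bool (snd p = e)) * Q p)"
    by (rule sum.swap)
  also have "\<dots> = (\<Sum>p\<in>pairs k. (x (fst p) ^ r - x (snd p) ^ r) * Q p)"
  proof (intro sum.cong refl)
    fix p assume p: "p \<in> pairs k"
    have a: "(\<Sum>e<k. x e ^ r * of_bool (i = e)) = x i ^ r" if "i < k" for i
    proof -
      have "(\<Sum>e<k. x e ^ r * of_bool (i = e)) = (\<Sum>e<k. if e = i then x e ^ r else 0)" by (intro sum.cong) auto
      then show ?thesis using that by simp
    qed
    have "fst p < k" "snd p < k" using p by (auto simp: pairs_def)
    then show "(\<Sum>e<k. x e ^ r * (of_bool (fst p = e) - of_bool (snd p = e)) * Q p) = (x (fst p) ^ r - x (snd p) ^ r) * Q p"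
      using a[of "fst p"] a[of "snd p"] by (simp add: right_diff_distrib sum_subtractf flip: sum_distrib_right)
  qed
  also have "\<dots> = (\<Sum>(i, j)\<in>pairs k. vdm k x * (\<Sum>a<r. x i ^ a * x j ^ (r - 1 - a)))"
  proof (intro sum.cong refl)
    fix p assume p: "p \<in> pairs k"
    obtain i j where ij: "p = (i, j)" by (cases p)
    have "vdm k x = (x i - x j) * Q p"
      unfolding vdm_pairs Q_def using p ij by (subst prod.remove[of _ p]) auto
    moreover have "x i ^ r - x j ^ r = (x i - x j) * (\<Sum>a<r. x i ^ a * x j ^ (r - 1 - a))"
      by (subst power_diff_sumr2) (auto intro!: sum.cong simp: mult.commute)
    ultimately show "(x (fst p) ^ r - x (snd p) ^ r) * Q p =
      (case p of (i, j) \<Rightarrow> vdm k x * (\<Sum>a<r. x i ^ a * x j ^ (r - 1 - a)))"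
      unfolding ij by simp
  qed
  also have "\<dots> = vdm k x * (\<Sum>(i, j)\<in>pairs k. \<Sum>a<r. x i ^ a * x j ^ (r - 1 - a))"
    by (simp add: sum_distrib_left split_beta)
  finally show ?thesis unfolding sum_complete_pairs .
qed

fun dpmon :: "nat \<Rightarrow> nat \<Rightarrow> nat list \<Rightarrow> (nat \<Rightarrow> real) \<Rightarrow> real" where
  "dpmon k e [] x = 0"
| "dpmon k e (s # rs) x = real s * x e ^ (s - 1) * pmon k rs x + psum k s x * dpmon k e rs x"

lemma psum_derivative:
  assumes "e < k"
  shows "((\<lambda>t. psum k s (x(e := t))) has_real_derivative real s * (x(e := t)) e ^ (s - 1)) (at t)"
proof -
  have d: "((\<lambda>t. (x(e := t)) i ^ s) has_real_derivative (if i = e then real s * t ^ (s - 1) else 0)) (at t)" for i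
    by (cases "i = e") (auto intro!: derivative_eq_intros)
  have "((\<lambda>t. psum k s (x(e := t))) has_real_derivative (\<Sum>i<k. if i = e then real s * t ^ (s - 1) else 0)) (at t)"
    unfolding psum_def by (intro DERIV_sum d)
  then show ?thesis using assms by simp
qed

lemma pmon_derivative:
  "e < k \<Longrightarrow> ((\<lambda>t. pmon k rs (x(e := t))) has_real_derivative dpmon k e rs (x(e := t))) (at t)"
proof (induction rs)
  case (Cons s rs)
  have "((\<lambda>t. psum k s (x(e := t)) * pmon k rs (x(e := t))) has_real_derivative
      dpmon k e (s # rs) (x(e := t))) (at t)"
    by (rule DERIV_cong[OF DERIV_mult[OF psum_derivative[OF Cons.prems] Cons.IH[OF Cons.prems]]])
      (simp add: algebra_simps del: fun_upd_apply)
  then show ?case by (simp only: pmon_simps)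
qed simp

lemma tame_dpmon: "e < k \<Longrightarrow> tame {..<k} (dpmon k e rs)"
proof (induction rs)
  case Nil
  have "dpmon k e [] = (\<lambda>_. 0)" by (rule ext) simp
  then show ?case using tame_const by simp
next
  case (Cons s rs)
  have "dpmon k e (s # rs) = (\<lambda>x. real s * x e ^ (s - 1) * pmon k rs x + psum k s x * dpmon k e rs x)"
    by (rule ext) simp
  then show ?case using Cons by (auto intro!: tame_intros tame_pmon tame_psum)
qed

lemma sum_dpmon:
  "(\<Sum>e<k. x e ^ r * dpmon k e rs x) = (\<Sum>m<length rs. real (rs ! m) * pmon k (rs[m := r + rs ! m - 1]) x)"
proof (induction rs)
  case (Cons s rs)
  have s: "(\<Sum>e<k. x e ^ r * (real s * x e ^ (s - 1))) = real s * psum k (r + s - 1) x"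
  proof (cases "s = 0")
    case False
    then have "r + s - 1 = r + (s - 1)" by simp
    then show ?thesis unfolding psum_def sum_distrib_left by (simp add: power_add mult_ac)
  qed simp
  have "(\<Sum>e<k. x e ^ r * dpmon k e (s # rs) x) =
      (\<Sum>e<k. x e ^ r * (real s * x e ^ (s - 1))) * pmon k rs x + psum k s x * (\<Sum>e<k. x e ^ r * dpmon k e rs x)"
    by (simp add: sum_distrib_left sum_distrib_right sum.distrib algebra_simps)
  also have "\<dots> = real s * pmon k ((r + s - 1) # rs) x +
      (\<Sum>m<length rs. real (rs ! m) * pmon k (s # rs[m := r + rs ! m - 1]) x)"
    unfolding s Cons.IH by (simp add: sum_distrib_left mult_ac)
  also have "\<dots> = (\<Sum>m<length (s # rs). real ((s # rs) ! m) * pmon k ((s # rs)[m := r + (s # rs) ! m - 1]) x)"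
    unfolding length_Cons sum.lessThan_Suc_shift by simp
  finally show ?case .
qed simp

lemma tame_dvdm: "tame {..<k} (dvdm k e)"
  unfolding dvdm_def[abs_def] split_beta
  by (intro tame_intros) (auto simp: pairs_def)

text \<open>Integrate by parts in each coordinate \<open>x\<^sub>e\<close> after splitting off one factor
  \<open>x\<^sub>e\<close> from \<open>x\<^sub>e ^ Suc r\<close>. Cutting off outside the chamber causes no
  boundary term, because the Vandermonde product vanishes on the walls.\<close>

lemma loop_vandermonde:
  fixes k :: nat
  defines "\<Phi> \<equiv> \<lambda>rs. \<integral>x. pmon k rs x * vdmp k x \<partial>gauss_prod {..<k} (\<lambda>_. 1)"
  shows "\<Phi> (Suc r # rs) = loop_rhs \<Phi> r rs"
proof -
  let ?\<gamma> = "gauss_prod {..<k} (\<lambda>_. 1)"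
  define H where "H e x = x e ^ r * pmon k rs x * vdm k x" for e and x :: "nat \<Rightarrow> real"
  define H' where "H' e x = real r * x e ^ (r - 1) * pmon k rs x * vdm k x + x e ^ r * dpmon k e rs x * vdm k x +
    x e ^ r * pmon k rs x * dvdm k e x" for e and x :: "nat \<Rightarrow> real"
  define G where "G e x = (if chamber k x then H e x else 0)" for e x
  define G' where "G' e x = (if chamber k x then H' e x else 0)" for e x
  have tH: "tame {..<k} (H e)" and tH': "tame {..<k} (H' e)" if "e < k" for e
    unfolding H_def[abs_def] H'_def[abs_def] using that
    by (auto intro!: tame_intros tame_pmon tame_vdm tame_dpmon tame_dvdm)
  have int: "integrable ?\<gamma> f" if "tame {..<k} f" for f
    using that by (intro integrable_tame) auto
  have dH: "((\<lambda>t. H e (x(e := t))) has_real_derivative H' e (x(e := t))) (at t)" if e: "e < k" for e x t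
    unfolding H_def H'_def
    by (rule derivative_eq_intros vdm_derivative pmon_derivative[OF e] refl | simp add: algebra_simps)+
  have st: "(\<integral>x. x e * G e x \<partial>?\<gamma>) = (\<integral>x. G' e x \<partial>?\<gamma>)" if e: "e < k" for e
  proof -
    \<comment> \<open>Membership in the chamber changes only where two coordinates coincide.\<close>
    have loc: "\<forall>\<^sub>F s in nhds t. chamber k (x(e := s)) = chamber k (x(e := t))"
      if t: "t \<notin> x ` ({..<k} - {e})" for x t
    proof -
      have "\<forall>\<^sub>F s in nhds t. ((x(e := s)) j \<le> (x(e := s)) i) = ((x(e := t)) j \<le> (x(e := t)) i)"
        if ij: "(i, j) \<in> pairs k" for i j
      proof -
        have ne: "i \<noteq> j" "i < k" "j < k" using ij by (auto simp: pairs_def)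
        have a: "\<forall>\<^sub>F s in nhds t. (s \<le> c) = (t \<le> c) \<and> (c \<le> s) = (c \<le> t)" if "c \<noteq> t" for c :: real
        proof (cases "c < t")
          case True
          have "\<forall>\<^sub>F s in nhds t. c < s" using True eventually_nhds_in_open[of "{c<..}" t] by auto
          then show ?thesis by eventually_elim (use True in auto)
        next
          case False
          then have "t < c" using that by simp
          have "\<forall>\<^sub>F s in nhds t. s < c" using \<open>t < c\<close> eventually_nhds_in_open[of "{..<c}" t] by auto
          then show ?thesis by eventually_elim (use \<open>t < c\<close> in auto)
        qed
        show ?thesis
        proof (cases "i = e \<or> j = e")
          case True
          then have "x (if i = e then j else i) \<noteq> t" using t ne by auto
          from a[OF this] show ?thesis by eventually_elim (use True ne in auto)
        qed auto
      qed
      then have "\<forall>\<^sub>F s in nhds t. \<forall>p\<in>pairs k. ((x(e := s)) (snd p) \<le> (x(e := s)) (fst p)) = ((x(e := t)) (snd p) \<le> (x(e := t)) (fst p))"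
        by (intro eventually_ball_finite) auto
      then show ?thesis by eventually_elim (auto simp: chamber_def split_beta)
    qed
    have cH: "isCont (\<lambda>t. H e (x(e := t))) t" for x t using dH[OF e] by (rule DERIV_isCont)
    \<comment> \<open>On a wall the Vandermonde product vanishes, which makes the cut-off continuous there.\<close>
    have cG: "isCont (\<lambda>t. G e (x(e := t))) t" for x t
    proof (cases "t \<in> x ` ({..<k} - {e})")
      case True
      then obtain i where i: "i < k" "i \<noteq> e" "t = x i" by auto
      have "vdm k (x(e := t)) = 0"
        using i e vdm_eq_0[of i e k "x(e := t)"] vdm_eq_0[of e i k "x(e := t)"] by (cases "i < e") auto
      then have z: "H e (x(e := t)) = 0" "G e (x(e := t)) = 0" by (auto simp: H_def G_def)
      have "((\<lambda>s. H e (x(e := s))) \<longlongrightarrow> 0) (at t)" using cH[where x = x and t = t] z by (simp add: isCont_def)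
      then have "((\<lambda>s. norm (H e (x(e := s)))) \<longlongrightarrow> 0) (at t)" by (rule tendsto_norm_zero)
      moreover have "\<forall>\<^sub>F s in at t. norm (G e (x(e := s))) \<le> norm (H e (x(e := s)))" by (auto simp: G_def)
      ultimately have "((\<lambda>s. G e (x(e := s))) \<longlongrightarrow> 0) (at t)" by (rule Lim_null_comparison[rotated])
      then show ?thesis using z by (simp add: isCont_def)
    next
      case False
      have ev: "\<forall>\<^sub>F s in nhds t. G e (x(e := s)) = (if chamber k (x(e := t)) then H e (x(e := s)) else 0)"
        using loc[OF False] by eventually_elim (simp add: G_def)
      show ?thesis unfolding isCont_cong[OF ev] using cH[where x = x and t = t]
        by (cases "chamber k (x(e := t))") auto
    qed
    have dG: "((\<lambda>t. G e (x(e := t))) has_real_derivative G' e (x(e := t))) (at t)"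
      if t: "t \<notin> x ` ({..<k} - {e})" for x t
    proof -
      have ev: "\<forall>\<^sub>F s in nhds t. G e (x(e := s)) = (if chamber k (x(e := t)) then H e (x(e := s)) else 0)"
        using loc[OF t] by eventually_elim (simp add: G_def)
      show ?thesis using dH[OF e, where x = x and t = t] by (subst DERIV_cong_ev[OF refl ev refl]) (auto simp: G'_def)
    qed
    have "(\<integral>x. x e * G e x \<partial>?\<gamma>) = (1::real)\<^sup>2 * (\<integral>x. G' e x \<partial>?\<gamma>)"
    proof (rule stein)
      show "tame {..<k} (G e)" "tame {..<k} (G' e)"
        unfolding G_def[abs_def] G'_def[abs_def] by (intro tame_chamber tH tH' e)+
      show "continuous_on UNIV (\<lambda>t. G e (x(e := t)))" for x using cG by (simp add: continuous_at_imp_continuous_on)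
      show "\<exists>S. finite S \<and> (\<forall>t. t \<notin> S \<longrightarrow> ((\<lambda>t. G e (x(e := t))) has_real_derivative G' e (x(e := t))) (at t))" for x
        using dG by (intro exI[of _ "x ` ({..<k} - {e})"]) auto
    qed (use e in auto)
    then show ?thesis by simp
  qed
  have iG: "integrable ?\<gamma> (\<lambda>x. x e * G e x)" "integrable ?\<gamma> (G' e)" if "e < k" for e
    unfolding G_def[abs_def] G'_def[abs_def] using that by (auto intro!: int tame_intros tame_chamber tH tH')
  have ip: "integrable ?\<gamma> (\<lambda>x. pmon k ss x * vdmp k x)" for ss by (intro int tame_mult tame_pmon tame_vdmp)
  have "\<Phi> (Suc r # rs) = (\<integral>x. (\<Sum>e<k. x e * G e x) \<partial>?\<gamma>)"
    unfolding \<Phi>_def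
  proof (intro Bochner_Integration.integral_cong refl)
    fix x :: "nat \<Rightarrow> real"
    have "(\<Sum>e<k. x e * (x e ^ r * pmon k rs x * vdm k x)) = psum k (Suc r) x * (pmon k rs x * vdm k x)"
      unfolding psum_def sum_distrib_right by (intro sum.cong) auto
    then show "pmon k (Suc r # rs) x * vdmp k x = (\<Sum>e<k. x e * G e x)"
      by (simp add: G_def H_def vdmp_chamber)
  qed
  also have "\<dots> = (\<Sum>e<k. \<integral>x. x e * G e x \<partial>?\<gamma>)" using iG by (intro Bochner_Integration.integral_sum) auto
  also have "\<dots> = (\<Sum>e<k. \<integral>x. G' e x \<partial>?\<gamma>)" using st by (intro sum.cong) auto
  also have "\<dots> = (\<integral>x. (\<Sum>e<k. G' e x) \<partial>?\<gamma>)" using iG by (intro Bochner_Integration.integral_sum[symmetric]) auto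
  also have "\<dots> = (\<integral>x. real r / 2 * (pmon k ((r - 1) # rs) x * vdmp k x) +
      (\<Sum>a<r. pmon k (a # (r - 1 - a) # rs) x * vdmp k x) / 2 +
      (\<Sum>m<length rs. real (rs ! m) * (pmon k (rs[m := r + rs ! m - 1]) x * vdmp k x)) \<partial>?\<gamma>)"
  proof (intro Bochner_Integration.integral_cong refl)
    fix x :: "nat \<Rightarrow> real"
    have "(\<Sum>e<k. H' e x) = real r * psum k (r - 1) x * pmon k rs x * vdm k x +
      (\<Sum>e<k. x e ^ r * dpmon k e rs x) * vdm k x + pmon k rs x * (\<Sum>e<k. x e ^ r * dvdm k e x)"
      unfolding H'_def psum_def by (simp add: sum.distrib sum_distrib_left sum_distrib_right mult_ac)
    also have "\<dots> = (real r / 2 * pmon k ((r - 1) # rs) x +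
      (\<Sum>a<r. pmon k (a # (r - 1 - a) # rs) x) / 2 +
      (\<Sum>m<length rs. real (rs ! m) * pmon k (rs[m := r + rs ! m - 1]) x)) * vdm k x"
      unfolding sum_dpmon sum_dvdm by (simp add: field_simps sum_distrib_left sum_distrib_right)
    finally have e: "(\<Sum>e<k. H' e x) = (real r / 2 * pmon k ((r - 1) # rs) x +
      (\<Sum>a<r. pmon k (a # (r - 1 - a) # rs) x) / 2 +
      (\<Sum>m<length rs. real (rs ! m) * pmon k (rs[m := r + rs ! m - 1]) x)) * vdm k x" .
    show "(\<Sum>e<k. G' e x) = real r / 2 * (pmon k ((r - 1) # rs) x * vdmp k x) +
      (\<Sum>a<r. pmon k (a # (r - 1 - a) # rs) x * vdmp k x) / 2 +
      (\<Sum>m<length rs. real (rs ! m) * (pmon k (rs[m := r + rs ! m - 1]) x * vdmp k x))"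
    proof (cases "chamber k x")
      case True
      then show ?thesis using e unfolding G'_def vdmp_chamber
        by (simp add: distrib_right sum_distrib_right mult.assoc del: pmon_simps)
    qed (simp add: G'_def vdmp_chamber)
  qed
  also have "\<dots> = loop_rhs \<Phi> r rs"
    unfolding loop_rhs_def \<Phi>_def using ip
    by (simp add: Bochner_Integration.integral_add Bochner_Integration.integral_sum del: pmon_simps)
  finally show ?thesis .
qed

section \<open>Loop equations for the Gaussian Orthogonal Ensemble\<close>

definition idx :: "nat \<Rightarrow> (nat \<times> nat) set" where
  "idx k = {(i, j). i \<le> j \<and> j < k}"

definition goe_sd :: "nat \<times> nat \<Rightarrow> real" where
  "goe_sd e = (if fst e = snd e then 1 else sqrt (1 / 2))"

lemma goe_sd_pos: "goe_sd e > 0" by (simp add: goe_sd_def)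

lemma finite_idx [simp]: "finite (idx k)"
  by (rule finite_subset[of _ "{..<k} \<times> {..<k}"]) (auto simp: idx_def)

lemma goe_space_eq: "goe_space k = gauss_prod (idx k) goe_sd"
  unfolding goe_space_def gauss_prod_def idx_def goe_sd_def by (simp add: case_prod_unfold)

text \<open>The matrix entries, read off from the independent ones on and above the diagonal.\<close>

definition ent :: "(nat \<times> nat \<Rightarrow> real) \<Rightarrow> nat \<Rightarrow> nat \<Rightarrow> real" where
  "ent x i j = x (min i j, max i j)"

lemma ent_sym: "ent x i j = ent x j i" by (simp add: ent_def min.commute max.commute)

text \<open>The entry at \<open>(i, j)\<close> of the \<open>r\<close>-th matrix power, as a polynomial in
  the independent entries.\<close>

fun pw :: "nat \<Rightarrow> (nat \<times> nat \<Rightarrow> real) \<Rightarrow> nat \<Rightarrow> nat \<Rightarrow> nat \<Rightarrow> real" where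
  "pw k x 0 i j = of_bool (i = j)"
| "pw k x (Suc r) i j = (\<Sum>l<k. pw k x r i l * ent x l j)"

definition trp :: "nat \<Rightarrow> nat \<Rightarrow> (nat \<times> nat \<Rightarrow> real) \<Rightarrow> real" where
  "trp k r x = (\<Sum>i<k. pw k x r i i)"

lemma sum_of_bool_left: fixes k :: nat shows "i < k \<Longrightarrow> (\<Sum>l<k. of_bool (i = l) * f l) = (f i :: real)"
proof -
  assume "i < k"
  moreover have "(\<Sum>l<k. of_bool (i = l) * f l) = (\<Sum>l<k. if l = i then f l else 0)" by (intro sum.cong) auto
  ultimately show ?thesis by simp
qed

lemma sum_of_bool_right: fixes k :: nat shows "i < k \<Longrightarrow> (\<Sum>l<k. f l * of_bool (l = i)) = (f i :: real)"
proof -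
  assume "i < k"
  moreover have "(\<Sum>l<k. f l * of_bool (l = i)) = (\<Sum>l<k. if l = i then f l else 0)" by (intro sum.cong) auto
  ultimately show ?thesis by simp
qed

lemma pw_add: "i < k \<Longrightarrow> j < k \<Longrightarrow> (\<Sum>l<k. pw k x b i l * pw k x c l j) = pw k x (b + c) i j"
proof (induction c arbitrary: j)
  case 0
  then show ?case by (simp add: sum_of_bool_right)
next
  case (Suc c)
  have "(\<Sum>l<k. pw k x b i l * pw k x (Suc c) l j) = (\<Sum>l<k. \<Sum>m<k. pw k x b i l * pw k x c l m * ent x m j)"
    by (simp add: sum_distrib_left mult.assoc)
  also have "\<dots> = (\<Sum>m<k. (\<Sum>l<k. pw k x b i l * pw k x c l m) * ent x m j)"
    by (subst sum.swap) (simp add: sum_distrib_right)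
  also have "\<dots> = (\<Sum>m<k. pw k x (b + c) i m * ent x m j)"
    using Suc by (intro sum.cong) auto
  finally show ?case by simp
qed

lemma pw_1: "i < k \<Longrightarrow> pw k x 1 i j = ent x i j"
  by (simp add: sum_of_bool_left)

lemma pw_sym: "i < k \<Longrightarrow> j < k \<Longrightarrow> pw k x r i j = pw k x r j i"
proof (induction r arbitrary: i j)
  case (Suc r)
  have "pw k x (Suc r) i j = (\<Sum>l<k. pw k x 1 j l * pw k x r l i)"
    using Suc by (auto simp: ent_sym[of x _ j] mult.commute pw_1 simp del: One_nat_def intro!: sum.cong)
  also have "\<dots> = pw k x (Suc r) j i" using pw_add[of j k i x 1 r] Suc.prems by simp
  finally show ?case .
qed auto

lemma trp_Suc: "trp k (Suc r) x = (\<Sum>i<k. \<Sum>j<k. ent x i j * pw k x r j i)"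
  unfolding trp_def pw.simps by (subst sum.swap) (simp add: mult.commute)

lemma trp_mult: "(\<Sum>i<k. \<Sum>j<k. pw k x b j i * pw k x c i j) = trp k (b + c) x"
proof -
  have "(\<Sum>i<k. \<Sum>j<k. pw k x b j i * pw k x c i j) = (\<Sum>j<k. \<Sum>i<k. pw k x b j i * pw k x c i j)"
    by (rule sum.swap)
  also have "\<dots> = trp k (b + c) x" unfolding trp_def by (intro sum.cong refl) (simp add: pw_add)
  finally show ?thesis .
qed

text \<open>The covariance of the entries at \<open>(i, j)\<close> and \<open>(l, m)\<close> in the
  ensemble.\<close>

definition kron :: "nat \<Rightarrow> nat \<Rightarrow> nat \<Rightarrow> nat \<Rightarrow> real" where
  "kron i j l m = (of_bool (l = i) * of_bool (m = j) + of_bool (l = j) * of_bool (m = i)) / 2"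

text \<open>The coordinate that carries the matrix entry at \<open>(i, j)\<close>.\<close>

definition dir :: "nat \<Rightarrow> nat \<Rightarrow> nat \<times> nat" where
  "dir i j = (min i j, max i j)"

lemma dir_idx: "i < k \<Longrightarrow> j < k \<Longrightarrow> dir i j \<in> idx k"
  by (auto simp: dir_def idx_def)

lemma ent_derivative:
  "((\<lambda>t. ent (x(dir i j := t)) l m) has_real_derivative kron i j l m / (goe_sd (dir i j))\<^sup>2) (at t)"
proof -
  have "((\<lambda>t. ent (x(dir i j := t)) l m) has_real_derivative of_bool (dir l m = dir i j)) (at t)"
    by (cases "dir l m = dir i j") (auto simp: ent_def dir_def)
  moreover have "kron i j l m / (goe_sd (dir i j))\<^sup>2 = of_bool (dir l m = dir i j)"
    by (auto simp: kron_def goe_sd_def dir_def min_def max_def power_divide of_bool_def)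
  ultimately show ?thesis by simp
qed

text \<open>The derivative in the coordinate of the entry at \<open>(i, j)\<close>, multiplied by the
  variance of that entry. With this normalisation diagonal and off-diagonal entries need no separate
  treatment.\<close>

fun dpw :: "nat \<Rightarrow> nat \<Rightarrow> nat \<Rightarrow> (nat \<times> nat \<Rightarrow> real) \<Rightarrow> nat \<Rightarrow> nat \<Rightarrow> nat \<Rightarrow> real" where
  "dpw k i j x 0 p q = 0"
| "dpw k i j x (Suc r) p q = (\<Sum>l<k. dpw k i j x r p l * ent x l q + pw k x r p l * kron i j l q)"

lemma pw_derivative:
  "((\<lambda>t. pw k (x(dir i j := t)) r p q) has_real_derivative
     dpw k i j (x(dir i j := t)) r p q / (goe_sd (dir i j))\<^sup>2) (at t)"
proof (induction r arbitrary: q)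
  case (Suc r)
  have "((\<lambda>t. pw k (x(dir i j := t)) (Suc r) p q) has_real_derivative
    (\<Sum>l<k. dpw k i j (x(dir i j := t)) r p l / (goe_sd (dir i j))\<^sup>2 * ent (x(dir i j := t)) l q +
      kron i j l q / (goe_sd (dir i j))\<^sup>2 * pw k (x(dir i j := t)) r p l)) (at t)"
    unfolding pw.simps by (intro DERIV_sum DERIV_mult Suc.IH ent_derivative)
  then show ?case
    by (simp add: sum_divide_distrib add_divide_distrib mult.commute del: fun_upd_apply pw.simps)
qed simp

lemma sum_kron:
  "i < k \<Longrightarrow> j < k \<Longrightarrow> (\<Sum>l<k. f l * kron i j l q) = (f i * of_bool (q = j) + f j * of_bool (q = i)) / 2"
proof -
  assume ij: "i < k" "j < k"
  have "f l * kron i j l q = (f l * of_bool (l = i)) * (of_bool (q = j) / 2) + (f l * of_bool (l = j)) * (of_bool (q = i) / 2)" for l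
    by (simp add: kron_def field_simps)
  then have "(\<Sum>l<k. f l * kron i j l q) =
    (\<Sum>l<k. f l * of_bool (l = i)) * (of_bool (q = j) / 2) + (\<Sum>l<k. f l * of_bool (l = j)) * (of_bool (q = i) / 2)"
    by (simp only: sum.distrib sum_distrib_right)
  then show ?thesis using ij by (simp only: sum_of_bool_right) (simp add: field_simps)
qed

text \<open>The Leibniz rule, where \<open>b\<close> is the number of factors in front of the differentiated
  one.\<close>

lemma dpw_eq:
  assumes "i < k" "j < k" "p < k"
  shows "q < k \<Longrightarrow> dpw k i j x r p q =
    (\<Sum>b<r. pw k x b p i * pw k x (r - 1 - b) j q + pw k x b p j * pw k x (r - 1 - b) i q) / 2"
proof (induction r arbitrary: q)
  case (Suc r)
  have "(\<Sum>l<k. dpw k i j x r p l * ent x l q) =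
    (\<Sum>l<k. \<Sum>b<r. (pw k x b p i * (pw k x (r - 1 - b) j l * ent x l q) + pw k x b p j * (pw k x (r - 1 - b) i l * ent x l q)) / 2)"
  proof (intro sum.cong refl)
    fix l assume "l \<in> {..<k}"
    then have "dpw k i j x r p l * ent x l q =
      (\<Sum>b<r. (pw k x b p i * pw k x (r - 1 - b) j l + pw k x b p j * pw k x (r - 1 - b) i l) / 2 * ent x l q)"
      using Suc.IH[of l] by (simp only: sum_distrib_right sum_divide_distrib lessThan_iff)
    also have "\<dots> = (\<Sum>b<r. (pw k x b p i * (pw k x (r - 1 - b) j l * ent x l q) + pw k x b p j * (pw k x (r - 1 - b) i l * ent x l q)) / 2)"
      by (intro sum.cong refl) (simp add: field_simps)
    finally show "dpw k i j x r p l * ent x l q =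
      (\<Sum>b<r. (pw k x b p i * (pw k x (r - 1 - b) j l * ent x l q) + pw k x b p j * (pw k x (r - 1 - b) i l * ent x l q)) / 2)" .
  qed
  also have "\<dots> = (\<Sum>b<r. \<Sum>l<k. (pw k x b p i * (pw k x (r - 1 - b) j l * ent x l q) + pw k x b p j * (pw k x (r - 1 - b) i l * ent x l q)) / 2)"
    by (rule sum.swap)
  also have "\<dots> = (\<Sum>b<r. (pw k x b p i * pw k x (Suc r - 1 - b) j q + pw k x b p j * pw k x (Suc r - 1 - b) i q) / 2)"
  proof (intro sum.cong refl)
    fix b assume "b \<in> {..<r}"
    then have "Suc r - 1 - b = Suc (r - 1 - b)" by auto
    then show "(\<Sum>l<k. (pw k x b p i * (pw k x (r - 1 - b) j l * ent x l q) + pw k x b p j * (pw k x (r - 1 - b) i l * ent x l q)) / 2) =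
      (pw k x b p i * pw k x (Suc r - 1 - b) j q + pw k x b p j * pw k x (Suc r - 1 - b) i q) / 2"
      by (simp add: sum.distrib sum_distrib_left flip: sum_divide_distrib)
  qed
  finally have 1: "(\<Sum>l<k. dpw k i j x r p l * ent x l q) =
    (\<Sum>b<r. (pw k x b p i * pw k x (Suc r - 1 - b) j q + pw k x b p j * pw k x (Suc r - 1 - b) i q) / 2)" .
  have 2: "(\<Sum>l<k. pw k x r p l * kron i j l q) = (pw k x r p i * pw k x 0 j q + pw k x r p j * pw k x 0 i q) / 2"
    using assms by (subst sum_kron) auto
  have 3: "(\<Sum>b<Suc r. f b) / 2 = (\<Sum>b<r. f b / 2) + f r / 2" for f :: "nat \<Rightarrow> real"
    by (simp only: sum.lessThan_Suc add_divide_distrib sum_divide_distrib)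
  show ?case unfolding dpw.simps sum.distrib[of _ _ "{..<k}"] 1 2 3
    by (simp only: diff_Suc_1 diff_self_eq_0)
qed simp

definition tmon :: "nat \<Rightarrow> nat list \<Rightarrow> (nat \<times> nat \<Rightarrow> real) \<Rightarrow> real" where
  "tmon k rs x = prod_list (map (\<lambda>r. trp k r x) rs)"

lemma tmon_simps [simp]: "tmon k [] x = 1" "tmon k (r # rs) x = trp k r x * tmon k rs x"
  by (simp_all add: tmon_def)

definition dtr :: "nat \<Rightarrow> nat \<Rightarrow> nat \<Rightarrow> nat \<Rightarrow> (nat \<times> nat \<Rightarrow> real) \<Rightarrow> real" where
  "dtr k i j s x = (\<Sum>p<k. dpw k i j x s p p)"

text \<open>Under the trace the factors rotate, so all \<open>s\<close> positions of the differentiated factor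
  contribute the same.\<close>

lemma dtr_eq:
  assumes ij: "i < k" "j < k"
  shows "dtr k i j s x = real s * pw k x (s - 1) i j"
proof -
  have "dtr k i j s x = (\<Sum>p<k. \<Sum>b<s. (pw k x b p i * pw k x (s - 1 - b) j p + pw k x b p j * pw k x (s - 1 - b) i p) / 2)"
    unfolding dtr_def using ij by (intro sum.cong refl) (simp add: dpw_eq flip: sum_divide_distrib)
  also have "\<dots> = (\<Sum>b<s. \<Sum>p<k. (pw k x b p i * pw k x (s - 1 - b) j p + pw k x b p j * pw k x (s - 1 - b) i p) / 2)"
    by (rule sum.swap)
  also have "\<dots> = (\<Sum>b<s. pw k x (s - 1) i j)"
  proof (intro sum.cong refl)
    fix b assume b: "b \<in> {..<s}"
    have c: "(\<Sum>p<k. pw k x b p i * pw k x (s - 1 - b) j p) = pw k x (s - 1) i j" if "i < k" "j < k" for i j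
    proof -
      have "(\<Sum>p<k. pw k x b p i * pw k x (s - 1 - b) j p) = (\<Sum>p<k. pw k x b i p * pw k x (s - 1 - b) p j)"
        using that by (intro sum.cong refl) (simp add: pw_sym)
      then show ?thesis using pw_add[OF that, of x b "s - 1 - b"] b by simp
    qed
    have "(\<Sum>p<k. (pw k x b p i * pw k x (s - 1 - b) j p + pw k x b p j * pw k x (s - 1 - b) i p) / 2) =
      (pw k x (s - 1) i j + pw k x (s - 1) j i) / 2"
      using c[OF ij] c[OF ij(2,1)] by (simp add: sum.distrib flip: sum_divide_distrib)
    then show "(\<Sum>p<k. (pw k x b p i * pw k x (s - 1 - b) j p + pw k x b p j * pw k x (s - 1 - b) i p) / 2) = pw k x (s - 1) i j"
      using pw_sym[OF ij, of x "s - 1"] by simp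
  qed
  finally show ?thesis by simp
qed

fun dtmon :: "nat \<Rightarrow> nat \<Rightarrow> nat \<Rightarrow> nat list \<Rightarrow> (nat \<times> nat \<Rightarrow> real) \<Rightarrow> real" where
  "dtmon k i j [] x = 0"
| "dtmon k i j (s # rs) x = dtr k i j s x * tmon k rs x + trp k s x * dtmon k i j rs x"

lemma tmon_derivative:
  "((\<lambda>t. tmon k rs (x(dir i j := t))) has_real_derivative
     dtmon k i j rs (x(dir i j := t)) / (goe_sd (dir i j))\<^sup>2) (at t)"
proof (induction rs)
  case (Cons s rs)
  have "((\<lambda>t. trp k s (x(dir i j := t))) has_real_derivative dtr k i j s (x(dir i j := t)) / (goe_sd (dir i j))\<^sup>2) (at t)"
    unfolding trp_def dtr_def sum_divide_distrib by (intro DERIV_sum pw_derivative)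
  from DERIV_mult[OF this Cons.IH]
  have "((\<lambda>t. trp k s (x(dir i j := t)) * tmon k rs (x(dir i j := t))) has_real_derivative
     dtmon k i j (s # rs) (x(dir i j := t)) / (goe_sd (dir i j))\<^sup>2) (at t)"
    by (rule DERIV_cong) (simp add: algebra_simps add_divide_distrib del: fun_upd_apply)
  then show ?case by (simp only: tmon_simps)
qed simp

lemma tame_ent: "i < k \<Longrightarrow> j < k \<Longrightarrow> tame (idx k) (\<lambda>x. ent x i j)"
  unfolding ent_def by (intro tame_coord finite_idx) (auto simp: idx_def)

lemma tame_pw: "i < k \<Longrightarrow> j < k \<Longrightarrow> tame (idx k) (\<lambda>x. pw k x r i j)"
  by (induction r arbitrary: j) (auto intro!: tame_intros tame_ent)

lemma tame_dpw: "p < k \<Longrightarrow> q < k \<Longrightarrow> tame (idx k) (\<lambda>x. dpw k i j x r p q)"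
  by (induction r arbitrary: q) (auto intro!: tame_intros tame_ent tame_pw)

lemma tame_trp: "tame (idx k) (trp k r)"
  unfolding trp_def[abs_def] by (intro tame_sum tame_pw) auto

lemma tame_tmon: "tame (idx k) (tmon k rs)"
  unfolding tmon_def[abs_def] by (intro tame_prod_list tame_trp)

lemma tame_dtmon: "tame (idx k) (dtmon k i j rs)"
proof (induction rs)
  case Nil
  have "dtmon k i j [] = (\<lambda>_. 0)" by (rule ext) simp
  then show ?case using tame_const by simp
next
  case (Cons s rs)
  have "dtmon k i j (s # rs) = (\<lambda>x. dtr k i j s x * tmon k rs x + trp k s x * dtmon k i j rs x)"
    by (rule ext) simp
  then show ?case using Cons unfolding dtr_def by (auto intro!: tame_intros tame_tmon tame_trp tame_dpw)
qed

lemma sum_dtmon: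
  "(\<Sum>i<k. \<Sum>j<k. pw k x r j i * dtmon k i j rs x) =
    (\<Sum>m<length rs. real (rs ! m) * tmon k (rs[m := r + rs ! m - 1]) x)"
proof (induction rs)
  case (Cons s rs)
  have s: "(\<Sum>i<k. \<Sum>j<k. pw k x r j i * dtr k i j s x) = real s * trp k (r + s - 1) x"
  proof (cases "s = 0")
    case False
    then have e: "r + (s - 1) = r + s - 1" by simp
    have "(\<Sum>i<k. \<Sum>j<k. pw k x r j i * dtr k i j s x) = (\<Sum>i<k. \<Sum>j<k. real s * (pw k x r j i * pw k x (s - 1) i j))"
      by (intro sum.cong refl) (simp add: dtr_eq)
    also have "\<dots> = real s * trp k (r + (s - 1)) x" by (simp add: trp_mult flip: sum_distrib_left)
    finally show ?thesis unfolding e .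
  qed (simp add: dtr_eq)
  have "(\<Sum>i<k. \<Sum>j<k. pw k x r j i * dtmon k i j (s # rs) x) =
      (\<Sum>i<k. \<Sum>j<k. pw k x r j i * dtr k i j s x) * tmon k rs x + trp k s x * (\<Sum>i<k. \<Sum>j<k. pw k x r j i * dtmon k i j rs x)"
    by (simp add: sum_distrib_left sum_distrib_right sum.distrib algebra_simps)
  also have "\<dots> = real s * tmon k ((r + s - 1) # rs) x +
      (\<Sum>m<length rs. real (rs ! m) * tmon k (s # rs[m := r + rs ! m - 1]) x)"
    unfolding s Cons.IH by (simp add: sum_distrib_left mult_ac)
  also have "\<dots> = (\<Sum>m<length (s # rs). real ((s # rs) ! m) * tmon k ((s # rs)[m := r + (s # rs) ! m - 1]) x)"
    unfolding length_Cons sum.lessThan_Suc_shift by simp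
  finally show ?case .
qed simp

text \<open>Write the first trace as a sum of \<open>A\<^sub>i\<^sub>j (A ^ r)\<^sub>j\<^sub>i\<close> and
  integrate by parts in \<open>A\<^sub>i\<^sub>j\<close>. The derivative of \<open>A ^ r\<close> gives the
  first two terms of the loop equation, those of the other traces give the third.\<close>

lemma loop_goe:
  fixes k :: nat
  defines "\<Phi> \<equiv> \<lambda>rs. \<integral>x. tmon k rs x \<partial>goe_space k"
  shows "\<Phi> (Suc r # rs) = loop_rhs \<Phi> r rs"
proof -
  let ?g = "goe_space k"
  define G where "G i j x = pw k x r j i * tmon k rs x" for i j and x :: "nat \<times> nat \<Rightarrow> real"
  define G' where "G' i j x = dpw k i j x r j i * tmon k rs x + pw k x r j i * dtmon k i j rs x" for i j and x :: "nat \<times> nat \<Rightarrow> real"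
  have int: "integrable ?g f" if "tame (idx k) f" for f
    unfolding goe_space_eq using that by (intro integrable_tame goe_sd_pos) auto
  have tG: "tame (idx k) (G i j)" and tG': "tame (idx k) (G' i j)" if "i < k" "j < k" for i j
    unfolding G_def[abs_def] G'_def[abs_def] using that
    by (auto intro!: tame_add tame_mult tame_pw tame_tmon tame_dpw tame_dtmon)
  have st: "(\<integral>x. ent x i j * G i j x \<partial>?g) = (\<integral>x. G' i j x \<partial>?g)" if ij: "i < k" "j < k" for i j
  proof -
    define s where "s = (goe_sd (dir i j))\<^sup>2"
    have s: "s > 0" using goe_sd_pos[of "dir i j"] by (simp add: s_def)
    have d: "((\<lambda>t. G i j (x(dir i j := t))) has_real_derivative (1 / s) * G' i j (x(dir i j := t))) (at t)" for x t
      unfolding G_def by (rule DERIV_cong[OF DERIV_mult[OF pw_derivative tmon_derivative]])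
        (simp add: G'_def s_def add_divide_distrib mult.commute del: fun_upd_apply)
    have "(\<integral>x. x (dir i j) * G i j x \<partial>gauss_prod (idx k) goe_sd) =
      (goe_sd (dir i j))\<^sup>2 * (\<integral>x. (1 / s) * G' i j x \<partial>gauss_prod (idx k) goe_sd)"
    proof (rule stein[OF finite_idx dir_idx[OF ij] goe_sd_pos tG[OF ij] tame_cmult[OF tG'[OF ij]]])
      show "continuous_on UNIV (\<lambda>t. G i j (x(dir i j := t)))" for x
        using d DERIV_isCont by (intro continuous_at_imp_continuous_on) blast
      show "\<exists>S. finite S \<and> (\<forall>t. t \<notin> S \<longrightarrow> ((\<lambda>t. G i j (x(dir i j := t))) has_real_derivative (1 / s) * G' i j (x(dir i j := t))) (at t))" for x
        using d by (intro exI[of _ "{}"]) auto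
    qed
    then show ?thesis using s unfolding goe_space_eq ent_def dir_def[symmetric] s_def[symmetric] by simp
  qed
  have iG: "integrable ?g (\<lambda>x. ent x i j * G i j x)" "integrable ?g (G' i j)" if "i < k" "j < k" for i j
    using that by (auto intro!: int tame_mult tame_ent tG tG')
  have im: "integrable ?g (tmon k ss)" for ss by (intro int tame_tmon)
  have "\<Phi> (Suc r # rs) = (\<integral>x. (\<Sum>i<k. \<Sum>j<k. ent x i j * G i j x) \<partial>?g)"
    unfolding \<Phi>_def tmon_simps trp_Suc G_def by (simp add: sum_distrib_right mult.assoc)
  also have "\<dots> = (\<Sum>i<k. \<Sum>j<k. \<integral>x. ent x i j * G i j x \<partial>?g)"
    using iG by (subst Bochner_Integration.integral_sum) (auto intro!: sum.cong Bochner_Integration.integral_sum Bochner_Integration.integrable_sum)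
  also have "\<dots> = (\<Sum>i<k. \<Sum>j<k. \<integral>x. G' i j x \<partial>?g)" using st by (intro sum.cong) auto
  also have "\<dots> = (\<integral>x. (\<Sum>i<k. \<Sum>j<k. G' i j x) \<partial>?g)"
    using iG by (subst Bochner_Integration.integral_sum) (auto intro!: sum.cong Bochner_Integration.integral_sum[symmetric] Bochner_Integration.integrable_sum)
  also have "\<dots> = (\<integral>x. real r / 2 * tmon k ((r - 1) # rs) x + (\<Sum>a<r. tmon k (a # (r - 1 - a) # rs) x) / 2 +
      (\<Sum>m<length rs. real (rs ! m) * tmon k (rs[m := r + rs ! m - 1]) x) \<partial>?g)"
  proof (intro Bochner_Integration.integral_cong refl)
    fix x :: "nat \<times> nat \<Rightarrow> real"
    have "(\<Sum>i<k. \<Sum>j<k. dpw k i j x r j i) =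
      (\<Sum>i<k. \<Sum>j<k. \<Sum>b<r. (pw k x b j i * pw k x (r - 1 - b) j i + pw k x b j j * pw k x (r - 1 - b) i i) / 2)"
      by (intro sum.cong refl) (simp add: dpw_eq flip: sum_divide_distrib)
    also have "\<dots> = (\<Sum>i<k. \<Sum>b<r. \<Sum>j<k. (pw k x b j i * pw k x (r - 1 - b) j i + pw k x b j j * pw k x (r - 1 - b) i i) / 2)"
      by (intro sum.cong refl sum.swap)
    also have "\<dots> = (\<Sum>b<r. \<Sum>i<k. \<Sum>j<k. (pw k x b j i * pw k x (r - 1 - b) j i + pw k x b j j * pw k x (r - 1 - b) i i) / 2)"
      by (rule sum.swap)
    also have "\<dots> = (\<Sum>b<r. (trp k (r - 1) x + trp k b x * trp k (r - 1 - b) x) / 2)"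
    proof (intro sum.cong refl)
      fix b assume b: "b \<in> {..<r}"
      have "(\<Sum>i<k. \<Sum>j<k. pw k x b j i * pw k x (r - 1 - b) j i) = (\<Sum>i<k. \<Sum>j<k. pw k x b j i * pw k x (r - 1 - b) i j)"
        by (intro sum.cong refl) (simp add: pw_sym)
      also have "\<dots> = trp k (r - 1) x" using trp_mult[of k x b "r - 1 - b"] b by simp
      finally have 1: "(\<Sum>i<k. \<Sum>j<k. pw k x b j i * pw k x (r - 1 - b) j i) = trp k (r - 1) x" .
      have 2: "(\<Sum>i<k. \<Sum>j<k. pw k x b j j * pw k x (r - 1 - b) i i) = trp k b x * trp k (r - 1 - b) x"
        unfolding trp_def sum_product by (rule sum.swap)
      show "(\<Sum>i<k. \<Sum>j<k. (pw k x b j i * pw k x (r - 1 - b) j i + pw k x b j j * pw k x (r - 1 - b) i i) / 2) =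
        (trp k (r - 1) x + trp k b x * trp k (r - 1 - b) x) / 2"
        unfolding sum_divide_distrib[symmetric] sum.distrib 1 2 ..
    qed
    finally have d: "(\<Sum>i<k. \<Sum>j<k. dpw k i j x r j i) = real r / 2 * trp k (r - 1) x + (\<Sum>b<r. trp k b x * trp k (r - 1 - b) x) / 2"
      by (simp add: sum.distrib add_divide_distrib sum_divide_distrib)
    have "(\<Sum>i<k. \<Sum>j<k. G' i j x) = (\<Sum>i<k. \<Sum>j<k. dpw k i j x r j i) * tmon k rs x + (\<Sum>i<k. \<Sum>j<k. pw k x r j i * dtmon k i j rs x)"
      unfolding G'_def by (simp add: sum.distrib sum_distrib_right)
    then show "(\<Sum>i<k. \<Sum>j<k. G' i j x) = real r / 2 * tmon k ((r - 1) # rs) x + (\<Sum>a<r. tmon k (a # (r - 1 - a) # rs) x) / 2 +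
      (\<Sum>m<length rs. real (rs ! m) * tmon k (rs[m := r + rs ! m - 1]) x)"
      unfolding d sum_dtmon by (simp add: algebra_simps sum_distrib_left sum_distrib_right)
  qed
  also have "\<dots> = loop_rhs \<Phi> r rs"
    unfolding loop_rhs_def \<Phi>_def using im
    by (simp add: Bochner_Integration.integral_add Bochner_Integration.integral_sum del: tmon_simps)
  finally show ?thesis .
qed

section \<open>Equality of moments and of damped moments\<close>

abbreviation gauss :: "nat \<Rightarrow> (nat \<Rightarrow> real) measure" where
  "gauss k \<equiv> gauss_prod {..<k} (\<lambda>_. 1)"

definition Zv :: "nat \<Rightarrow> real" where
  "Zv k = (\<integral>x. vdmp k x \<partial>gauss k)"

lemma vdmp_nonneg: "vdmp k x \<ge> 0"
  unfolding vdmp_def vdm_def by (auto intro!: prod_nonneg)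

lemma integrable_gauss: "tame {..<k} f \<Longrightarrow> integrable (gauss k) f"
  by (intro integrable_tame) auto

text \<open>The Vandermonde product is positive on a product of disjoint decreasing intervals, which has
  positive Gaussian measure.\<close>

lemma Zv_pos: "Zv k > 0"
proof -
  let ?N = "\<lambda>_::nat. density lborel (normal_density 0 1)"
  interpret product_sigma_finite ?N
    by (intro product_sigma_finite.intro prob_space_imp_sigma_finite prob_space_normal_density) simp
  define B where "B = Pi\<^sub>E {..<k} (\<lambda>i. {real (k - i) .. real (k - i) + 1 / 2})"
  have Bpos: "vdmp k x > 0" if "x \<in> B" for x
  proof -
    have "x j < x i" if "i < j" "j < k" for i j
    proof -
      have "real (k - i) \<le> x i" "x j \<le> real (k - j) + 1 / 2"
        using \<open>x \<in> B\<close> that by (auto simp: B_def PiE_iff)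
      moreover have "real (k - j) + 1 \<le> real (k - i)" using that by linarith
      ultimately show ?thesis by linarith
    qed
    then show ?thesis unfolding vdmp_def vdm_def by (auto intro!: prod_pos simp: less_imp_le)
  qed
  have e: "emeasure (density lborel (normal_density 0 1)) {a..a + 1 / 2} \<noteq> 0" for a :: real
  proof
    assume "emeasure (density lborel (normal_density 0 1)) {a..a + 1 / 2} = 0"
    then have "{a..a + 1 / 2} \<in> null_sets (density lborel (normal_density 0 1))" by auto
    then have "AE x in lborel. x \<in> {a..a + 1 / 2} \<longrightarrow> ennreal (normal_density 0 1 x) = 0"
      by (subst (asm) null_sets_density_iff) auto
    then have "AE x in lborel. x \<notin> {a..a + 1 / 2}"
    proof eventually_elim
      case (elim x)
      have "ennreal (normal_density 0 1 x) \<noteq> 0" using normal_density_pos[of 1 0 x] by simp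
      then show ?case using elim by blast
    qed
    then have "emeasure lborel {a..a + 1 / 2} = 0" by (subst (asm) AE_iff_null_sets[symmetric]) auto
    then show False by simp
  qed
  have "emeasure (gauss k) B = (\<Prod>i<k. emeasure (density lborel (normal_density 0 1)) {real (k - i) .. real (k - i) + 1 / 2})"
    unfolding gauss_prod_def B_def by (rule emeasure_PiM) auto
  then have eB: "emeasure (gauss k) B \<noteq> 0" using e by (simp add: prod_zero_iff)
  have int: "integrable (gauss k) (vdmp k)" by (intro integrable_gauss tame_vdmp)
  have "Zv k \<noteq> 0"
  proof
    assume "Zv k = 0"
    then have "AE x in gauss k. vdmp k x = 0"
      using integral_nonneg_eq_0_iff_AE[OF int] vdmp_nonneg by (auto simp: Zv_def)
    then have "AE x in gauss k. x \<notin> B" by eventually_elim (use Bpos in force)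
    moreover have "B \<in> sets (gauss k)" unfolding gauss_prod_def B_def by (intro sets_PiM_I_finite) auto
    ultimately show False using eB by (subst (asm) AE_iff_null_sets[symmetric]) auto
  qed
  moreover have "Zv k \<ge> 0" unfolding Zv_def by (intro integral_nonneg_AE) (simp add: vdmp_nonneg)
  ultimately show ?thesis by simp
qed

text \<open>The partial sums are dominated by \<open>\<bar>f\<bar> exp g\<close>.\<close>

lemma exp_series_integral:
  fixes f g :: "'a \<Rightarrow> real"
  assumes m: "f \<in> borel_measurable M" "g \<in> borel_measurable M" and g: "\<And>x. g x \<ge> 0"
    and i: "integrable M (\<lambda>x. f x * exp (g x))"
  shows "(\<lambda>j. (- 1) ^ j / fact j * (\<integral>x. f x * g x ^ j \<partial>M)) sums (\<integral>x. f x * exp (- g x) \<partial>M)"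
proof -
  define F where "F j x = f x * (- g x) ^ j / fact j" for j x
  have s: "(\<lambda>j. F j x) sums (f x * exp (- g x))" for x
    using sums_mult[OF exp_converges[of "- g x"], of "f x"] by (simp add: F_def divide_inverse mult_ac)
  have sn: "(\<lambda>j. norm (F j x)) sums (\<bar>f x\<bar> * exp (g x))" for x
    using sums_mult[OF exp_converges[of "g x"], of "\<bar>f x\<bar>"] g[of x]
    by (simp add: F_def divide_inverse mult_ac abs_mult power_abs)
  have ib: "integrable M (\<lambda>x. \<bar>f x\<bar> * exp (g x))" using integrable_abs[OF i] by (simp add: abs_mult)
  have le: "(\<Sum>j<n. norm (F j x)) \<le> \<bar>f x\<bar> * exp (g x)" for n x
    using sum_le_suminf[OF sums_summable[OF sn[of x]], of "{..<n}"] sums_unique[OF sn[of x]] by simp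
  have iF: "integrable M (F j)" for j
  proof (rule Bochner_Integration.integrable_bound[OF ib])
    show "F j \<in> borel_measurable M" unfolding F_def[abs_def] using m by measurable
    have "norm (F j x) \<le> \<bar>f x\<bar> * exp (g x)" for x
    proof -
      have "0 \<le> (\<Sum>i<j. norm (F i x))" by (rule sum_nonneg) simp
      then show ?thesis using le[where n = "Suc j" and x = x] unfolding sum.lessThan_Suc by linarith
    qed
    then show "AE x in M. norm (F j x) \<le> norm (\<bar>f x\<bar> * exp (g x))" by (simp add: abs_mult)
  qed
  have "(\<lambda>j. integral\<^sup>L M (F j)) sums (\<integral>x. (\<Sum>j. F j x) \<partial>M)"
  proof (rule sums_integral[OF iF])
    show "AE x in M. summable (\<lambda>j. norm (F j x))" using sn by (auto intro: sums_summable)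
    show "summable (\<lambda>j. \<integral>x. norm (F j x) \<partial>M)"
    proof (rule summableI_nonneg_bounded)
      fix n
      have "(\<Sum>j<n. \<integral>x. norm (F j x) \<partial>M) = (\<integral>x. (\<Sum>j<n. norm (F j x)) \<partial>M)"
        using iF by (intro Bochner_Integration.integral_sum[symmetric]) auto
      also have "\<dots> \<le> (\<integral>x. \<bar>f x\<bar> * exp (g x) \<partial>M)"
        using iF le by (intro integral_mono ib Bochner_Integration.integrable_sum) auto
      finally show "(\<Sum>j<n. \<integral>x. norm (F j x) \<partial>M) \<le> (\<integral>x. \<bar>f x\<bar> * exp (g x) \<partial>M)" .
    qed simp
  qed
  also have "(\<lambda>x. \<Sum>j. F j x) = (\<lambda>x. f x * exp (- g x))" by (rule ext) (rule sums_unique[OF s, symmetric])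
  also have "(\<lambda>j. integral\<^sup>L M (F j)) = (\<lambda>j. (- 1) ^ j / fact j * (\<integral>x. f x * g x ^ j \<partial>M))"
  proof
    fix j
    have "F j = (\<lambda>x. (- 1) ^ j / fact j * (f x * g x ^ j))"
      by (rule ext) (simp add: F_def power_minus[of "g _"] mult_ac)
    then show "integral\<^sup>L M (F j) = (- 1) ^ j / fact j * (\<integral>x. f x * g x ^ j \<partial>M)" by simp
  qed
  finally show ?thesis .
qed

text \<open>This is, up to the factor \<open>- 1 / 2\<close>, the exponent of the Gaussian density.\<close>

lemma trp_2: "trp k 2 x = (\<Sum>e\<in>idx k. (x e)\<^sup>2 / (goe_sd e)\<^sup>2)"
proof -
  have "trp k 2 x = (\<Sum>i<k. \<Sum>j<k. ent x i j * ent x j i)"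
    using trp_Suc[of k 1 x] by (simp add: pw_1 numeral_2_eq_2 del: One_nat_def pw.simps)
  also have "\<dots> = (\<Sum>(i, j)\<in>{..<k} \<times> {..<k}. (ent x i j)\<^sup>2)"
    by (simp add: ent_sym[of x _ ] sum.cartesian_product power2_eq_square ent_def min.commute max.commute)
  also have "\<dots> = (\<Sum>e\<in>idx k. \<Sum>p | p \<in> {..<k} \<times> {..<k} \<and> dir (fst p) (snd p) = e. (ent x (fst p) (snd p))\<^sup>2)"
  proof -
    have "(\<lambda>p. dir (fst p) (snd p)) ` ({..<k} \<times> {..<k}) \<subseteq> idx k" using dir_idx by auto
    from sum.group[OF _ finite_idx this, of "\<lambda>p. (ent x (fst p) (snd p))\<^sup>2"]
    show ?thesis by (simp add: case_prod_unfold)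
  qed
  also have "\<dots> = (\<Sum>e\<in>idx k. \<Sum>p | p \<in> {..<k} \<times> {..<k} \<and> dir (fst p) (snd p) = e. (x e)\<^sup>2)"
    by (intro sum.cong refl) (auto simp: ent_def dir_def)
  also have "\<dots> = (\<Sum>e\<in>idx k. (x e)\<^sup>2 / (goe_sd e)\<^sup>2)"
  proof (intro sum.cong refl)
    fix e assume e: "e \<in> idx k"
    obtain i j where ij: "e = (i, j)" "i \<le> j" "j < k" using e by (auto simp: idx_def)
    have "{p. p \<in> {..<k} \<times> {..<k} \<and> dir (fst p) (snd p) = e} = {(i, j), (j, i)}"
      using ij by (auto simp: dir_def min_def max_def split: if_splits)
    then show "(\<Sum>p | p \<in> {..<k} \<times> {..<k} \<and> dir (fst p) (snd p) = e. (x e)\<^sup>2) = (x e)\<^sup>2 / (goe_sd e)\<^sup>2"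
      using ij by (cases "i = j") (auto simp: goe_sd_def power_divide)
  qed
  finally show ?thesis .
qed

lemma integrable_tmon_exp:
  assumes "tame (idx k) f" "c \<le> 1 / 4"
  shows "integrable (goe_space k) (\<lambda>x. f x * exp (c * trp k 2 x))"
proof -
  have "integrable (gauss_prod (idx k) goe_sd) (\<lambda>x. f x * exp (\<Sum>e\<in>idx k. c / (goe_sd e)\<^sup>2 * (x e)\<^sup>2))"
    by (intro integrable_tame_exp goe_sd_pos assms finite_idx)
       (use assms(2) goe_sd_pos in \<open>auto simp: less_imp_neq[THEN not_sym]\<close>)
  then show ?thesis unfolding goe_space_eq trp_2 by (simp add: sum_distrib_left)
qed

lemma integrable_pmon_exp:
  assumes "tame {..<k} f" "c \<le> 1 / 4"
  shows "integrable (gauss k) (\<lambda>x. f x * exp (c * psum k 2 x))"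
  using integrable_tame_exp[OF _ _ assms(1), of "\<lambda>_. 1" "\<lambda>_. c"] assms(2)
  by (simp add: psum_def sum_distrib_left)

text \<open>Both sides solve the loop equations and agree on the empty product.\<close>

lemma goe_moments: "(\<integral>x. tmon k rs x \<partial>goe_space k) = (\<integral>x. pmon k rs x * vdmp k x \<partial>gauss k) / Zv k"
proof (rule loop_unique)
  show "(\<integral>x. tmon k [] x \<partial>goe_space k) = (\<integral>x. pmon k [] x * vdmp k x \<partial>gauss k) / Zv k"
    using Zv_pos[of k] prob_space.prob_space[OF prob_space_goe_space] by (simp add: Zv_def)
  show "(\<integral>x. tmon k (0 # rs) x \<partial>goe_space k) = real k * (\<integral>x. tmon k rs x \<partial>goe_space k)" for rs
    by (simp add: trp_def)
  show "(\<integral>x. pmon k (0 # rs) x * vdmp k x \<partial>gauss k) / Zv k = real k * ((\<integral>x. pmon k rs x * vdmp k x \<partial>gauss k) / Zv k)" for rs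
    by (simp add: psum_0 mult.assoc)
  show "(\<integral>x. tmon k (as @ b # bs) x \<partial>goe_space k) = (\<integral>x. tmon k (b # as @ bs) x \<partial>goe_space k)" for as b bs
    by (simp add: tmon_def mult.left_commute)
  show "(\<integral>x. pmon k (as @ b # bs) x * vdmp k x \<partial>gauss k) / Zv k = (\<integral>x. pmon k (b # as @ bs) x * vdmp k x \<partial>gauss k) / Zv k" for as b bs
    by (simp only: pmon_perm)
  show "(\<integral>x. tmon k (Suc r # rs) x \<partial>goe_space k) = loop_rhs (\<lambda>rs. \<integral>x. tmon k rs x \<partial>goe_space k) r rs" for r rs
    by (rule loop_goe)
  show "(\<integral>x. pmon k (Suc r # rs) x * vdmp k x \<partial>gauss k) / Zv k =
    loop_rhs (\<lambda>rs. (\<integral>x. pmon k rs x * vdmp k x \<partial>gauss k) / Zv k) r rs" for r rs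
    unfolding loop_vandermonde loop_rhs_def by (simp add: add_divide_distrib sum_divide_distrib mult.commute[of 2])
qed

lemma tmon_replicate: "tmon k (replicate j r @ rs) x = trp k r x ^ j * tmon k rs x"
  by (induction j) (simp_all add: mult.assoc)

lemma pmon_replicate: "pmon k (replicate j r @ rs) x = psum k r x ^ j * pmon k rs x"
  by (induction j) (simp_all add: mult.assoc)

lemma trp_2_nonneg: "trp k 2 x \<ge> 0" unfolding trp_2 by (intro sum_nonneg) auto
lemma psum_2_nonneg: "psum k 2 x \<ge> 0" unfolding psum_def by (intro sum_nonneg) auto

text \<open>The damping factor is expanded into its power series, whose terms are moments. It is introduced
  one quarter at a time: the series of \<open>exp (- p\<^sub>2 / 4)\<close> is dominated by
  \<open>exp (p\<^sub>2 / 4)\<close>, which is integrable, while \<open>exp (m p\<^sub>2 / 4)\<close>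
  is not for \<open>m \<ge> 2\<close>.\<close>

lemma goe_exp_moments:
  "(\<integral>x. tmon k rs x * exp (- (real m / 4) * trp k 2 x) \<partial>goe_space k) =
    (\<integral>x. pmon k rs x * exp (- (real m / 4) * psum k 2 x) * vdmp k x \<partial>gauss k) / Zv k"
proof (induction m arbitrary: rs)
  case 0
  then show ?case by (simp add: goe_moments)
next
  case (Suc m)
  \<comment> \<open>The exponent that is left after multiplying the factor present so far with the majorant.\<close>
  define c where "c = 1 / 4 - real m / 4"
  have c: "c \<le> 1 / 4" by (simp add: c_def)
  have A: "(\<lambda>j. (- 1) ^ j / fact j * (\<integral>x. (tmon k rs x * exp (- (real m / 4) * trp k 2 x)) * (trp k 2 x / 4) ^ j \<partial>goe_space k))
    sums (\<integral>x. (tmon k rs x * exp (- (real m / 4) * trp k 2 x)) * exp (- (trp k 2 x / 4)) \<partial>goe_space k)"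
  proof (rule exp_series_integral)
    show "(\<lambda>x. tmon k rs x * exp (- (real m / 4) * trp k 2 x)) \<in> borel_measurable (goe_space k)"
      "(\<lambda>x. trp k 2 x / 4) \<in> borel_measurable (goe_space k)"
      unfolding goe_space_eq measurable_gauss_prod using tame_measurable[OF tame_tmon] tame_measurable[OF tame_trp] by measurable
    show "integrable (goe_space k) (\<lambda>x. tmon k rs x * exp (- (real m / 4) * trp k 2 x) * exp (trp k 2 x / 4))"
      using integrable_tmon_exp[OF tame_tmon c] by (simp add: c_def mult.assoc mult_exp_exp algebra_simps)
  qed (simp add: trp_2_nonneg)
  have B: "(\<lambda>j. (- 1) ^ j / fact j * (\<integral>x. (pmon k rs x * vdmp k x * exp (- (real m / 4) * psum k 2 x)) * (psum k 2 x / 4) ^ j \<partial>gauss k))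
    sums (\<integral>x. (pmon k rs x * vdmp k x * exp (- (real m / 4) * psum k 2 x)) * exp (- (psum k 2 x / 4)) \<partial>gauss k)"
  proof (rule exp_series_integral)
    show "(\<lambda>x. pmon k rs x * vdmp k x * exp (- (real m / 4) * psum k 2 x)) \<in> borel_measurable (gauss k)"
      "(\<lambda>x. psum k 2 x / 4) \<in> borel_measurable (gauss k)"
      unfolding measurable_gauss_prod using tame_measurable[OF tame_pmon] tame_measurable[OF tame_psum] tame_measurable[OF tame_vdmp] by measurable
    show "integrable (gauss k) (\<lambda>x. pmon k rs x * vdmp k x * exp (- (real m / 4) * psum k 2 x) * exp (psum k 2 x / 4))"
      using integrable_pmon_exp[OF tame_mult[OF tame_pmon tame_vdmp] c] by (simp add: c_def mult.assoc mult_exp_exp algebra_simps)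
  qed (simp add: psum_2_nonneg)
  have eq: "(\<integral>x. (tmon k rs x * exp (- (real m / 4) * trp k 2 x)) * (trp k 2 x / 4) ^ j \<partial>goe_space k) =
    (\<integral>x. (pmon k rs x * vdmp k x * exp (- (real m / 4) * psum k 2 x)) * (psum k 2 x / 4) ^ j \<partial>gauss k) / Zv k" for j
  proof -
    have "(\<integral>x. (tmon k rs x * exp (- (real m / 4) * trp k 2 x)) * (trp k 2 x / 4) ^ j \<partial>goe_space k) =
      (\<integral>x. (1 / 4) ^ j * (tmon k (replicate j 2 @ rs) x * exp (- (real m / 4) * trp k 2 x)) \<partial>goe_space k)"
      by (intro Bochner_Integration.integral_cong refl) (simp add: tmon_replicate power_divide)
    also have "\<dots> = (1 / 4) ^ j * ((\<integral>x. pmon k (replicate j 2 @ rs) x * exp (- (real m / 4) * psum k 2 x) * vdmp k x \<partial>gauss k) / Zv k)"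
      using Suc.IH[of "replicate j 2 @ rs"] by simp
    also have "\<dots> = (\<integral>x. (1 / 4) ^ j * (pmon k (replicate j 2 @ rs) x * exp (- (real m / 4) * psum k 2 x) * vdmp k x) \<partial>gauss k) / Zv k"
      by simp
    also have "(\<integral>x. (1 / 4) ^ j * (pmon k (replicate j 2 @ rs) x * exp (- (real m / 4) * psum k 2 x) * vdmp k x) \<partial>gauss k) =
      (\<integral>x. (pmon k rs x * vdmp k x * exp (- (real m / 4) * psum k 2 x)) * (psum k 2 x / 4) ^ j \<partial>gauss k)"
      by (intro Bochner_Integration.integral_cong refl) (simp add: pmon_replicate power_divide)
    finally show ?thesis .
  qed
  have "(\<lambda>j. (- 1) ^ j / fact j * (\<integral>x. (tmon k rs x * exp (- (real m / 4) * trp k 2 x)) * (trp k 2 x / 4) ^ j \<partial>goe_space k))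
    sums ((\<integral>x. (pmon k rs x * vdmp k x * exp (- (real m / 4) * psum k 2 x)) * exp (- (psum k 2 x / 4)) \<partial>gauss k) / Zv k)"
    unfolding eq using sums_divide[OF B, of "Zv k"] by simp
  from sums_unique2[OF A this] show ?case
    by (simp add: mult_exp_exp algebra_simps add_divide_distrib)
qed

text \<open>Damping makes the generators bounded. The generator with \<open>r = 0\<close> is the damping
  factor itself, up to a constant, so that no information about the power sums is lost.\<close>

inductive_set stat_ring :: "nat \<Rightarrow> ((nat \<Rightarrow> real) \<Rightarrow> real) set" for k where
  const: "(\<lambda>_. c) \<in> stat_ring k"
| gen: "(\<lambda>x. psum k r x * exp (- (1 / 4) * psum k 2 x)) \<in> stat_ring k"
| add: "f \<in> stat_ring k \<Longrightarrow> g \<in> stat_ring k \<Longrightarrow> (\<lambda>x. f x + g x) \<in> stat_ring k"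
| mult: "f \<in> stat_ring k \<Longrightarrow> g \<in> stat_ring k \<Longrightarrow> (\<lambda>x. f x * g x) \<in> stat_ring k"

lemma continuous_psum: "continuous_on UNIV (psum k r)"
  unfolding psum_def[abs_def] by (intro continuous_intros continuous_on_product_coordinates)

lemma stat_ring_continuous: "f \<in> stat_ring k \<Longrightarrow> continuous_on UNIV f"
  by (induction rule: stat_ring.induct) (auto intro!: continuous_intros continuous_psum)

lemma stat_ring_bounded: "f \<in> stat_ring k \<Longrightarrow> \<exists>B. \<forall>x. \<bar>f x\<bar> \<le> B"
proof (induction rule: stat_ring.induct)
  case (gen r)
  obtain C where C: "\<And>x. \<bar>psum k r x\<bar> \<le> C * exp (1 / 4 * (\<Sum>i<k. (x i)\<^sup>2))"
    using tame_bound[OF tame_psum, of "1 / 4" k r] by auto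
  have "\<bar>psum k r x * exp (- (1 / 4) * psum k 2 x)\<bar> \<le> C" for x
  proof -
    have "\<bar>psum k r x * exp (- (1 / 4) * psum k 2 x)\<bar> \<le> (C * exp (1 / 4 * (\<Sum>i<k. (x i)\<^sup>2))) * exp (- (1 / 4) * psum k 2 x)"
      using C[of x] by (simp add: abs_mult)
    also have "\<dots> = C" by (simp add: psum_def exp_minus)
    finally show ?thesis .
  qed
  then show ?case by blast
next
  case (add f g)
  then obtain A B where "\<And>x. \<bar>f x\<bar> \<le> A" "\<And>x. \<bar>g x\<bar> \<le> B" by blast
  then have "\<bar>f x + g x\<bar> \<le> A + B" for x by (meson abs_triangle_ineq add_mono order_trans)
  then show ?case by blast
next
  case (mult f g)
  then obtain A B where "\<And>x. \<bar>f x\<bar> \<le> A" "\<And>x. \<bar>g x\<bar> \<le> B" by blast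
  then have "\<bar>f x * g x\<bar> \<le> A * B" for x unfolding abs_mult by (intro mult_mono) (auto intro: order_trans[OF abs_ge_zero])
  then show ?case by blast
qed auto

definition stat_term :: "nat \<Rightarrow> real \<times> nat list \<times> nat \<Rightarrow> (nat \<Rightarrow> real) \<Rightarrow> real" where
  "stat_term k t x = fst t * (pmon k (fst (snd t)) x * exp (- (real (snd (snd t)) / 4) * psum k 2 x))"

lemma pmon_append: "pmon k (rs @ ss) x = pmon k rs x * pmon k ss x"
  by (simp add: pmon_def)

lemma stat_ring_normal_form: "f \<in> stat_ring k \<Longrightarrow> \<exists>L. f = (\<lambda>x. \<Sum>t\<leftarrow>L. stat_term k t x)"
proof (induction rule: stat_ring.induct)
  case (const c)
  show ?case by (intro exI[of _ "[(c, [], 0)]"]) (simp add: stat_term_def)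
next
  case (gen r)
  show ?case by (intro exI[of _ "[(1, [r], 1)]"]) (simp add: stat_term_def)
next
  case (add f g)
  then obtain L L' where "f = (\<lambda>x. \<Sum>t\<leftarrow>L. stat_term k t x)" "g = (\<lambda>x. \<Sum>t\<leftarrow>L'. stat_term k t x)" by blast
  then show ?case by (intro exI[of _ "L @ L'"]) simp
next
  case (mult f g)
  then obtain L L' where L: "f = (\<lambda>x. \<Sum>t\<leftarrow>L. stat_term k t x)" "g = (\<lambda>x. \<Sum>t\<leftarrow>L'. stat_term k t x)" by blast
  define tm where "tm t u = (fst t * fst u, fst (snd t) @ fst (snd u), snd (snd t) + snd (snd u))"
    for t u :: "real \<times> nat list \<times> nat"
  have tm: "stat_term k (tm t u) x = stat_term k t x * stat_term k u x" for t u x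
  proof -
    have e: "exp (- (real (a + b) / 4) * y) = exp (- (real a / 4) * y) * exp (- (real b / 4) * y)" for a b and y :: real
    proof -
      have "- (real (a + b) / 4) * y = - (real a / 4) * y + - (real b / 4) * y" by (simp add: field_simps)
      then show ?thesis by (simp only: exp_add)
    qed
    show ?thesis unfolding stat_term_def tm_def fst_conv snd_conv pmon_append e by simp
  qed
  have "(\<Sum>t\<leftarrow>concat (map (\<lambda>t. map (tm t) L') L). stat_term k t x) = (\<Sum>t\<leftarrow>L. stat_term k t x) * (\<Sum>t\<leftarrow>L'. stat_term k t x)" for x
    by (induction L) (simp_all add: o_def tm sum_list_const_mult distrib_right)
  then show ?case unfolding L by (intro exI[of _ "concat (map (\<lambda>t. map (tm t) L') L)"]) simp
qed

text \<open>Only the power sums of \<open>V\<close> enter. In this form the statement yields the measurability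
  of the eigenvalues, which is itself derived by approximation from the algebra.\<close>

lemma stat_ring_expectation:
  assumes f: "f \<in> stat_ring k" and V: "\<And>r x. psum k r (V x) = trp k r x"
  shows "(\<lambda>x. f (V x)) \<in> borel_measurable (goe_space k)"
    "(\<integral>x. f (V x) \<partial>goe_space k) = (\<integral>x. f x * vdmp k x \<partial>gauss k) / Zv k"
proof -
  obtain L where L: "f = (\<lambda>x. \<Sum>t\<leftarrow>L. stat_term k t x)" using stat_ring_normal_form[OF f] by blast
  have pV: "pmon k rs (V x) = tmon k rs x" for rs x by (simp add: pmon_def tmon_def V)
  have tV: "stat_term k t (V x) = fst t * (tmon k (fst (snd t)) x * exp (- (real (snd (snd t)) / 4) * trp k 2 x))" for t x
    by (simp add: stat_term_def pV V)
  have i1: "integrable (goe_space k) (\<lambda>x. stat_term k t (V x))" for t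
    unfolding tV by (intro integrable_mult_right integrable_tmon_exp tame_tmon) auto
  have i2: "integrable (gauss k) (\<lambda>x. stat_term k t x * vdmp k x)" for t
  proof -
    have "integrable (gauss k) (\<lambda>x. fst t * ((pmon k (fst (snd t)) x * vdmp k x) * exp (- (real (snd (snd t)) / 4) * psum k 2 x)))"
      by (intro integrable_mult_right integrable_pmon_exp tame_mult tame_pmon tame_vdmp) auto
    then show ?thesis by (simp add: stat_term_def mult_ac)
  qed
  have e: "(\<integral>x. stat_term k t (V x) \<partial>goe_space k) = (\<integral>x. stat_term k t x * vdmp k x \<partial>gauss k) / Zv k" for t
    unfolding tV unfolding stat_term_def using goe_exp_moments[of k "fst (snd t)" "snd (snd t)"] by (simp add: mult.assoc)
  have "integrable (goe_space k) (\<lambda>x. \<Sum>t\<leftarrow>L. stat_term k t (V x)) \<and>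
    integrable (gauss k) (\<lambda>x. (\<Sum>t\<leftarrow>L. stat_term k t x) * vdmp k x) \<and>
    (\<integral>x. (\<Sum>t\<leftarrow>L. stat_term k t (V x)) \<partial>goe_space k) = (\<integral>x. (\<Sum>t\<leftarrow>L. stat_term k t x) * vdmp k x \<partial>gauss k) / Zv k"
    using i1 i2 by (induction L) (auto simp: e distrib_right add_divide_distrib)
  then show "(\<lambda>x. f (V x)) \<in> borel_measurable (goe_space k)"
    "(\<integral>x. f (V x) \<partial>goe_space k) = (\<integral>x. f x * vdmp k x \<partial>gauss k) / Zv k" unfolding L by auto
qed

section \<open>Eigenvalues of real symmetric matrices\<close>

lemma mat_mult_entry:
  assumes "A \<in> carrier_mat n n" "B \<in> carrier_mat n n" "i < n" "j < n"
  shows "(A * B) $$ (i, j) = (\<Sum>l<n. A $$ (i, l) * B $$ (l, j))"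
  using assms by (simp add: scalar_prod_def lessThan_atLeast0)

lemma mat_vec_entry:
  assumes "A \<in> carrier_mat n n" "v \<in> carrier_vec n" "i < n"
  shows "(A *\<^sub>v v) $ i = (\<Sum>l<n. A $$ (i, l) * v $ l)"
  using assms by (simp add: scalar_prod_def lessThan_atLeast0)

text \<open>For an eigenvector \<open>v\<close> the Hermitian form of the matrix at \<open>v\<close> is real
  and equals \<open>a\<close> times the squared norm of \<open>v\<close>.\<close>

lemma eigenvalue_real_symmetric:
  fixes A :: "real mat"
  assumes A: "A \<in> carrier_mat n n" and sym: "\<And>i j. i < n \<Longrightarrow> j < n \<Longrightarrow> A $$ (i, j) = A $$ (j, i)"
    and e: "eigenvalue (map_mat complex_of_real A) a"
  shows "a \<in> \<real>"
proof -
  let ?B = "map_mat complex_of_real A"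
  have B: "?B \<in> carrier_mat n n" using A by simp
  obtain v where v: "v \<in> carrier_vec n" "v \<noteq> 0\<^sub>v n" "?B *\<^sub>v v = a \<cdot>\<^sub>v v"
    using e A unfolding eigenvalue_def eigenvector_def by auto
  define s where "s = (\<Sum>i<n. cnj (v $ i) * v $ i)"
  define q where "q = (\<Sum>i<n. \<Sum>j<n. cnj (v $ i) * complex_of_real (A $$ (i, j)) * v $ j)"
  have "q = (\<Sum>i<n. cnj (v $ i) * (?B *\<^sub>v v) $ i)"
    unfolding q_def using A v(1) by (intro sum.cong refl) (simp add: mat_vec_entry[OF B v(1)] sum_distrib_left mult.assoc del: index_mult_mat_vec)
  also have "\<dots> = a * s"
    unfolding v(3) s_def using v(1) by (simp add: sum_distrib_left mult_ac)
  finally have q: "q = a * s" .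
  have "cnj q = (\<Sum>i<n. \<Sum>j<n. cnj (v $ j) * complex_of_real (A $$ (j, i)) * v $ i)"
    unfolding q_def cnj_sum by (intro sum.cong refl) (simp add: sym mult_ac)
  also have "\<dots> = q" unfolding q_def by (rule sum.swap)
  finally have "cnj q = q" .
  have cs: "cnj s = s" unfolding s_def cnj_sum by (intro sum.cong refl) (simp add: mult.commute)
  have "s = complex_of_real (\<Sum>i<n. (cmod (v $ i))\<^sup>2)"
    unfolding s_def of_real_sum by (intro sum.cong refl) (metis complex_norm_square mult.commute)
  moreover have "(\<Sum>i<n. (cmod (v $ i))\<^sup>2) \<noteq> 0"
  proof
    assume "(\<Sum>i<n. (cmod (v $ i))\<^sup>2) = 0"
    then have "\<forall>i<n. v $ i = 0" by (simp add: sum_nonneg_eq_0_iff)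
    then have "v = 0\<^sub>v n" using v(1) by (intro eq_vecI) auto
    then show False using v(2) by simp
  qed
  ultimately have "s \<noteq> 0" by (simp only: of_real_eq_0_iff not_False_eq_True)
  then have "cnj a = a" using \<open>cnj q = q\<close> unfolding q by (simp add: cs)
  then show ?thesis by (simp add: Reals_cnj_iff)
qed

text \<open>The characteristic polynomial splits over the complex numbers, and its roots are real.\<close>

lemma real_symmetric_char_poly:
  fixes A :: "real mat"
  assumes A: "A \<in> carrier_mat n n" and sym: "\<And>i j. i < n \<Longrightarrow> j < n \<Longrightarrow> A $$ (i, j) = A $$ (j, i)"
  shows "\<exists>es. char_poly A = (\<Prod>e\<leftarrow>es. [:- e, 1:]) \<and> length es = n"
proof -
  interpret m: map_poly_comm_ring_hom complex_of_real ..
  let ?B = "map_mat complex_of_real A"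
  have B: "?B \<in> carrier_mat n n" using A by simp
  obtain as where as: "char_poly ?B = (\<Prod>a\<leftarrow>as. [:- a, 1:])" "length as = n"
    using char_poly_factorized[OF B] by blast
  have re: "a = complex_of_real (Re a)" if "a \<in> set as" for a
  proof -
    have "poly (char_poly ?B) a = 0" unfolding as(1) using that by (induction as) auto
    then have "eigenvalue ?B a" using eigenvalue_root_char_poly[OF B] by simp
    then show ?thesis using eigenvalue_real_symmetric[OF A sym] by simp
  qed
  define es where "es = map Re as"
  have cp: "char_poly ?B = map_poly complex_of_real (char_poly A)" by (rule of_real_hom.char_poly_hom[OF A])
  have "map_poly complex_of_real (\<Prod>e\<leftarrow>map Re bs. [:- e, 1:]) = (\<Prod>a\<leftarrow>bs. [:- a, 1:])" if "set bs \<subseteq> set as" for bs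
    using that
  proof (induction bs)
    case (Cons b bs)
    have 1: "map_poly complex_of_real [:- Re b, 1:] = [:- b, 1:]" using re[of b] Cons.prems by simp
    have "map_poly complex_of_real (\<Prod>e\<leftarrow>map Re bs. [:- e, 1:]) = (\<Prod>a\<leftarrow>bs. [:- a, 1:])"
      using Cons by simp
    then show ?case using 1 by (simp only: list.map prod_list.Cons m.hom_mult)
  qed simp
  from this[of as] have "map_poly complex_of_real (char_poly A) = map_poly complex_of_real (\<Prod>e\<leftarrow>es. [:- e, 1:])"
    unfolding es_def using cp as(1) by simp
  then have "complex_of_real (coeff (char_poly A) i) = complex_of_real (coeff (\<Prod>e\<leftarrow>es. [:- e, 1:]) i)" for i
    by (metis coeff_map_poly of_real_0)
  then have "char_poly A = (\<Prod>e\<leftarrow>es. [:- e, 1:])" by (intro poly_eqI) simp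
  then show ?thesis using as(2) by (intro exI[of _ es]) (simp add: es_def)
qed

definition mtr :: "nat \<Rightarrow> real mat \<Rightarrow> real" where "mtr n A = (\<Sum>i<n. A $$ (i, i))"

lemma mtr_commute:
  assumes "A \<in> carrier_mat n n" "B \<in> carrier_mat n n"
  shows "mtr n (A * B) = mtr n (B * A)"
proof -
  have "mtr n (A * B) = (\<Sum>i<n. \<Sum>l<n. A $$ (i, l) * B $$ (l, i))"
    unfolding mtr_def by (intro sum.cong refl mat_mult_entry assms) auto
  also have "\<dots> = (\<Sum>l<n. \<Sum>i<n. B $$ (l, i) * A $$ (i, l))" by (subst sum.swap) (simp add: mult.commute)
  also have "\<dots> = mtr n (B * A)"
    unfolding mtr_def by (intro sum.cong refl mat_mult_entry[symmetric] assms) auto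
  finally show ?thesis .
qed

lemma upper_triangular_power:
  fixes B :: "real mat"
  assumes B: "B \<in> carrier_mat n n" "upper_triangular B"
  shows "(\<forall>i<n. \<forall>j<i. (B ^\<^sub>m r) $$ (i, j) = 0) \<and> (\<forall>i<n. (B ^\<^sub>m r) $$ (i, i) = B $$ (i, i) ^ r)"
proof (induction r)
  case 0
  show ?case using B by auto
next
  case (Suc r)
  have c: "B ^\<^sub>m r \<in> carrier_mat n n" using B by simp
  have up: "B $$ (l, j) = 0" if "j < l" "l < n" for l j using B that by auto
  have e: "(B ^\<^sub>m Suc r) $$ (i, j) = (\<Sum>l<n. (B ^\<^sub>m r) $$ (i, l) * B $$ (l, j))" if "i < n" "j < n" for i j
    using mat_mult_entry[OF c B(1) that] by simp
  show ?case
  proof (intro conjI allI impI)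
    fix i j assume ij: "i < n" "j < i"
    have "(B ^\<^sub>m r) $$ (i, l) * B $$ (l, j) = 0" if "l < n" for l
      using Suc ij up[of j l] that by (cases "l < i") auto
    then have "(\<Sum>l<n. (B ^\<^sub>m r) $$ (i, l) * B $$ (l, j)) = 0" by (intro sum.neutral) simp
    then show "(B ^\<^sub>m Suc r) $$ (i, j) = 0" using ij by (subst e) auto
  next
    fix i assume i: "i < n"
    have "(B ^\<^sub>m r) $$ (i, l) * B $$ (l, i) = (if l = i then B $$ (i, i) ^ r * B $$ (i, i) else 0)" if "l < n" for l
      using Suc i up[of i l] that by (cases l i rule: linorder_cases) auto
    then have "(\<Sum>l<n. (B ^\<^sub>m r) $$ (i, l) * B $$ (l, i)) = (\<Sum>l<n. if l = i then B $$ (i, i) ^ r * B $$ (i, i) else 0)"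
      by (intro sum.cong) auto
    then show "(B ^\<^sub>m Suc r) $$ (i, i) = B $$ (i, i) ^ Suc r" using i by (subst e) auto
  qed
qed

text \<open>A Schur decomposition makes the matrix triangular with the eigenvalues on the diagonal, and powers
  of triangular matrices have the powers there.\<close>

lemma trace_power_eigenvalues:
  fixes A :: "real mat"
  assumes A: "A \<in> carrier_mat n n" and c: "char_poly A = (\<Prod>e\<leftarrow>es. [:- e, 1:])"
  shows "mtr n (A ^\<^sub>m r) = (\<Sum>e\<leftarrow>es. e ^ r)"
proof -
  obtain B P Q where d: "schur_decomposition A es = (B, P, Q)" by (cases "schur_decomposition A es")
  have s: "similar_mat_wit A B P Q" "upper_triangular B" "diag_mat B = es"
    using schur_decomposition[OF A c d] by auto
  have car: "B \<in> carrier_mat n n" "P \<in> carrier_mat n n" "Q \<in> carrier_mat n n" "Q * P = 1\<^sub>m n"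
    using similar_mat_witD2[OF A s(1)] by auto
  have Bc: "B ^\<^sub>m r \<in> carrier_mat n n" using car by simp
  have "mtr n (A ^\<^sub>m r) = mtr n (P * B ^\<^sub>m r * Q)" using similar_mat_wit_pow_id[OF s(1)] by simp
  also have "\<dots> = mtr n (Q * (P * B ^\<^sub>m r))" using car Bc by (intro mtr_commute) auto
  also have "Q * (P * B ^\<^sub>m r) = B ^\<^sub>m r"
    using car Bc by (subst assoc_mult_mat[symmetric, of _ n n _ n _ n]) auto
  also have "mtr n (B ^\<^sub>m r) = (\<Sum>i<n. B $$ (i, i) ^ r)"
    unfolding mtr_def using upper_triangular_power[OF car(1) s(2)] by (intro sum.cong) auto
  also have "\<dots> = (\<Sum>e\<leftarrow>diag_mat B. e ^ r)"
    using car(1) unfolding diag_mat_def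
    by (simp add: o_def lessThan_atLeast0 sum_list_distinct_conv_sum_set)
  finally show ?thesis using s(3) by simp
qed

lemma ordered_eigenvalues_factored:
  assumes c: "char_poly A = (\<Prod>e\<leftarrow>es. [:- e, 1:])"
  shows "ordered_eigenvalues A = rev (sort es)"
proof -
  have "proots (\<Prod>e\<leftarrow>es. [:- e, 1:]) = mset es"
  proof (induction es)
    case (Cons e es)
    have "(\<Prod>e\<leftarrow>es. [:- e, 1:] :: real poly) \<noteq> 0"
      unfolding prod_list_zero_iff by auto
    then have nz: "[:- e, 1:] * (\<Prod>e\<leftarrow>es. [:- e, 1:]) \<noteq> 0" by (intro no_zero_divisors) auto
    have "proots ([:- e, 1:] * (\<Prod>e\<leftarrow>es. [:- e, 1:])) = proots [:- e, 1:] + proots (\<Prod>e\<leftarrow>es. [:- e, 1:])"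
      by (rule proots_mult) (use nz in auto)
    then show ?case using Cons by (simp del: mult_pCons_left)
  qed simp
  then show ?thesis unfolding ordered_eigenvalues_def c by simp
qed

definition eigvec :: "nat \<Rightarrow> (nat \<times> nat \<Rightarrow> real) \<Rightarrow> nat \<Rightarrow> real" where
  "eigvec k x i = (if i < k then ordered_eigenvalues (goe_matrix k x) ! i else 0)"

lemma goe_matrix_carrier: "goe_matrix k x \<in> carrier_mat k k"
  by (simp add: goe_matrix_def)

lemma goe_matrix_entry: "i < k \<Longrightarrow> j < k \<Longrightarrow> goe_matrix k x $$ (i, j) = ent x i j"
  by (simp add: goe_matrix_def ent_def)

lemma goe_matrix_power: "i < k \<Longrightarrow> j < k \<Longrightarrow> (goe_matrix k x ^\<^sub>m r) $$ (i, j) = pw k x r i j"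
proof (induction r arbitrary: j)
  case 0
  then show ?case using goe_matrix_carrier[of k x] by simp
next
  case (Suc r)
  have "(goe_matrix k x ^\<^sub>m Suc r) $$ (i, j) = (\<Sum>l<k. (goe_matrix k x ^\<^sub>m r) $$ (i, l) * goe_matrix k x $$ (l, j))"
    using mat_mult_entry[OF pow_carrier_mat[OF goe_matrix_carrier] goe_matrix_carrier, of i k j x r x] Suc.prems by simp
  also have "\<dots> = pw k x (Suc r) i j" using Suc by (simp add: goe_matrix_entry)
  finally show ?case .
qed

lemma goe_factored:
  obtains es where "char_poly (goe_matrix k x) = (\<Prod>e\<leftarrow>es. [:- e, 1:])" "length es = k"
  using real_symmetric_char_poly[OF goe_matrix_carrier, of k x] by (auto simp: goe_matrix_entry ent_sym)

lemma sum_nth_lessThan: "(\<Sum>i<length xs. f (xs ! i)) = sum_list (map f xs)" for f :: "'a \<Rightarrow> real"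
  by (induction xs) (simp_all add: sum.lessThan_Suc_shift del: sum.lessThan_Suc)

text \<open>The power sums of the eigenvalues are polynomials in the entries, namely traces of powers.\<close>

lemma psum_eigvec: "psum k r (eigvec k x) = trp k r x"
proof -
  obtain es where es: "char_poly (goe_matrix k x) = (\<Prod>e\<leftarrow>es. [:- e, 1:])" "length es = k" by (rule goe_factored)
  have "psum k r (eigvec k x) = (\<Sum>i<length (rev (sort es)). (rev (sort es) ! i) ^ r)"
    using es by (simp add: psum_def eigvec_def ordered_eigenvalues_factored)
  also have "\<dots> = sum_list (map (\<lambda>e. e ^ r) (rev (sort es)))" by (rule sum_nth_lessThan)
  also have "\<dots> = sum_list (map (\<lambda>e. e ^ r) es)"
  proof -
    have "mset (map (\<lambda>e. e ^ r) (rev (sort es))) = mset (map (\<lambda>e. e ^ r) es)" by simp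
    then show ?thesis unfolding sum_mset_sum_list[symmetric] by (rule arg_cong)
  qed
  also have "\<dots> = mtr k (goe_matrix k x ^\<^sub>m r)" using trace_power_eigenvalues[OF goe_matrix_carrier es(1)] by simp
  also have "\<dots> = trp k r x" unfolding mtr_def trp_def by (intro sum.cong) (auto simp: goe_matrix_power)
  finally show ?thesis .
qed

lemma chamber_eigvec: "chamber k (eigvec k x)"
proof -
  obtain es where es: "char_poly (goe_matrix k x) = (\<Prod>e\<leftarrow>es. [:- e, 1:])" "length es = k" by (rule goe_factored)
  have "rev (sort es) ! j \<le> rev (sort es) ! i" if "i < j" "j < k" for i j
    using that es(2) by (simp add: rev_nth sorted_nth_mono)
  then show ?thesis unfolding chamber_def pairs_def eigvec_def by (auto simp: ordered_eigenvalues_factored[OF es(1)])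
qed

lemma sort_map_mono: "mono f \<Longrightarrow> sort (map f xs) = map f (sort xs)"
  by (rule properties_for_sort) (auto simp: sorted_map intro: sorted_wrt_mono_rel[OF _ sorted_sort] dest: monoD)

lemma char_poly_shift:
  fixes A :: "real mat"
  assumes A: "A \<in> carrier_mat n n" and c: "char_poly A = (\<Prod>e\<leftarrow>es. [:- e, 1:])"
  shows "char_poly (A - c \<cdot>\<^sub>m 1\<^sub>m n) = (\<Prod>e\<leftarrow>map (\<lambda>e. e - c) es. [:- e, 1:])"
proof (rule poly_ext)
  fix z
  have A': "A - c \<cdot>\<^sub>m 1\<^sub>m n \<in> carrier_mat n n" using A by auto
  have "char_matrix (A - c \<cdot>\<^sub>m 1\<^sub>m n) z = char_matrix A (z + c)"
    unfolding char_matrix_def using A by (intro eq_matI) auto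
  then have "poly (char_poly (A - c \<cdot>\<^sub>m 1\<^sub>m n)) z = poly (char_poly A) (z + c)"
    by (simp add: char_poly_matrix[OF A] char_poly_matrix[OF A'])
  also have "\<dots> = poly (\<Prod>e\<leftarrow>map (\<lambda>e. e - c) es. [:- e, 1:]) z"
    unfolding c by (induction es) (auto simp: algebra_simps)
  finally show "poly (char_poly (A - c \<cdot>\<^sub>m 1\<^sub>m n)) z = poly (\<Prod>e\<leftarrow>map (\<lambda>e. e - c) es. [:- e, 1:]) z" .
qed

text \<open>Removing the trace shifts all eigenvalues by the same amount, which cancels in an alternating sum
  of even length.\<close>

lemma alternating_sum_goe0:
  assumes k: "even k"
  shows "alternating_eigenvalue_sum k (goe0_matrix k x) = alt k (eigvec k x)"
proof -
  obtain es where es: "char_poly (goe_matrix k x) = (\<Prod>e\<leftarrow>es. [:- e, 1:])" "length es = k" by (rule goe_factored)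
  define c where "c = mat_trace (goe_matrix k x) / real k"
  have "ordered_eigenvalues (goe0_matrix k x) = rev (sort (map (\<lambda>e. e - c) es))"
    unfolding goe0_matrix_def c_def[symmetric]
    by (rule ordered_eigenvalues_factored[OF char_poly_shift[OF goe_matrix_carrier es(1)]])
  also have "\<dots> = map (\<lambda>e. e - c) (rev (sort es))"
    by (subst sort_map_mono) (auto simp: mono_def rev_map)
  finally have o: "ordered_eigenvalues (goe0_matrix k x) = map (\<lambda>e. e - c) (rev (sort es))" .
  have "alternating_eigenvalue_sum k (goe0_matrix k x) = (\<Sum>i<k. (-1) ^ (Suc i + 1) * ordered_eigenvalues (goe0_matrix k x) ! i)"
    unfolding alternating_eigenvalue_sum_def
    by (rule sum.reindex_bij_witness[of _ Suc "\<lambda>j. j - 1"]) auto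
  also have "\<dots> = (\<Sum>i<k. (-1) ^ i * (rev (sort es) ! i - c))"
    using es(2) by (intro sum.cong) (auto simp: o)
  also have "\<dots> = alt k (eigvec k x) - c * (\<Sum>i<k. (-1) ^ i)"
    unfolding alt_def eigvec_def ordered_eigenvalues_factored[OF es(1)]
    by (simp add: right_diff_distrib sum_subtractf sum_distrib_left mult.commute)
  also have "(\<Sum>i<k. (-1) ^ i :: real) = 0"
  proof -
    have "(\<Sum>i<2 * m. (-1) ^ i :: real) = 0" for m by (induction m) auto
    then show ?thesis using k by (metis evenE)
  qed
  finally show ?thesis by simp
qed

section \<open>The law of the ordered eigenvalues\<close>

text \<open>Points of the product space are undefined from coordinate \<open>k\<close> on; setting these
  coordinates to \<open>0\<close> makes them comparable with \<open>eigvec\<close>.\<close>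

definition trunc :: "nat \<Rightarrow> (nat \<Rightarrow> real) \<Rightarrow> nat \<Rightarrow> real" where
  "trunc k x i = (if i < k then x i else 0)"

definition sorted_ball :: "nat \<Rightarrow> nat \<Rightarrow> (nat \<Rightarrow> real) set" where
  "sorted_ball k N = {y. (\<forall>i\<ge>k. y i = 0) \<and> chamber k y \<and> psum k 2 y \<le> (real N)\<^sup>2}"

lemma sorted_ball_coord:
  assumes "y \<in> sorted_ball k N"
  shows "\<bar>y i\<bar> \<le> real N"
proof (cases "i < k")
  case True
  have "(y i)\<^sup>2 \<le> psum k 2 y" unfolding psum_def using True by (intro member_le_sum) auto
  also have "\<dots> \<le> (real N)\<^sup>2" using assms by (simp add: sorted_ball_def)
  finally show ?thesis by (simp add: abs_le_square_iff[symmetric])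
next
  case False
  then show ?thesis using assms by (auto simp: sorted_ball_def not_less)
qed

lemma compact_sorted_ball: "compact (sorted_ball k N)"
proof -
  have c: "continuous_on UNIV (\<lambda>y :: nat \<Rightarrow> real. y i)" for i by (rule continuous_on_product_coordinates)
  have "compact (Pi\<^sub>E UNIV (\<lambda>_::nat. {- real N..real N}))"
  proof -
    have "compactin (product_topology (\<lambda>_::nat. euclidean) UNIV) (Pi\<^sub>E UNIV (\<lambda>_. {- real N..real N}))"
      by (subst compactin_PiE) auto
    then show ?thesis by (metis compactin_euclidean_iff euclidean_product_topology)
  qed
  moreover have "closed (sorted_ball k N)"
  proof -
    have e: "sorted_ball k N = (\<Inter>i\<in>{k..}. {y. y i = 0}) \<inter> (\<Inter>p\<in>pairs k. {y. y (snd p) \<le> y (fst p)}) \<inter> {y. psum k 2 y \<le> (real N)\<^sup>2}"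
      unfolding sorted_ball_def chamber_def by (auto simp: split_beta)
    show ?thesis unfolding e
      by (intro closed_Int closed_INT ballI closed_Collect_eq closed_Collect_le c continuous_psum continuous_on_const)
  qed
  ultimately have "compact (Pi\<^sub>E UNIV (\<lambda>_::nat. {- real N..real N}) \<inter> sorted_ball k N)"
    by (rule compact_Int_closed)
  moreover have "Pi\<^sub>E UNIV (\<lambda>_::nat. {- real N..real N}) \<inter> sorted_ball k N = sorted_ball k N"
    using sorted_ball_coord by (auto simp: PiE_iff abs_le_iff minus_le_iff)
  ultimately show ?thesis by simp
qed

text \<open>Equal power sums give equal sums of every polynomial over the coordinates. A polynomial that
  vanishes at all coordinate values but one counts how often that one occurs.\<close>

lemma sorted_psum_inj:
  assumes x: "\<forall>i\<ge>k. x i = 0" "chamber k x" and y: "\<forall>i\<ge>k. y i = 0" "chamber k y"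
    and p: "\<And>r. psum k r x = psum k r y"
  shows "x = y"
proof -
  define xs where "xs = map x [0..<k]"
  define ys where "ys = map y [0..<k]"
  have sl: "sum_list (map h (map z [0..<k])) = (\<Sum>i<k. h (z i))" for h :: "real \<Rightarrow> real" and z
    by (simp add: sum_list_distinct_conv_sum_set o_def lessThan_atLeast0)
  have q: "sum_list (map (poly q) xs) = sum_list (map (poly q) ys)" for q :: "real poly"
  proof -
    have "(\<Sum>i<k. poly q (z i)) = (\<Sum>j\<le>degree q. coeff q j * psum k j z)" for z
      unfolding psum_def poly_altdef sum_distrib_left by (rule sum.swap)
    then show ?thesis unfolding xs_def ys_def sl by (simp add: p)
  qed
  define S where "S = set xs \<union> set ys"
  have cnt: "count_list xs a = count_list ys a" for a
  proof (cases "a \<in> S")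
    case True
    \<comment> \<open>Summing \<open>q\<close> over the coordinates counts the occurrences of \<open>a\<close>, up to the factor \<open>poly q a\<close>.\<close>
    define q where "q = (\<Prod>b\<in>S - {a}. [:- b, 1:])"
    have fS: "finite S" by (simp add: S_def)
    have q0: "poly q b = 0" if "b \<in> S" "b \<noteq> a" for b
      unfolding q_def poly_prod using that fS by (intro prod_zero) auto
    have qa: "poly q a \<noteq> 0" unfolding q_def poly_prod using fS by (auto simp: prod_zero_iff)
    have "sum_list (map (poly q) zs) = real (count_list zs a) * poly q a" if "set zs \<subseteq> S" for zs
      using that
    proof (induction zs)
      case (Cons b zs)
      then show ?case using q0[of b] by (cases "b = a") (auto simp: algebra_simps)
    qed simp
    then have "real (count_list xs a) * poly q a = real (count_list ys a) * poly q a"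
      using q[of q] by (simp add: S_def)
    then show ?thesis using qa by simp
  next
    case False
    then show ?thesis by (simp add: S_def count_notin)
  qed
  then have m: "mset xs = mset ys" by (intro multiset_eqI) (simp add: count_mset)
  have sorted: "sorted (rev (map z [0..<k]))" if "chamber k z" for z
    using that unfolding sorted_rev_iff_nth_mono by (auto simp: chamber_def pairs_def le_less)
  have "rev xs = sort xs" "rev ys = sort xs"
    using sorted[OF x(2)] sorted[OF y(2)] m by (auto simp: xs_def ys_def intro!: properties_for_sort[symmetric])
  then have "xs = ys" by (metis rev_rev_ident)
  then have "x i = y i" if "i < k" for i using that unfolding xs_def ys_def by (metis atLeast0LessThan lessThan_iff map_eq_conv set_upt)
  then show ?thesis using x(1) y(1) by (intro ext) (metis not_le)
qed

text \<open>The damping factor can be divided out, since the generator with \<open>r = 0\<close> determines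
  it.\<close>

lemma stat_ring_separates:
  assumes x: "x \<in> sorted_ball k N" and y: "y \<in> sorted_ball k N" and ne: "x \<noteq> y"
  shows "\<exists>f\<in>stat_ring k. f x \<noteq> f y"
proof (rule ccontr)
  assume "\<not> ?thesis"
  then have e: "psum k r x * exp (- (1 / 4) * psum k 2 x) = psum k r y * exp (- (1 / 4) * psum k 2 y)" for r
    using stat_ring.gen[of k r] by auto
  have "psum k r x = psum k r y" for r
  proof (cases "k = 0")
    case False
    then have "exp (- (1 / 4) * psum k 2 x) = exp (- (1 / 4) * psum k 2 y)" using e[of 0] by (simp add: psum_0)
    then show ?thesis using e[of r] by simp
  qed (simp add: psum_def)
  then have "x = y" using x y unfolding sorted_ball_def by (intro sorted_psum_inj[of k]) auto
  then show False using ne by simp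
qed

lemma eigvec_sorted_ball:
  assumes "trp k 2 x \<le> (real N)\<^sup>2"
  shows "eigvec k x \<in> sorted_ball k N"
  using assms chamber_eigvec[of k x] psum_eigvec[of k 2 x] by (auto simp: sorted_ball_def eigvec_def)

lemma sorted_ball_approx:
  assumes F: "continuous_on UNIV F" "\<And>y. y \<in> sorted_ball k N \<Longrightarrow> \<bar>F y\<bar> \<le> C" "C \<ge> 0" and e: "e > 0"
  shows "\<exists>h\<in>stat_ring k. \<forall>y\<in>sorted_ball k N. \<bar>F y - h y\<bar> \<le> e"
proof -
  have "\<exists>h\<in>stat_ring k. (\<forall>y\<in>sorted_ball k N. \<bar>F y - h y\<bar> \<le> e) \<and> (\<forall>y. \<bar>h y\<bar> \<le> C + e)"
  proof (rule algebra_approx_clamped[OF stat_ring.const stat_ring.add stat_ring.mult])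
    show "continuous_on (sorted_ball k N) f" if "f \<in> stat_ring k" for f
      using stat_ring_continuous[OF that] continuous_on_subset by blast
    show "continuous_on (sorted_ball k N) F" using F(1) continuous_on_subset by blast
  qed (use stat_ring_bounded compact_sorted_ball stat_ring_separates F e in auto)
  then show ?thesis by blast
qed

text \<open>Each eigenvalue is a pointwise limit of functions in \<open>stat_ring\<close>, which are
  measurable because they are polynomials and exponentials of traces.\<close>

lemma eigvec_measurable: "eigvec k \<in> goe_space k \<rightarrow>\<^sub>M borel"
proof (rule measurable_coordinatewise_then_product)
  fix i
  have "\<exists>h\<in>stat_ring k. \<forall>y\<in>sorted_ball k N. \<bar>y i - h y\<bar> \<le> 1 / real (Suc N)" for N
    using sorted_ball_coord by (intro sorted_ball_approx[where C = "real N"] continuous_on_product_coordinates) auto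
  then obtain h where h: "\<And>N. h N \<in> stat_ring k"
    "\<And>N y. y \<in> sorted_ball k N \<Longrightarrow> \<bar>y i - h N y\<bar> \<le> 1 / real (Suc N)" by metis
  show "(\<lambda>x. eigvec k x i) \<in> borel_measurable (goe_space k)"
  proof (rule borel_measurable_LIMSEQ_real)
    show "(\<lambda>x. h N (eigvec k x)) \<in> borel_measurable (goe_space k)" for N
      by (rule stat_ring_expectation(1)[OF h(1) psum_eigvec])
    fix x
    obtain N0 where N0: "trp k 2 x \<le> real N0" using real_arch_simple by blast
    have "\<bar>h N (eigvec k x) - eigvec k x i\<bar> \<le> 1 / real (Suc N)" if "N \<ge> Suc N0" for N
    proof -
      have "trp k 2 x \<le> real N * real N" using N0 that mult_mono[of 1 "real N" "real N0" "real N"] by linarith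
      then have "eigvec k x \<in> sorted_ball k N" by (intro eigvec_sorted_ball) (simp add: power2_eq_square)
      from h(2)[OF this] show ?thesis by (simp add: abs_minus_commute)
    qed
    then have "\<forall>\<^sub>F N in sequentially. norm (h N (eigvec k x) - eigvec k x i) \<le> 1 / real (Suc N)"
      by (intro eventually_sequentiallyI[of "Suc N0"]) auto
    moreover have "(\<lambda>N. 1 / real (Suc N)) \<longlonglongrightarrow> 0" by (rule LIMSEQ_Suc[OF lim_1_over_n])
    ultimately have "(\<lambda>N. h N (eigvec k x) - eigvec k x i) \<longlonglongrightarrow> 0" by (rule Lim_null_comparison)
    then show "(\<lambda>N. h N (eigvec k x)) \<longlonglongrightarrow> eigvec k x i" by (simp add: LIM_zero_iff)
  qed
qed

lemma tail_small:
  assumes "prob_space M" and h: "h \<in> borel_measurable M" and e: "e > 0"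
  shows "\<exists>N::nat. measure M {x \<in> space M. h x > (real N)\<^sup>2} \<le> e"
proof -
  interpret prob_space M by fact
  define A where "A N = {x \<in> space M. h x > (real N)\<^sup>2}" for N :: nat
  have "(\<lambda>N. measure M (A N)) \<longlonglongrightarrow> measure M (\<Inter>N. A N)"
  proof (rule finite_Lim_measure_decseq)
    show "range A \<subseteq> sets M" using h unfolding A_def by auto
    show "decseq A"
    proof (rule decseq_SucI)
      fix n
      have "(real n)\<^sup>2 \<le> (real (Suc n))\<^sup>2" by (intro power_mono) auto
      then have "(real n)\<^sup>2 < z" if "(real (Suc n))\<^sup>2 < z" for z using that by linarith
      then show "A (Suc n) \<subseteq> A n" unfolding A_def by (auto simp del: of_nat_Suc)
    qed
  qed
  moreover have "(\<Inter>N. A N) = {}"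
  proof -
    have False if "x \<in> (\<Inter>N. A N)" for x
    proof -
      obtain n :: nat where n: "h x \<le> real n" using real_arch_simple by blast
      have "real n \<le> (real (Suc n))\<^sup>2" by (simp add: power2_eq_square algebra_simps)
      moreover have "h x > (real (Suc n))\<^sup>2" using that unfolding A_def by (auto simp del: of_nat_Suc)
      ultimately show False using n by linarith
    qed
    then show ?thesis by blast
  qed
  ultimately have "(\<lambda>N. measure M (A N)) \<longlonglongrightarrow> 0" by simp
  then have "\<forall>\<^sub>F N in sequentially. measure M (A N) < e" using e by (intro order_tendstoD) auto
  then show ?thesis unfolding A_def eventually_sequentially by (meson less_imp_le order_refl)
qed

definition vgauss :: "nat \<Rightarrow> (nat \<Rightarrow> real) measure" where
  "vgauss k = density (gauss k) (\<lambda>x. ennreal (vdmp k x / Zv k))"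

lemma vdmp_measurable: "vdmp k \<in> borel_measurable (gauss k)"
  unfolding measurable_gauss_prod by (rule tame_measurable[OF tame_vdmp])

lemma integral_vgauss:
  assumes "f \<in> borel_measurable (gauss k)"
  shows "(\<integral>x. f x \<partial>vgauss k) = (\<integral>x. f x * vdmp k x \<partial>gauss k) / Zv k"
proof -
  have "(\<integral>x. f x \<partial>vgauss k) = (\<integral>x. (vdmp k x / Zv k) *\<^sub>R f x \<partial>gauss k)"
    unfolding vgauss_def
    by (rule integral_density) (use assms vdmp_measurable vdmp_nonneg Zv_pos[of k] in auto)
  also have "\<dots> = (\<integral>x. (f x * vdmp k x) / Zv k \<partial>gauss k)" by (simp add: mult.commute)
  finally show ?thesis by simp
qed

lemma prob_space_vgauss: "prob_space (vgauss k)"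
proof (rule prob_spaceI)
  have nn: "AE x in gauss k. 0 \<le> vdmp k x / Zv k" using vdmp_nonneg Zv_pos[of k] by (intro AE_I2) (simp add: less_imp_le)
  have "emeasure (vgauss k) (space (vgauss k)) = (\<integral>\<^sup>+x. ennreal (vdmp k x / Zv k) \<partial>gauss k)"
    unfolding vgauss_def using vdmp_measurable by (subst emeasure_density) (auto intro!: nn_integral_cong)
  also have "\<dots> = ennreal (\<integral>x. vdmp k x / Zv k \<partial>gauss k)"
    by (rule nn_integral_eq_integral[OF _ nn]) (intro integrable_divide integrable_gauss tame_vdmp)
  also have "\<dots> = 1" using Zv_pos[of k] by (simp add: Zv_def)
  finally show "emeasure (vgauss k) (space (vgauss k)) = 1" .
qed

text \<open>Outside the chamber, where the Vandermonde weight is \<open>0\<close>, the vector is replaced by a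
  decreasing one, so that all values lie where the power sums separate points.\<close>

definition sorted_part :: "nat \<Rightarrow> (nat \<Rightarrow> real) \<Rightarrow> nat \<Rightarrow> real" where
  "sorted_part k x i = (if i < k \<and> chamber k x then x i else 0)"

lemma sorted_part_measurable: "sorted_part k \<in> gauss k \<rightarrow>\<^sub>M borel"
proof (rule measurable_coordinatewise_then_product)
  fix i
  have "(\<lambda>x. if chamber k x then x i else (0::real)) \<in> borel_measurable (Pi\<^sub>M {..<k} (\<lambda>_. borel))" if "i < k"
    using tame_measurable[OF tame_chamber[OF tame_coord[of "{..<k}" i]]] that by simp
  then show "(\<lambda>x. sorted_part k x i) \<in> borel_measurable (gauss k)"
    unfolding measurable_gauss_prod sorted_part_def by (cases "i < k") auto
qed

lemma sorted_part_vdmp: "f (sorted_part k x) * vdmp k x = f (trunc k x) * vdmp k x"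
proof (cases "chamber k x")
  case True
  then have "sorted_part k x = trunc k x" by (auto simp: sorted_part_def trunc_def fun_eq_iff)
  then show ?thesis by simp
qed (simp add: vdmp_chamber)

lemma psum_trunc: "psum k r (trunc k x) = psum k r x"
  by (simp add: psum_def trunc_def)

lemma stat_ring_trunc: "f \<in> stat_ring k \<Longrightarrow> f (trunc k x) = f x"
  by (induction rule: stat_ring.induct) (auto simp: psum_trunc)

text \<open>The convergence theorem for algebras of test functions, applied to a constant sequence:
  expectations agree on \<open>stat_ring\<close>, and both vectors are decreasing.\<close>

theorem goe_eigvec_law:
  fixes F :: "(nat \<Rightarrow> real) \<Rightarrow> real"
  assumes F: "continuous_on UNIV F" "\<And>x. \<bar>F x\<bar> \<le> C"
  shows "(\<integral>x. F (eigvec k x) \<partial>goe_space k) = (\<integral>x. F (trunc k x) * vdmp k x \<partial>gauss k) / Zv k"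
proof -
  have sp: "(\<lambda>x. f (sorted_part k x)) \<in> borel_measurable (gauss k)" if "continuous_on UNIV f" for f :: "(nat \<Rightarrow> real) \<Rightarrow> real"
    by (rule measurable_compose[OF sorted_part_measurable borel_measurable_continuous_onI[OF that]])
  have spV: "sorted_part k \<in> vgauss k \<rightarrow>\<^sub>M borel" unfolding vgauss_def using sorted_part_measurable by simp
  have chsp: "chamber k (sorted_part k x)" for x
  proof (cases "chamber k x")
    case True
    then show ?thesis unfolding chamber_def sorted_part_def pairs_def by auto
  qed (auto simp: chamber_def sorted_part_def pairs_def)
  have "(\<lambda>n::nat. \<integral>x. F (sorted_part k x) \<partial>vgauss k) \<longlonglongrightarrow> (\<integral>x. F (eigvec k x) \<partial>goe_space k)"
  proof (rule expectation_convergence_algebra[where R = "stat_ring k" and C = C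
        and M = "\<lambda>_. vgauss k" and X = "\<lambda>_. sorted_part k" and L = "goe_space k" and Y = "eigvec k"])
    show "f \<in> stat_ring k \<Longrightarrow> (\<lambda>n::nat. \<integral>x. f (sorted_part k x) \<partial>vgauss k) \<longlonglongrightarrow> (\<integral>x. f (eigvec k x) \<partial>goe_space k)" for f
      using stat_ring_expectation(2)[of f k "eigvec k", OF _ psum_eigvec]
      by (simp add: integral_vgauss sp stat_ring_continuous sorted_part_vdmp stat_ring_trunc)
    show "\<exists>K. compact K \<and> (\<forall>x\<in>K. \<forall>y\<in>K. x \<noteq> y \<longrightarrow> (\<exists>f\<in>stat_ring k. f x \<noteq> f y)) \<and>
      (\<forall>\<^sub>F n::nat in sequentially. measure (vgauss k) {x \<in> space (vgauss k). sorted_part k x \<notin> K} \<le> e) \<and>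
      measure (goe_space k) {x \<in> space (goe_space k). eigvec k x \<notin> K} \<le> e" if e: "e > 0" for e
    proof -
      interpret v: prob_space "vgauss k" by (rule prob_space_vgauss)
      interpret g: prob_space "goe_space k" by (rule prob_space_goe_space)
      have m1: "(\<lambda>x. psum k 2 (sorted_part k x)) \<in> borel_measurable (vgauss k)"
        unfolding vgauss_def using sp[OF continuous_psum] by simp
      have m2: "(\<lambda>x. psum k 2 (eigvec k x)) \<in> borel_measurable (goe_space k)"
        by (rule measurable_compose[OF eigvec_measurable borel_measurable_continuous_onI[OF continuous_psum]])
      obtain N1 :: nat where N1: "measure (vgauss k) {x \<in> space (vgauss k). psum k 2 (sorted_part k x) > (real N1)\<^sup>2} \<le> e"
        using tail_small[OF prob_space_vgauss m1 e] by blast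
      obtain N2 :: nat where N2: "measure (goe_space k) {x \<in> space (goe_space k). psum k 2 (eigvec k x) > (real N2)\<^sup>2} \<le> e"
        using tail_small[OF prob_space_goe_space m2 e] by blast
      define N where "N = max N1 N2"
      have sq: "(real N1)\<^sup>2 \<le> (real N)\<^sup>2" "(real N2)\<^sup>2 \<le> (real N)\<^sup>2"
        unfolding N_def by (intro power_mono; simp)+
      have lt: "(real N1)\<^sup>2 < z" "(real N2)\<^sup>2 < z" if "\<not> z \<le> (real N)\<^sup>2" for z
        using sq that by linarith+
      have "measure (vgauss k) {x \<in> space (vgauss k). sorted_part k x \<notin> sorted_ball k N} \<le>
          measure (vgauss k) {x \<in> space (vgauss k). psum k 2 (sorted_part k x) > (real N1)\<^sup>2}"
        by (intro v.finite_measure_mono) (use chsp m1 in \<open>auto simp: sorted_ball_def sorted_part_def intro!: lt\<close>)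
      moreover have "measure (goe_space k) {x \<in> space (goe_space k). eigvec k x \<notin> sorted_ball k N} \<le>
          measure (goe_space k) {x \<in> space (goe_space k). psum k 2 (eigvec k x) > (real N2)\<^sup>2}"
        by (intro g.finite_measure_mono) (use chamber_eigvec m2 in \<open>auto simp: sorted_ball_def eigvec_def intro!: lt\<close>)
      ultimately show ?thesis using N1 N2 compact_sorted_ball stat_ring_separates
        by (intro exI[of _ "sorted_ball k N"]) auto
    qed
  qed (use F prob_space_vgauss prob_space_goe_space spV eigvec_measurable stat_ring_continuous stat_ring_bounded in
      \<open>auto intro: stat_ring.intros\<close>)
  then have "(\<integral>x. F (sorted_part k x) \<partial>vgauss k) = (\<integral>x. F (eigvec k x) \<partial>goe_space k)"
    using LIMSEQ_unique tendsto_const by blast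
  then show ?thesis using integral_vgauss[OF sp[OF F(1)]] by (simp add: sorted_part_vdmp)
qed

section \<open>Letter counts of random words\<close>

lemma sum_words_prod:
  fixes z :: "nat \<Rightarrow> 'a::comm_ring_1"
  shows "(\<Sum>w\<in>words N k. prod_list (map z w)) = (\<Sum>r<k. z r) ^ N"
proof (induction N)
  case 0
  have "words 0 k = {[]}" by (auto simp: words_def)
  then show ?case by simp
next
  case (Suc N)
  have e: "words (Suc N) k = (\<lambda>(c, w). c # w) ` ({..<k} \<times> words N k)"
    by (auto simp: words_def length_Suc_conv image_iff)
  have "(\<Sum>w\<in>words (Suc N) k. prod_list (map z w)) = (\<Sum>(c, w)\<in>{..<k} \<times> words N k. z c * prod_list (map z w))"
    unfolding e by (subst sum.reindex) (auto simp: inj_on_def split_beta)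
  also have "\<dots> = (\<Sum>c<k. z c) * (\<Sum>w\<in>words N k. prod_list (map z w))"
    by (simp add: sum_product sum.cartesian_product)
  finally show ?case using Suc by simp
qed

lemma card_words: "card (words N k) = k ^ N"
  using card_lists_length_eq[of "{..<k}" N] by (simp add: words_def conj_commute)

definition step :: "nat \<Rightarrow> nat \<Rightarrow> real" where "step k n = sqrt (real k / real n)"
text \<open>The staircase adds \<open>k (k - 1) / 2\<close> letters to the \<open>n\<close> letters of a
  ballot word.\<close>

definition wlen :: "nat \<Rightarrow> nat \<Rightarrow> nat" where "wlen k n = n + k * (k - 1) div 2"

definition scaled :: "nat \<Rightarrow> nat \<Rightarrow> nat list \<Rightarrow> nat \<Rightarrow> real" where
  "scaled k n w r = (if r < k then step k n * (real (count_list w r) - real (wlen k n) / real k) else 0)"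

definition wmean :: "nat \<Rightarrow> nat \<Rightarrow> (nat list \<Rightarrow> real) \<Rightarrow> real" where
  "wmean k n f = (\<Sum>w\<in>words (wlen k n) k. f w) / real k ^ wlen k n"

definition wmeasure :: "nat \<Rightarrow> nat \<Rightarrow> nat list measure" where
  "wmeasure k n = uniform_count_measure (words (wlen k n) k)"

lemma words_nonempty: "k \<ge> 1 \<Longrightarrow> words N k \<noteq> {}"
  using card_words[of N k] by (metis card.empty power_not_zero not_one_le_zero)

lemma prob_space_wmeasure: "k \<ge> 1 \<Longrightarrow> prob_space (wmeasure k n)"
  unfolding wmeasure_def by (intro prob_space_uniform_count_measure finite_words words_nonempty)

lemma integral_wmeasure: "(\<integral>w. f w \<partial>wmeasure k n) = wmean k n f" for f :: "nat list \<Rightarrow> real"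
  unfolding wmeasure_def wmean_def
  by (subst integral_uniform_count_measure[OF finite_words]) (simp add: card_words)

lemma sum_theta_count:
  assumes "w \<in> words N k"
  shows "(\<Sum>r<k. \<theta> r * real (count_list w r)) = (\<Sum>c\<leftarrow>w. \<theta> c)"
proof -
  have "set w \<subseteq> {..<k}" using assms by (simp add: words_def)
  then show ?thesis
  proof (induction w)
    case (Cons c w)
    have "(\<Sum>r<k. \<theta> r * real (count_list (c # w) r)) = (\<Sum>r<k. \<theta> r * real (count_list w r) + (if r = c then \<theta> r else 0))"
      by (intro sum.cong) (auto simp: algebra_simps)
    then show ?case using Cons by (simp add: sum.distrib)
  qed simp
qed

definition centred :: "nat \<Rightarrow> (nat \<Rightarrow> real) \<Rightarrow> nat \<Rightarrow> real" where
  "centred k \<theta> r = \<theta> r - (\<Sum>i<k. \<theta> i) / real k"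

lemma sum_centred: "k \<ge> 1 \<Longrightarrow> (\<Sum>r<k. centred k \<theta> r) = 0"
  by (simp add: centred_def sum_subtractf)

text \<open>A linear functional of the letter counts is a sum of independent contributions, one for each
  letter; centring the coefficients accounts for centring the counts.\<close>

lemma dot_scaled:
  assumes w: "w \<in> words (wlen k n) k" and k: "k \<ge> 1"
  shows "(\<Sum>r<k. \<theta> r * scaled k n w r) = (\<Sum>c\<leftarrow>w. step k n * centred k \<theta> c)"
proof -
  have l: "length w = wlen k n" using w by (simp add: words_def)
  have "(\<Sum>r<k. \<theta> r * scaled k n w r) = step k n * ((\<Sum>r<k. \<theta> r * real (count_list w r)) - (\<Sum>r<k. \<theta> r) * real (wlen k n) / real k)"
    by (simp add: scaled_def right_diff_distrib sum_subtractf sum_distrib_left sum_distrib_right sum_divide_distrib mult_ac)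
  also have "\<dots> = (\<Sum>c\<leftarrow>w. step k n * centred k \<theta> c)"
    unfolding sum_theta_count[OF w] l[symmetric]
    by (induction w) (simp_all add: centred_def algebra_simps add_divide_distrib)
  finally show ?thesis .
qed

lemma prod_list_exp: "prod_list (map (\<lambda>c. exp (f c)) w) = exp (\<Sum>c\<leftarrow>w. f c)"
  for f :: "'b \<Rightarrow> 'a::{real_normed_field,banach}"
  by (induction w) (simp_all add: exp_add)

text \<open>The letters are independent, so the expectation is a power.\<close>

lemma wmean_exp:
  assumes k: "k \<ge> 1"
  shows "wmean k n (\<lambda>w. exp (\<Sum>r<k. \<theta> r * scaled k n w r)) =
    ((\<Sum>c<k. exp (step k n * centred k \<theta> c)) / real k) ^ wlen k n"
proof -
  have "(\<Sum>w\<in>words (wlen k n) k. exp (\<Sum>r<k. \<theta> r * scaled k n w r)) =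
    (\<Sum>w\<in>words (wlen k n) k. prod_list (map (\<lambda>c. exp (step k n * centred k \<theta> c)) w))"
    by (intro sum.cong refl) (simp add: dot_scaled[OF _ k] prod_list_exp)
  then show ?thesis unfolding wmean_def sum_words_prod by (simp add: power_divide)
qed

lemma wmean_iexp:
  assumes k: "k \<ge> 1"
  shows "(\<Sum>w\<in>words (wlen k n) k. iexp (\<Sum>r<k. \<theta> r * scaled k n w r)) / of_real (real k ^ wlen k n) =
    ((\<Sum>c<k. iexp (step k n * centred k \<theta> c)) / of_real (real k)) ^ wlen k n"
proof -
  have "iexp (\<Sum>r<k. \<theta> r * scaled k n w r) = prod_list (map (\<lambda>c. iexp (step k n * centred k \<theta> c)) w)"
    if w: "w \<in> words (wlen k n) k" for w
  proof -
    have "\<i> * of_real (\<Sum>c\<leftarrow>w. step k n * centred k \<theta> c) = (\<Sum>c\<leftarrow>w. \<i> * of_real (step k n * centred k \<theta> c))"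
      by (induction w) (simp_all add: distrib_left)
    then show ?thesis unfolding dot_scaled[OF w k] prod_list_exp by (rule arg_cong)
  qed
  then have "(\<Sum>w\<in>words (wlen k n) k. iexp (\<Sum>r<k. \<theta> r * scaled k n w r)) =
    (\<Sum>w\<in>words (wlen k n) k. prod_list (map (\<lambda>c. iexp (step k n * centred k \<theta> c)) w))" by (rule sum.cong[OF refl])
  then show ?thesis unfolding sum_words_prod by (simp add: power_divide)
qed

lemma step_tendsto: "(\<lambda>n. step k n) \<longlonglongrightarrow> 0"
proof -
  have "(\<lambda>n. real k * (1 / real n)) \<longlonglongrightarrow> real k * 0" by (intro tendsto_mult tendsto_const lim_1_over_n)
  then have "(\<lambda>n. sqrt (real k * (1 / real n))) \<longlonglongrightarrow> sqrt (real k * 0)" by (rule tendsto_real_sqrt)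
  then show ?thesis by (simp add: step_def)
qed

lemma step_sq: "(step k n)\<^sup>2 = real k / real n"
  by (simp add: step_def)

lemma wlen_step_tendsto: "(\<lambda>n. real (wlen k n) * (step k n)\<^sup>2) \<longlonglongrightarrow> real k"
proof -
  have "(\<lambda>n. real k + real k * real (k * (k - 1) div 2) * (1 / real n)) \<longlonglongrightarrow> real k + real k * real (k * (k - 1) div 2) * 0"
    by (intro tendsto_intros lim_1_over_n)
  moreover have "\<forall>\<^sub>F n in sequentially. real k + real k * real (k * (k - 1) div 2) * (1 / real n) = real (wlen k n) * (step k n)\<^sup>2"
    by (intro eventually_sequentiallyI[of 1]) (simp add: step_sq wlen_def field_simps)
  ultimately show ?thesis using Lim_transform_eventually by fastforce
qed

lemma exp_le_quadratic: "exp x \<le> 1 + x + x\<^sup>2" if "x \<le> 1" for x :: real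
proof (cases "x \<ge> 0")
  case True
  then show ?thesis using exp_bound[of x] that by simp
next
  case False
  define y where "y = - x"
  have y: "y \<ge> 0" using False by (simp add: y_def)
  have "1 \<le> (1 - y + y\<^sup>2) * (1 + y)"
    using y by (simp add: algebra_simps power2_eq_square)
  also have "\<dots> \<le> (1 - y + y\<^sup>2) * exp y"
  proof (intro mult_left_mono exp_ge_add_one_self)
    have "0 \<le> (y - 1)\<^sup>2 + y" using y by simp
    then show "0 \<le> 1 - y + y\<^sup>2" by (simp add: power2_eq_square algebra_simps)
  qed
  finally show ?thesis by (simp add: y_def exp_minus field_simps)
qed

text \<open>Taylor expansion of one factor to second order: the linear terms cancel as the coefficients are
  centred, and the number of factors times \<open>(step k n)\<^sup>2\<close> tends to
  \<open>k\<close>.\<close>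

lemma char_limit:
  assumes k: "k \<ge> 1"
  shows "(\<lambda>n. ((\<Sum>c<k. iexp (step k n * centred k \<theta> c)) / of_real (real k)) ^ wlen k n) \<longlonglongrightarrow>
    of_real (exp (- (\<Sum>c<k. (centred k \<theta> c)\<^sup>2) / 2))"
proof -
  define Q where "Q = (\<Sum>c<k. (centred k \<theta> c)\<^sup>2)"
  define T where "T = (\<Sum>c<k. \<bar>centred k \<theta> c\<bar> ^ 3)"
  define u where "u n = (\<Sum>c<k. iexp (step k n * centred k \<theta> c)) / of_real (real k)" for n
  \<comment> \<open>Each factor is \<open>1 - y n\<close> up to an error of third order in \<open>step k n\<close>.\<close>
  define y where "y n = (step k n)\<^sup>2 * Q / (2 * real k)" for n
  have Q: "Q \<ge> 0" unfolding Q_def by (intro sum_nonneg) auto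
  have T: "T \<ge> 0" unfolding T_def by (intro sum_nonneg) auto
  have y0: "y n \<ge> 0" for n using Q by (simp add: y_def)
  have s0: "step k n \<ge> 0" for n by (simp add: step_def)
  have u1: "norm (u n) \<le> 1" for n
  proof -
    have "norm (\<Sum>c<k. iexp (step k n * centred k \<theta> c)) \<le> (\<Sum>c<k. norm (iexp (step k n * centred k \<theta> c)))" by (rule norm_sum)
    also have "\<dots> = real k" by simp
    finally show ?thesis using k by (simp add: u_def norm_divide)
  qed
  have ud: "norm (u n - of_real (1 - y n)) \<le> (step k n) ^ 3 * T" for n
  proof -
    define s where "s = step k n"
    have a: "norm (iexp (s * t) - (1 + \<i> * of_real (s * t) - of_real ((s * t)\<^sup>2 / 2))) \<le> s ^ 3 * \<bar>t\<bar> ^ 3" for t :: real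
    proof -
      have two: "(\<Sum>j\<le>2. z ^ j / fact j) = 1 + z + z\<^sup>2 / 2" for z :: complex
        by (simp add: numeral_2_eq_2)
      have "norm (iexp (s * t) - (\<Sum>j\<le>2. (\<i> * of_real (s * t)) ^ j / fact j)) \<le> \<bar>s * t\<bar> ^ Suc 2 / fact (Suc 2)"
        by (rule iexp_approx1)
      also have "(\<Sum>j\<le>2. (\<i> * of_real (s * t)) ^ j / fact j) = 1 + \<i> * of_real (s * t) - of_real ((s * t)\<^sup>2 / 2)"
        unfolding two by (simp only: power_mult_distrib i_squared of_real_power of_real_divide of_real_numeral) (simp add: power_mult_distrib)
      also have "\<bar>s * t\<bar> ^ Suc 2 / fact (Suc 2) \<le> \<bar>s * t\<bar> ^ 3" using zero_le_power[of "\<bar>s * t\<bar>" 3] by (simp add: fact_numeral del: zero_le_power)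
      also have "\<dots> = s ^ 3 * \<bar>t\<bar> ^ 3" using s0[of n] by (simp add: s_def abs_mult power_mult_distrib)
      finally show ?thesis .
    qed
    have "(\<Sum>c<k. 1 + \<i> * of_real (s * centred k \<theta> c) - of_real ((s * centred k \<theta> c)\<^sup>2 / 2)) =
      of_nat k + \<i> * of_real (s * (\<Sum>c<k. centred k \<theta> c)) - of_real (s\<^sup>2 * Q / 2)"
      unfolding Q_def by (simp add: sum.distrib sum_subtractf sum_distrib_left power_mult_distrib sum_divide_distrib)
    also have "\<dots> = of_real (real k) * of_real (1 - y n)"
      using k by (simp add: sum_centred y_def s_def field_simps)
    finally have e: "of_real (real k) * of_real (1 - y n) = (\<Sum>c<k. 1 + \<i> * of_real (s * centred k \<theta> c) - of_real ((s * centred k \<theta> c)\<^sup>2 / 2))" ..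
    have "of_real (real k) * (u n - of_real (1 - y n)) =
      (\<Sum>c<k. iexp (s * centred k \<theta> c) - (1 + \<i> * of_real (s * centred k \<theta> c) - of_real ((s * centred k \<theta> c)\<^sup>2 / 2)))"
      unfolding right_diff_distrib e sum_subtractf using k by (simp add: u_def s_def)
    then have "real k * norm (u n - of_real (1 - y n)) =
      norm (\<Sum>c<k. iexp (s * centred k \<theta> c) - (1 + \<i> * of_real (s * centred k \<theta> c) - of_real ((s * centred k \<theta> c)\<^sup>2 / 2)))"
      by (metis norm_mult norm_of_real abs_of_nat)
    also have "\<dots> \<le> (\<Sum>c<k. s ^ 3 * \<bar>centred k \<theta> c\<bar> ^ 3)" by (intro sum_norm_le a)
    also have "\<dots> = s ^ 3 * T" by (simp add: T_def sum_distrib_left)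
    finally have "real k * norm (u n - of_real (1 - y n)) \<le> s ^ 3 * T" .
    moreover have "1 * norm (u n - of_real (1 - y n)) \<le> real k * norm (u n - of_real (1 - y n))"
      using k by (intro mult_right_mono) auto
    ultimately show ?thesis by (simp add: s_def)
  qed
  have vd: "\<bar>exp (- y n) - (1 - y n)\<bar> \<le> (y n)\<^sup>2" for n
  proof -
    have "exp (- y n) \<ge> 1 - y n" using exp_ge_add_one_self[of "- y n"] by simp
    moreover have "exp (- y n) \<le> 1 - y n + (y n)\<^sup>2" using exp_le_quadratic[of "- y n"] y0[of n] by simp
    ultimately show ?thesis by simp
  qed
  have diff: "norm (u n ^ wlen k n - of_real (exp (- y n)) ^ wlen k n) \<le>
      real (wlen k n) * (step k n)\<^sup>2 * (step k n * T + (step k n)\<^sup>2 * (Q / (2 * real k))\<^sup>2)" for n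
  proof -
    have "norm (u n ^ wlen k n - of_real (exp (- y n)) ^ wlen k n) \<le> real (wlen k n) * norm (u n - of_real (exp (- y n)))"
      by (rule norm_power_diff) (use u1 y0 in auto)
    also have "norm (u n - of_real (exp (- y n))) \<le> norm (u n - of_real (1 - y n)) + norm (complex_of_real (1 - y n) - of_real (exp (- y n)))"
      by (metis norm_diff_triangle_ineq norm_triangle_ineq diff_add_cancel add_diff_eq order_refl norm_diff_triangle_le)
    also have "norm (complex_of_real (1 - y n) - of_real (exp (- y n))) \<le> (y n)\<^sup>2"
      using vd[of n] by (simp only: of_real_diff[symmetric] norm_of_real abs_minus_commute)
    also have "norm (u n - of_real (1 - y n)) \<le> (step k n) ^ 3 * T" by (rule ud)
    also have "(step k n) ^ 3 * T + (y n)\<^sup>2 = (step k n)\<^sup>2 * (step k n * T + (step k n)\<^sup>2 * (Q / (2 * real k))\<^sup>2)"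
      by (simp add: y_def power_mult_distrib power_divide power3_eq_cube power2_eq_square algebra_simps)
    finally show ?thesis by (simp add: mult_left_mono mult.assoc)
  qed
  have "(\<lambda>n. real (wlen k n) * (step k n)\<^sup>2 * (step k n * T + (step k n)\<^sup>2 * (Q / (2 * real k))\<^sup>2)) \<longlonglongrightarrow>
    real k * (0 * T + 0\<^sup>2 * (Q / (2 * real k))\<^sup>2)"
    by (intro tendsto_intros wlen_step_tendsto step_tendsto)
  then have "(\<lambda>n. real (wlen k n) * (step k n)\<^sup>2 * (step k n * T + (step k n)\<^sup>2 * (Q / (2 * real k))\<^sup>2)) \<longlonglongrightarrow> 0" by simp
  then have 1: "(\<lambda>n. u n ^ wlen k n - of_real (exp (- y n)) ^ wlen k n) \<longlonglongrightarrow> 0"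
    by (rule Lim_null_comparison[rotated]) (use diff in auto)
  have "(\<lambda>n. exp (- (real (wlen k n) * (step k n)\<^sup>2 * (Q / (2 * real k))))) \<longlonglongrightarrow> exp (- (real k * (Q / (2 * real k))))"
    by (intro tendsto_intros wlen_step_tendsto)
  moreover have "exp (- (real (wlen k n) * (step k n)\<^sup>2 * (Q / (2 * real k)))) = exp (- y n) ^ wlen k n" for n
    by (simp add: y_def mult_ac flip: exp_of_nat_mult)
  ultimately have "(\<lambda>n. exp (- y n) ^ wlen k n) \<longlonglongrightarrow> exp (- Q / 2)" using k by simp
  then have "(\<lambda>n. complex_of_real (exp (- y n) ^ wlen k n)) \<longlonglongrightarrow> of_real (exp (- Q / 2))" by (rule tendsto_of_real)
  then have 2: "(\<lambda>n. of_real (exp (- y n)) ^ wlen k n) \<longlonglongrightarrow> complex_of_real (exp (- Q / 2))" by simp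
  from tendsto_add[OF 1 2] show ?thesis unfolding u_def Q_def by simp
qed

text \<open>A Gaussian vector minus its mean. The scaled counts have sum \<open>0\<close>, and so has their
  limit.\<close>

definition gcentred :: "nat \<Rightarrow> (nat \<Rightarrow> real) \<Rightarrow> nat \<Rightarrow> real" where
  "gcentred k x r = (if r < k then centred k x r else 0)"

lemma dot_gcentred: "(\<Sum>r<k. \<theta> r * gcentred k x r) = (\<Sum>r<k. centred k \<theta> r * x r)"
proof -
  have "(\<Sum>r<k. \<theta> r * gcentred k x r) = (\<Sum>r<k. \<theta> r * x r) - (\<Sum>r<k. \<theta> r) * (\<Sum>i<k. x i) / real k"
    by (simp add: gcentred_def centred_def right_diff_distrib sum_subtractf sum_distrib_right flip: sum_divide_distrib)
  also have "\<dots> = (\<Sum>r<k. centred k \<theta> r * x r)"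
    by (simp add: centred_def left_diff_distrib sum_subtractf flip: sum_distrib_left sum_divide_distrib)
  finally show ?thesis .
qed

lemma gauss_iexp:
  "integrable (gauss k) (\<lambda>x. iexp (\<Sum>r<k. c r * x r))"
  "(\<integral>x. iexp (\<Sum>r<k. c r * x r) \<partial>gauss k) = of_real (exp (- (\<Sum>r<k. (c r)\<^sup>2) / 2))"
proof -
  let ?N = "\<lambda>_::nat. density lborel (normal_density 0 1)"
  interpret product_sigma_finite ?N
    by (intro product_sigma_finite.intro prob_space_imp_sigma_finite prob_space_normal_density) simp
  interpret p: prob_space "density lborel (normal_density 0 1)" by (rule prob_space_normal_density) simp
  have e: "iexp (\<Sum>r<k. c r * x r) = (\<Prod>r<k. iexp (c r * x r))" for x :: "nat \<Rightarrow> real"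
    by (simp add: exp_sum sum_distrib_left)
  have i: "integrable (density lborel (normal_density 0 1)) (\<lambda>t. iexp (c r * t))" for r
    by (rule p.integrable_const_bound[of _ 1]) auto
  show "integrable (gauss k) (\<lambda>x. iexp (\<Sum>r<k. c r * x r))"
    unfolding gauss_prod_def e by (intro product_integrable_prod i) auto
  have "(\<integral>x. iexp (\<Sum>r<k. c r * x r) \<partial>gauss k) = (\<Prod>r<k. \<integral>t. iexp (c r * t) \<partial>density lborel (normal_density 0 1))"
    unfolding gauss_prod_def e by (intro product_integral_prod i) auto
  also have "\<dots> = (\<Prod>r<k. complex_of_real (exp (- (c r)\<^sup>2 / 2)))"
    using fun_cong[OF char_std_normal_distribution] unfolding char_def by (intro prod.cong refl) simp
  also have "\<dots> = of_real (exp (\<Sum>r<k. - (c r)\<^sup>2 / 2))" by (simp add: exp_sum)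
  also have "(\<Sum>r<k. - (c r)\<^sup>2 / 2) = - (\<Sum>r<k. (c r)\<^sup>2) / 2" by (simp add: sum_negf sum_divide_distrib)
  finally show "(\<integral>x. iexp (\<Sum>r<k. c r * x r) \<partial>gauss k) = of_real (exp (- (\<Sum>r<k. (c r)\<^sup>2) / 2))" .
qed

text \<open>A wave is encoded by its amplitude, its vector of frequencies and its phase.\<close>

definition wave :: "nat \<Rightarrow> real \<times> (nat \<Rightarrow> real) \<times> real \<Rightarrow> (nat \<Rightarrow> real) \<Rightarrow> real" where
  "wave k t x = fst t * cos ((\<Sum>r<k. fst (snd t) r * x r) + snd (snd t))"

definition trig_ring :: "nat \<Rightarrow> ((nat \<Rightarrow> real) \<Rightarrow> real) set" where
  "trig_ring k = {f. \<exists>L. f = (\<lambda>x. \<Sum>t\<leftarrow>L. wave k t x)}"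

lemma trig_ring_const: "(\<lambda>_. c) \<in> trig_ring k"
  unfolding trig_ring_def by (auto intro!: exI[of _ "[(c, \<lambda>_. 0, 0)]"] simp: wave_def)

lemma trig_ring_add: "f \<in> trig_ring k \<Longrightarrow> g \<in> trig_ring k \<Longrightarrow> (\<lambda>x. f x + g x) \<in> trig_ring k"
proof -
  assume "f \<in> trig_ring k" "g \<in> trig_ring k"
  then obtain L L' where "f = (\<lambda>x. \<Sum>t\<leftarrow>L. wave k t x)" "g = (\<lambda>x. \<Sum>t\<leftarrow>L'. wave k t x)"
    unfolding trig_ring_def by blast
  then show ?thesis unfolding trig_ring_def by (auto intro!: exI[of _ "L @ L'"])
qed

text \<open>The product of two cosines is half the sum of the cosines of the sum and of the
  difference.\<close>

lemma trig_ring_mult: "f \<in> trig_ring k \<Longrightarrow> g \<in> trig_ring k \<Longrightarrow> (\<lambda>x. f x * g x) \<in> trig_ring k"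
proof -
  assume "f \<in> trig_ring k" "g \<in> trig_ring k"
  then obtain L L' where L: "f = (\<lambda>x. \<Sum>t\<leftarrow>L. wave k t x)" "g = (\<lambda>x. \<Sum>t\<leftarrow>L'. wave k t x)"
    unfolding trig_ring_def by blast
  define tp where "tp t u = [(fst t * fst u / 2, \<lambda>r. fst (snd t) r + fst (snd u) r, snd (snd t) + snd (snd u)),
     (fst t * fst u / 2, \<lambda>r. fst (snd t) r - fst (snd u) r, snd (snd t) - snd (snd u))]"
    for t u :: "real \<times> (nat \<Rightarrow> real) \<times> real"
  have tp: "(\<Sum>v\<leftarrow>tp t u. wave k v x) = wave k t x * wave k u x" for t u x
  proof -
    define A where "A = (\<Sum>r<k. fst (snd t) r * x r) + snd (snd t)"
    define B where "B = (\<Sum>r<k. fst (snd u) r * x r) + snd (snd u)"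
    have "(\<Sum>r<k. (fst (snd t) r + fst (snd u) r) * x r) + (snd (snd t) + snd (snd u)) = A + B"
      "(\<Sum>r<k. (fst (snd t) r - fst (snd u) r) * x r) + (snd (snd t) - snd (snd u)) = A - B"
      by (simp_all add: A_def B_def algebra_simps sum.distrib sum_subtractf)
    then have "(\<Sum>v\<leftarrow>tp t u. wave k v x) = fst t * fst u / 2 * (cos (A + B) + cos (A - B))"
      by (simp add: tp_def wave_def distrib_left)
    also have "\<dots> = fst t * cos A * (fst u * cos B)" by (simp add: cos_add cos_diff)
    finally show ?thesis by (simp add: wave_def A_def B_def)
  qed
  have i: "(\<Sum>v\<leftarrow>concat (map (tp t) M). wave k v x) = wave k t x * (\<Sum>u\<leftarrow>M. wave k u x)" for t M x
    by (induction M) (simp_all add: tp distrib_left)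
  have "(\<Sum>v\<leftarrow>concat (map (\<lambda>t. concat (map (tp t) L')) L). wave k v x) = (\<Sum>t\<leftarrow>L. wave k t x) * (\<Sum>t\<leftarrow>L'. wave k t x)" for x
    by (induction L) (simp_all add: i distrib_right)
  then show ?thesis unfolding trig_ring_def L by (auto intro!: exI[of _ "concat (map (\<lambda>t. concat (map (tp t) L')) L)"])
qed

lemma trig_ring_continuous: "f \<in> trig_ring k \<Longrightarrow> continuous_on UNIV f"
proof -
  assume "f \<in> trig_ring k"
  then obtain L where f: "f = (\<lambda>x. \<Sum>t\<leftarrow>L. wave k t x)" unfolding trig_ring_def by blast
  have w: "continuous_on UNIV (wave k t)" for t
    unfolding wave_def[abs_def] by (intro continuous_intros continuous_on_product_coordinates)
  show ?thesis unfolding f by (induction L) (auto intro!: continuous_intros w)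
qed

lemma trig_ring_bounded: "f \<in> trig_ring k \<Longrightarrow> \<exists>B. \<forall>x. \<bar>f x\<bar> \<le> B"
proof -
  assume "f \<in> trig_ring k"
  then obtain L where f: "f = (\<lambda>x. \<Sum>t\<leftarrow>L. wave k t x)" unfolding trig_ring_def by blast
  have "\<bar>\<Sum>t\<leftarrow>L. wave k t x\<bar> \<le> (\<Sum>t\<leftarrow>L. \<bar>fst t\<bar>)" for x
  proof (induction L)
    case (Cons t L)
    have "\<bar>wave k t x\<bar> \<le> \<bar>fst t\<bar>" by (simp add: wave_def abs_mult mult_left_le)
    then show ?case using Cons by auto
  qed simp
  then show ?thesis unfolding f by blast
qed

lemma wmean_add: "wmean k n (\<lambda>w. f w + g w) = wmean k n f + wmean k n g"
  by (simp add: wmean_def sum.distrib add_divide_distrib)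

lemma cos_via_iexp: "cos (a + b) = Re (iexp b * iexp a)"
proof -
  have "iexp b * iexp a = iexp (a + b)" by (simp add: exp_add distrib_left mult.commute)
  then show ?thesis by (simp only: cis_conv_exp[symmetric] cis.sel)
qed

text \<open>For a single wave this is convergence of the characteristic function.\<close>

lemma trig_ring_conv:
  assumes k: "k \<ge> 1" and f: "f \<in> trig_ring k"
  shows "(\<lambda>n. wmean k n (\<lambda>w. f (scaled k n w))) \<longlonglongrightarrow> (\<integral>x. f (gcentred k x) \<partial>gauss k)"
proof -
  obtain L where L: "f = (\<lambda>x. \<Sum>t\<leftarrow>L. wave k t x)" using f unfolding trig_ring_def by blast
  have one: "(\<lambda>n. wmean k n (\<lambda>w. wave k t (scaled k n w))) \<longlonglongrightarrow> (\<integral>x. wave k t (gcentred k x) \<partial>gauss k) \<and>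
    integrable (gauss k) (\<lambda>x. wave k t (gcentred k x))" for t
  proof -
    define a \<theta> \<phi> where "a = fst t" and "\<theta> = fst (snd t)" and "\<phi> = snd (snd t)"
    have w: "wmean k n (\<lambda>w. wave k t (scaled k n w)) =
      a * Re (iexp \<phi> * ((\<Sum>c<k. iexp (step k n * centred k \<theta> c)) / of_real (real k)) ^ wlen k n)" for n
    proof -
      have "wmean k n (\<lambda>w. wave k t (scaled k n w)) =
        (\<Sum>w\<in>words (wlen k n) k. a * Re (iexp \<phi> * iexp (\<Sum>r<k. \<theta> r * scaled k n w r))) / real k ^ wlen k n"
        unfolding wmean_def wave_def a_def \<theta>_def \<phi>_def cos_via_iexp ..
      also have "\<dots> = a * Re (iexp \<phi> * ((\<Sum>w\<in>words (wlen k n) k. iexp (\<Sum>r<k. \<theta> r * scaled k n w r)) / of_real (real k ^ wlen k n)))"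
        by (simp only: sum_distrib_left[symmetric] Re_sum[symmetric] times_divide_eq_right Re_divide_of_real)
      finally show ?thesis unfolding wmean_iexp[OF k] .
    qed
    have g: "wave k t (gcentred k x) = a * Re (iexp \<phi> * iexp (\<Sum>r<k. centred k \<theta> r * x r))" for x
      unfolding wave_def a_def \<theta>_def \<phi>_def cos_via_iexp dot_gcentred ..
    have ig: "integrable (gauss k) (\<lambda>x. iexp \<phi> * iexp (\<Sum>r<k. centred k \<theta> r * x r))"
      by (intro integrable_mult_right gauss_iexp)
    have "(\<integral>x. wave k t (gcentred k x) \<partial>gauss k) = a * Re (iexp \<phi> * of_real (exp (- (\<Sum>c<k. (centred k \<theta> c)\<^sup>2) / 2)))"
      unfolding g by (simp only: integral_mult_right_zero integral_Re[OF ig] gauss_iexp(2)[where c = "centred k \<theta>" and k = k])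
    moreover have "(\<lambda>n. a * Re (iexp \<phi> * ((\<Sum>c<k. iexp (step k n * centred k \<theta> c)) / of_real (real k)) ^ wlen k n)) \<longlonglongrightarrow>
      a * Re (iexp \<phi> * of_real (exp (- (\<Sum>c<k. (centred k \<theta> c)\<^sup>2) / 2)))"
      by (intro tendsto_intros char_limit k)
    moreover have "integrable (gauss k) (\<lambda>x. wave k t (gcentred k x))"
      unfolding g by (intro integrable_mult_right integrable_Re ig)
    ultimately show ?thesis by (simp only: w)
  qed
  have "(\<lambda>n. wmean k n (\<lambda>w. \<Sum>t\<leftarrow>L. wave k t (scaled k n w))) \<longlonglongrightarrow> (\<integral>x. (\<Sum>t\<leftarrow>L. wave k t (gcentred k x)) \<partial>gauss k) \<and>
    integrable (gauss k) (\<lambda>x. \<Sum>t\<leftarrow>L. wave k t (gcentred k x))"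
  proof (induction L)
    case Nil
    show ?case by (simp add: wmean_def)
  next
    case (Cons t L)
    then show ?case using one[of t] by (auto simp: wmean_add intro!: tendsto_intros)
  qed
  then show ?thesis unfolding L by blast
qed

section \<open>The central limit theorem with unbounded weights\<close>

lemma wmean_mono:
  assumes "\<And>w. w \<in> words (wlen k n) k \<Longrightarrow> f w \<le> g w"
  shows "wmean k n f \<le> wmean k n g"
  unfolding wmean_def by (intro divide_right_mono sum_mono assms) auto

lemma wmean_cmult: "wmean k n (\<lambda>w. c * f w) = c * wmean k n f"
  by (simp add: wmean_def sum_distrib_left)

lemma wmean_diff: "wmean k n (\<lambda>w. f w - g w) = wmean k n f - wmean k n g"
  by (simp add: wmean_def sum_subtractf diff_divide_distrib)

lemma wmean_sum: "finite A \<Longrightarrow> wmean k n (\<lambda>w. \<Sum>i\<in>A. f i w) = (\<Sum>i\<in>A. wmean k n (f i))"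
proof (induction A rule: finite_induct)
  case empty
  show ?case by (simp add: wmean_def)
next
  case (insert a A)
  then show ?case by (simp add: wmean_add)
qed

lemma wmean_abs: "\<bar>wmean k n f\<bar> \<le> wmean k n (\<lambda>w. \<bar>f w\<bar>)"
  unfolding wmean_def abs_divide by (auto intro!: divide_right_mono)

text \<open>Evaluated at the scaled letter counts, it has an expectation that is bounded uniformly in
  \<open>n\<close>, which gives tightness and dominates the polynomially growing Vandermonde weight.\<close>

definition expsum :: "nat \<Rightarrow> (nat \<Rightarrow> real) \<Rightarrow> real" where
  "expsum k y = (\<Sum>r<k. exp (y r) + exp (- y r))"

lemma exp_abs_le_expsum: "r < k \<Longrightarrow> exp \<bar>y r\<bar> \<le> expsum k y"
proof -
  assume r: "r < k"
  have "exp \<bar>y r\<bar> \<le> exp (y r) + exp (- y r)" by (simp add: abs_if)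
  also have "\<dots> \<le> expsum k y" unfolding expsum_def
    using r by (intro member_le_sum[where f = "\<lambda>r. exp (y r) + exp (- y r)"]) (auto intro: add_nonneg_nonneg)
  finally show ?thesis .
qed

text \<open>Each of the independent factors has expectation \<open>1 + O((step k n)\<^sup>2)\<close>,
  because its linear term vanishes.\<close>

lemma wmean_exp_coord:
  assumes k: "k \<ge> 1" and n: "n \<ge> k" and i: "i < k" and a: "a = 1 \<or> a = - 1"
  shows "wmean k n (\<lambda>w. exp (a * scaled k n w i)) \<le> exp (real (wlen k n) * (step k n)\<^sup>2)"
proof -
  define s where "s = step k n"
  have "sqrt (real k / real n) \<le> sqrt 1" using k n by (intro real_sqrt_le_mono) simp
  then have s: "0 \<le> s" "s \<le> 1" by (auto simp: s_def step_def)
  define \<theta> where "\<theta> r = (if r = i then a else 0)" for r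
  have dot: "(\<Sum>r<k. \<theta> r * y r) = a * y i" for y
    using i by (simp add: \<theta>_def if_distrib[of "\<lambda>u. u * _"] cong: if_cong)
  have c1: "\<bar>centred k \<theta> c\<bar> \<le> 1" if "c < k" for c
    using a i k by (auto simp: centred_def \<theta>_def abs_le_iff field_simps)
  have "(\<Sum>c<k. exp (s * centred k \<theta> c)) \<le> (\<Sum>c<k. 1 + s * centred k \<theta> c + s\<^sup>2)"
  proof (intro sum_mono)
    fix c assume "c \<in> {..<k}"
    then have c: "\<bar>centred k \<theta> c\<bar> \<le> 1" using c1 by simp
    have "s * \<bar>centred k \<theta> c\<bar> \<le> 1 * 1" using s c by (intro mult_mono) auto
    then have "s * centred k \<theta> c \<le> 1" using s by (metis abs_le_D1 abs_mult abs_of_nonneg mult_1)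
    from exp_le_quadratic[OF this]
    have "exp (s * centred k \<theta> c) \<le> 1 + s * centred k \<theta> c + s\<^sup>2 * (centred k \<theta> c)\<^sup>2"
      by (simp add: power_mult_distrib)
    moreover have "s\<^sup>2 * (centred k \<theta> c)\<^sup>2 \<le> s\<^sup>2 * 1"
      using c by (intro mult_left_mono) (auto simp: abs_square_le_1)
    ultimately show "exp (s * centred k \<theta> c) \<le> 1 + s * centred k \<theta> c + s\<^sup>2" by simp
  qed
  also have "\<dots> = real k * (1 + s\<^sup>2)"
    using sum_centred[OF k, of \<theta>] by (simp add: sum.distrib distrib_left flip: sum_distrib_left)
  finally have "(\<Sum>c<k. exp (s * centred k \<theta> c)) / real k \<le> 1 + s\<^sup>2" using k by (simp add: field_simps)
  also have "\<dots> \<le> exp (s\<^sup>2)" by simp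
  finally have le: "(\<Sum>c<k. exp (s * centred k \<theta> c)) / real k \<le> exp (s\<^sup>2)" .
  have "wmean k n (\<lambda>w. exp (a * scaled k n w i)) = ((\<Sum>c<k. exp (s * centred k \<theta> c)) / real k) ^ wlen k n"
    using wmean_exp[OF k, of n \<theta>] unfolding dot s_def .
  also have "\<dots> \<le> exp (s\<^sup>2) ^ wlen k n" using le by (intro power_mono) (auto intro!: divide_nonneg_nonneg sum_nonneg)
  also have "\<dots> = exp (real (wlen k n) * (step k n)\<^sup>2)" by (simp add: s_def flip: exp_of_nat_mult)
  finally show ?thesis .
qed

lemma wmean_expsum_bounded:
  assumes k: "k \<ge> 1"
  shows "\<exists>B. \<forall>n\<ge>k. wmean k n (\<lambda>w. expsum k (scaled k n w)) \<le> B"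
proof -
  have "Bseq (\<lambda>n. real (wlen k n) * (step k n)\<^sup>2)"
    using wlen_step_tendsto by (intro convergent_imp_Bseq) (auto simp: convergent_def)
  then obtain B where B: "\<And>n. norm (real (wlen k n) * (step k n)\<^sup>2) \<le> B" unfolding Bseq_def by blast
  have "wmean k n (\<lambda>w. expsum k (scaled k n w)) \<le> (\<Sum>r<k. exp B + exp B)" if n: "n \<ge> k" for n
  proof -
    have "wmean k n (\<lambda>w. exp (a * scaled k n w r)) \<le> exp B" if "r < k" "a = 1 \<or> a = - 1" for a r
    proof -
      have "real (wlen k n) * (step k n)\<^sup>2 \<le> B" using B[of n] by simp
      then show ?thesis using wmean_exp_coord[OF k n that] by (meson exp_le_cancel_iff order_trans)
    qed
    from this[of _ 1] this[of _ "- 1"] show ?thesis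
      unfolding expsum_def by (simp only: wmean_sum wmean_add finite_lessThan) (intro sum_mono add_mono; simp)
  qed
  then show ?thesis by blast
qed

lemma power_le_fact_exp: "x ^ m \<le> fact m * exp x" if "x \<ge> 0" for x :: real
proof -
  have "(\<Sum>j\<in>{m}. x ^ j /\<^sub>R fact j) \<le> (\<Sum>j. x ^ j /\<^sub>R fact j)"
    using that by (intro sum_le_suminf summable_exp_generic) auto
  then show ?thesis by (simp add: exp_def field_simps)
qed

text \<open>All factors are at most twice the largest modulus of a coordinate, and a power of it is dominated
  by its exponential.\<close>

lemma vdmp_sq_le:
  assumes k: "k \<ge> 1"
  shows "\<exists>A\<ge>0. \<forall>y. (vdmp k y)\<^sup>2 \<le> A * expsum k y"
proof -
  define d where "d = card (pairs k)"
  have "(vdmp k y)\<^sup>2 \<le> 2 ^ (2 * d) * fact (2 * d) * expsum k y" for y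
  proof -
    define m where "m = Max ((\<lambda>r. \<bar>y r\<bar>) ` {..<k})"
    have "m \<in> (\<lambda>r. \<bar>y r\<bar>) ` {..<k}" unfolding m_def using k by (intro Max_in) (auto simp: lessThan_empty_iff)
    then obtain r0 where r0: "r0 < k" "m = \<bar>y r0\<bar>" by auto
    have m: "\<bar>y r\<bar> \<le> m" if "r < k" for r unfolding m_def using that by (intro Max_ge) auto
    have m0: "m \<ge> 0" using r0 by simp
    have "\<bar>vdm k y\<bar> = (\<Prod>(i, j)\<in>pairs k. \<bar>y i - y j\<bar>)" by (simp add: vdm_pairs abs_prod split_beta)
    also have "\<dots> \<le> (\<Prod>p\<in>pairs k. 2 * m)"
    proof (rule prod_mono)
      fix p assume "p \<in> pairs k"
      then have "\<bar>y (fst p)\<bar> \<le> m" "\<bar>y (snd p)\<bar> \<le> m" by (auto simp: pairs_def intro!: m)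
      then show "0 \<le> (case p of (i, j) \<Rightarrow> \<bar>y i - y j\<bar>) \<and> (case p of (i, j) \<Rightarrow> \<bar>y i - y j\<bar>) \<le> 2 * m"
        by (auto simp: split_beta)
    qed
    also have "\<dots> = (2 * m) ^ d" by (simp add: d_def)
    finally have "\<bar>vdmp k y\<bar> \<le> (2 * m) ^ d" using m0 by (auto simp: vdmp_def)
    then have "\<bar>vdmp k y\<bar>\<^sup>2 \<le> ((2 * m) ^ d)\<^sup>2" by (intro power_mono) auto
    then have "(vdmp k y)\<^sup>2 \<le> 2 ^ (2 * d) * m ^ (2 * d)" by (simp add: power_mult_distrib mult.commute flip: power_mult)
    also have "\<dots> \<le> 2 ^ (2 * d) * (fact (2 * d) * exp m)" by (intro mult_left_mono power_le_fact_exp m0) auto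
    also have "\<dots> \<le> 2 ^ (2 * d) * (fact (2 * d) * expsum k y)"
      unfolding r0(2) by (intro mult_left_mono exp_abs_le_expsum r0) auto
    finally show ?thesis by (simp add: mult.assoc)
  qed
  moreover have "(0::real) \<le> 2 ^ (2 * d) * fact (2 * d)" by simp
  ultimately show ?thesis by blast
qed

text \<open>In this form the cut-off Vandermonde product is visibly continuous: leaving the chamber makes some
  factor \<open>0\<close>.\<close>

lemma vdmp_prod: "vdmp k y = (\<Prod>(i, j)\<in>pairs k. max 0 (y i - y j))"
proof (cases "chamber k y")
  case True
  then have "vdmp k y = (\<Prod>(i, j)\<in>pairs k. y i - y j)" by (simp add: vdmp_chamber vdm_pairs)
  also have "\<dots> = (\<Prod>(i, j)\<in>pairs k. max 0 (y i - y j))"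
    using True by (intro prod.cong) (auto simp: chamber_def)
  finally show ?thesis .
next
  case False
  then obtain p where "p \<in> pairs k" "(case p of (i, j) \<Rightarrow> max 0 (y i - y j)) = 0" unfolding chamber_def by fastforce
  then have "(\<Prod>(i, j)\<in>pairs k. max 0 (y i - y j)) = 0" by (intro prod_zero) auto
  then show ?thesis using False by (simp add: vdmp_chamber)
qed

lemma continuous_vdmp: "continuous_on UNIV (vdmp k)"
  unfolding vdmp_prod[abs_def] split_beta by (intro continuous_intros continuous_on_product_coordinates)

lemma continuous_alt: "continuous_on UNIV (alt k)"
  unfolding alt_def[abs_def] by (intro continuous_intros continuous_on_product_coordinates)

lemma vdmp_affine:
  assumes "s \<ge> 0" "\<And>r. r < k \<Longrightarrow> y r = s * (x r - c)"
  shows "vdmp k y = s ^ card (pairs k) * vdmp k x"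
proof -
  have "vdmp k y = (\<Prod>(i, j)\<in>pairs k. s * max 0 (x i - x j))"
    unfolding vdmp_prod
  proof (intro prod.cong refl, clarify)
    fix i j assume "(i, j) \<in> pairs k"
    then have "y i - y j = s * (x i - x j)" using assms(2)[of i] assms(2)[of j] by (simp add: pairs_def algebra_simps)
    then show "max 0 (y i - y j) = s * max 0 (x i - x j)"
      using assms(1) by (simp add: max_mult_distrib_left)
  qed
  also have "\<dots> = s ^ card (pairs k) * vdmp k x" by (simp add: split_beta prod.distrib vdmp_prod)
  finally show ?thesis .
qed

lemma sum_alternating_even: "even k \<Longrightarrow> (\<Sum>r<k. (- 1) ^ r) = (0::real)"
  by (induction k rule: nat_induct2) auto

lemma alt_affine:
  assumes "even k" "\<And>r. r < k \<Longrightarrow> y r = s * (x r - c)"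
  shows "alt k y = s * alt k x"
proof -
  have "alt k y = (\<Sum>r<k. (- 1) ^ r * (s * (x r - c)))" unfolding alt_def using assms(2) by (intro sum.cong) auto
  also have "\<dots> = s * alt k x - s * c * (\<Sum>r<k. (- 1) ^ r)"
    by (simp add: alt_def algebra_simps sum_subtractf sum_distrib_left)
  finally show ?thesis using sum_alternating_even[OF assms(1)] by simp
qed

definition cube :: "nat \<Rightarrow> nat \<Rightarrow> (nat \<Rightarrow> real) set" where
  "cube k N = Pi\<^sub>E UNIV (\<lambda>i. if i < k then {- real N..real N} else {0})"

lemma compact_cube: "compact (cube k N)"
proof -
  have "compactin (product_topology (\<lambda>_::nat. euclidean) UNIV) (cube k N)"
    unfolding cube_def by (subst compactin_PiE) auto
  then show ?thesis by (metis compactin_euclidean_iff euclidean_product_topology)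
qed

text \<open>A sine wave in one coordinate, slow enough to be injective on \<open>{- N..N}\<close>.\<close>

lemma trig_ring_separates:
  assumes "x \<in> cube k N" "y \<in> cube k N" "x \<noteq> y"
  shows "\<exists>f\<in>trig_ring k. f x \<noteq> f y"
proof -
  obtain r where r: "x r \<noteq> y r" using assms(3) by blast
  have rk: "r < k"
  proof (rule ccontr)
    assume "\<not> r < k"
    then have "x r = 0" "y r = 0" using assms(1,2) PiE_mem[of _ UNIV _ r] unfolding cube_def by fastforce+
    then show False using r by simp
  qed
  \<comment> \<open>The arguments \<open>c * z r\<close> then stay within \<open>{- 1..1}\<close>, inside the interval where the sine is injective.\<close>
  define c where "c = 1 / (real N + 1)"
  have c: "c > 0" by (simp add: c_def)
  define f where "f = (\<lambda>z. sin (c * z r))"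
  have "f = (\<lambda>z. \<Sum>t\<leftarrow>[(1, \<lambda>i. if i = r then - c else 0, pi / 2)]. wave k t z)"
    using rk by (simp add: f_def wave_def fun_eq_iff if_distrib[of "\<lambda>u. u * _"] sin_cos_eq cong: if_cong)
  then have "f \<in> trig_ring k" unfolding trig_ring_def by blast
  moreover have "f x \<noteq> f y"
  proof
    assume eq: "f x = f y"
    have b: "\<bar>c * z r\<bar> \<le> pi / 2" if "z \<in> cube k N" for z
    proof -
      have "z r \<in> {- real N..real N}" using PiE_mem[OF that[unfolded cube_def], of r] rk by simp
      then have "\<bar>z r\<bar> \<le> real N" by (auto simp: abs_le_iff)
      then have "c * \<bar>z r\<bar> \<le> 1" by (simp add: c_def field_simps)
      then show ?thesis using c pi_ge_two by (simp add: abs_mult)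
    qed
    have "c * x r = c * y r"
      by (rule sin_inj_pi) (use b[OF assms(1)] b[OF assms(2)] eq[unfolded f_def] in linarith)+
    then show False using r c by simp
  qed
  ultimately show ?thesis by blast
qed

lemma gcentred_measurable: "gcentred k \<in> gauss k \<rightarrow>\<^sub>M borel"
proof (rule measurable_coordinatewise_then_product)
  fix i
  have "(\<lambda>x. centred k x i) \<in> borel_measurable (Pi\<^sub>M {..<k} (\<lambda>_. borel))" if "i < k"
    unfolding centred_def
    by (intro borel_measurable_diff borel_measurable_divide borel_measurable_sum measurable_component_singleton borel_measurable_const)
      (use that in auto)
  then show "(\<lambda>x. gcentred k x i) \<in> borel_measurable (gauss k)"
    unfolding measurable_gauss_prod gcentred_def by (cases "i < k") auto
qed

text \<open>Tightness follows from the bounded exponential moments.\<close>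

lemma word_clt:
  assumes k: "k \<ge> 1" and F: "continuous_on UNIV F" "\<And>y. \<bar>F y\<bar> \<le> C"
  shows "(\<lambda>n. wmean k n (\<lambda>w. F (scaled k n w))) \<longlonglongrightarrow> (\<integral>x. F (gcentred k x) \<partial>gauss k)"
proof -
  have g: "prob_space (gauss k)" by (rule prob_space_gauss_prod) simp
  have "(\<lambda>n. \<integral>w. F (scaled k n w) \<partial>wmeasure k n) \<longlonglongrightarrow> (\<integral>x. F (gcentred k x) \<partial>gauss k)"
  proof (rule expectation_convergence_algebra[where R = "trig_ring k" and C = C
        and M = "wmeasure k" and X = "scaled k" and L = "gauss k" and Y = "gcentred k"])
    show "\<exists>K. compact K \<and> (\<forall>x\<in>K. \<forall>y\<in>K. x \<noteq> y \<longrightarrow> (\<exists>f\<in>trig_ring k. f x \<noteq> f y)) \<and>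
      (\<forall>\<^sub>F n in sequentially. measure (wmeasure k n) {w \<in> space (wmeasure k n). scaled k n w \<notin> K} \<le> e) \<and>
      measure (gauss k) {x \<in> space (gauss k). gcentred k x \<notin> K} \<le> e" if e: "e > 0" for e
    proof -
      interpret g: prob_space "gauss k" by (rule g)
      obtain B where B: "\<And>n. n \<ge> k \<Longrightarrow> wmean k n (\<lambda>w. expsum k (scaled k n w)) \<le> B"
        using wmean_expsum_bounded[OF k] by blast
      obtain N1 :: nat where N1: "B / e \<le> real N1" using real_arch_simple by blast
      have m: "(\<lambda>x. \<Sum>r<k. (gcentred k x r)\<^sup>2) \<in> borel_measurable (gauss k)"
        by (rule measurable_compose[OF gcentred_measurable borel_measurable_continuous_onI])
          (intro continuous_intros continuous_on_product_coordinates)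
      obtain N2 :: nat where N2: "measure (gauss k) {x \<in> space (gauss k). (\<Sum>r<k. (gcentred k x r)\<^sup>2) > (real N2)\<^sup>2} \<le> e"
        using tail_small[OF g m e] by blast
      define N where "N = Suc (max N1 N2)"
      have out: "\<exists>i<k. \<bar>y i\<bar> > real N" if "y \<notin> cube k N" "\<And>i. i \<ge> k \<Longrightarrow> y i = 0" for y
        using that by (fastforce simp: cube_def PiE_iff abs_le_iff not_less minus_le_iff split: if_splits)
      have 1: "measure (wmeasure k n) {w \<in> space (wmeasure k n). scaled k n w \<notin> cube k N} \<le> e" if n: "n \<ge> k" for n
      proof -
        define A where "A = {w \<in> space (wmeasure k n). scaled k n w \<notin> cube k N}"
        have "measure (wmeasure k n) A = (\<integral>w. indicator A w \<partial>wmeasure k n)"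
          by (simp add: A_def Collect_conj_eq Int_commute Int_assoc)
        also have "\<dots> = wmean k n (indicator A)" by (rule integral_wmeasure)
        also have "\<dots> \<le> wmean k n (\<lambda>w. (1 / real N) * expsum k (scaled k n w))"
        proof (rule wmean_mono)
          fix w
          have p: "expsum k (scaled k n w) \<ge> 0" unfolding expsum_def by (intro sum_nonneg add_nonneg_nonneg) auto
          show "indicator A w \<le> (1 / real N) * expsum k (scaled k n w)"
          proof (cases "w \<in> A")
            case True
            then obtain i where i: "i < k" "\<bar>scaled k n w i\<bar> > real N"
              using out[of "scaled k n w"] by (auto simp: A_def scaled_def)
            have "real N \<le> exp \<bar>scaled k n w i\<bar>" using i exp_ge_add_one_self[of "\<bar>scaled k n w i\<bar>"] by linarith
            also have "\<dots> \<le> expsum k (scaled k n w)" by (rule exp_abs_le_expsum[OF i(1)])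
            finally show ?thesis using True by (simp add: N_def field_simps)
          qed (use p in simp)
        qed
        also have "\<dots> \<le> (1 / real N) * B" unfolding wmean_cmult by (intro mult_left_mono B n) auto
        also have "\<dots> \<le> e"
        proof -
          have "B / e \<le> real N" using N1 by (simp add: N_def)
          then have "B \<le> real N * e" using e by (simp add: field_simps)
          then show ?thesis by (simp add: N_def field_simps)
        qed
        finally show ?thesis unfolding A_def .
      qed
      have 2: "measure (gauss k) {x \<in> space (gauss k). gcentred k x \<notin> cube k N} \<le> e"
      proof -
        have "measure (gauss k) {x \<in> space (gauss k). gcentred k x \<notin> cube k N} \<le>
            measure (gauss k) {x \<in> space (gauss k). (\<Sum>r<k. (gcentred k x r)\<^sup>2) > (real N2)\<^sup>2}"
        proof (rule g.finite_measure_mono)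
          show "{x \<in> space (gauss k). gcentred k x \<notin> cube k N} \<subseteq> {x \<in> space (gauss k). (\<Sum>r<k. (gcentred k x r)\<^sup>2) > (real N2)\<^sup>2}"
          proof clarify
            fix x assume x: "gcentred k x \<notin> cube k N"
            obtain i where i: "i < k" "\<bar>gcentred k x i\<bar> > real N"
              using out[OF x] by (auto simp: gcentred_def)
            have "real N2 < \<bar>gcentred k x i\<bar>" using i by (simp add: N_def)
            then have "(real N2)\<^sup>2 < \<bar>gcentred k x i\<bar>\<^sup>2" by (intro power_strict_mono) auto
            also have "\<dots> \<le> (\<Sum>r<k. (gcentred k x r)\<^sup>2)"
              using i member_le_sum[of i "{..<k}" "\<lambda>r. (gcentred k x r)\<^sup>2"] by simp
            finally show "(real N2)\<^sup>2 < (\<Sum>r<k. (gcentred k x r)\<^sup>2)" .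
          qed
        qed (use m in measurable)
        then show ?thesis using N2 by linarith
      qed
      show ?thesis
        using compact_cube trig_ring_separates 1 2
        by (intro exI[of _ "cube k N"] conjI ballI impI) (auto simp: eventually_sequentially)
    qed
    show "(\<lambda>n. \<integral>w. f (scaled k n w) \<partial>wmeasure k n) \<longlonglongrightarrow> (\<integral>x. f (gcentred k x) \<partial>gauss k)" if "f \<in> trig_ring k" for f
      unfolding integral_wmeasure by (rule trig_ring_conv[OF k that])
    show "\<forall>\<^sub>F n in sequentially. scaled k n \<in> wmeasure k n \<rightarrow>\<^sub>M borel"
      by (simp add: wmeasure_def measurable_def sets_uniform_count_measure space_uniform_count_measure)
  qed (use k F g in \<open>auto intro!: prob_space_wmeasure eventuallyI gcentred_measurable trig_ring_const trig_ring_add trig_ring_mult trig_ring_continuous trig_ring_bounded\<close>)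
  then show ?thesis unfolding integral_wmeasure .
qed

lemma clamp_error: "\<bar>u - max (- T) (min T u)\<bar> \<le> u\<^sup>2 / T" if "T > 0" for u T :: real
proof (cases "\<bar>u\<bar> \<le> T")
  case True
  then have "max (- T) (min T u) = u" by (auto simp: max_def min_def)
  then show ?thesis using that by simp
next
  case False
  then have "\<bar>u - max (- T) (min T u)\<bar> \<le> \<bar>u\<bar>" using that by linarith
  also have "\<bar>u\<bar> \<le> u\<^sup>2 / T"
  proof -
    have "\<bar>u\<bar> * T \<le> \<bar>u\<bar> * \<bar>u\<bar>" using False by (intro mult_left_mono) auto
    then show ?thesis using that by (simp add: field_simps power2_eq_square)
  qed
  finally show ?thesis .
qed

text \<open>Truncation at \<open>\<plusminus> T\<close> changes the expectations by at most the second moment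
  divided by \<open>T\<close>, uniformly in \<open>n\<close>.\<close>

lemma word_clt_square_integrable:
  assumes k: "k \<ge> 1" and h: "continuous_on UNIV h" "\<And>y. (h y)\<^sup>2 \<le> A * expsum k y" "A \<ge> 0"
    and i: "integrable (gauss k) (\<lambda>x. (h (gcentred k x))\<^sup>2)"
  shows "(\<lambda>n. wmean k n (\<lambda>w. h (scaled k n w))) \<longlonglongrightarrow> (\<integral>x. h (gcentred k x) \<partial>gauss k)"
proof (rule tendstoI)
  fix r :: real assume r: "r > 0"
  interpret prob_space "gauss k" by (rule prob_space_gauss_prod) simp
  have hm: "(\<lambda>x. h (gcentred k x)) \<in> borel_measurable (gauss k)"
    by (rule measurable_compose[OF gcentred_measurable borel_measurable_continuous_onI[OF h(1)]])
  have ih: "integrable (gauss k) (\<lambda>x. h (gcentred k x))"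
  proof (rule Bochner_Integration.integrable_bound[OF Bochner_Integration.integrable_add[OF integrable_const[of 1] i] hm], rule AE_I2)
    fix x
    have "\<bar>u\<bar> \<le> 1 + u\<^sup>2" for u :: real
    proof -
      have "0 \<le> (\<bar>u\<bar> - 1)\<^sup>2 + \<bar>u\<bar>" by simp
      then show ?thesis by (simp add: power2_eq_square algebra_simps)
    qed
    then show "norm (h (gcentred k x)) \<le> norm (1 + (h (gcentred k x))\<^sup>2)" by simp
  qed
  obtain B where B: "\<And>n. n \<ge> k \<Longrightarrow> wmean k n (\<lambda>w. expsum k (scaled k n w)) \<le> B"
    using wmean_expsum_bounded[OF k] by blast
  define D where "D = (\<integral>x. (h (gcentred k x))\<^sup>2 \<partial>gauss k)"
  \<comment> \<open>Both truncation errors are then at most \<open>r / 4\<close>.\<close>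
  define T where "T = 4 * (\<bar>A * B\<bar> + \<bar>D\<bar> + 1) / r"
  have T: "T > 0" using r by (simp add: T_def)
  have T': "A * B / T \<le> r / 4" "D / T \<le> r / 4"
  proof -
    have "r / 4 * T = \<bar>A * B\<bar> + \<bar>D\<bar> + 1" using r by (simp add: T_def)
    then have "A * B \<le> r / 4 * T" "D \<le> r / 4 * T" by linarith+
    then show "A * B / T \<le> r / 4" "D / T \<le> r / 4" using T by (simp_all add: pos_divide_le_eq)
  qed
  define F where "F y = max (- T) (min T (h y))" for y
  have Fc: "continuous_on UNIV F" unfolding F_def by (intro continuous_intros h)
  have Fb: "\<bar>F y\<bar> \<le> T" for y using T by (auto simp: F_def)
  have Fe: "\<bar>h y - F y\<bar> \<le> (h y)\<^sup>2 / T" for y unfolding F_def by (rule clamp_error[OF T])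
  have Fm: "(\<lambda>x. F (gcentred k x)) \<in> borel_measurable (gauss k)"
    by (rule measurable_compose[OF gcentred_measurable borel_measurable_continuous_onI[OF Fc]])
  have iF: "integrable (gauss k) (\<lambda>x. F (gcentred k x))"
    by (rule integrable_const_bound[of _ T]) (use Fm Fb in auto)
  have lim: "\<bar>(\<integral>x. h (gcentred k x) \<partial>gauss k) - (\<integral>x. F (gcentred k x) \<partial>gauss k)\<bar> \<le> r / 4"
  proof -
    have "\<bar>(\<integral>x. h (gcentred k x) \<partial>gauss k) - (\<integral>x. F (gcentred k x) \<partial>gauss k)\<bar> =
        \<bar>\<integral>x. h (gcentred k x) - F (gcentred k x) \<partial>gauss k\<bar>" using ih iF by simp
    also have "\<dots> \<le> (\<integral>x. \<bar>h (gcentred k x) - F (gcentred k x)\<bar> \<partial>gauss k)" by (rule integral_abs_bound)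
    also have "\<dots> \<le> (\<integral>x. (h (gcentred k x))\<^sup>2 / T \<partial>gauss k)"
      by (rule integral_mono) (use Fe ih iF i in auto)
    also have "\<dots> = D / T" by (simp add: D_def)
    finally show ?thesis using T' by linarith
  qed
  have "\<forall>\<^sub>F n in sequentially. dist (wmean k n (\<lambda>w. F (scaled k n w))) (\<integral>x. F (gcentred k x) \<partial>gauss k) < r / 4"
    using word_clt[OF k Fc Fb] r by (intro tendstoD) auto
  then show "\<forall>\<^sub>F n in sequentially. dist (wmean k n (\<lambda>w. h (scaled k n w))) (\<integral>x. h (gcentred k x) \<partial>gauss k) < r"
    using eventually_ge_at_top[of k]
  proof eventually_elim
    case (elim n)
    have "\<bar>wmean k n (\<lambda>w. h (scaled k n w)) - wmean k n (\<lambda>w. F (scaled k n w))\<bar> \<le>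
      wmean k n (\<lambda>w. \<bar>h (scaled k n w) - F (scaled k n w)\<bar>)"
      unfolding wmean_diff[symmetric] by (rule wmean_abs)
    also have "\<dots> \<le> wmean k n (\<lambda>w. A / T * expsum k (scaled k n w))"
    proof (rule wmean_mono)
      fix w
      have "(h (scaled k n w))\<^sup>2 / T \<le> A * expsum k (scaled k n w) / T" using T by (intro divide_right_mono h) auto
      then show "\<bar>h (scaled k n w) - F (scaled k n w)\<bar> \<le> A / T * expsum k (scaled k n w)"
        using Fe[of "scaled k n w"] by simp
    qed
    also have "\<dots> \<le> A / T * B" unfolding wmean_cmult using T h(3) elim(2) by (intro mult_left_mono B) auto
    finally have "\<bar>wmean k n (\<lambda>w. h (scaled k n w)) - wmean k n (\<lambda>w. F (scaled k n w))\<bar> \<le> A / T * B" .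
    moreover have "A / T * B \<le> r / 4" using T'(1) by simp
    ultimately have "\<bar>wmean k n (\<lambda>w. h (scaled k n w)) - wmean k n (\<lambda>w. F (scaled k n w))\<bar> \<le> r / 4" by linarith
    then show ?case using elim(1) lim r unfolding dist_real_def by linarith
  qed
qed

text \<open>The Vandermonde product and, for even \<open>k\<close>, the alternating sum depend on differences
  of coordinates only, so the mean subtracted in \<open>gcentred\<close> has no effect.\<close>

theorem weighted_word_clt:
  assumes k: "k \<ge> 1" "even k" and g: "continuous_on UNIV g" "\<And>u. \<bar>g u\<bar> \<le> C"
  shows "(\<lambda>n. wmean k n (\<lambda>w. vdmp k (scaled k n w) * g (alt k (scaled k n w)))) \<longlonglongrightarrow>
    (\<integral>x. vdmp k x * g (alt k x) \<partial>gauss k)"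
proof -
  define h where "h y = vdmp k y * g (alt k y)" for y
  have hc: "h (gcentred k x) = h x" for x
  proof -
    have e: "gcentred k x r = 1 * (x r - (\<Sum>i<k. x i) / real k)" if "r < k" for r
      using that by (simp add: gcentred_def centred_def)
    show ?thesis unfolding h_def using vdmp_affine[of 1 k "gcentred k x" x, OF _ e] alt_affine[OF k(2), of "gcentred k x" 1 x, OF e] by simp
  qed
  obtain A where A: "A \<ge> 0" "\<And>y. (vdmp k y)\<^sup>2 \<le> A * expsum k y" using vdmp_sq_le[OF k(1)] by blast
  have g2: "(g u)\<^sup>2 \<le> C\<^sup>2" for u using g(2)[of u] by (metis abs_ge_zero power2_abs power_mono)
  have hsq: "(h y)\<^sup>2 \<le> (vdmp k y)\<^sup>2 * C\<^sup>2" for y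
    unfolding h_def power_mult_distrib by (intro mult_left_mono g2) auto
  have hcont: "continuous_on UNIV h"
    unfolding h_def by (intro continuous_intros continuous_vdmp continuous_on_compose2[OF g(1) continuous_alt]) auto
  have "(\<lambda>n. wmean k n (\<lambda>w. h (scaled k n w))) \<longlonglongrightarrow> (\<integral>x. h (gcentred k x) \<partial>gauss k)"
  proof (rule word_clt_square_integrable[OF k(1) hcont])
    show "(h y)\<^sup>2 \<le> (A * C\<^sup>2) * expsum k y" for y
    proof -
      have "(vdmp k y)\<^sup>2 * C\<^sup>2 \<le> (A * expsum k y) * C\<^sup>2" by (intro mult_right_mono A) auto
      then show ?thesis using hsq[of y] by (simp add: mult_ac)
    qed
    show "integrable (gauss k) (\<lambda>x. (h (gcentred k x))\<^sup>2)"
    proof (rule Bochner_Integration.integrable_bound[OF integrable_gauss[of k "\<lambda>x. (vdmp k x)\<^sup>2 * C\<^sup>2"]])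
      show "tame {..<k} (\<lambda>x. (vdmp k x)\<^sup>2 * C\<^sup>2)" by (intro tame_intros tame_vdmp)
      show "(\<lambda>x. (h (gcentred k x))\<^sup>2) \<in> borel_measurable (gauss k)"
        by (intro borel_measurable_power measurable_compose[OF gcentred_measurable borel_measurable_continuous_onI[OF hcont]])
    qed (use hsq in \<open>auto simp: hc\<close>)
  qed (use A in simp)
  then show ?thesis unfolding hc unfolding h_def .
qed

section \<open>The number of fixed points\<close>

text \<open>The factor \<open>c\<close> collects the factorials and the powers of \<open>k\<close> and of
  \<open>step k n\<close>. It does not depend on \<open>\<phi>\<close> and hence cancels in quotients of
  such sums.\<close>

lemma involution_sum_as_word_mean:
  assumes k: "k \<ge> 1" "even k" and n: "n \<ge> 1"
  obtains c where "c > 0"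
    "\<And>\<phi>. (\<Sum>p\<in>avoiding_involutions n (k + 1) (decreasing_perm (k + 1)). \<phi> (step k n * real (fp n p))) =
      c * wmean k n (\<lambda>w. vdmp k (scaled k n w) * \<phi> (alt k (scaled k n w) - step k n * real (k div 2)))"
proof -
  define s where "s = step k n"
  define m where "m = real (k div 2)"
  define d where "d = card (pairs k)"
  define N where "N = wlen k n"
  define c where "c = fact n / fact N * real k ^ N / s ^ d"
  have s: "s > 0" using k n by (simp add: s_def step_def)
  have c: "c > 0" using k s by (simp add: c_def)
  have w: "vdmp k (\<lambda>r. real (count_list w r)) = vdmp k (scaled k n w) / s ^ d"
    "s * (alt k (\<lambda>r. real (count_list w r)) - m) = alt k (scaled k n w) - s * m" for w
  proof -
    have e: "scaled k n w r = s * (real (count_list w r) - real (wlen k n) / real k)" if "r < k" for r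
      using that by (simp add: scaled_def s_def)
    show "vdmp k (\<lambda>r. real (count_list w r)) = vdmp k (scaled k n w) / s ^ d"
      using vdmp_affine[of s k "scaled k n w" "\<lambda>r. real (count_list w r)", OF _ e] s by (simp add: d_def)
    show "s * (alt k (\<lambda>r. real (count_list w r)) - m) = alt k (scaled k n w) - s * m"
      using alt_affine[OF k(2), of "scaled k n w" s "\<lambda>r. real (count_list w r)", OF e] by (simp add: right_diff_distrib)
  qed
  have "(\<Sum>p\<in>avoiding_involutions n (k + 1) (decreasing_perm (k + 1)). \<phi> (step k n * real (fp n p))) =
      c * wmean k n (\<lambda>w. vdmp k (scaled k n w) * \<phi> (alt k (scaled k n w) - step k n * real (k div 2)))" for \<phi>
  proof -
    define G where "G l = \<phi> (s * (alt k (\<lambda>r. real (l r)) - m))" for l :: "nat \<Rightarrow> nat"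
    have "(\<Sum>p\<in>avoiding_involutions n (k + 1) (decreasing_perm (k + 1)). \<phi> (s * real (fp n p))) =
        (\<Sum>y\<in>ballot_words n k. \<phi> (s * real_of_int (sum_list (map sg y))))"
      using sum_involutions_words[where G = "\<lambda>z. \<phi> (s * real_of_int z)" and n = n and k = k] by simp
    also have "\<dots> = (\<Sum>y\<in>ballot_words n k. G (shifted_content k y))"
      by (intro sum.cong refl) (simp add: G_def sum_sg_content[OF _ k(2)] m_def)
    also have "\<dots> = fact n / fact N * (\<Sum>w\<in>words N k. vdmp k (\<lambda>r. real (count_list w r)) * G (count_list w))"
      unfolding N_def wlen_def by (rule sum_ballot_words_eq)
    also have "\<dots> = fact n / fact N * (\<Sum>w\<in>words N k. vdmp k (scaled k n w) * \<phi> (alt k (scaled k n w) - s * m) / s ^ d)"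
      unfolding G_def w by simp
    also have "\<dots> = c * wmean k n (\<lambda>w. vdmp k (scaled k n w) * \<phi> (alt k (scaled k n w) - s * m))"
      unfolding wmean_def c_def N_def using k by (simp flip: sum_divide_distrib)
    finally show ?thesis unfolding s_def m_def .
  qed
  then show ?thesis using that c by blast
qed

lemma finite_avoiding_involutions: "finite (avoiding_involutions n m \<sigma>)"
  by (rule finite_subset[OF _ finite_permutations[of "{1..n}"]]) (auto simp: avoiding_involutions_def)

lemma id_avoiding: "k \<ge> 1 \<Longrightarrow> id \<in> avoiding_involutions n (k + 1) (decreasing_perm (k + 1))"
proof -
  assume k: "k \<ge> 1"
  have False if i: "strict_mono_on {1..k + 1} i"
    "\<And>j l. j \<in> {1..k + 1} \<Longrightarrow> l \<in> {1..k + 1} \<Longrightarrow> j < l \<Longrightarrow>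
      id (i j) < id (i l) \<longleftrightarrow> decreasing_perm (k + 1) j < decreasing_perm (k + 1) l" for i :: "nat \<Rightarrow> nat"
  proof -
    have "i 1 < i 2" using k by (intro strict_mono_onD[OF i(1)]) auto
    then have "decreasing_perm (k + 1) 1 < decreasing_perm (k + 1) 2" using i(2)[of 1 2] k by simp
    then show False using k by (simp add: decreasing_perm_def)
  qed
  then have "\<not> perm_contains n id (k + 1) (decreasing_perm (k + 1))" unfolding perm_contains_def by blast
  then show ?thesis by (simp add: avoiding_involutions_def permutes_id)
qed

lemma fp_law_integral:
  fixes f :: "real \<Rightarrow> real"
  assumes q: "q > 0"
  shows "(\<integral>p. f (s * real (fp n p)) \<partial>fp_weighted_measure (q powr s) n m \<sigma>) =
    (\<Sum>p\<in>avoiding_involutions n m \<sigma>. q powr (s * real (fp n p)) * f (s * real (fp n p))) /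
    (\<Sum>p\<in>avoiding_involutions n m \<sigma>. q powr (s * real (fp n p)))"
proof -
  have e: "(q powr s) ^ j = q powr (s * real j)" for j :: nat
    using q by (simp add: powr_realpow[symmetric] powr_powr)
  show ?thesis
    unfolding fp_weighted_measure_def e
    by (subst lebesgue_integral_point_measure_finite[OF finite_avoiding_involutions])
      (auto intro!: divide_nonneg_nonneg sum_nonneg simp: sum_divide_distrib)
qed

lemma alt_nonneg: "chamber k y \<Longrightarrow> even k \<Longrightarrow> alt k y \<ge> 0"
proof (induction k rule: nat_induct2)
  case (step k)
  have "chamber k y" "y (Suc k) \<le> y k" using step.prems(1) by (auto simp: chamber_def pairs_def)
  then show ?case using step by (simp add: alt_def)
qed (auto simp: alt_def)

lemma powr_le_one: "q powr u \<le> 1" if "0 < q" "q \<le> 1" "u \<ge> 0" for q u :: real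
  using powr_mono2[of u q 1] that by simp

text \<open>The maximum with \<open>0\<close> makes the tilt bounded and continuous. The vanishing shift in
  the argument of \<open>f\<close>, which comes from the staircase, is absorbed by uniform continuity.\<close>

lemma tilted_word_limit:
  assumes k: "k \<ge> 1" "even k" and q: "0 < q" "q \<le> 1"
    and f: "uniformly_continuous_on UNIV f" "\<And>u. \<bar>f u\<bar> \<le> 1"
  shows "(\<lambda>n. wmean k n (\<lambda>w. vdmp k (scaled k n w) *
      (q powr max 0 (alt k (scaled k n w)) * f (alt k (scaled k n w) - step k n * c)))) \<longlonglongrightarrow>
    (\<integral>x. vdmp k x * (q powr max 0 (alt k x) * f (alt k x)) \<partial>gauss k)"
proof -
  define g where "g u = q powr max 0 u" for u
  have g: "continuous_on UNIV g" unfolding g_def using q by (intro continuous_intros) auto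
  have g01: "0 \<le> g u" "g u \<le> 1" for u
    unfolding g_def using powr_le_one[OF q] by auto
  have fc: "continuous_on UNIV f" using f(1) by (rule uniformly_continuous_imp_continuous)
  define I where "I = (\<integral>x. vdmp k x * (g (alt k x) * f (alt k x)) \<partial>gauss k)"
  have 1: "(\<lambda>n. wmean k n (\<lambda>w. vdmp k (scaled k n w) * (g (alt k (scaled k n w)) * f (alt k (scaled k n w))))) \<longlonglongrightarrow> I"
    unfolding I_def
  proof (rule weighted_word_clt[OF k, where g = "\<lambda>u. g u * f u" and C = 1])
    show "continuous_on UNIV (\<lambda>u. g u * f u)" by (intro continuous_on_mult g fc)
    show "\<bar>g u * f u\<bar> \<le> 1" for u
      using mult_mono[of "\<bar>g u\<bar>" 1 "\<bar>f u\<bar>" 1] g01[of u] f(2)[of u] by (simp add: abs_mult)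
  qed
  have "(\<lambda>n. wmean k n (\<lambda>w. vdmp k (scaled k n w) * (\<lambda>_. 1) (alt k (scaled k n w)))) \<longlonglongrightarrow>
      (\<integral>x. vdmp k x * (\<lambda>_. 1) (alt k x) \<partial>gauss k)"
    by (rule weighted_word_clt[OF k, where C = 1]) auto
  then have "Bseq (\<lambda>n. wmean k n (\<lambda>w. vdmp k (scaled k n w)))"
    by (intro convergent_imp_Bseq) (auto simp: convergent_def)
  then obtain V where V: "V > 0" "\<And>n. norm (wmean k n (\<lambda>w. vdmp k (scaled k n w))) \<le> V" unfolding Bseq_def by blast
  have 2: "(\<lambda>n. wmean k n (\<lambda>w. vdmp k (scaled k n w) * (g (alt k (scaled k n w)) * f (alt k (scaled k n w) - step k n * c))) -
      wmean k n (\<lambda>w. vdmp k (scaled k n w) * (g (alt k (scaled k n w)) * f (alt k (scaled k n w))))) \<longlonglongrightarrow> 0"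
    (is "?D \<longlonglongrightarrow> 0")
  proof (rule tendstoI)
    fix e :: real assume e: "e > 0"
    define e' where "e' = e / (2 * V)"
    have e': "e' > 0" "e' * V < e" using e V by (simp_all add: e'_def)
    from f(1)[unfolded uniformly_continuous_on_def, rule_format, OF e'(1)]
    obtain \<delta> where \<delta>: "\<delta> > 0" "\<And>u v. dist v u < \<delta> \<Longrightarrow> dist (f v) (f u) < e'" by auto
    have "(\<lambda>n. step k n * c) \<longlonglongrightarrow> 0 * c" by (intro tendsto_intros step_tendsto)
    then have "(\<lambda>n. step k n * c) \<longlonglongrightarrow> 0" by simp
    from tendstoD[OF this \<delta>(1)] show "\<forall>\<^sub>F n in sequentially. dist (?D n) 0 < e"
    proof eventually_elim
      case (elim n)
      have "\<bar>?D n\<bar> \<le> wmean k n (\<lambda>w. \<bar>vdmp k (scaled k n w) * (g (alt k (scaled k n w)) * f (alt k (scaled k n w) - step k n * c)) -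
          vdmp k (scaled k n w) * (g (alt k (scaled k n w)) * f (alt k (scaled k n w)))\<bar>)"
        unfolding wmean_diff[symmetric] by (rule wmean_abs)
      also have "\<dots> \<le> wmean k n (\<lambda>w. e' * vdmp k (scaled k n w))"
      proof (rule wmean_mono)
        fix w
        define u where "u = alt k (scaled k n w)"
        define v where "v = vdmp k (scaled k n w)"
        have v: "v \<ge> 0" unfolding v_def by (rule vdmp_nonneg)
        have "\<bar>f (u - step k n * c) - f u\<bar> \<le> e'"
          using \<delta>(2)[of "u - step k n * c" u] elim by (simp add: dist_real_def)
        then have "g u * \<bar>f (u - step k n * c) - f u\<bar> \<le> 1 * e'" using g01 e' by (intro mult_mono) auto
        then have "v * (g u * \<bar>f (u - step k n * c) - f u\<bar>) \<le> v * e'" using v by (intro mult_left_mono) auto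
        moreover have "\<bar>v * (g u * f (u - step k n * c)) - v * (g u * f u)\<bar> = v * (g u * \<bar>f (u - step k n * c) - f u\<bar>)"
          using v g01[of u] by (simp add: abs_mult flip: right_diff_distrib)
        ultimately show "\<bar>v * (g u * f (u - step k n * c)) - v * (g u * f u)\<bar> \<le> e' * v" by (simp add: mult.commute)
      qed
      also have "\<dots> \<le> e' * V" unfolding wmean_cmult using V(2)[of n] e' by (intro mult_left_mono) auto
      also have "\<dots> < e" by (rule e')
      finally show ?case by simp
    qed
  qed
  from tendsto_add[OF 2 1] show ?thesis unfolding I_def g_def by simp
qed

lemma S_law_eq: "even k \<Longrightarrow> S_law k = distr (goe_space k) borel (\<lambda>x. alt k (eigvec k x))"
  unfolding S_law_def by (simp add: alternating_sum_goe0)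

lemma alt_eigvec_measurable: "(\<lambda>x. alt k (eigvec k x)) \<in> borel_measurable (goe_space k)"
  by (rule measurable_compose[OF eigvec_measurable borel_measurable_continuous_onI[OF continuous_alt]])

text \<open>The ordered eigenvalues lie in the chamber, where the alternating sum is nonnegative and the
  maximum with \<open>0\<close> changes nothing.\<close>

lemma S_law_powr_integral:
  assumes k: "even k" and q: "0 < q" "q \<le> 1" and f: "continuous_on UNIV f" "\<And>u. \<bar>f u\<bar> \<le> 1"
  shows "(\<integral>u. q powr u * f u \<partial>S_law k) =
      (\<integral>x. vdmp k x * (q powr max 0 (alt k x) * f (alt k x)) \<partial>gauss k) / Zv k"
proof -
  define F where "F y = q powr max 0 (alt k y) * f (alt k y)" for y
  have m: "(\<lambda>u. q powr u * f u) \<in> borel_measurable borel"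
    using q by (intro borel_measurable_continuous_onI continuous_intros f) auto
  have "(\<integral>u. q powr u * f u \<partial>S_law k) = (\<integral>x. q powr alt k (eigvec k x) * f (alt k (eigvec k x)) \<partial>goe_space k)"
    unfolding S_law_eq[OF k] by (rule integral_distr[OF alt_eigvec_measurable m])
  also have "\<dots> = (\<integral>x. F (eigvec k x) \<partial>goe_space k)"
    using alt_nonneg[OF chamber_eigvec k] by (simp add: F_def max_absorb2)
  also have "\<dots> = (\<integral>x. F (trunc k x) * vdmp k x \<partial>gauss k) / Zv k"
  proof (rule goe_eigvec_law)
    show "continuous_on UNIV F" unfolding F_def using q
      by (intro continuous_intros continuous_alt continuous_on_compose2[OF f(1) continuous_alt]) auto
    show "\<bar>F y\<bar> \<le> 1" for y
      using mult_mono[of "q powr max 0 (alt k y)" 1 "\<bar>f (alt k y)\<bar>" 1] powr_le_one[OF q, of "max 0 (alt k y)"] f(2)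
      by (simp add: F_def abs_mult)
  qed
  also have "\<dots> = (\<integral>x. F x * vdmp k x \<partial>gauss k) / Zv k" by (simp add: F_def alt_def trunc_def)
  finally show ?thesis by (simp add: F_def mult.commute)
qed

lemma integrable_powr_S_law:
  assumes k: "even k" and q: "0 < q" "q \<le> 1"
  shows "integrable (S_law k) (\<lambda>u. q powr u)" and "(\<integral>u. q powr u \<partial>S_law k) > 0"
proof -
  interpret g: prob_space "goe_space k" by (rule prob_space_goe_space)
  have m: "(\<lambda>u. q powr u) \<in> borel_measurable borel"
    using q by (intro borel_measurable_continuous_onI continuous_intros) auto
  have i: "integrable (goe_space k) (\<lambda>x. q powr alt k (eigvec k x))"
  proof (rule g.integrable_const_bound[of _ 1])
    show "AE x in goe_space k. norm (q powr alt k (eigvec k x)) \<le> 1"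
      using powr_le_one[OF q alt_nonneg[OF chamber_eigvec k]] by simp
  qed (rule measurable_compose[OF alt_eigvec_measurable m])
  then show "integrable (S_law k) (\<lambda>u. q powr u)"
    unfolding S_law_eq[OF k] by (subst integrable_distr_eq[OF alt_eigvec_measurable m])
  have "(\<integral>x. q powr alt k (eigvec k x) \<partial>goe_space k) \<noteq> 0"
  proof
    assume "(\<integral>x. q powr alt k (eigvec k x) \<partial>goe_space k) = 0"
    then have "AE x in goe_space k. q powr alt k (eigvec k x) = 0"
      using integral_nonneg_eq_0_iff_AE[OF i] by simp
    then have "AE x in goe_space k. False" by eventually_elim (use q in simp)
    then show False by simp
  qed
  moreover have "(\<integral>x. q powr alt k (eigvec k x) \<partial>goe_space k) \<ge> 0" by (intro integral_nonneg_AE) simp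
  ultimately have "(\<integral>x. q powr alt k (eigvec k x) \<partial>goe_space k) > 0" by linarith
  then show "(\<integral>u. q powr u \<partial>S_law k) > 0"
    unfolding S_law_eq[OF k] by (subst integral_distr[OF alt_eigvec_measurable m])
qed

lemma sets_S_law [simp]: "sets (S_law k) = sets borel" "space (S_law k) = UNIV"
  by (simp_all add: S_law_def)

lemma real_distribution_X_law:
  assumes k: "even k" and q: "0 < q" "q \<le> 1"
  shows "real_distribution (X_law k q)"
proof -
  define E where "E = (\<integral>u. q powr u \<partial>S_law k)"
  have E: "E > 0" unfolding E_def by (rule integrable_powr_S_law[OF assms])
  have m: "(\<lambda>u. q powr u / E) \<in> borel_measurable (S_law k)"
    unfolding measurable_cong_sets[OF sets_S_law(1) refl]
    using q E by (intro borel_measurable_continuous_onI continuous_intros) auto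
  have "emeasure (X_law k q) (space (X_law k q)) = (\<integral>\<^sup>+u. ennreal (q powr u / E) \<partial>S_law k)"
    unfolding X_law_def E_def[symmetric] using m by (subst emeasure_density) (auto intro!: nn_integral_cong)
  also have "\<dots> = ennreal (\<integral>u. q powr u / E \<partial>S_law k)"
    using E by (intro nn_integral_eq_integral integrable_divide integrable_powr_S_law[OF assms]) auto
  also have "\<dots> = 1" using E by (simp add: E_def[symmetric])
  finally have "prob_space (X_law k q)" by (rule prob_spaceI)
  then show ?thesis
    unfolding real_distribution_def real_distribution_axioms_def by (simp add: X_law_def)
qed

lemma X_law_integral:
  assumes k: "even k" and q: "0 < q" "q \<le> 1" and f: "continuous_on UNIV f"
  shows "(\<integral>u. f u \<partial>X_law k q) = (\<integral>u. q powr u * f u \<partial>S_law k) / (\<integral>u. q powr u \<partial>S_law k)"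
proof -
  define E where "E = (\<integral>u. q powr u \<partial>S_law k)"
  have E: "E > 0" unfolding E_def by (rule integrable_powr_S_law[OF k q])
  have m: "(\<lambda>u. q powr u / E) \<in> borel_measurable (S_law k)" "f \<in> borel_measurable (S_law k)"
    unfolding measurable_cong_sets[OF sets_S_law(1) refl]
    using q E f by (auto intro!: borel_measurable_continuous_onI continuous_intros)
  have "(\<integral>u. f u \<partial>X_law k q) = (\<integral>u. (q powr u / E) *\<^sub>R f u \<partial>S_law k)"
    unfolding X_law_def E_def[symmetric] by (rule integral_density) (use m E in auto)
  then show ?thesis by (simp add: E_def)
qed

theorem theorem2:
  fixes k :: nat and q :: real
  assumes "k \<ge> 1" and "even k" and "0 < q" and "q \<le> 1"
  shows "weak_conv_m
    (\<lambda>n. distr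
       (fp_weighted_measure (q powr sqrt (real k / real n)) n (k + 1) (decreasing_perm (k + 1)))
       borel
       (\<lambda>p. sqrt (real k / real n) * real (fp n p)))
    (X_law k q)"
proof -
  define FP where "FP n = fp_weighted_measure (q powr step k n) n (k + 1) (decreasing_perm (k + 1))" for n
  define H where "H f = (\<integral>x. vdmp k x * (q powr max 0 (alt k x) * f (alt k x)) \<partial>gauss k)" for f
  have FPm: "X \<in> FP n \<rightarrow>\<^sub>M borel" for X :: "(nat \<Rightarrow> nat) \<Rightarrow> real" and n
    unfolding FP_def fp_weighted_measure_def by simp
  have FP_prob: "prob_space (FP n)" for n
    unfolding FP_def using id_avoiding[OF assms(1)] assms(3) by (intro prob_space_fp_weighted_measure) auto
  have "weak_conv_m (\<lambda>n. distr (FP n) borel (\<lambda>p. step k n * real (fp n p))) (X_law k q)"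
  proof (rule integral_cts_step_conv_imp_weak_conv)
    show "real_distribution (distr (FP n) borel (\<lambda>p. step k n * real (fp n p)))" for n
      by (rule prob_space.real_distribution_distr[OF FP_prob FPm])
    show "real_distribution (X_law k q)" by (rule real_distribution_X_law[OF assms(2-4)])
    fix a b :: real assume ab: "a < b"
    define f where "f = cts_step a b"
    have fu: "uniformly_continuous_on UNIV f" unfolding f_def by (rule cts_step_uniformly_continuous[OF ab])
    have fc: "continuous_on UNIV f" using fu by (rule uniformly_continuous_imp_continuous)
    have f1: "\<bar>f u\<bar> \<le> 1" for u using ab by (auto simp: f_def cts_step_def)
    have H1: "H (\<lambda>_. 1) = Zv k * (\<integral>u. q powr u \<partial>S_law k)"
      using S_law_powr_integral[OF assms(2-4), of "\<lambda>_. 1"] Zv_pos[of k] by (simp add: H_def)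
    have Hf: "H f = Zv k * (\<integral>u. q powr u * f u \<partial>S_law k)"
      using S_law_powr_integral[OF assms(2-4) fc f1] Zv_pos[of k] by (simp add: H_def)
    define W where "W h n = wmean k n (\<lambda>w. vdmp k (scaled k n w) *
      (q powr max 0 (alt k (scaled k n w)) * h (alt k (scaled k n w) - step k n * real (k div 2))))" for h n
    have lim: "(\<lambda>n. W f n / W (\<lambda>_. 1) n) \<longlonglongrightarrow> H f / H (\<lambda>_. 1)"
    proof (rule tendsto_divide)
      show "W f \<longlonglongrightarrow> H f" unfolding W_def H_def by (rule tilted_word_limit[OF assms fu f1])
      show "W (\<lambda>_. 1) \<longlonglongrightarrow> H (\<lambda>_. 1)" unfolding W_def H_def
        by (rule tilted_word_limit[OF assms]) (auto intro: uniformly_continuous_on_const)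
      show "H (\<lambda>_. 1) \<noteq> 0" unfolding H1 using Zv_pos[of k] integrable_powr_S_law(2)[OF assms(2-4)] by simp
    qed
    have limit: "H f / H (\<lambda>_. 1) = (\<integral>u. f u \<partial>X_law k q)"
      unfolding H1 Hf X_law_integral[OF assms(2-4) fc] using Zv_pos[of k] by simp
    have "\<forall>\<^sub>F n in sequentially. W f n / W (\<lambda>_. 1) n = (\<integral>u. f u \<partial>distr (FP n) borel (\<lambda>p. step k n * real (fp n p)))"
    proof (rule eventually_sequentiallyI[of 1])
      fix n :: nat assume n: "n \<ge> 1"
      define s where "s = step k n"
      have s: "s \<ge> 0" by (simp add: s_def step_def)
      define A where "A = avoiding_involutions n (k + 1) (decreasing_perm (k + 1))"
      \<comment> \<open>The staircase shifts the alternating sum by \<open>\<mu>\<close>; the resulting factor \<open>q powr (- \<mu>)\<close> is common to numerator and denominator.\<close>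
      define \<mu> where "\<mu> = s * real (k div 2)"
      obtain c where c: "c > 0" "\<And>\<phi>. (\<Sum>p\<in>A. \<phi> (s * real (fp n p))) =
          c * wmean k n (\<lambda>w. vdmp k (scaled k n w) * \<phi> (alt k (scaled k n w) - \<mu>))"
        unfolding A_def s_def \<mu>_def by (rule involution_sum_as_word_mean[OF assms(1,2) n]) blast
      have sum: "(\<Sum>p\<in>A. q powr (s * real (fp n p)) * h (s * real (fp n p))) = q powr (- \<mu>) * (c * W h n)" for h
      proof -
        have "(\<Sum>p\<in>A. q powr (s * real (fp n p)) * h (s * real (fp n p))) =
          (\<Sum>p\<in>A. q powr (- \<mu>) * (q powr max 0 (s * real (fp n p) + \<mu>) * h (s * real (fp n p))))"
        proof (intro sum.cong refl)
          fix p
          have "max 0 (s * real (fp n p) + \<mu>) = s * real (fp n p) + \<mu>" using s by (simp add: \<mu>_def)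
          then show "q powr (s * real (fp n p)) * h (s * real (fp n p)) =
              q powr (- \<mu>) * (q powr max 0 (s * real (fp n p) + \<mu>) * h (s * real (fp n p)))"
            by (simp add: powr_add[symmetric] mult.assoc[symmetric])
        qed
        also have "\<dots> = q powr (- \<mu>) * (c * W h n)"
          unfolding sum_distrib_left[symmetric] c(2)[where \<phi> = "\<lambda>u. q powr max 0 (u + \<mu>) * h u"] W_def
          by (simp add: \<mu>_def s_def)
        finally show ?thesis .
      qed
      have "(\<integral>u. f u \<partial>distr (FP n) borel (\<lambda>p. step k n * real (fp n p))) = (\<integral>p. f (s * real (fp n p)) \<partial>FP n)"
        unfolding s_def by (rule integral_distr[OF FPm borel_measurable_continuous_onI[OF fc]])
      also have "\<dots> = (\<Sum>p\<in>A. q powr (s * real (fp n p)) * f (s * real (fp n p))) / (\<Sum>p\<in>A. q powr (s * real (fp n p)) * (\<lambda>_. 1) (s * real (fp n p)))"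
        using fp_law_integral[OF assms(3), where f = f and s = s and n = n and m = "k + 1" and \<sigma> = "decreasing_perm (k + 1)"] unfolding FP_def s_def[symmetric] A_def[symmetric] by simp
      also have "\<dots> = W f n / W (\<lambda>_. 1) n" using c(1) assms(3) by (simp add: sum[of f] sum[of "\<lambda>_. 1", simplified])
      finally show "W f n / W (\<lambda>_. 1) n = (\<integral>u. f u \<partial>distr (FP n) borel (\<lambda>p. step k n * real (fp n p)))" ..
    qed
    from Lim_transform_eventually[OF lim[unfolded limit] this] show "(\<lambda>n. \<integral>u. cts_step a b u \<partial>distr (FP n) borel (\<lambda>p. step k n * real (fp n p))) \<longlonglongrightarrow> (\<integral>u. cts_step a b u \<partial>X_law k q)"
      unfolding f_def .
  qed
  then show ?thesis unfolding FP_def step_def .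
qed

end
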